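(* Let $H$ be a finite-dimensional Hopf algebra. The assignments (identity on underlying algebras and on morphisms) $$(X,\alpha,\beta)\in\mathfrak{YD}^{rl}(H,\widehat H)\ \longleftrightarrow\ (X,\beta,\alpha)\in\mathfrak{YD}^{lr}(\widehat H,H),$$ $$(X,\alpha,\beta)\in\mathfrak{YD}^{rl}(H,\widehat H)\ \longleftrightarrow\ (X,(S^{-1}\otimes\mathrm{id})\Sigma\alpha,\beta)\in\mathfrak{YD}^{ll}(H,\widehat H),$$ $$(X,\beta,\alpha)\in\mathfrak{YD}^{lr}(\widehat H,H)\ \longleftrightarrow\ (X,(\mathrm{id}\otimes\widehat S^{-1})\Sigma\beta,\alpha)\in\mathfrak{YD}^{rr}(\widehat H,H),$$ $$(X,(S^{-1}\otimes\mathrm{id})\Sigma\alpha,\beta)\in\mathfrak{YD}^{ll}(H,\widehat H)\ \longleftrightarrow\ (X,(\mathrm{id}\otimes\widehat S^{-1})\Sigma\beta,\alpha)\in\mathfrak{YD}^{rr}(\widehat H,H)$$ are equivalences of categories. They are compatible, under the passage from the "only coaction" to the standard form of Yetter--Drinfeld algebras at each corner, with the equivalences of categories between $(X,\lhd_\beta,\alpha)\in\mathfrak{YD}^H_H$, $(X,\rhd_\alpha,\beta)\in{}^{\widehat H}_{\widehat H}\mathfrak{YD}$, $(X,\lhd_\beta,(S^{-1}\otimes\mathrm{id})\Sigma\alpha)\in{}^H\mathfrak{YD}_H$ and $(X,\rhd_\alpha,(\mathrm{id}\otimes\widehat S^{-1})\Sigma\beta)\in{}_{\widehat H}\mathfrak{YD}^{\widehat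 H}$. Moreover, these equivalences respect the braided commutativity conditions (corresponding objects are simultaneously braided commutative).
   Context: $\Bbbk$ is a field, algebras are unital; $Y^{\mathrm{op}}$ is the opposite algebra. For a finite-dimensional Hopf algebra $K$ (structure maps $\Delta,\varepsilon,S_K$, antipode bijective), $\widehat K$ is the dual Hopf algebra (antipode $\widehat S$), $\mathbf p(k,\theta)=\theta(k)$, $\mathbf p(k,\theta\theta')=\mathbf p(k_{(1)},\theta)\mathbf p(k_{(2)},\theta')$, $\mathbf p(kk',\theta)=\mathbf p(k,\theta_{(1)})\mathbf p(k',\theta_{(2)})$; the bidual of $H$ is identified with $H$. $K^{\mathrm{op}}$ has opposite product (elements $k^{\mathrm{op}}$) and the same coproduct. For dual bases, $U_K=\sum k_i\otimes\widehat k_i\in K\otimes\widehat K$, ${}^{\circ}U_K=\sum k_i^{\mathrm{op}}\otimes\widehat k_i\in K^{\mathrm{op}}\otimes\widehat K$ (both invertible). $\mathrm{Ad}(W)(z)=WzW^{-1}$; $\Sigma$ is the flip; subscripts $13$ denote placement in legs 1 and 3. Coactions are coassociative counital algebra homomorphisms; actions are module algebra structures; all morphisms are algebra homomorphisms intertwining the given structures. "Only coaction" categories (objects $(X,\alpha,\beta)$): - $\mathfrak{YD}^{lr}(K,\widehat K)$: $\alpha:X\to K\otimes X$, $\beta:X\to X\otimes\widehat K$ coactions of $K$, $\widehat K$ with $(\alpha\otimes\mathrm{id})\beta=\mathrm{Ad}((U_K)_{13})(\mathrm{id}\otimes\beta)\alpha$. - $\mathfrak{YD}^{rl}(K,\widehat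 K)$: $\alpha:X\to X\otimes K$, $\beta:X\to\widehat K\otimes X$ with $(\mathrm{id}\otimes\alpha)\beta=\mathrm{Ad}(\Sigma(U_K)^{-1}_{13})(\beta\otimes\mathrm{id})\alpha$. - $\mathfrak{YD}^{ll}(K,\widehat K)$: $\alpha:X\to K^{\mathrm{op}}\otimes X$, $\beta:X\to\widehat K\otimes X$ with $(\mathrm{id}\otimes\alpha)\beta=(\Sigma\otimes\mathrm{id})(\mathrm{Ad}({}^{\circ}U_K)\otimes\mathrm{id})(\mathrm{id}\otimes\beta)\alpha$. - $\mathfrak{YD}^{rr}(K,\widehat K)$: $\alpha:X\to X\otimes K^{\mathrm{op}}$, $\beta:X\to X\otimes\widehat K$ with $(\alpha\otimes\mathrm{id})\beta=(\mathrm{id}\otimes\mathrm{Ad}({}^{\circ}U_K)^{-1}\Sigma)(\beta\otimes\mathrm{id})\alpha$. In the claim, $(S^{-1}\otimes\mathrm{id})\Sigma\alpha:X\to H^{\mathrm{op}}\otimes X$ means $x\mapsto S^{-1}(x_{[1]})^{\mathrm{op}}\otimes x_{[0]}$ for $\alpha(x)=x_{[0]}\otimes x_{[1]}$, and $(\mathrm{id}\otimes\widehat S^{-1})\Sigma\beta:X\to X\otimes\widehat H^{\mathrm{op}}$ means $x\mapsto x^{[0]}\otimes\widehat S^{-1}(x^{[-1]})^{\mathrm{op}}$ for $\beta(x)=x^{[-1]}\otimes x^{[0]}$. Standard categories over $K$ (conditions for all $k\in K$, $x\in X$): - ${}^K_K\mathfrak{YD}$: left action $\rhd$, left coaction $x\mapsto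 x_{[-1]}\otimes x_{[0]}$ of $K$, $k_{(1)}x_{[-1]}\otimes(k_{(2)}\rhd x_{[0]})=(k_{(1)}\rhd x)_{[-1]}k_{(2)}\otimes(k_{(1)}\rhd x)_{[0]}$. - $\mathfrak{YD}^K_K$: right action $\lhd$, right coaction $x\mapsto x_{[0]}\otimes x_{[1]}$ of $K$, $(x_{[0]}\lhd k_{(1)})\otimes x_{[1]}k_{(2)}=(x\lhd k_{(2)})_{[0]}\otimes k_{(1)}(x\lhd k_{(2)})_{[1]}$. - ${}^K\mathfrak{YD}_K$: right action, left coaction $x\mapsto x_{[-1]}^{\mathrm{op}}\otimes x_{[0]}$ of $K^{\mathrm{op}}$, $x_{[-1]}k_{(1)}\otimes(x_{[0]}\lhd k_{(2)})=k_{(2)}(x\lhd k_{(1)})_{[-1]}\otimes(x\lhd k_{(1)})_{[0]}$. - ${}_K\mathfrak{YD}^K$: left action, right coaction $x\mapsto x_{[0]}\otimes x_{[1]}^{\mathrm{op}}$ of $K^{\mathrm{op}}$, $(k_{(1)}\rhd x_{[0]})\otimes k_{(2)}x_{[1]}=(k_{(2)}\rhd x)_{[0]}\otimes(k_{(2)}\rhd x)_{[1]}k_{(1)}$. A right coaction $\beta$ of $\widehat K$ induces the left action $k\rhd_\beta x=(\mathrm{id}\otimes\mathbf p(k,\cdot))\beta(x)$ of $K$, and a left coaction $\beta$ of $\widehat K$ induces the right action $x\lhd_\beta k=(\mathbf p(k,\cdot)\otimes\mathrm{id})\beta(x)$; likewise a right coaction $\alpha$ of $H$ induces the left action $\rhd_\alpha$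 of $\widehat H$. Passage to the standard form: $(X,\alpha,\beta)\mapsto(X,\rhd_\beta,\alpha)$ from $\mathfrak{YD}^{lr}(K,\widehat K)$ to ${}^K_K\mathfrak{YD}$ and from $\mathfrak{YD}^{rr}(K,\widehat K)$ to ${}_K\mathfrak{YD}^K$; $(X,\alpha,\beta)\mapsto(X,\lhd_\beta,\alpha)$ from $\mathfrak{YD}^{rl}(K,\widehat K)$ to $\mathfrak{YD}^K_K$ and from $\mathfrak{YD}^{ll}(K,\widehat K)$ to ${}^K\mathfrak{YD}_K$. Braided commutativity. The Heisenberg algebra $\mathcal H(K)=K\#\widehat K$ is $K\otimes\widehat K$ with product $(k\#\theta)(k'\#\theta')=kk'_{(1)}\mathbf p(k'_{(2)},\theta_{(1)})\#\theta_{(2)}\theta'$; so $\mathcal H(\widehat K)=\widehat K\#K$ has product $(\theta\#k)(\theta'\#k')=\theta\theta'_{(1)}\mathbf p(k_{(1)},\theta'_{(2)})\#k_{(2)}k'$. An object $(X,\alpha,\beta)$ is braided commutative if for all $x,y\in X$ the following two elements commute: - $lr$: $x_{[-1]}\#1\otimes x_{[0]}$ and $1\#y^{[1]}\otimes y^{[0]}$ in $\mathcal H(K)\otimes X$; - $rr$: $x_{[0]}\otimes S_K(x_{[1]})\#1$ and $y^{[0]}\otimes1\#y^{[1]}$ in $X\otimes\mathcal H(K)$; - $rl$: $x_{[0]}\otimes1\#x_{[1]}$ and $y^{[0]}\otimes y^{[-1]}\#1$ in $X\otimes\mathcal H(\widehat K)$; - $ll$: $x_{[-1]}\#1\otimes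 x_{[0]}^{\mathrm{op}}$ and $1\#\widehat S(y^{[-1]})\otimes(y^{[0]})^{\mathrm{op}}$ in $\mathcal H(K)\otimes X^{\mathrm{op}}$; where lower indices are legs of $\alpha(x)$ (with the superscript op on the $K^{\mathrm{op}}$-leg removed) and upper indices legs of $\beta(y)$. *)

theory Defs
  imports "HOL-Algebra.Module"
begin

section \<open>Algebras and linear maps\<close>

text \<open>The base field is a type of class field. Vector spaces and algebras are carrier-based records
  of HOL-Algebra, viewed as modules over the following ring.\<close>

definition scalars :: "'k::field ring" where
  "scalars = \<lparr>carrier = UNIV, mult = (*), one = 1, zero = 0, add = (+)\<rparr>"

locale k_algebra = ring A + module scalars A
  for A :: "('k::field, 'a, 'z) module_scheme" (structure) +
  assumes smult_mult_left: "\<And>c a b. a \<in> carrier A \<Longrightarrow> b \<in> carrier A \<Longrightarrow>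
      (c \<odot>\<^bsub>A\<^esub> a) \<otimes>\<^bsub>A\<^esub> b = c \<odot>\<^bsub>A\<^esub> (a \<otimes>\<^bsub>A\<^esub> b)"
    and smult_mult_right: "\<And>c a b. a \<in> carrier A \<Longrightarrow> b \<in> carrier A \<Longrightarrow>
      a \<otimes>\<^bsub>A\<^esub> (c \<odot>\<^bsub>A\<^esub> b) = c \<odot>\<^bsub>A\<^esub> (a \<otimes>\<^bsub>A\<^esub> b)"

definition alg_hom :: "('k::field, 'a, 'z) module_scheme \<Rightarrow> ('k, 'b, 'y) module_scheme \<Rightarrow> ('a \<Rightarrow> 'b) set" where
  "alg_hom A B = {f \<in> ring_hom A B. \<forall>c. \<forall>a\<in>carrier A. f (c \<odot>\<^bsub>A\<^esub> a) = c \<odot>\<^bsub>B\<^esub> f a}"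

definition opp :: "('k, 'a, 'z) module_scheme \<Rightarrow> ('k, 'a, 'z) module_scheme" where
  "opp A = A\<lparr>mult := \<lambda>a b. b \<otimes>\<^bsub>A\<^esub> a\<rparr>"

definition linear_form :: "('k::field, 'a, 'z) module_scheme \<Rightarrow> ('a \<Rightarrow> 'k) \<Rightarrow> bool" where
  "linear_form V f \<longleftrightarrow>
     (\<forall>v\<in>carrier V. \<forall>w\<in>carrier V. f (v \<oplus>\<^bsub>V\<^esub> w) = f v + f w) \<and>
     (\<forall>c. \<forall>v\<in>carrier V. f (c \<odot>\<^bsub>V\<^esub> v) = c * f v)"

definition linear_map ::
  "('k::field, 'a, 'z) module_scheme \<Rightarrow> ('k, 'b, 'y) module_scheme \<Rightarrow> ('a \<Rightarrow> 'b) \<Rightarrow> bool" where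
  "linear_map V W f \<longleftrightarrow> f \<in> carrier V \<rightarrow> carrier W \<and>
     (\<forall>v\<in>carrier V. \<forall>w\<in>carrier V. f (v \<oplus>\<^bsub>V\<^esub> w) = f v \<oplus>\<^bsub>W\<^esub> f w) \<and>
     (\<forall>c. \<forall>v\<in>carrier V. f (c \<odot>\<^bsub>V\<^esub> v) = c \<odot>\<^bsub>W\<^esub> f v)"

definition bilinear_map ::
  "('k::field, 'a, 'z) module_scheme \<Rightarrow> ('k, 'b, 'y) module_scheme \<Rightarrow> ('k, 'c, 'w) module_scheme
    \<Rightarrow> ('a \<Rightarrow> 'b \<Rightarrow> 'c) \<Rightarrow> bool" where
  "bilinear_map V W Z b \<longleftrightarrow>
     (\<forall>v\<in>carrier V. linear_map W Z (b v)) \<and> (\<forall>w\<in>carrier W. linear_map V Z (\<lambda>v. b v w))"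

definition bilinear_form ::
  "('k::field, 'a, 'z) module_scheme \<Rightarrow> ('k, 'b, 'y) module_scheme \<Rightarrow> ('a \<Rightarrow> 'b \<Rightarrow> 'k) \<Rightarrow> bool" where
  "bilinear_form V W B \<longleftrightarrow>
     (\<forall>v\<in>carrier V. linear_form W (B v)) \<and> (\<forall>w\<in>carrier W. linear_form V (\<lambda>v. B v w))"

definition trilinear_form ::
  "('k::field, 'a, 'z) module_scheme \<Rightarrow> ('k, 'b, 'y) module_scheme \<Rightarrow> ('k, 'c, 'w) module_scheme
    \<Rightarrow> ('a \<Rightarrow> 'b \<Rightarrow> 'c \<Rightarrow> 'k) \<Rightarrow> bool" where
  "trilinear_form U V W T \<longleftrightarrow>
     (\<forall>u\<in>carrier U. \<forall>v\<in>carrier V. linear_form W (T u v)) \<and>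
     (\<forall>u\<in>carrier U. \<forall>w\<in>carrier W. linear_form V (\<lambda>v. T u v w)) \<and>
     (\<forall>v\<in>carrier V. \<forall>w\<in>carrier W. linear_form U (\<lambda>u. T u v w))"

definition spans :: "('k::field, 'a, 'z) module_scheme \<Rightarrow> nat \<Rightarrow> (nat \<Rightarrow> 'a) \<Rightarrow> bool" where
  "spans V n e \<longleftrightarrow> e \<in> {..<n} \<rightarrow> carrier V \<and>
     (\<forall>v\<in>carrier V. \<exists>c. v = (\<Oplus>\<^bsub>V\<^esub>i\<in>{..<n}. c i \<odot>\<^bsub>V\<^esub> e i))"

definition finite_dim :: "('k::field, 'a, 'z) module_scheme \<Rightarrow> bool" where
  "finite_dim V \<longleftrightarrow> (\<exists>n e. spans V n e)"


section \<open>Tensor products\<close>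

text \<open>The canonical map from the tensor product of V and W to the dual of the space of bilinear forms
  is injective over a field, and this is used as the model: a sum of pure tensors, with summands
  indexed by i, is the functional sending a bilinear form B to the sum of the B (v i) (w i). It is
  set to 0 on functions that are not bilinear, so that equality of tensors is equality of
  functionals. Thus t (\<lambda>v w. E v w) is the value at t of the linear form obtained by
  extending E, which makes it a replacement for Sweedler notation. Triple tensor products are
  treated in the same way, with trilinear forms and without bracketing.\<close>

type_synonym ('k, 'a, 'b) tensor = "('a \<Rightarrow> 'b \<Rightarrow> 'k) \<Rightarrow> 'k"
type_synonym ('k, 'a, 'b, 'c) tensor3 = "('a \<Rightarrow> 'b \<Rightarrow> 'c \<Rightarrow> 'k) \<Rightarrow> 'k"

definition T2 :: "('k::field, 'a, 'z) module_scheme \<Rightarrow> ('k, 'b, 'y) module_scheme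
    \<Rightarrow> ('k, 'a, 'b) tensor \<Rightarrow> ('k, 'a, 'b) tensor" where
  "T2 V W \<phi> = (\<lambda>B. if bilinear_form V W B then \<phi> B else 0)"

definition T3 :: "('k::field, 'a, 'z) module_scheme \<Rightarrow> ('k, 'b, 'y) module_scheme
    \<Rightarrow> ('k, 'c, 'w) module_scheme \<Rightarrow> ('k, 'a, 'b, 'c) tensor3 \<Rightarrow> ('k, 'a, 'b, 'c) tensor3" where
  "T3 U V W \<phi> = (\<lambda>T. if trilinear_form U V W T then \<phi> T else 0)"

definition pure2 :: "('k::field, 'a, 'z) module_scheme \<Rightarrow> ('k, 'b, 'y) module_scheme
    \<Rightarrow> 'a \<Rightarrow> 'b \<Rightarrow> ('k, 'a, 'b) tensor" where
  "pure2 V W v w = T2 V W (\<lambda>B. B v w)"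

definition pure3 :: "('k::field, 'a, 'z) module_scheme \<Rightarrow> ('k, 'b, 'y) module_scheme
    \<Rightarrow> ('k, 'c, 'w) module_scheme \<Rightarrow> 'a \<Rightarrow> 'b \<Rightarrow> 'c \<Rightarrow> ('k, 'a, 'b, 'c) tensor3" where
  "pure3 U V W u v w = T3 U V W (\<lambda>T. T u v w)"

definition tensor_alg :: "('k::field, 'a, 'z) module_scheme \<Rightarrow> ('k, 'b, 'y) module_scheme
    \<Rightarrow> ('k, ('k, 'a, 'b) tensor) module" where
  "tensor_alg V W =
    \<lparr>carrier = {T2 V W (\<lambda>B. \<Sum>i<n. B (v i) (w i)) | (n::nat) v w.
        v \<in> {..<n} \<rightarrow> carrier V \<and> w \<in> {..<n} \<rightarrow> carrier W},
     mult = \<lambda>s t. T2 V W (\<lambda>B. s (\<lambda>v w. t (\<lambda>v' w'. B (v \<otimes>\<^bsub>V\<^esub> v') (w \<otimes>\<^bsub>W\<^esub> w')))),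
     one = pure2 V W \<one>\<^bsub>V\<^esub> \<one>\<^bsub>W\<^esub>,
     zero = \<lambda>B. 0,
     add = \<lambda>s t B. s B + t B,
     smult = \<lambda>c t B. c * t B\<rparr>"

definition tensor_alg3 :: "('k::field, 'a, 'z) module_scheme \<Rightarrow> ('k, 'b, 'y) module_scheme
    \<Rightarrow> ('k, 'c, 'w) module_scheme \<Rightarrow> ('k, ('k, 'a, 'b, 'c) tensor3) module" where
  "tensor_alg3 U V W =
    \<lparr>carrier = {T3 U V W (\<lambda>T. \<Sum>i<n. T (u i) (v i) (w i)) | (n::nat) u v w.
        u \<in> {..<n} \<rightarrow> carrier U \<and> v \<in> {..<n} \<rightarrow> carrier V \<and> w \<in> {..<n} \<rightarrow> carrier W},
     mult = \<lambda>s t. T3 U V W (\<lambda>T. s (\<lambda>u v w. t (\<lambda>u' v' w'.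
        T (u \<otimes>\<^bsub>U\<^esub> u') (v \<otimes>\<^bsub>V\<^esub> v') (w \<otimes>\<^bsub>W\<^esub> w')))),
     one = pure3 U V W \<one>\<^bsub>U\<^esub> \<one>\<^bsub>V\<^esub> \<one>\<^bsub>W\<^esub>,
     zero = \<lambda>T. 0,
     add = \<lambda>s t T. s T + t T,
     smult = \<lambda>c t T. c * t T\<rparr>"

text \<open>The linear map on the tensor product induced by a bilinear map b into Z.\<close>

definition tensor_lift :: "('k::field, 'a, 'z) module_scheme \<Rightarrow> ('k, 'b, 'y) module_scheme
    \<Rightarrow> ('k, 'c, 'w) module_scheme \<Rightarrow> ('a \<Rightarrow> 'b \<Rightarrow> 'c) \<Rightarrow> ('k, 'a, 'b) tensor \<Rightarrow> 'c" where
  "tensor_lift V W Z b t = (THE z. \<exists>(n::nat) v w.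
      v \<in> {..<n} \<rightarrow> carrier V \<and> w \<in> {..<n} \<rightarrow> carrier W \<and>
      t = T2 V W (\<lambda>B. \<Sum>i<n. B (v i) (w i)) \<and> z = (\<Oplus>\<^bsub>Z\<^esub>i\<in>{..<n}. b (v i) (w i)))"

text \<open>In the following definitions, the algebra arguments are the tensor factors of the target.\<close>

definition map2 :: "('k::field, 'a, 'z) module_scheme \<Rightarrow> ('k, 'b, 'y) module_scheme
    \<Rightarrow> ('c \<Rightarrow> 'a) \<Rightarrow> ('d \<Rightarrow> 'b) \<Rightarrow> ('k, 'c, 'd) tensor \<Rightarrow> ('k, 'a, 'b) tensor" where
  "map2 V W f g t = T2 V W (\<lambda>B. t (\<lambda>c d. B (f c) (g d)))"

definition flip :: "('k::field, 'a, 'z) module_scheme \<Rightarrow> ('k, 'b, 'y) module_scheme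
    \<Rightarrow> ('k, 'b, 'a) tensor \<Rightarrow> ('k, 'a, 'b) tensor" where
  "flip V W t = T2 V W (\<lambda>B. t (\<lambda>w v. B v w))"

text \<open>f tensor id and id tensor g, for maps f and g into a tensor product.\<close>

definition map_left :: "('k::field, 'a, 'z) module_scheme \<Rightarrow> ('k, 'b, 'y) module_scheme
    \<Rightarrow> ('k, 'c, 'w) module_scheme
    \<Rightarrow> ('d \<Rightarrow> ('k, 'a, 'b) tensor) \<Rightarrow> ('k, 'd, 'c) tensor \<Rightarrow> ('k, 'a, 'b, 'c) tensor3" where
  "map_left U V W f t = T3 U V W (\<lambda>T. t (\<lambda>d w. f d (\<lambda>u v. T u v w)))"

definition map_right :: "('k::field, 'a, 'z) module_scheme \<Rightarrow> ('k, 'b, 'y) module_scheme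
    \<Rightarrow> ('k, 'c, 'w) module_scheme
    \<Rightarrow> ('d \<Rightarrow> ('k, 'b, 'c) tensor) \<Rightarrow> ('k, 'a, 'd) tensor \<Rightarrow> ('k, 'a, 'b, 'c) tensor3" where
  "map_right U V W g t = T3 U V W (\<lambda>T. t (\<lambda>u d. g d (\<lambda>v w. T u v w)))"

text \<open>F tensor id and id tensor G on triple tensor products, for endomorphisms F of the tensor
  product of U and V and G of that of V and W.\<close>

definition on12 :: "('k::field, 'a, 'z) module_scheme \<Rightarrow> ('k, 'b, 'y) module_scheme
    \<Rightarrow> ('k, 'c, 'w) module_scheme \<Rightarrow> (('k, 'a, 'b) tensor \<Rightarrow> ('k, 'a, 'b) tensor)
    \<Rightarrow> ('k, 'a, 'b, 'c) tensor3 \<Rightarrow> ('k, 'a, 'b, 'c) tensor3" where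
  "on12 U V W F t = T3 U V W (\<lambda>T. t (\<lambda>u v w. F (pure2 U V u v) (\<lambda>u' v'. T u' v' w)))"

definition on23 :: "('k::field, 'a, 'z) module_scheme \<Rightarrow> ('k, 'b, 'y) module_scheme
    \<Rightarrow> ('k, 'c, 'w) module_scheme \<Rightarrow> (('k, 'b, 'c) tensor \<Rightarrow> ('k, 'b, 'c) tensor)
    \<Rightarrow> ('k, 'a, 'b, 'c) tensor3 \<Rightarrow> ('k, 'a, 'b, 'c) tensor3" where
  "on23 U V W G t = T3 U V W (\<lambda>T. t (\<lambda>u v w. G (pure2 V W v w) (\<lambda>v' w'. T u v' w')))"

definition flip12 :: "('k::field, 'a, 'z) module_scheme \<Rightarrow> ('k, 'b, 'y) module_scheme
    \<Rightarrow> ('k, 'c, 'w) module_scheme \<Rightarrow> ('k, 'b, 'a, 'c) tensor3 \<Rightarrow> ('k, 'a, 'b, 'c) tensor3" where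
  "flip12 U V W t = T3 U V W (\<lambda>T. t (\<lambda>v u w. T u v w))"

definition flip23 :: "('k::field, 'a, 'z) module_scheme \<Rightarrow> ('k, 'b, 'y) module_scheme
    \<Rightarrow> ('k, 'c, 'w) module_scheme \<Rightarrow> ('k, 'a, 'c, 'b) tensor3 \<Rightarrow> ('k, 'a, 'b, 'c) tensor3" where
  "flip23 U V W t = T3 U V W (\<lambda>T. t (\<lambda>u w v. T u v w))"

definition leg13 :: "('k::field, 'a, 'z) module_scheme \<Rightarrow> ('k, 'b, 'y) module_scheme
    \<Rightarrow> ('k, 'c, 'w) module_scheme \<Rightarrow> ('k, 'a, 'c) tensor \<Rightarrow> ('k, 'a, 'b, 'c) tensor3" where
  "leg13 U V W t = T3 U V W (\<lambda>T. t (\<lambda>u w. T u \<one>\<^bsub>V\<^esub> w))"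

definition Ad :: "('k, 'a, 'z) module_scheme \<Rightarrow> 'a \<Rightarrow> 'a \<Rightarrow> 'a" where
  "Ad A u z = u \<otimes>\<^bsub>A\<^esub> z \<otimes>\<^bsub>A\<^esub> inv\<^bsub>A\<^esub> u"


section \<open>Finite-dimensional Hopf algebras and duality\<close>

record ('k, 'h) hopf = "('k, 'h) module" +
  comult :: "'h \<Rightarrow> ('h \<Rightarrow> 'h \<Rightarrow> 'k) \<Rightarrow> 'k"
  counit :: "'h \<Rightarrow> 'k"
  antipode :: "'h \<Rightarrow> 'h"

text \<open>In accordance with the standing convention, bijectivity of the antipode is part of the
  definition; it is automatic in the finite-dimensional case.\<close>

locale fd_hopf_algebra = k_algebra K for K :: "('k::field, 'h) hopf" (structure) +
  assumes finite_dim: "finite_dim K"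
    and comult_hom: "comult K \<in> alg_hom K (tensor_alg K K)"
    and counit_linear: "linear_form K (counit K)"
    and counit_mult: "\<And>h k. h \<in> carrier K \<Longrightarrow> k \<in> carrier K \<Longrightarrow>
      counit K (h \<otimes>\<^bsub>K\<^esub> k) = counit K h * counit K k"
    and counit_one: "counit K \<one>\<^bsub>K\<^esub> = 1"
    and coassoc: "\<And>h. h \<in> carrier K \<Longrightarrow>
      map_left K K K (comult K) (comult K h) = map_right K K K (comult K) (comult K h)"
    and counit_left: "\<And>h. h \<in> carrier K \<Longrightarrow>
      tensor_lift K K K (\<lambda>h1 h2. counit K h1 \<odot>\<^bsub>K\<^esub> h2) (comult K h) = h"
    and counit_right: "\<And>h. h \<in> carrier K \<Longrightarrow>
      tensor_lift K K K (\<lambda>h1 h2. counit K h2 \<odot>\<^bsub>K\<^esub> h1) (comult K h) = h"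
    and antipode_linear: "linear_map K K (antipode K)"
    and antipode_left: "\<And>h. h \<in> carrier K \<Longrightarrow>
      tensor_lift K K K (\<lambda>h1 h2. antipode K h1 \<otimes>\<^bsub>K\<^esub> h2) (comult K h) = counit K h \<odot>\<^bsub>K\<^esub> \<one>\<^bsub>K\<^esub>"
    and antipode_right: "\<And>h. h \<in> carrier K \<Longrightarrow>
      tensor_lift K K K (\<lambda>h1 h2. h1 \<otimes>\<^bsub>K\<^esub> antipode K h2) (comult K h) = counit K h \<odot>\<^bsub>K\<^esub> \<one>\<^bsub>K\<^esub>"
    and antipode_bij: "bij_betw (antipode K) (carrier K) (carrier K)"

definition antipode_inv :: "('k, 'h) hopf \<Rightarrow> 'h \<Rightarrow> 'h" where
  "antipode_inv K = inv_into (carrier K) (antipode K)"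

definition dual_alg :: "('k::field, 'h) hopf \<Rightarrow> ('k, 'h \<Rightarrow> 'k) module" where
  "dual_alg K =
    \<lparr>carrier = {\<theta>. linear_form K \<theta> \<and> \<theta> \<in> extensional (carrier K)},
     mult = \<lambda>\<theta> \<theta>'. (\<lambda>h\<in>carrier K. comult K h (\<lambda>h1 h2. \<theta> h1 * \<theta>' h2)),
     one = restrict (counit K) (carrier K),
     zero = (\<lambda>h\<in>carrier K. 0),
     add = \<lambda>\<theta> \<theta>'. (\<lambda>h\<in>carrier K. \<theta> h + \<theta>' h),
     smult = \<lambda>c \<theta>. (\<lambda>h\<in>carrier K. c * \<theta> h)\<rparr>"

definition dual_comult :: "('k::field, 'h) hopf \<Rightarrow> ('h \<Rightarrow> 'k) \<Rightarrow> ('k, 'h \<Rightarrow> 'k, 'h \<Rightarrow> 'k) tensor" where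
  "dual_comult K \<theta> = (THE u. u \<in> carrier (tensor_alg (dual_alg K) (dual_alg K)) \<and>
     (\<forall>h\<in>carrier K. \<forall>k\<in>carrier K. u (\<lambda>\<theta>1 \<theta>2. \<theta>1 h * \<theta>2 k) = \<theta> (h \<otimes>\<^bsub>K\<^esub> k)))"

definition dual_hopf :: "('k::field, 'h) hopf \<Rightarrow> ('k, 'h \<Rightarrow> 'k) hopf" where
  "dual_hopf K = module.extend (dual_alg K)
     (hopf.fields (dual_comult K) (\<lambda>\<theta>. \<theta> \<one>\<^bsub>K\<^esub>) (\<lambda>\<theta>. (\<lambda>h\<in>carrier K. \<theta> (antipode K h))))"

text \<open>From here on, a finite-dimensional Hopf algebra K and its dual enter as a triple K, L, p, where
  p k l is the pairing. The triples used later are K = H with L = dual_hopf H and evaluation, and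
  K = dual_hopf H with L = H and flipped evaluation; the latter implements the identification
  of the bidual of H with H.\<close>

definition dual_bases :: "('k::field, 'a) hopf \<Rightarrow> ('k, 'b) hopf \<Rightarrow> ('a \<Rightarrow> 'b \<Rightarrow> 'k)
    \<Rightarrow> nat \<Rightarrow> (nat \<Rightarrow> 'a) \<Rightarrow> (nat \<Rightarrow> 'b) \<Rightarrow> bool" where
  "dual_bases K L p n e f \<longleftrightarrow> spans K n e \<and> spans L n f \<and>
     (\<forall>i<n. \<forall>j<n. p (e i) (f j) = (if i = j then 1 else 0))"

definition copairing :: "('k::field, 'a) hopf \<Rightarrow> ('k, 'b) hopf \<Rightarrow> ('a \<Rightarrow> 'b \<Rightarrow> 'k)
    \<Rightarrow> ('k, 'a, 'b) tensor" where
  "copairing K L p = (SOME u. \<exists>n e f. dual_bases K L p n e f \<and>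
     u = T2 K L (\<lambda>B. \<Sum>i<n. B (e i) (f i)))"

text \<open>The same element, in the tensor product of the opposite of K with L.\<close>

definition copairing_op :: "('k::field, 'a) hopf \<Rightarrow> ('k, 'b) hopf \<Rightarrow> ('a \<Rightarrow> 'b \<Rightarrow> 'k)
    \<Rightarrow> ('k, 'a, 'b) tensor" where
  "copairing_op K L p = T2 (opp K) L (copairing K L p)"


section \<open>Coactions and actions\<close>

text \<open>Structure maps are extensional, so that equality of maps is equality on carriers. Only the
  bialgebra structure of C is used, so that C may be of the form opp K; the antipode field
  of opp K is meaningless.\<close>

definition left_coaction :: "('k::field, 'h) hopf \<Rightarrow> ('k, 'x) module
    \<Rightarrow> ('x \<Rightarrow> ('k, 'h, 'x) tensor) \<Rightarrow> bool" where
  "left_coaction C X \<alpha> \<longleftrightarrow> \<alpha> \<in> alg_hom X (tensor_alg C X) \<inter> extensional (carrier X) \<and>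
     (\<forall>x\<in>carrier X. map_left C C X (comult C) (\<alpha> x) = map_right C C X \<alpha> (\<alpha> x)) \<and>
     (\<forall>x\<in>carrier X. tensor_lift C X X (\<lambda>c x'. counit C c \<odot>\<^bsub>X\<^esub> x') (\<alpha> x) = x)"

definition right_coaction :: "('k::field, 'h) hopf \<Rightarrow> ('k, 'x) module
    \<Rightarrow> ('x \<Rightarrow> ('k, 'x, 'h) tensor) \<Rightarrow> bool" where
  "right_coaction C X \<alpha> \<longleftrightarrow> \<alpha> \<in> alg_hom X (tensor_alg X C) \<inter> extensional (carrier X) \<and>
     (\<forall>x\<in>carrier X. map_right X C C (comult C) (\<alpha> x) = map_left X C C \<alpha> (\<alpha> x)) \<and>
     (\<forall>x\<in>carrier X. tensor_lift X C X (\<lambda>x' c. counit C c \<odot>\<^bsub>X\<^esub> x') (\<alpha> x) = x)"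

definition left_action :: "('k::field, 'h) hopf \<Rightarrow> ('k, 'x) module \<Rightarrow> ('h \<Rightarrow> 'x \<Rightarrow> 'x) \<Rightarrow> bool" where
  "left_action K X a \<longleftrightarrow>
     a \<in> extensional (carrier K) \<and> (\<forall>k\<in>carrier K. a k \<in> extensional (carrier X)) \<and>
     bilinear_map K X X a \<and>
     (\<forall>x\<in>carrier X. a \<one>\<^bsub>K\<^esub> x = x) \<and>
     (\<forall>k\<in>carrier K. \<forall>k'\<in>carrier K. \<forall>x\<in>carrier X. a (k \<otimes>\<^bsub>K\<^esub> k') x = a k (a k' x)) \<and>
     (\<forall>k\<in>carrier K. \<forall>x\<in>carrier X. \<forall>y\<in>carrier X.
        a k (x \<otimes>\<^bsub>X\<^esub> y) = tensor_lift K K X (\<lambda>k1 k2. a k1 x \<otimes>\<^bsub>X\<^esub> a k2 y) (comult K k)) \<and>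
     (\<forall>k\<in>carrier K. a k \<one>\<^bsub>X\<^esub> = counit K k \<odot>\<^bsub>X\<^esub> \<one>\<^bsub>X\<^esub>)"

definition right_action :: "('k::field, 'h) hopf \<Rightarrow> ('k, 'x) module \<Rightarrow> ('x \<Rightarrow> 'h \<Rightarrow> 'x) \<Rightarrow> bool" where
  "right_action K X a \<longleftrightarrow>
     a \<in> extensional (carrier X) \<and> (\<forall>x\<in>carrier X. a x \<in> extensional (carrier K)) \<and>
     bilinear_map X K X a \<and>
     (\<forall>x\<in>carrier X. a x \<one>\<^bsub>K\<^esub> = x) \<and>
     (\<forall>k\<in>carrier K. \<forall>k'\<in>carrier K. \<forall>x\<in>carrier X. a x (k \<otimes>\<^bsub>K\<^esub> k') = a (a x k) k') \<and>
     (\<forall>k\<in>carrier K. \<forall>x\<in>carrier X. \<forall>y\<in>carrier X.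
        a (x \<otimes>\<^bsub>X\<^esub> y) k = tensor_lift K K X (\<lambda>k1 k2. a x k1 \<otimes>\<^bsub>X\<^esub> a y k2) (comult K k)) \<and>
     (\<forall>k\<in>carrier K. a \<one>\<^bsub>X\<^esub> k = counit K k \<odot>\<^bsub>X\<^esub> \<one>\<^bsub>X\<^esub>)"

definition lcoact_equivariant where
  "lcoact_equivariant C X Y \<alpha> \<alpha>' f \<longleftrightarrow> (\<forall>x\<in>carrier X. \<alpha>' (f x) = map2 C Y (\<lambda>c. c) f (\<alpha> x))"

definition rcoact_equivariant where
  "rcoact_equivariant C X Y \<alpha> \<alpha>' f \<longleftrightarrow> (\<forall>x\<in>carrier X. \<alpha>' (f x) = map2 Y C f (\<lambda>c. c) (\<alpha> x))"

definition lact_equivariant where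
  "lact_equivariant K X a a' f \<longleftrightarrow> (\<forall>k\<in>carrier K. \<forall>x\<in>carrier X. f (a k x) = a' k (f x))"

definition ract_equivariant where
  "ract_equivariant K X a a' f \<longleftrightarrow> (\<forall>k\<in>carrier K. \<forall>x\<in>carrier X. f (a x k) = a' (f x) k)"

text \<open>The actions of K induced by coactions of L.\<close>

definition induced_lact :: "('k::field, 'a) hopf \<Rightarrow> ('k, 'b) hopf \<Rightarrow> ('a \<Rightarrow> 'b \<Rightarrow> 'k)
    \<Rightarrow> ('k, 'x) module \<Rightarrow> ('x \<Rightarrow> ('k, 'x, 'b) tensor) \<Rightarrow> 'a \<Rightarrow> 'x \<Rightarrow> 'x" where
  "induced_lact K L p X \<beta> = (\<lambda>k\<in>carrier K. \<lambda>x\<in>carrier X.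
     tensor_lift X L X (\<lambda>x' l. p k l \<odot>\<^bsub>X\<^esub> x') (\<beta> x))"

definition induced_ract :: "('k::field, 'a) hopf \<Rightarrow> ('k, 'b) hopf \<Rightarrow> ('a \<Rightarrow> 'b \<Rightarrow> 'k)
    \<Rightarrow> ('k, 'x) module \<Rightarrow> ('x \<Rightarrow> ('k, 'b, 'x) tensor) \<Rightarrow> 'x \<Rightarrow> 'a \<Rightarrow> 'x" where
  "induced_ract K L p X \<beta> = (\<lambda>x\<in>carrier X. \<lambda>k\<in>carrier K.
     tensor_lift L X X (\<lambda>l x'. p k l \<odot>\<^bsub>X\<^esub> x') (\<beta> x))"

text \<open>The coaction of L that induces a given right action of K.\<close>

definition coact_of_ract :: "('k::field, 'a) hopf \<Rightarrow> ('k, 'b) hopf \<Rightarrow> ('a \<Rightarrow> 'b \<Rightarrow> 'k)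
    \<Rightarrow> ('k, 'x) module \<Rightarrow> ('x \<Rightarrow> 'a \<Rightarrow> 'x) \<Rightarrow> 'x \<Rightarrow> ('k, 'b, 'x) tensor" where
  "coact_of_ract K L p X a = (THE \<beta>. left_coaction L X \<beta> \<and> induced_ract K L p X \<beta> = a)"

text \<open>Passage from right coactions of C to left coactions of opp C via the inverse of the
  antipode, its inverse, and the analogous passage from left to right coactions.\<close>

definition right_to_left_op :: "('k::field, 'h) hopf \<Rightarrow> ('k, 'x) module
    \<Rightarrow> ('x \<Rightarrow> ('k, 'x, 'h) tensor) \<Rightarrow> 'x \<Rightarrow> ('k, 'h, 'x) tensor" where
  "right_to_left_op C X \<alpha> = (\<lambda>x\<in>carrier X.
     map2 (opp C) X (antipode_inv C) (\<lambda>x'. x') (flip C X (\<alpha> x)))"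

definition left_op_to_right :: "('k::field, 'h) hopf \<Rightarrow> ('k, 'x) module
    \<Rightarrow> ('x \<Rightarrow> ('k, 'h, 'x) tensor) \<Rightarrow> 'x \<Rightarrow> ('k, 'x, 'h) tensor" where
  "left_op_to_right C X \<alpha> = (\<lambda>x\<in>carrier X.
     flip X C (map2 C X (antipode C) (\<lambda>x'. x') (\<alpha> x)))"

definition left_to_right_op :: "('k::field, 'h) hopf \<Rightarrow> ('k, 'x) module
    \<Rightarrow> ('x \<Rightarrow> ('k, 'h, 'x) tensor) \<Rightarrow> 'x \<Rightarrow> ('k, 'x, 'h) tensor" where
  "left_to_right_op C X \<beta> = (\<lambda>x\<in>carrier X.
     map2 X (opp C) (\<lambda>x'. x') (antipode_inv C) (flip X C (\<beta> x)))"


section \<open>Categories\<close>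

text \<open>Morphisms need not determine their source and target, hence the object arguments of
  composition.\<close>

record ('o, 'm) category =
  Obj :: "'o set"
  Hom :: "'o \<Rightarrow> 'o \<Rightarrow> 'm set"
  Ident :: "'o \<Rightarrow> 'm"
  Comp :: "'o \<Rightarrow> 'o \<Rightarrow> 'o \<Rightarrow> 'm \<Rightarrow> 'm \<Rightarrow> 'm"

locale category =
  fixes C :: "('o, 'm) category"
  assumes Ident_in: "\<And>a. a \<in> Obj C \<Longrightarrow> Ident C a \<in> Hom C a a"
    and Comp_in: "\<And>a b c f g. \<lbrakk>a \<in> Obj C; b \<in> Obj C; c \<in> Obj C; f \<in> Hom C a b; g \<in> Hom C b c\<rbrakk>
      \<Longrightarrow> Comp C a b c g f \<in> Hom C a c"
    and Comp_Ident: "\<And>a b f. \<lbrakk>a \<in> Obj C; b \<in> Obj C; f \<in> Hom C a b\<rbrakk>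
      \<Longrightarrow> Comp C a a b f (Ident C a) = f"
    and Ident_Comp: "\<And>a b f. \<lbrakk>a \<in> Obj C; b \<in> Obj C; f \<in> Hom C a b\<rbrakk>
      \<Longrightarrow> Comp C a b b (Ident C b) f = f"
    and Comp_assoc: "\<And>a b c d f g h. \<lbrakk>a \<in> Obj C; b \<in> Obj C; c \<in> Obj C; d \<in> Obj C;
      f \<in> Hom C a b; g \<in> Hom C b c; h \<in> Hom C c d\<rbrakk>
      \<Longrightarrow> Comp C a b d (Comp C b c d h g) f = Comp C a c d h (Comp C a b c g f)"

text \<open>A functor is given by its map on objects and, for each pair of objects, its map on morphisms.\<close>

type_synonym ('o, 'm, 'o2, 'm2) functor_data = "('o \<Rightarrow> 'o2) \<times> ('o \<Rightarrow> 'o \<Rightarrow> 'm \<Rightarrow> 'm2)"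

definition is_functor :: "('o, 'm) category \<Rightarrow> ('o2, 'm2) category
    \<Rightarrow> ('o, 'm, 'o2, 'm2) functor_data \<Rightarrow> bool" where
  "is_functor C D F \<longleftrightarrow> category C \<and> category D \<and>
     (\<forall>a\<in>Obj C. fst F a \<in> Obj D) \<and>
     (\<forall>a\<in>Obj C. \<forall>b\<in>Obj C. \<forall>f\<in>Hom C a b. snd F a b f \<in> Hom D (fst F a) (fst F b)) \<and>
     (\<forall>a\<in>Obj C. snd F a a (Ident C a) = Ident D (fst F a)) \<and>
     (\<forall>a\<in>Obj C. \<forall>b\<in>Obj C. \<forall>c\<in>Obj C. \<forall>f\<in>Hom C a b. \<forall>g\<in>Hom C b c.
        snd F a c (Comp C a b c g f) =
        Comp D (fst F a) (fst F b) (fst F c) (snd F b c g) (snd F a b f))"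

definition id_functor :: "('o, 'm, 'o, 'm) functor_data" where
  "id_functor = (\<lambda>a. a, \<lambda>a b f. f)"

definition comp_functor :: "('o2, 'm2, 'o3, 'm3) functor_data \<Rightarrow> ('o, 'm, 'o2, 'm2) functor_data
    \<Rightarrow> ('o, 'm, 'o3, 'm3) functor_data" where
  "comp_functor G F =
     (\<lambda>a. fst G (fst F a), \<lambda>a b f. snd G (fst F a) (fst F b) (snd F a b f))"

definition functors_eq :: "('o, 'm) category \<Rightarrow> ('o, 'm, 'o2, 'm2) functor_data
    \<Rightarrow> ('o, 'm, 'o2, 'm2) functor_data \<Rightarrow> bool" where
  "functors_eq C F G \<longleftrightarrow> (\<forall>a\<in>Obj C. fst F a = fst G a) \<and>
     (\<forall>a\<in>Obj C. \<forall>b\<in>Obj C. \<forall>f\<in>Hom C a b. snd F a b f = snd G a b f)"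

definition is_iso :: "('o, 'm) category \<Rightarrow> 'o \<Rightarrow> 'o \<Rightarrow> 'm \<Rightarrow> bool" where
  "is_iso C a b f \<longleftrightarrow> f \<in> Hom C a b \<and>
     (\<exists>g\<in>Hom C b a. Comp C a b a g f = Ident C a \<and> Comp C b a b f g = Ident C b)"

definition natural_iso :: "('o, 'm) category \<Rightarrow> ('o2, 'm2) category
    \<Rightarrow> ('o, 'm, 'o2, 'm2) functor_data \<Rightarrow> ('o, 'm, 'o2, 'm2) functor_data \<Rightarrow> ('o \<Rightarrow> 'm2) \<Rightarrow> bool" where
  "natural_iso C D F G \<eta> \<longleftrightarrow>
     (\<forall>a\<in>Obj C. is_iso D (fst F a) (fst G a) (\<eta> a)) \<and>
     (\<forall>a\<in>Obj C. \<forall>b\<in>Obj C. \<forall>f\<in>Hom C a b.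
        Comp D (fst F a) (fst F b) (fst G b) (\<eta> b) (snd F a b f) =
        Comp D (fst F a) (fst G a) (fst G b) (snd G a b f) (\<eta> a))"

definition is_equivalence :: "('o, 'm) category \<Rightarrow> ('o2, 'm2) category
    \<Rightarrow> ('o, 'm, 'o2, 'm2) functor_data \<Rightarrow> bool" where
  "is_equivalence C D F \<longleftrightarrow> is_functor C D F \<and>
     (\<exists>G \<eta> \<epsilon>. is_functor D C G \<and>
        natural_iso C C id_functor (comp_functor G F) \<eta> \<and>
        natural_iso D D (comp_functor F G) id_functor \<epsilon>)"

text \<open>The category of algebras with two further pieces of structure, where P singles out the objects
  and M a b f states that f intertwines these structures. The algebras range over all
  carrier sets in the type 'x.\<close>

definition structured_algebras ::
  "(('k::field, 'x) module \<times> 's \<times> 't \<Rightarrow> bool)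
    \<Rightarrow> (('k, 'x) module \<times> 's \<times> 't \<Rightarrow> ('k, 'x) module \<times> 's \<times> 't \<Rightarrow> ('x \<Rightarrow> 'x) \<Rightarrow> bool)
    \<Rightarrow> (('k, 'x) module \<times> 's \<times> 't, 'x \<Rightarrow> 'x) category" where
  "structured_algebras P M =
    \<lparr>Obj = {a. k_algebra (fst a) \<and> P a},
     Hom = \<lambda>a b. {f \<in> alg_hom (fst a) (fst b) \<inter> extensional (carrier (fst a)). M a b f},
     Ident = \<lambda>a. (\<lambda>x\<in>carrier (fst a). x),
     Comp = \<lambda>a b c g f. compose (carrier (fst a)) g f\<rparr>"

definition id_on_morphisms :: "('o \<Rightarrow> 'o2) \<Rightarrow> ('o, 'm, 'o2, 'm) functor_data" where
  "id_on_morphisms \<Phi> = (\<Phi>, \<lambda>a b f. f)"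


section \<open>Yetter--Drinfeld algebras in terms of two coactions\<close>

type_synonym ('k, 'x, 's, 't) ll_obj =
  "('k, 'x) module \<times> ('x \<Rightarrow> ('k, 's, 'x) tensor) \<times> ('x \<Rightarrow> ('k, 't, 'x) tensor)"
type_synonym ('k, 'x, 's, 't) lr_obj =
  "('k, 'x) module \<times> ('x \<Rightarrow> ('k, 's, 'x) tensor) \<times> ('x \<Rightarrow> ('k, 'x, 't) tensor)"
type_synonym ('k, 'x, 's, 't) rl_obj =
  "('k, 'x) module \<times> ('x \<Rightarrow> ('k, 'x, 's) tensor) \<times> ('x \<Rightarrow> ('k, 't, 'x) tensor)"
type_synonym ('k, 'x, 's, 't) rr_obj =
  "('k, 'x) module \<times> ('x \<Rightarrow> ('k, 'x, 's) tensor) \<times> ('x \<Rightarrow> ('k, 'x, 't) tensor)"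

definition YD_lr :: "('k::field, 'a) hopf \<Rightarrow> ('k, 'b) hopf \<Rightarrow> ('a \<Rightarrow> 'b \<Rightarrow> 'k)
    \<Rightarrow> (('k, 'x, 'a, 'b) lr_obj, 'x \<Rightarrow> 'x) category" where
  "YD_lr K L p = structured_algebras
     (\<lambda>(X, \<alpha>, \<beta>). left_coaction K X \<alpha> \<and> right_coaction L X \<beta> \<and>
        (\<forall>x\<in>carrier X. map_left K X L \<alpha> (\<beta> x) =
           Ad (tensor_alg3 K X L) (leg13 K X L (copairing K L p)) (map_right K X L \<beta> (\<alpha> x))))
     (\<lambda>(X, \<alpha>, \<beta>) (Y, \<alpha>', \<beta>') f.
        lcoact_equivariant K X Y \<alpha> \<alpha>' f \<and> rcoact_equivariant L X Y \<beta> \<beta>' f)"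

definition YD_rl :: "('k::field, 'a) hopf \<Rightarrow> ('k, 'b) hopf \<Rightarrow> ('a \<Rightarrow> 'b \<Rightarrow> 'k)
    \<Rightarrow> (('k, 'x, 'a, 'b) rl_obj, 'x \<Rightarrow> 'x) category" where
  "YD_rl K L p = structured_algebras
     (\<lambda>(X, \<alpha>, \<beta>). right_coaction K X \<alpha> \<and> left_coaction L X \<beta> \<and>
        (\<forall>x\<in>carrier X. map_right L X K \<alpha> (\<beta> x) =
           Ad (tensor_alg3 L X K)
             (leg13 L X K (flip L K (inv\<^bsub>tensor_alg K L\<^esub> (copairing K L p))))
             (map_left L X K \<beta> (\<alpha> x))))
     (\<lambda>(X, \<alpha>, \<beta>) (Y, \<alpha>', \<beta>') f.
        rcoact_equivariant K X Y \<alpha> \<alpha>' f \<and> lcoact_equivariant L X Y \<beta> \<beta>' f)"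

definition YD_ll :: "('k::field, 'a) hopf \<Rightarrow> ('k, 'b) hopf \<Rightarrow> ('a \<Rightarrow> 'b \<Rightarrow> 'k)
    \<Rightarrow> (('k, 'x, 'a, 'b) ll_obj, 'x \<Rightarrow> 'x) category" where
  "YD_ll K L p = structured_algebras
     (\<lambda>(X, \<alpha>, \<beta>). left_coaction (opp K) X \<alpha> \<and> left_coaction L X \<beta> \<and>
        (\<forall>x\<in>carrier X. map_right L (opp K) X \<alpha> (\<beta> x) =
           flip12 L (opp K) X
             (on12 (opp K) L X (Ad (tensor_alg (opp K) L) (copairing_op K L p))
               (map_right (opp K) L X \<beta> (\<alpha> x)))))
     (\<lambda>(X, \<alpha>, \<beta>) (Y, \<alpha>', \<beta>') f.
        lcoact_equivariant (opp K) X Y \<alpha> \<alpha>' f \<and> lcoact_equivariant L X Y \<beta> \<beta>' f)"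

definition YD_rr :: "('k::field, 'a) hopf \<Rightarrow> ('k, 'b) hopf \<Rightarrow> ('a \<Rightarrow> 'b \<Rightarrow> 'k)
    \<Rightarrow> (('k, 'x, 'a, 'b) rr_obj, 'x \<Rightarrow> 'x) category" where
  "YD_rr K L p = structured_algebras
     (\<lambda>(X, \<alpha>, \<beta>). right_coaction (opp K) X \<alpha> \<and> right_coaction L X \<beta> \<and>
        (\<forall>x\<in>carrier X. map_left X (opp K) L \<alpha> (\<beta> x) =
           on23 X (opp K) L
             (Ad (tensor_alg (opp K) L) (inv\<^bsub>tensor_alg (opp K) L\<^esub> (copairing_op K L p)))
             (flip23 X (opp K) L (map_left X L (opp K) \<beta> (\<alpha> x)))))
     (\<lambda>(X, \<alpha>, \<beta>) (Y, \<alpha>', \<beta>') f.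
        rcoact_equivariant (opp K) X Y \<alpha> \<alpha>' f \<and> rcoact_equivariant L X Y \<beta> \<beta>' f)"

text \<open>Functors between these categories that are the identity on algebras and morphisms. In
  ll_to_rr, the coaction of K in the given pair is
  \<open>\<alpha>' = (S\<^sup>-\<^sup>1 \<otimes> id)\<Sigma>\<alpha>\<close> for
  \<open>\<alpha> = left_op_to_right K X \<alpha>'\<close>.\<close>

definition rl_to_lr :: "(('k, 'x, 'a, 'b) rl_obj, 'm, ('k, 'x, 'b, 'a) lr_obj, 'm) functor_data" where
  "rl_to_lr = id_on_morphisms (\<lambda>(X, \<alpha>, \<beta>). (X, \<beta>, \<alpha>))"

definition rl_to_ll :: "('k::field, 'a) hopf
    \<Rightarrow> (('k, 'x, 'a, 'b) rl_obj, 'm, ('k, 'x, 'a, 'b) ll_obj, 'm) functor_data" where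
  "rl_to_ll K = id_on_morphisms (\<lambda>(X, \<alpha>, \<beta>). (X, right_to_left_op K X \<alpha>, \<beta>))"

definition lr_to_rr :: "('k::field, 'a) hopf
    \<Rightarrow> (('k, 'x, 'a, 'b) lr_obj, 'm, ('k, 'x, 'a, 'b) rr_obj, 'm) functor_data" where
  "lr_to_rr K = id_on_morphisms (\<lambda>(X, \<alpha>, \<beta>). (X, left_to_right_op K X \<alpha>, \<beta>))"

definition ll_to_rr :: "('k::field, 'a) hopf \<Rightarrow> ('k, 'b) hopf
    \<Rightarrow> (('k, 'x, 'a, 'b) ll_obj, 'm, ('k, 'x, 'b, 'a) rr_obj, 'm) functor_data" where
  "ll_to_rr K L = id_on_morphisms
     (\<lambda>(X, \<alpha>', \<beta>). (X, left_to_right_op L X \<beta>, left_op_to_right K X \<alpha>'))"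


section \<open>Yetter--Drinfeld algebras in standard form\<close>

type_synonym ('k, 'x, 's, 't) lact_lcoact_obj =
  "('k, 'x) module \<times> ('s \<Rightarrow> 'x \<Rightarrow> 'x) \<times> ('x \<Rightarrow> ('k, 't, 'x) tensor)"
type_synonym ('k, 'x, 's, 't) ract_rcoact_obj =
  "('k, 'x) module \<times> ('x \<Rightarrow> 's \<Rightarrow> 'x) \<times> ('x \<Rightarrow> ('k, 'x, 't) tensor)"
type_synonym ('k, 'x, 's, 't) ract_lcoact_obj =
  "('k, 'x) module \<times> ('x \<Rightarrow> 's \<Rightarrow> 'x) \<times> ('x \<Rightarrow> ('k, 't, 'x) tensor)"
type_synonym ('k, 'x, 's, 't) lact_rcoact_obj =
  "('k, 'x) module \<times> ('s \<Rightarrow> 'x \<Rightarrow> 'x) \<times> ('x \<Rightarrow> ('k, 'x, 't) tensor)"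

definition YD_lact_lcoact :: "('k::field, 'h) hopf
    \<Rightarrow> (('k, 'x, 'h, 'h) lact_lcoact_obj, 'x \<Rightarrow> 'x) category" where
  "YD_lact_lcoact K = structured_algebras
     (\<lambda>(X, a, \<alpha>). left_action K X a \<and> left_coaction K X \<alpha> \<and>
        (\<forall>k\<in>carrier K. \<forall>x\<in>carrier X.
           T2 K X (\<lambda>B. comult K k (\<lambda>k1 k2. \<alpha> x (\<lambda>h x0. B (k1 \<otimes>\<^bsub>K\<^esub> h) (a k2 x0)))) =
           T2 K X (\<lambda>B. comult K k (\<lambda>k1 k2. \<alpha> (a k1 x) (\<lambda>h y0. B (h \<otimes>\<^bsub>K\<^esub> k2) y0)))))
     (\<lambda>(X, a, \<alpha>) (Y, a', \<alpha>') f.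
        lact_equivariant K X a a' f \<and> lcoact_equivariant K X Y \<alpha> \<alpha>' f)"

definition YD_ract_rcoact :: "('k::field, 'h) hopf
    \<Rightarrow> (('k, 'x, 'h, 'h) ract_rcoact_obj, 'x \<Rightarrow> 'x) category" where
  "YD_ract_rcoact K = structured_algebras
     (\<lambda>(X, a, \<alpha>). right_action K X a \<and> right_coaction K X \<alpha> \<and>
        (\<forall>k\<in>carrier K. \<forall>x\<in>carrier X.
           T2 X K (\<lambda>B. comult K k (\<lambda>k1 k2. \<alpha> x (\<lambda>x0 h. B (a x0 k1) (h \<otimes>\<^bsub>K\<^esub> k2)))) =
           T2 X K (\<lambda>B. comult K k (\<lambda>k1 k2. \<alpha> (a x k2) (\<lambda>y0 h. B y0 (k1 \<otimes>\<^bsub>K\<^esub> h))))))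
     (\<lambda>(X, a, \<alpha>) (Y, a', \<alpha>') f.
        ract_equivariant K X a a' f \<and> rcoact_equivariant K X Y \<alpha> \<alpha>' f)"

definition YD_ract_lcoact :: "('k::field, 'h) hopf
    \<Rightarrow> (('k, 'x, 'h, 'h) ract_lcoact_obj, 'x \<Rightarrow> 'x) category" where
  "YD_ract_lcoact K = structured_algebras
     (\<lambda>(X, a, \<alpha>). right_action K X a \<and> left_coaction (opp K) X \<alpha> \<and>
        (\<forall>k\<in>carrier K. \<forall>x\<in>carrier X.
           T2 K X (\<lambda>B. comult K k (\<lambda>k1 k2. \<alpha> x (\<lambda>h x0. B (h \<otimes>\<^bsub>K\<^esub> k1) (a x0 k2)))) =
           T2 K X (\<lambda>B. comult K k (\<lambda>k1 k2. \<alpha> (a x k1) (\<lambda>h y0. B (k2 \<otimes>\<^bsub>K\<^esub> h) y0)))))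
     (\<lambda>(X, a, \<alpha>) (Y, a', \<alpha>') f.
        ract_equivariant K X a a' f \<and> lcoact_equivariant (opp K) X Y \<alpha> \<alpha>' f)"

definition YD_lact_rcoact :: "('k::field, 'h) hopf
    \<Rightarrow> (('k, 'x, 'h, 'h) lact_rcoact_obj, 'x \<Rightarrow> 'x) category" where
  "YD_lact_rcoact K = structured_algebras
     (\<lambda>(X, a, \<alpha>). left_action K X a \<and> right_coaction (opp K) X \<alpha> \<and>
        (\<forall>k\<in>carrier K. \<forall>x\<in>carrier X.
           T2 X K (\<lambda>B. comult K k (\<lambda>k1 k2. \<alpha> x (\<lambda>x0 h. B (a k1 x0) (k2 \<otimes>\<^bsub>K\<^esub> h)))) =
           T2 X K (\<lambda>B. comult K k (\<lambda>k1 k2. \<alpha> (a k2 x) (\<lambda>y0 h. B y0 (h \<otimes>\<^bsub>K\<^esub> k1))))))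
     (\<lambda>(X, a, \<alpha>) (Y, a', \<alpha>') f.
        lact_equivariant K X a a' f \<and> rcoact_equivariant (opp K) X Y \<alpha> \<alpha>' f)"

definition std_lr :: "('k::field, 'a) hopf \<Rightarrow> ('k, 'b) hopf \<Rightarrow> ('a \<Rightarrow> 'b \<Rightarrow> 'k)
    \<Rightarrow> (('k, 'x, 'a, 'b) lr_obj, 'm, ('k, 'x, 'a, 'a) lact_lcoact_obj, 'm) functor_data" where
  "std_lr K L p = id_on_morphisms (\<lambda>(X, \<alpha>, \<beta>). (X, induced_lact K L p X \<beta>, \<alpha>))"

definition std_rr :: "('k::field, 'a) hopf \<Rightarrow> ('k, 'b) hopf \<Rightarrow> ('a \<Rightarrow> 'b \<Rightarrow> 'k)
    \<Rightarrow> (('k, 'x, 'a, 'b) rr_obj, 'm, ('k, 'x, 'a, 'a) lact_rcoact_obj, 'm) functor_data" where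
  "std_rr K L p = id_on_morphisms (\<lambda>(X, \<alpha>, \<beta>). (X, induced_lact K L p X \<beta>, \<alpha>))"

definition std_rl :: "('k::field, 'a) hopf \<Rightarrow> ('k, 'b) hopf \<Rightarrow> ('a \<Rightarrow> 'b \<Rightarrow> 'k)
    \<Rightarrow> (('k, 'x, 'a, 'b) rl_obj, 'm, ('k, 'x, 'a, 'a) ract_rcoact_obj, 'm) functor_data" where
  "std_rl K L p = id_on_morphisms (\<lambda>(X, \<alpha>, \<beta>). (X, induced_ract K L p X \<beta>, \<alpha>))"

definition std_ll :: "('k::field, 'a) hopf \<Rightarrow> ('k, 'b) hopf \<Rightarrow> ('a \<Rightarrow> 'b \<Rightarrow> 'k)
    \<Rightarrow> (('k, 'x, 'a, 'b) ll_obj, 'm, ('k, 'x, 'a, 'a) ract_lcoact_obj, 'm) functor_data" where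
  "std_ll K L p = id_on_morphisms (\<lambda>(X, \<alpha>, \<beta>). (X, induced_ract K L p X \<beta>, \<alpha>))"

text \<open>Functors between the categories of Yetter--Drinfeld algebras in standard form. Here q is the
  pairing with the roles of K and L exchanged.\<close>

definition std_rl_to_lr :: "('k::field, 'a) hopf \<Rightarrow> ('k, 'b) hopf \<Rightarrow> ('a \<Rightarrow> 'b \<Rightarrow> 'k) \<Rightarrow> ('b \<Rightarrow> 'a \<Rightarrow> 'k)
    \<Rightarrow> (('k, 'x, 'a, 'a) ract_rcoact_obj, 'm, ('k, 'x, 'b, 'b) lact_lcoact_obj, 'm) functor_data" where
  "std_rl_to_lr K L p q = id_on_morphisms
     (\<lambda>(X, a, \<alpha>). (X, induced_lact L K q X \<alpha>, coact_of_ract K L p X a))"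

definition std_rl_to_ll :: "('k::field, 'a) hopf
    \<Rightarrow> (('k, 'x, 'a, 'a) ract_rcoact_obj, 'm, ('k, 'x, 'a, 'a) ract_lcoact_obj, 'm) functor_data" where
  "std_rl_to_ll K = id_on_morphisms (\<lambda>(X, a, \<alpha>). (X, a, right_to_left_op K X \<alpha>))"

definition std_lr_to_rr :: "('k::field, 'a) hopf
    \<Rightarrow> (('k, 'x, 'a, 'a) lact_lcoact_obj, 'm, ('k, 'x, 'a, 'a) lact_rcoact_obj, 'm) functor_data" where
  "std_lr_to_rr K = id_on_morphisms (\<lambda>(X, a, \<alpha>). (X, a, left_to_right_op K X \<alpha>))"

definition std_ll_to_rr :: "('k::field, 'a) hopf \<Rightarrow> ('k, 'b) hopf \<Rightarrow> ('a \<Rightarrow> 'b \<Rightarrow> 'k) \<Rightarrow> ('b \<Rightarrow> 'a \<Rightarrow> 'k)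
    \<Rightarrow> (('k, 'x, 'a, 'a) ract_lcoact_obj, 'm, ('k, 'x, 'b, 'b) lact_rcoact_obj, 'm) functor_data" where
  "std_ll_to_rr K L p q = id_on_morphisms
     (\<lambda>(X, a, \<alpha>'). (X, induced_lact L K q X (left_op_to_right K X \<alpha>'),
                    left_to_right_op L X (coact_of_ract K L p X a)))"


section \<open>Braided commutativity\<close>

definition heisenberg :: "('k::field, 'a) hopf \<Rightarrow> ('k, 'b) hopf \<Rightarrow> ('a \<Rightarrow> 'b \<Rightarrow> 'k)
    \<Rightarrow> ('k, ('k, 'a, 'b) tensor) module" where
  "heisenberg K L p = (tensor_alg K L)
     \<lparr>mult := \<lambda>s t. T2 K L (\<lambda>B. s (\<lambda>k \<theta>. t (\<lambda>k' \<theta>'.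
        comult K k' (\<lambda>k1 k2. comult L \<theta> (\<lambda>\<theta>1 \<theta>2.
          p k2 \<theta>1 * B (k \<otimes>\<^bsub>K\<^esub> k1) (\<theta>2 \<otimes>\<^bsub>L\<^esub> \<theta>'))))))\<rparr>"

definition commuting :: "('k, 'a) module \<Rightarrow> 'a \<Rightarrow> 'a \<Rightarrow> bool" where
  "commuting A u v \<longleftrightarrow> u \<otimes>\<^bsub>A\<^esub> v = v \<otimes>\<^bsub>A\<^esub> u"

definition braided_commutative_lr :: "('k::field, 'a) hopf \<Rightarrow> ('k, 'b) hopf \<Rightarrow> ('a \<Rightarrow> 'b \<Rightarrow> 'k)
    \<Rightarrow> ('k, 'x, 'a, 'b) lr_obj \<Rightarrow> bool" where
  "braided_commutative_lr K L p = (\<lambda>(X, \<alpha>, \<beta>). \<forall>x\<in>carrier X. \<forall>y\<in>carrier X.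
     commuting (tensor_alg (heisenberg K L p) X)
       (T2 (heisenberg K L p) X (\<lambda>B. \<alpha> x (\<lambda>k x0. B (pure2 K L k \<one>\<^bsub>L\<^esub>) x0)))
       (T2 (heisenberg K L p) X (\<lambda>B. \<beta> y (\<lambda>y0 l. B (pure2 K L \<one>\<^bsub>K\<^esub> l) y0))))"

definition braided_commutative_rr :: "('k::field, 'a) hopf \<Rightarrow> ('k, 'b) hopf \<Rightarrow> ('a \<Rightarrow> 'b \<Rightarrow> 'k)
    \<Rightarrow> ('k, 'x, 'a, 'b) rr_obj \<Rightarrow> bool" where
  "braided_commutative_rr K L p = (\<lambda>(X, \<alpha>, \<beta>). \<forall>x\<in>carrier X. \<forall>y\<in>carrier X.
     commuting (tensor_alg X (heisenberg K L p))
       (T2 X (heisenberg K L p) (\<lambda>B. \<alpha> x (\<lambda>x0 k. B x0 (pure2 K L (antipode K k) \<one>\<^bsub>L\<^esub>))))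
       (T2 X (heisenberg K L p) (\<lambda>B. \<beta> y (\<lambda>y0 l. B y0 (pure2 K L \<one>\<^bsub>K\<^esub> l)))))"

definition braided_commutative_rl :: "('k::field, 'a) hopf \<Rightarrow> ('k, 'b) hopf \<Rightarrow> ('a \<Rightarrow> 'b \<Rightarrow> 'k)
    \<Rightarrow> ('k, 'x, 'a, 'b) rl_obj \<Rightarrow> bool" where
  "braided_commutative_rl K L p = (\<lambda>(X, \<alpha>, \<beta>).
     let Heis = heisenberg L K (\<lambda>l k. p k l) in \<forall>x\<in>carrier X. \<forall>y\<in>carrier X.
     commuting (tensor_alg X Heis)
       (T2 X Heis (\<lambda>B. \<alpha> x (\<lambda>x0 k. B x0 (pure2 L K \<one>\<^bsub>L\<^esub> k))))
       (T2 X Heis (\<lambda>B. \<beta> y (\<lambda>l y0. B y0 (pure2 L K l \<one>\<^bsub>K\<^esub>)))))"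

definition braided_commutative_ll :: "('k::field, 'a) hopf \<Rightarrow> ('k, 'b) hopf \<Rightarrow> ('a \<Rightarrow> 'b \<Rightarrow> 'k)
    \<Rightarrow> ('k, 'x, 'a, 'b) ll_obj \<Rightarrow> bool" where
  "braided_commutative_ll K L p = (\<lambda>(X, \<alpha>, \<beta>). \<forall>x\<in>carrier X. \<forall>y\<in>carrier X.
     commuting (tensor_alg (heisenberg K L p) (opp X))
       (T2 (heisenberg K L p) (opp X) (\<lambda>B. \<alpha> x (\<lambda>k x0. B (pure2 K L k \<one>\<^bsub>L\<^esub>) x0)))
       (T2 (heisenberg K L p) (opp X) (\<lambda>B. \<beta> y (\<lambda>l y0. B (pure2 K L \<one>\<^bsub>K\<^esub> (antipode L l)) y0))))"

end

theory Submission
  imports Defs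
begin

text \<open>A tensor is a functional on bilinear or trilinear forms, so an identity between tensors, coactions or
  iterated coactions is an identity between the values of these functionals on all multilinear forms.
  Every definition is first put into this form; no choice of representatives is then needed, and
  exchanging two coactions that act on different variables is an instance of Fubini for finite sums.
  Linear forms separate the points of a vector space of any dimension, which turns identities
  between values back into identities between elements.

  A finite-dimensional Hopf algebra K and its dual L are treated symmetrically, as a pair with
  dual bases e i and f i. A left coaction of L is the same as a right action of K, because testing the
  leg in L against the elements of K loses no information; likewise on the other side.

  The four Yetter--Drinfeld conditions compare the two iterated coactions after multiplication
  with the copairing, which is the sum of the tensors of e i and f i, or with its inverse, from the two
  sides. Passing from rl to lr exchanges K and L, and the flipped inverse of the copairing conjugates in the
  direction opposite to the copairing of L and K. The inverse antipode moves a coaction of K to the other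
  side; it reverses products, so that the copairing in the tensor product of K and L is carried to the
  inverse of the copairing in the tensor product of the opposite of K and L. Pairing the leg in L with
  elements of K turns multiplication by f i into a coproduct of K, and this yields the
  four conditions in standard form.

  All the functors do nothing to underlying maps, so an equivalence reduces to a bijection on
  objects that respects equivariance. It suffices to construct enough of these isomorphisms:
  the others complete commuting squares.

  Braided commutativity is one identity in the smash product once the multiplication with the generators of
  K and L is worked out. For rr the antipode in the condition cancels the inverse antipode in the
  change of side. For ll the inverse antipode of K and the antipode of L are adjoint to
  each other up to inversion, so that the pairing in the smash product is preserved while both coproducts
  are reversed.\<close>

section \<open>Linear forms separate points\<close>

abbreviation vspace :: "('k::field, 'a, 'z) module_scheme => bool" where
  "vspace V == module scalars V"

lemma scalars_simps [simp]:
  "carrier scalars = UNIV" "mult scalars = (*)" "one scalars = 1"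
  "zero scalars = 0" "add scalars = (+)"
  by (simp_all add: scalars_def)

lemma cring_scalars: "cring (scalars :: 'k::field ring)"
proof (rule cringI)
  show "abelian_group (scalars :: 'k ring)"
    by (rule abelian_groupI) (auto simp: algebra_simps, metis add.right_inverse add.commute)
  show "comm_monoid (scalars :: 'k ring)"
    by (rule comm_monoidI) (auto simp: algebra_simps)
qed (simp add: algebra_simps)

lemma vspace_smult:
  assumes "vspace V" "v \<in> carrier V"
  shows "c \<odot>\<^bsub>V\<^esub> v \<in> carrier V"
    and "(c + d) \<odot>\<^bsub>V\<^esub> v = c \<odot>\<^bsub>V\<^esub> v \<oplus>\<^bsub>V\<^esub> d \<odot>\<^bsub>V\<^esub> v"
    and "w \<in> carrier V ==> c \<odot>\<^bsub>V\<^esub> (v \<oplus>\<^bsub>V\<^esub> w) = c \<odot>\<^bsub>V\<^esub> v \<oplus>\<^bsub>V\<^esub> c \<odot>\<^bsub>V\<^esub> w"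
    and "(c * d) \<odot>\<^bsub>V\<^esub> v = c \<odot>\<^bsub>V\<^esub> (d \<odot>\<^bsub>V\<^esub> v)"
    and "1 \<odot>\<^bsub>V\<^esub> v = v"
proof -
  interpret module scalars V by fact
  show "c \<odot>\<^bsub>V\<^esub> v \<in> carrier V"
    and "(c + d) \<odot>\<^bsub>V\<^esub> v = c \<odot>\<^bsub>V\<^esub> v \<oplus>\<^bsub>V\<^esub> d \<odot>\<^bsub>V\<^esub> v"
    and "w \<in> carrier V ==> c \<odot>\<^bsub>V\<^esub> (v \<oplus>\<^bsub>V\<^esub> w) = c \<odot>\<^bsub>V\<^esub> v \<oplus>\<^bsub>V\<^esub> c \<odot>\<^bsub>V\<^esub> w"
    and "(c * d) \<odot>\<^bsub>V\<^esub> v = c \<odot>\<^bsub>V\<^esub> (d \<odot>\<^bsub>V\<^esub> v)"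
    and "1 \<odot>\<^bsub>V\<^esub> v = v"
    using assms smult_l_distr smult_r_distr smult_assoc1 smult_one smult_closed by auto
qed

lemma vspace_zero_smult:
  assumes V: "vspace V" "v \<in> carrier V"
  shows "0 \<odot>\<^bsub>V\<^esub> v = \<zero>\<^bsub>V\<^esub>"
  using module.smult_l_null[OF V] by simp

lemma linear_form_add:
  "linear_form V f ==> v \<in> carrier V ==> w \<in> carrier V ==> f (v \<oplus>\<^bsub>V\<^esub> w) = f v + f w"
  and linear_form_smult: "linear_form V f ==> v \<in> carrier V ==> f (c \<odot>\<^bsub>V\<^esub> v) = c * f v"
  by (auto simp: linear_form_def)

lemma linear_form_zero:
  assumes V: "vspace V" and f: "linear_form V f"
  shows "f \<zero>\<^bsub>V\<^esub> = 0"
proof -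
  interpret module scalars V by fact
  have "f (0 \<odot>\<^bsub>V\<^esub> \<zero>\<^bsub>V\<^esub>) = 0 * f \<zero>\<^bsub>V\<^esub>"
    by (rule linear_form_smult[OF f]) simp
  then show ?thesis using vspace_zero_smult[OF V] by simp
qed

lemma linear_form_finsum:
  assumes V: "vspace V" and f: "linear_form V f" and fin: "finite I"
    and v: "!!i. i \<in> I ==> v i \<in> carrier V"
  shows "f (\<Oplus>\<^bsub>V\<^esub>i\<in>I. v i) = (\<Sum>i\<in>I. f (v i))"
proof -
  interpret module scalars V by fact
  show ?thesis using fin v
    by (induction I) (auto simp: linear_form_zero[OF V f] linear_form_add[OF f] finsum_closed Pi_def)
qed

lemma linear_form_diff:
  assumes V: "vspace V" and f: "linear_form V f" and "v \<in> carrier V" "w \<in> carrier V"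
  shows "f (v \<ominus>\<^bsub>V\<^esub> w) = f v - f w"
proof -
  interpret module scalars V by fact
  have "f (\<ominus>\<^bsub>V\<^esub> w) + f w = 0"
    using linear_form_add[OF f, of "\<ominus>\<^bsub>V\<^esub> w" w] assms by (simp add: l_neg linear_form_zero)
  then show ?thesis using assms linear_form_add[OF f, of v "\<ominus>\<^bsub>V\<^esub> w"]
    by (simp add: a_minus_def eq_neg_iff_add_eq_0)
qed

lemma linear_form_cong:
  assumes "vspace V" "!!v. v \<in> carrier V ==> f v = g v"
  shows "linear_form V f \<longleftrightarrow> linear_form V g"
proof -
  interpret module scalars V by fact
  show ?thesis using assms(2) by (simp add: linear_form_def)
qed

definition subspace_of :: "('k::field, 'a, 'z) module_scheme => 'a set => bool" where
  "subspace_of V M \<longleftrightarrow> M \<subseteq> carrier V & \<zero>\<^bsub>V\<^esub> \<in> M &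
    (\<forall>v\<in>M. \<forall>w\<in>M. v \<oplus>\<^bsub>V\<^esub> w \<in> M) & (\<forall>c. \<forall>v\<in>M. c \<odot>\<^bsub>V\<^esub> v \<in> M)"

text \<open>A subspace that is maximal among those that avoid v is a complement of the line
  spanned by v, and the coordinate along v is the required form.\<close>

lemma linear_form_nonzero_at:
  fixes V :: "('k::field, 'a, 'z) module_scheme"
  assumes V: "vspace V" and v: "v \<in> carrier V" "v ~= \<zero>\<^bsub>V\<^esub>"
  obtains g where "linear_form V g" "g v = 1"
proof -
  interpret module scalars V by fact
  let ?S = "{M. subspace_of V M & v \<notin> M}"
  have ne: "{\<zero>\<^bsub>V\<^esub>} \<in> ?S"
    using v smult_r_null by (auto simp: subspace_of_def)
  have chain: "\<Union>C \<in> ?S" if C: "C ~= {}" "subset.chain ?S C" for C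
  proof -
    have sub: "subspace_of V M" "v \<notin> M" if "M \<in> C" for M
     using C(2) that unfolding subset.chain_def by auto
    have "x \<oplus>\<^bsub>V\<^esub> y \<in> \<Union>C" if xy: "x \<in> \<Union>C" "y \<in> \<Union>C" for x y
    proof -
     obtain M N where MN: "M \<in> C" "N \<in> C" "x \<in> M" "y \<in> N" using xy by auto
     have "M \<subseteq> N \<or> N \<subseteq> M" using C(2) MN unfolding subset.chain_def by auto
     then show ?thesis using MN sub unfolding subspace_of_def by blast
    qed
    moreover have "c \<odot>\<^bsub>V\<^esub> x \<in> \<Union>C" if "x \<in> \<Union>C" for c x
     using that sub(1) unfolding subspace_of_def by blast
    moreover have "\<Union>C \<subseteq> carrier V" "v \<notin> \<Union>C"
     using sub unfolding subspace_of_def by blast+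
    moreover have "\<zero>\<^bsub>V\<^esub> \<in> \<Union>C"
     using C(1) sub(1) unfolding subspace_of_def by blast
    ultimately show ?thesis unfolding subspace_of_def by simp
  qed
  have "\<exists>M\<in>?S. \<forall>N\<in>?S. M \<subseteq> N --> N = M"
    by (rule subset_Zorn_nonempty) (use ne chain in blast)+
  then obtain M where M: "M \<in> ?S" and max: "!!N. N \<in> ?S ==> M \<subseteq> N ==> N = M"
    by blast
  have MV: "M \<subseteq> carrier V" and M0: "\<zero>\<^bsub>V\<^esub> \<in> M"
    and Mi: "!!x y. x \<in> M ==> y \<in> M ==> x \<oplus>\<^bsub>V\<^esub> y \<in> M" "!!c x. x \<in> M ==> c \<odot>\<^bsub>V\<^esub> x \<in> M"
    and Mv: "v \<notin> M"
    using M by (auto simp: subspace_of_def)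
  have Mc: "x \<in> carrier V" if "x \<in> M" for x using that MV by auto
  note [simp] = vspace_smult[OF V] vspace_zero_smult[OF V]
  have cancel: "(- d) \<odot>\<^bsub>V\<^esub> x \<oplus>\<^bsub>V\<^esub> d \<odot>\<^bsub>V\<^esub> x = \<zero>\<^bsub>V\<^esub>" if "x \<in> carrier V" for x d
    using vspace_smult(2)[OF V that, of "- d" d] vspace_zero_smult[OF V that] by simp
  have dec: "\<exists>c. \<exists>m\<in>M. w = m \<oplus>\<^bsub>V\<^esub> c \<odot>\<^bsub>V\<^esub> v" if w: "w \<in> carrier V" for w
  proof (cases "w \<in> M")
    case True
    then show ?thesis using v w by (intro exI[of _ 0] bexI[of _ w]) simp_all
  next
    case False
    let ?N = "{m \<oplus>\<^bsub>V\<^esub> c \<odot>\<^bsub>V\<^esub> w | m c. m \<in> M}"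
    have "subspace_of V ?N"
     unfolding subspace_of_def
    proof (intro conjI ballI allI)
     show "?N \<subseteq> carrier V" using Mc w by auto
     show "\<zero>\<^bsub>V\<^esub> \<in> ?N" using M0 w by (auto intro!: exI[of _ "\<zero>\<^bsub>V\<^esub>"] exI[of _ 0])
    next
     fix x y assume "x \<in> ?N" "y \<in> ?N"
     then obtain m c m' c' where *: "m \<in> M" "m' \<in> M"
      "x = m \<oplus>\<^bsub>V\<^esub> c \<odot>\<^bsub>V\<^esub> w" "y = m' \<oplus>\<^bsub>V\<^esub> c' \<odot>\<^bsub>V\<^esub> w" by blast
     then have "x \<oplus>\<^bsub>V\<^esub> y = (m \<oplus>\<^bsub>V\<^esub> m') \<oplus>\<^bsub>V\<^esub> (c + c') \<odot>\<^bsub>V\<^esub> w"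
      using w Mc by (simp add: a_ac)
     then show "x \<oplus>\<^bsub>V\<^esub> y \<in> ?N" using Mi(1)[OF *(1,2)] by blast
    next
     fix c x assume "x \<in> ?N"
     then obtain m d where *: "m \<in> M" "x = m \<oplus>\<^bsub>V\<^esub> d \<odot>\<^bsub>V\<^esub> w" by blast
     then have "c \<odot>\<^bsub>V\<^esub> x = (c \<odot>\<^bsub>V\<^esub> m) \<oplus>\<^bsub>V\<^esub> (c * d) \<odot>\<^bsub>V\<^esub> w"
      using w Mc by simp
     then show "c \<odot>\<^bsub>V\<^esub> x \<in> ?N" using Mi(2)[OF *(1)] by blast
    qed
    moreover have "M \<subseteq> ?N"
    proof
     fix m assume "m \<in> M"
     then show "m \<in> ?N" using w Mc by (intro CollectI exI[of _ m] exI[of _ 0]) simp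
    qed
    moreover have "w \<in> ?N" using w M0 by (intro CollectI exI[of _ "\<zero>\<^bsub>V\<^esub>"] exI[of _ 1]) simp
    ultimately have "v \<in> ?N" using max[of ?N] False by blast
    then obtain m c where mc: "m \<in> M" "v = m \<oplus>\<^bsub>V\<^esub> c \<odot>\<^bsub>V\<^esub> w" by blast
    then have "c ~= 0" using Mv Mc w by auto
    have "inverse c \<odot>\<^bsub>V\<^esub> v = inverse c \<odot>\<^bsub>V\<^esub> m \<oplus>\<^bsub>V\<^esub> (inverse c * c) \<odot>\<^bsub>V\<^esub> w"
     using mc w Mc by simp
    then have "w = (- inverse c) \<odot>\<^bsub>V\<^esub> m \<oplus>\<^bsub>V\<^esub> inverse c \<odot>\<^bsub>V\<^esub> v"
     using \<open>c ~= 0\<close> mc w Mc cancel[of m "inverse c"] by (simp add: a_assoc[symmetric])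
    then show ?thesis using Mi(2)[OF mc(1)] by blast
  qed
  have uniq: "c = d" if "m \<in> M" "m' \<in> M" "m \<oplus>\<^bsub>V\<^esub> c \<odot>\<^bsub>V\<^esub> v = m' \<oplus>\<^bsub>V\<^esub> d \<odot>\<^bsub>V\<^esub> v" for m m' c d
  proof (rule ccontr)
    assume cd: "c ~= d"
    have cancel': "c \<odot>\<^bsub>V\<^esub> v \<oplus>\<^bsub>V\<^esub> (- c) \<odot>\<^bsub>V\<^esub> v = \<zero>\<^bsub>V\<^esub>" using cancel[of v "- c"] v by simp
    have "m = m \<oplus>\<^bsub>V\<^esub> (c \<odot>\<^bsub>V\<^esub> v \<oplus>\<^bsub>V\<^esub> (- c) \<odot>\<^bsub>V\<^esub> v)" unfolding cancel' using that Mc by simp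
    also have "... = (m \<oplus>\<^bsub>V\<^esub> c \<odot>\<^bsub>V\<^esub> v) \<oplus>\<^bsub>V\<^esub> (- c) \<odot>\<^bsub>V\<^esub> v" by (rule a_assoc[symmetric]) (use that Mc v in simp_all)
    also have "... = (m' \<oplus>\<^bsub>V\<^esub> d \<odot>\<^bsub>V\<^esub> v) \<oplus>\<^bsub>V\<^esub> (- c) \<odot>\<^bsub>V\<^esub> v" by (simp only: that(3))
    also have "... = m' \<oplus>\<^bsub>V\<^esub> (d \<odot>\<^bsub>V\<^esub> v \<oplus>\<^bsub>V\<^esub> (- c) \<odot>\<^bsub>V\<^esub> v)" by (rule a_assoc) (use that Mc v in simp_all)
    also have "... = m' \<oplus>\<^bsub>V\<^esub> (d - c) \<odot>\<^bsub>V\<^esub> v" using vspace_smult(2)[OF V v(1), of d "- c"] by simp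
    finally have "(- 1) \<odot>\<^bsub>V\<^esub> m' \<oplus>\<^bsub>V\<^esub> m = (- 1) \<odot>\<^bsub>V\<^esub> m' \<oplus>\<^bsub>V\<^esub> (m' \<oplus>\<^bsub>V\<^esub> (d - c) \<odot>\<^bsub>V\<^esub> v)" by (rule arg_cong)
    also have "... = ((- 1) \<odot>\<^bsub>V\<^esub> m' \<oplus>\<^bsub>V\<^esub> 1 \<odot>\<^bsub>V\<^esub> m') \<oplus>\<^bsub>V\<^esub> (d - c) \<odot>\<^bsub>V\<^esub> v"
     using that Mc v by (simp add: a_assoc)
    also have "... = (d - c) \<odot>\<^bsub>V\<^esub> v" unfolding cancel[OF Mc[OF that(2)]] using v by simp
    finally have "(- 1) \<odot>\<^bsub>V\<^esub> m' \<oplus>\<^bsub>V\<^esub> m = (d - c) \<odot>\<^bsub>V\<^esub> v" .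
    then have "(d - c) \<odot>\<^bsub>V\<^esub> v \<in> M" using Mi that by metis
    then have "inverse (d - c) \<odot>\<^bsub>V\<^esub> ((d - c) \<odot>\<^bsub>V\<^esub> v) \<in> M" by (rule Mi(2))
    then show False using Mv v cd vspace_smult(4)[OF V v(1), of "inverse (d - c)" "d - c", symmetric]
     by simp
  qed
  define g where "g w = (THE c. \<exists>m\<in>M. w = m \<oplus>\<^bsub>V\<^esub> c \<odot>\<^bsub>V\<^esub> v)" for w
  have g: "g w = c" if "m \<in> M" "w = m \<oplus>\<^bsub>V\<^esub> c \<odot>\<^bsub>V\<^esub> v" for w m c
    unfolding g_def by (rule the_equality) (use that uniq in blast)+
  have "linear_form V g"
    unfolding linear_form_def
  proof (intro conjI ballI allI)
    fix x y assume xy: "x \<in> carrier V" "y \<in> carrier V"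
    obtain m c m' c' where *: "m \<in> M" "m' \<in> M"
      "x = m \<oplus>\<^bsub>V\<^esub> c \<odot>\<^bsub>V\<^esub> v" "y = m' \<oplus>\<^bsub>V\<^esub> c' \<odot>\<^bsub>V\<^esub> v" using dec xy by metis
    then have "x \<oplus>\<^bsub>V\<^esub> y = (m \<oplus>\<^bsub>V\<^esub> m') \<oplus>\<^bsub>V\<^esub> (c + c') \<odot>\<^bsub>V\<^esub> v"
      using v Mc by (simp add: a_ac)
    then show "g (x \<oplus>\<^bsub>V\<^esub> y) = g x + g y"
     using g[OF Mi(1)[OF *(1,2)]] g[OF *(1,3)] g[OF *(2,4)] by simp
  next
    fix c x assume "x \<in> carrier V"
    then obtain m d where *: "m \<in> M" "x = m \<oplus>\<^bsub>V\<^esub> d \<odot>\<^bsub>V\<^esub> v" using dec by metis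
    then have "c \<odot>\<^bsub>V\<^esub> x = (c \<odot>\<^bsub>V\<^esub> m) \<oplus>\<^bsub>V\<^esub> (c * d) \<odot>\<^bsub>V\<^esub> v"
      using v Mc by simp
    then show "g (c \<odot>\<^bsub>V\<^esub> x) = c * g x" using g[OF Mi(2)[OF *(1)]] g[OF *] by simp
  qed
  moreover have "g v = 1" by (rule g[OF M0]) (use v in simp)
  ultimately show thesis by (rule that)
qed

lemma forms_separate:
  assumes V: "vspace V" and vw: "v \<in> carrier V" "w \<in> carrier V"
    and eq: "!!g. linear_form V g ==> g v = g w"
  shows "v = w"
proof (rule ccontr)
  interpret module scalars V by fact
  assume "v ~= w"
  moreover have "v = (v \<ominus>\<^bsub>V\<^esub> w) \<oplus>\<^bsub>V\<^esub> w" using vw by (simp add: a_minus_def a_assoc l_neg)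
  ultimately have "v \<ominus>\<^bsub>V\<^esub> w ~= \<zero>\<^bsub>V\<^esub>" using vw by auto
  then obtain g where g: "linear_form V g" "g (v \<ominus>\<^bsub>V\<^esub> w) = 1"
    using linear_form_nonzero_at[OF V] vw by (metis minus_closed)
  then show False using linear_form_diff[OF V g(1) vw] eq[OF g(1)] by simp
qed

text \<open>A finite-dimensional space has a finite basis with dual coordinate forms. Each further vector of
  a spanning family either lies in the span already obtained, or its remainder is added to the
  basis; equality of vectors is tested on linear forms.\<close>

lemma dual_coordinates:
  fixes V :: "('k::field, 'a, 'z) module_scheme"
  assumes V: "vspace V" and fin: "finite_dim V"
  obtains n e f where "e \<in> {..<n::nat} \<rightarrow> carrier V" "\<forall>i<n. linear_form V (f i)"
    "\<forall>i<n. \<forall>j<n. f i (e j) = (if i = j then 1 else 0)"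
    "\<forall>v\<in>carrier V. v = (\<Oplus>\<^bsub>V\<^esub>i\<in>{..<n}. f i v \<odot>\<^bsub>V\<^esub> e i)"
proof -
  interpret module scalars V by fact
  obtain N b where b: "b \<in> {..<N::nat} \<rightarrow> carrier V"
    "\<forall>v\<in>carrier V. \<exists>c. v = (\<Oplus>\<^bsub>V\<^esub>i\<in>{..<N}. c i \<odot>\<^bsub>V\<^esub> b i)"
    using fin unfolding finite_dim_def spans_def by (elim exE conjE) (rule that; assumption)
  have "\<exists>n e f. e \<in> {..<n::nat} \<rightarrow> carrier V & (\<forall>i<n. linear_form V (f i)) &
    (\<forall>i<n. \<forall>j<n. f i (e j) = (if i = j then 1 else 0)) &
    (\<forall>j<m. \<forall>g. linear_form V g --> g (b j) = (\<Sum>i<n. f i (b j) * g (e i)))"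
    if "m \<le> N" for m
    using that
  proof (induction m)
    case 0
    show ?case by (rule exI[of _ 0]) simp
  next
    case (Suc m)
    then have "m \<le> N" by simp
    from Suc.IH[OF this] obtain n e f where *: "e \<in> {..<n::nat} \<rightarrow> carrier V"
     "\<forall>i<n. linear_form V (f i)"
     "\<forall>i<n. \<forall>j<n. f i (e j) = (if i = j then 1 else 0)"
     "\<forall>j<m. \<forall>g. linear_form V g --> g (b j) = (\<Sum>i<n. f i (b j) * g (e i))"
     by (elim exE conjE) (rule that; assumption)
    then have e: "e \<in> {..<n::nat} \<rightarrow> carrier V"
     and f: "!!i. i < n ==> linear_form V (f i)"
     and fe: "!!i j. i < n ==> j < n ==> f i (e j) = (if i = j then 1 else 0)"
     and rep: "!!j g. j < m ==> linear_form V g ==> g (b j) = (\<Sum>i<n. f i (b j) * g (e i))"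
     by auto
    have ec: "e i \<in> carrier V" if "i < n" for i using e that by auto
    have bm: "b m \<in> carrier V" using b(1) Suc.prems by auto
    define s where "s = (\<Oplus>\<^bsub>V\<^esub>i\<in>{..<n}. f i (b m) \<odot>\<^bsub>V\<^esub> e i)"
    have s: "s \<in> carrier V" unfolding s_def using ec vspace_smult(1)[OF V]
     by (intro finsum_closed) auto
    have gs: "g s = (\<Sum>i<n. f i (b m) * g (e i))" if "linear_form V g" for g
     unfolding s_def using ec vspace_smult(1)[OF V] linear_form_smult[OF that]
     by (subst linear_form_finsum[OF V that]) (auto intro!: sum.cong)
    define r where "r = b m \<ominus>\<^bsub>V\<^esub> s"
    have r: "r \<in> carrier V" using bm s by (simp add: r_def)
    have gr: "g (b m) = g r + (\<Sum>i<n. f i (b m) * g (e i))" if "linear_form V g" for g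
     unfolding r_def using linear_form_diff[OF V that bm s] gs[OF that] by simp
    have fr: "f j r = 0" if "j < n" for j
     using gr[OF f[OF that]] that by (simp add: fe sum.delta if_distrib cong: if_cong)
    show ?case
    proof (cases "r = \<zero>\<^bsub>V\<^esub>")
     case True
     have gr0: "g (b m) = (\<Sum>i<n. f i (b m) * g (e i))" if "linear_form V g" for g
      using gr[OF that] True linear_form_zero[OF V that] by simp
     then have "\<forall>j<Suc m. \<forall>g. linear_form V g --> g (b j) = (\<Sum>i<n. f i (b j) * g (e i))"
      using rep gr0 by (auto simp: less_Suc_eq)
     then show ?thesis using e f fe by (intro exI[of _ n] exI[of _ e] exI[of _ f]) auto
    next
     case False
     obtain h where h: "linear_form V h" "h r = 1" using linear_form_nonzero_at[OF V r False] .
     define h' where "h' v = h v - (\<Sum>i<n. f i v * h (e i))" for v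
     have h': "linear_form V h'"
      unfolding linear_form_def h'_def
      by (auto simp: linear_form_add[OF h(1)] linear_form_smult[OF h(1)] linear_form_add[OF f]
       linear_form_smult[OF f] algebra_simps sum.distrib sum_distrib_left)
     have h'e: "h' (e j) = 0" if "j < n" for j
      using that by (simp add: h'_def fe if_distrib[of "%x. x * _"] cong: if_cong)
     have h'r: "h' r = 1" by (simp add: h'_def fr h)
     have h'b: "h' (b m) = 1" using gr[OF h'] h'r h'e by simp
     have h'bj: "h' (b j) = 0" if "j < m" for j using rep[OF that h'] h'e by simp
     let ?e = "%i. if i < n then e i else r" and ?f = "%i. if i < n then f i else h'"
     have "g (b j) = (\<Sum>i<Suc n. ?f i (b j) * g (?e i))" if "j < Suc m" "linear_form V g" for g j
      using that rep[of j g] gr[of g] h'b h'bj by (auto simp: less_Suc_eq)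
     then show ?thesis using e r f h' fe fr h'e h'r
      by (intro exI[of _ "Suc n"] exI[of _ ?e] exI[of _ ?f]) (auto simp: less_Suc_eq)
    qed
  qed
  from this[OF order_refl] obtain n e f where *: "e \<in> {..<n::nat} \<rightarrow> carrier V"
     "\<forall>i<n. linear_form V (f i)"
     "\<forall>i<n. \<forall>j<n. f i (e j) = (if i = j then 1 else 0)"
     "\<forall>j<N. \<forall>g. linear_form V g --> g (b j) = (\<Sum>i<n. f i (b j) * g (e i))"
    by (elim exE conjE) (rule that; assumption)
  then have e: "e \<in> {..<n::nat} \<rightarrow> carrier V"
     and f: "!!i. i < n ==> linear_form V (f i)"
     and fe: "!!i j. i < n ==> j < n ==> f i (e j) = (if i = j then 1 else 0)"
     and rep: "!!j g. j < N ==> linear_form V g ==> g (b j) = (\<Sum>i<n. f i (b j) * g (e i))"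
    by auto
  have ec: "e i \<in> carrier V" if "i < n" for i using e that by auto
  have bc: "b i \<in> carrier V" if "i < N" for i using b that by auto
  have sm: "c \<odot>\<^bsub>V\<^esub> v \<in> carrier V" if "v \<in> carrier V" for c v using vspace_smult(1)[OF V that] .
  have "v = (\<Oplus>\<^bsub>V\<^esub>i\<in>{..<n}. f i v \<odot>\<^bsub>V\<^esub> e i)" if v: "v \<in> carrier V" for v
  proof (rule forms_separate[OF V v])
    show "(\<Oplus>\<^bsub>V\<^esub>i\<in>{..<n}. f i v \<odot>\<^bsub>V\<^esub> e i) \<in> carrier V"
     using ec sm by (intro finsum_closed) auto
    fix g assume g: "linear_form V g"
    obtain c where c: "v = (\<Oplus>\<^bsub>V\<^esub>i\<in>{..<N}. c i \<odot>\<^bsub>V\<^esub> b i)" using b(2) v by fast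
    have gv: "g v = (\<Sum>j<N. c j * g (b j))" if "linear_form V g" for g
     unfolding c using bc sm linear_form_smult[OF that]
     by (subst linear_form_finsum[OF V that]) (auto intro!: sum.cong)
    have "g v = (\<Sum>j<N. \<Sum>i<n. c j * f i (b j) * g (e i))"
     unfolding gv[OF g] by (simp add: rep[OF _ g] sum_distrib_left mult.assoc)
    also have "... = (\<Sum>i<n. f i v * g (e i))"
     by (subst sum.swap) (simp add: gv[OF f] sum_distrib_right)
    also have "... = g (\<Oplus>\<^bsub>V\<^esub>i\<in>{..<n}. f i v \<odot>\<^bsub>V\<^esub> e i)"
     using ec sm linear_form_smult[OF g]
     by (subst linear_form_finsum[OF V g]) (auto intro!: sum.cong)
    finally show "g v = ..." .
  qed
  then show thesis using that[OF *(1-3)] by blast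
qed

section \<open>Multilinear forms\<close>

named_theorems lin

lemma linear_formI:
  "(!!v w. v \<in> carrier V ==> w \<in> carrier V ==> f (v \<oplus>\<^bsub>V\<^esub> w) = f v + f w) ==>
   (!!c v. v \<in> carrier V ==> f (c \<odot>\<^bsub>V\<^esub> v) = c * f v) ==> linear_form V f"
  by (simp add: linear_form_def)

lemma linear_mapI:
  "(!!v. v \<in> carrier V ==> f v \<in> carrier W) ==>
   (!!v w. v \<in> carrier V ==> w \<in> carrier V ==> f (v \<oplus>\<^bsub>V\<^esub> w) = f v \<oplus>\<^bsub>W\<^esub> f w) ==>
   (!!c v. v \<in> carrier V ==> f (c \<odot>\<^bsub>V\<^esub> v) = c \<odot>\<^bsub>W\<^esub> f v) ==> linear_map V W f"
  by (auto simp: linear_map_def)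

lemma linear_map_closed: "linear_map V W f ==> v \<in> carrier V ==> f v \<in> carrier W"
  and linear_map_add: "linear_map V W f ==> v \<in> carrier V ==> w \<in> carrier V ==>
     f (v \<oplus>\<^bsub>V\<^esub> w) = f v \<oplus>\<^bsub>W\<^esub> f w"
  and linear_map_smult: "linear_map V W f ==> v \<in> carrier V ==> f (c \<odot>\<^bsub>V\<^esub> v) = c \<odot>\<^bsub>W\<^esub> f v"
  by (auto simp: linear_map_def)

lemma k_algebra_vspace: "k_algebra A ==> vspace A"
  by (rule k_algebra.axioms)

lemma k_algebra_ring: "k_algebra A ==> ring A"
  by (rule k_algebra.axioms)

lemma linear_map_id [lin]: "linear_map Z Z (%z. z)"
  by (simp add: linear_map_def)

lemma linear_map_mult_right [lin]:
  assumes A: "k_algebra A" and m: "linear_map Z A m" and a: "a \<in> carrier A"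
  shows "linear_map Z A (%z. m z \<otimes>\<^bsub>A\<^esub> a)"
proof -
  interpret ring A using A by (rule k_algebra_ring)
  show ?thesis
    by (rule linear_mapI)
     (simp_all add: linear_map_closed[OF m] linear_map_add[OF m] linear_map_smult[OF m] a
       l_distr k_algebra.smult_mult_left[OF A])
qed

lemma linear_map_mult_left [lin]:
  assumes A: "k_algebra A" and m: "linear_map Z A m" and a: "a \<in> carrier A"
  shows "linear_map Z A (%z. a \<otimes>\<^bsub>A\<^esub> m z)"
proof -
  interpret ring A using A by (rule k_algebra_ring)
  show ?thesis
    by (rule linear_mapI)
     (simp_all add: linear_map_closed[OF m] linear_map_add[OF m] linear_map_smult[OF m] a
       r_distr k_algebra.smult_mult_right[OF A])
qed

lemma linear_map_smult_vec [lin]: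
  assumes V: "vspace V" and f: "linear_form Z f" and v: "v \<in> carrier V"
  shows "linear_map Z V (%z. f z \<odot>\<^bsub>V\<^esub> v)"
  by (rule linear_mapI)
    (simp_all add: vspace_smult[OF V v] linear_form_add[OF f] linear_form_smult[OF f])

lemma linear_map_smult_const [lin]:
  assumes V: "vspace V" and m: "linear_map Z V m"
  shows "linear_map Z V (%z. c \<odot>\<^bsub>V\<^esub> m z)"
  by (rule linear_mapI)
    (simp_all add: vspace_smult[OF V] linear_map_closed[OF m] linear_map_add[OF m]
      linear_map_smult[OF m] flip: vspace_smult(4)[OF V], simp add: mult.commute)

lemma linear_map_compose:
  assumes g: "linear_map V W g" and m: "linear_map Z V m"
  shows "linear_map Z W (%z. g (m z))"
  by (rule linear_mapI)
    (simp_all add: linear_map_closed[OF m] linear_map_add[OF m] linear_map_smult[OF m]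
      linear_map_closed[OF g] linear_map_add[OF g] linear_map_smult[OF g])

lemma linear_form_compose:
  assumes g: "linear_form V g" and m: "linear_map Z V m"
  shows "linear_form Z (%z. g (m z))"
  by (rule linear_formI)
    (simp_all add: linear_map_closed[OF m] linear_map_add[OF m] linear_map_smult[OF m]
      linear_form_add[OF g] linear_form_smult[OF g])

lemma linear_form_mult [lin]:
  "linear_form Z f ==> linear_form Z (%z. c * f z)"
  "linear_form Z f ==> linear_form Z (%z. f z * c)"
  by (simp_all add: linear_form_def algebra_simps)

lemma linear_form_sum [lin]:
  "(!!i. i \<in> I ==> linear_form Z (F i)) ==> linear_form Z (%z. \<Sum>i\<in>I. F i z)"
  by (simp add: linear_form_def sum.distrib sum_distrib_left)

lemma bilinear_formI [lin]:
  "(!!v. v \<in> carrier V ==> linear_form W (B v)) ==>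
   (!!w. w \<in> carrier W ==> linear_form V (%v. B v w)) ==> bilinear_form V W B"
  by (simp add: bilinear_form_def)

lemma trilinear_formI [lin]:
  "(!!u v. u \<in> carrier U ==> v \<in> carrier V ==> linear_form W (T u v)) ==>
   (!!u w. u \<in> carrier U ==> w \<in> carrier W ==> linear_form V (%v. T u v w)) ==>
   (!!v w. v \<in> carrier V ==> w \<in> carrier W ==> linear_form U (%u. T u v w)) ==>
   trilinear_form U V W T"
  by (simp add: trilinear_form_def)

lemma bilinear_form_slot:
  assumes B: "bilinear_form V W B"
  shows "linear_map Z1 V m1 ==> w \<in> carrier W ==> linear_form Z1 (%z. B (m1 z) w)"
    and "linear_map Z2 W m2 ==> v \<in> carrier V ==> linear_form Z2 (%z. B v (m2 z))"
  using linear_form_compose[of V "%v. B v w" Z1 m1] linear_form_compose[of W "B v" Z2 m2] B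
  by (simp_all add: bilinear_form_def)

lemma trilinear_form_slot:
  assumes T: "trilinear_form U V W T"
  shows "linear_map Z1 U m1 ==> v \<in> carrier V ==> w \<in> carrier W ==> linear_form Z1 (%z. T (m1 z) v w)"
    and "linear_map Z2 V m2 ==> u \<in> carrier U ==> w \<in> carrier W ==> linear_form Z2 (%z. T u (m2 z) w)"
    and "linear_map Z3 W m3 ==> u \<in> carrier U ==> v \<in> carrier V ==> linear_form Z3 (%z. T u v (m3 z))"
  using linear_form_compose[of U "%u. T u v w" Z1 m1] linear_form_compose[of V "%v. T u v w" Z2 m2]
    linear_form_compose[of W "T u v" Z3 m3] T
  by (simp_all add: trilinear_form_def)

lemma bilinear_map_slot:
  assumes b: "bilinear_map V W Y b"
  shows "linear_map Z1 V m1 ==> w \<in> carrier W ==> linear_map Z1 Y (%z. b (m1 z) w)"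
    and "linear_map Z2 W m2 ==> v \<in> carrier V ==> linear_map Z2 Y (%z. b v (m2 z))"
  using linear_map_compose[of V Y "%v. b v w" Z1 m1] linear_map_compose[of W Y "b v" Z2 m2] b
  by (simp_all add: bilinear_map_def)

lemma bilinear_mapI [lin]:
  "(!!v. v \<in> carrier V ==> linear_map W Y (b v)) ==>
   (!!w. w \<in> carrier W ==> linear_map V Y (%v. b v w)) ==> bilinear_map V W Y b"
  by (simp add: bilinear_map_def)

lemma bilinear_map_closed:
  "bilinear_map V W Y b ==> v \<in> carrier V ==> w \<in> carrier W ==> b v w \<in> carrier Y"
  by (auto simp: bilinear_map_def dest: linear_map_closed)

lemma bilinear_form_cong:
  assumes "vspace V" "vspace W"
    and "!!v w. v \<in> carrier V ==> w \<in> carrier W ==> B v w = C v w"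
  shows "bilinear_form V W B \<longleftrightarrow> bilinear_form V W C"
  using assms linear_form_cong[of V "%v. B v w" "%v. C v w" for w] linear_form_cong[of W "B v" "C v" for v]
  by (simp add: bilinear_form_def)

lemma trilinear_form_cong:
  assumes "vspace U" "vspace V" "vspace W"
    and "!!u v w. u \<in> carrier U ==> v \<in> carrier V ==> w \<in> carrier W ==> S u v w = T u v w"
  shows "trilinear_form U V W S \<longleftrightarrow> trilinear_form U V W T"
  using assms linear_form_cong[of U "%u. S u v w" "%u. T u v w" for v w]
    linear_form_cong[of V "%v. S u v w" "%v. T u v w" for u w]
    linear_form_cong[of W "S u v" "T u v" for u v]
  by (simp add: trilinear_form_def)

section \<open>Calculus of tensors\<close>

abbreviation tens where "tens V W == carrier (tensor_alg V W)"
abbreviation tens3 where "tens3 U V W == carrier (tensor_alg3 U V W)"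

lemma T2_apply [simp]: "bilinear_form V W B ==> T2 V W \<phi> B = \<phi> B"
  and T3_apply [simp]: "trilinear_form U V W T ==> T3 U V W \<psi> T = \<psi> T"
  by (simp_all add: T2_def T3_def)

lemma T2_eq_iff: "T2 V W \<phi> = T2 V W \<psi> \<longleftrightarrow> (\<forall>B. bilinear_form V W B --> \<phi> B = \<psi> B)"
  and T3_eq_iff: "T3 U V W \<phi>' = T3 U V W \<psi>' \<longleftrightarrow> (\<forall>T. trilinear_form U V W T --> \<phi>' T = \<psi>' T)"
  by (auto simp: T2_def T3_def fun_eq_iff)

lemma tens_def: "t \<in> tens V W \<longleftrightarrow> (\<exists>(n::nat) v w. v \<in> {..<n} \<rightarrow> carrier V & w \<in> {..<n} \<rightarrow> carrier W &
    t = T2 V W (%B. \<Sum>i<n. B (v i) (w i)))"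
  by (auto simp: tensor_alg_def)

lemma tens3_def: "t \<in> tens3 U V W \<longleftrightarrow> (\<exists>(n::nat) u v w. u \<in> {..<n} \<rightarrow> carrier U &
    v \<in> {..<n} \<rightarrow> carrier V & w \<in> {..<n} \<rightarrow> carrier W &
    t = T3 U V W (%T. \<Sum>i<n. T (u i) (v i) (w i)))"
  by (auto simp: tensor_alg3_def)

lemma tensE:
  assumes "t \<in> tens V W"
  obtains n v w where "\<forall>i<n::nat. v i \<in> carrier V" "\<forall>i<n. w i \<in> carrier W"
    "t = T2 V W (%B. \<Sum>i<n. B (v i) (w i))"
  using assms unfolding tens_def by (elim exE conjE) (rule that, auto)

lemma tens3E:
  assumes "t \<in> tens3 U V W"
  obtains n u v w where "\<forall>i<n::nat. u i \<in> carrier U" "\<forall>i<n. v i \<in> carrier V"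
    "\<forall>i<n. w i \<in> carrier W" "t = T3 U V W (%T. \<Sum>i<n. T (u i) (v i) (w i))"
  using assms unfolding tens3_def by (elim exE conjE) (rule that, auto)

lemma tens_nonbilinear: "t \<in> tens V W ==> \<not> bilinear_form V W B ==> t B = 0"
  by (elim tensE) (simp add: T2_def)

lemma tens3_nontrilinear: "t \<in> tens3 U V W ==> \<not> trilinear_form U V W T ==> t T = 0"
  by (elim tens3E) (simp add: T3_def)

lemma tens_T2: "t \<in> tens V W ==> T2 V W t = t"
  by (auto simp: T2_def fun_eq_iff tens_nonbilinear)

lemma tens3_T3: "t \<in> tens3 U V W ==> T3 U V W t = t"
  by (auto simp: T3_def fun_eq_iff tens3_nontrilinear)

lemma tens_eqI:
  assumes "s \<in> tens V W" "t \<in> tens V W" "!!B. bilinear_form V W B ==> s B = t B"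
  shows "s = t"
proof
  fix B show "s B = t B"
    using assms tens_nonbilinear[OF assms(1)] tens_nonbilinear[OF assms(2)] by (cases "bilinear_form V W B") auto
qed

lemma tens3_eqI:
  assumes "s \<in> tens3 U V W" "t \<in> tens3 U V W" "!!T. trilinear_form U V W T ==> s T = t T"
  shows "s = t"
proof
  fix T show "s T = t T"
    using assms tens3_nontrilinear[OF assms(1)] tens3_nontrilinear[OF assms(2)]
    by (cases "trilinear_form U V W T") auto
qed

lemma tens_cong:
  assumes t: "t \<in> tens V W" and V: "vspace V" "vspace W"
    and eq: "!!v w. v \<in> carrier V ==> w \<in> carrier W ==> B v w = C v w"
  shows "t B = t C"
proof -
  note b = bilinear_form_cong[OF V eq, simplified]
  obtain n v w where r: "\<forall>i<n::nat. v i \<in> carrier V" "\<forall>i<n. w i \<in> carrier W"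
    "t = T2 V W (%B. \<Sum>i<n. B (v i) (w i))" by (rule tensE[OF t])
  show ?thesis unfolding r(3) T2_def using b r(1,2) eq by simp
qed

lemma tens3_cong:
  assumes t: "t \<in> tens3 U V W" and V: "vspace U" "vspace V" "vspace W"
    and eq: "!!u v w. u \<in> carrier U ==> v \<in> carrier V ==> w \<in> carrier W ==> S u v w = T u v w"
  shows "t S = t T"
proof -
  note b = trilinear_form_cong[OF V eq, simplified]
  obtain n u v w where r: "\<forall>i<n::nat. u i \<in> carrier U" "\<forall>i<n. v i \<in> carrier V"
    "\<forall>i<n. w i \<in> carrier W" "t = T3 U V W (%T. \<Sum>i<n. T (u i) (v i) (w i))"
    by (rule tens3E[OF t])
  show ?thesis unfolding r(4) T3_def using b r(1-3) eq by simp
qed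

lemma tens_scale:
  assumes t: "t \<in> tens V W"
  shows "t (%v w. c * B v w) = c * t B" and "t (%v w. B v w * c) = t B * c"
proof -
  obtain n v w where r: "t = T2 V W (%B. \<Sum>i<n::nat. B (v i) (w i))" by (rule tensE[OF t])
  have "c ~= 0 ==> bilinear_form V W (%v w. c * B v w) \<longleftrightarrow> bilinear_form V W B"
    by (auto simp: bilinear_form_def linear_form_def simp flip: distrib_left mult.assoc)
  then show *: "t (%v w. c * B v w) = c * t B"
    unfolding r T2_def by (cases "c = 0") (auto simp: sum_distrib_left)
  then show "t (%v w. B v w * c) = t B * c" by (simp add: mult.commute)
qed

lemma tens_sum:
  assumes t: "t \<in> tens V W" and B: "!!i. i \<in> I ==> bilinear_form V W (B i)"
  shows "t (%v w. \<Sum>i\<in>I. B i v w) = (\<Sum>i\<in>I. t (B i))"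
proof -
  obtain n v w where r: "t = T2 V W (%B. \<Sum>i<n::nat. B (v i) (w i))" by (rule tensE[OF t])
  have "bilinear_form V W (%v w. \<Sum>i\<in>I. B i v w)"
    using B by (intro lin) (auto simp: bilinear_form_def)
  then have "t (%v w. \<Sum>i\<in>I. B i v w) = (\<Sum>j<n. \<Sum>i\<in>I. B i (v j) (w j))" by (simp add: r)
  also have "... = (\<Sum>i\<in>I. t (B i))" by (subst sum.swap) (simp add: r B cong: sum.cong)
  finally show ?thesis .
qed

lemma tens_add:
  assumes t: "t \<in> tens V W" and B: "bilinear_form V W B" "bilinear_form V W C"
  shows "t (%v w. B v w + C v w) = t B + t C"
  using tens_sum[OF t, of "{True, False}" "%i. if i then B else C"] B by simp

text \<open>The functionals of parameters obtained by evaluating a tensor are again linear.\<close>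

lemma tens_linear:
  assumes Z: "vspace Z" and t: "t \<in> tens V W"
    and F: "!!z. z \<in> carrier Z ==> bilinear_form V W (F z)"
    and lin: "!!v w. v \<in> carrier V ==> w \<in> carrier W ==> linear_form Z (%z. F z v w)"
  shows "linear_form Z (%z. t (F z))"
proof -
  obtain n v w where r: "\<forall>i<n::nat. v i \<in> carrier V" "\<forall>i<n. w i \<in> carrier W"
    "t = T2 V W (%B. \<Sum>i<n. B (v i) (w i))" by (rule tensE[OF t])
  have "linear_form Z (%z. \<Sum>i<n. F z (v i) (w i))"
    using lin r by (intro linear_form_sum) auto
  then show ?thesis
    by (subst linear_form_cong[OF Z, of _ "%z. \<Sum>i<n. F z (v i) (w i)"]) (simp_all add: r F)
qed

lemma tens_fubini:
  assumes s: "s \<in> tens V W" and t: "t \<in> tens V' W'"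
    and V: "vspace V" "vspace W" "vspace V'" "vspace W'"
    and F: "!!v w. v \<in> carrier V ==> w \<in> carrier W ==> bilinear_form V' W' (F v w)"
    and F': "!!v' w'. v' \<in> carrier V' ==> w' \<in> carrier W' ==> bilinear_form V W (%v w. F v w v' w')"
  shows "s (%v w. t (%v' w'. F v w v' w')) = t (%v' w'. s (%v w. F v w v' w'))"
proof -
  obtain n v w where r: "\<forall>i<n::nat. v i \<in> carrier V" "\<forall>i<n. w i \<in> carrier W"
    "s = T2 V W (%B. \<Sum>i<n. B (v i) (w i))" by (rule tensE[OF s])
  have "bilinear_form V W (%v w. t (F v w))"
  proof (rule bilinear_formI)
    show "linear_form W (%w. t (F v w))" if "v \<in> carrier V" for v
     by (rule tens_linear[OF V(2) t]) (use that F F' in \<open>simp_all add: bilinear_form_def\<close>)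
    show "linear_form V (%v. t (F v w))" if "w \<in> carrier W" for w
     by (rule tens_linear[OF V(1) t]) (use that F F' in \<open>simp_all add: bilinear_form_def\<close>)
  qed
  then have "s (%v w. t (F v w)) = (\<Sum>i<n. t (F (v i) (w i)))" by (simp add: r)
  also have "... = t (%v' w'. \<Sum>i<n. F (v i) (w i) v' w')"
    by (rule tens_sum[OF t, symmetric]) (use F r in auto)
  also have "... = t (%v' w'. s (%v w. F v w v' w'))"
    by (rule tens_cong[OF t V(3,4)]) (simp add: r(3) F')
  finally show ?thesis .
qed

lemma pure2_closed [simp]:
  "v \<in> carrier V ==> w \<in> carrier W ==> pure2 V W v w \<in> tens V W"
  unfolding tens_def pure2_def
  by (rule exI[of _ 1], rule exI[of _ "%_. v"], rule exI[of _ "%_. w"]) simp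

lemma pure3_closed [simp]:
  "u \<in> carrier U ==> v \<in> carrier V ==> w \<in> carrier W ==> pure3 U V W u v w \<in> tens3 U V W"
  unfolding tens3_def pure3_def
  by (rule exI[of _ 1], rule exI[of _ "%_. u"], rule exI[of _ "%_. v"], rule exI[of _ "%_. w"]) simp

lemma tens_rep_closed:
  assumes "!!i. i < (n::nat) ==> v i \<in> carrier V" "!!i. i < n ==> w i \<in> carrier W"
  shows "T2 V W (%B. \<Sum>i<n. B (v i) (w i)) \<in> tens V W"
  unfolding tens_def using assms by (intro exI[of _ n] exI[of _ v] exI[of _ w]) auto

lemma tens_zero_closed: "(%B. 0) \<in> tens V W"
  unfolding tens_def by (rule exI[of _ 0]) (auto simp: T2_def)

lemma tens_add_closed:
  assumes s: "s \<in> tens V W" and t: "t \<in> tens V W"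
  shows "(%B. s B + t B) \<in> tens V W"
proof -
  obtain n v w where r: "\<forall>i<n::nat. v i \<in> carrier V" "\<forall>i<n. w i \<in> carrier W"
    "t = T2 V W (%B. \<Sum>i<n. B (v i) (w i))" by (rule tensE[OF t])
  have "(%B. s B + T2 V W (%B. \<Sum>i<m. B (v i) (w i)) B) \<in> tens V W" if "m \<le> n" for m
    using that
  proof (induction m)
    case 0
    then show ?case using s by (simp add: T2_def)
  next
    case (Suc m)
    then have IH: "(%B. s B + T2 V W (%B. \<Sum>i<m. B (v i) (w i)) B) \<in> tens V W" by simp
    obtain k a b where k: "\<forall>i<k::nat. a i \<in> carrier V" "\<forall>i<k. b i \<in> carrier W"
     "(%B. s B + T2 V W (%B. \<Sum>i<m. B (v i) (w i)) B) = T2 V W (%B. \<Sum>i<k. B (a i) (b i))"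
     by (rule tensE[OF IH])
    have "(%B. s B + T2 V W (%B. \<Sum>i<Suc m. B (v i) (w i)) B) =
     T2 V W (%B. \<Sum>i<Suc k. B ((a(k := v m)) i) ((b(k := w m)) i))"
    proof
     fix B
     show "s B + T2 V W (%B. \<Sum>i<Suc m. B (v i) (w i)) B =
      T2 V W (%B. \<Sum>i<Suc k. B ((a(k := v m)) i) ((b(k := w m)) i)) B"
      using fun_cong[OF k(3), of B] by (auto simp: T2_def split: if_splits)
    qed
    also have "... \<in> tens V W"
     by (rule tens_rep_closed) (use k r Suc.prems in \<open>auto simp: less_Suc_eq\<close>)
    finally show ?case .
  qed
  from this[of n] show ?thesis by (simp add: r)
qed

lemma tens_sum_closed:
  "(!!i. i < (n::nat) ==> t i \<in> tens V W) ==> (%B. \<Sum>i<n. t i B) \<in> tens V W"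
  by (induction n) (auto simp: tens_zero_closed intro: tens_add_closed)

lemma tens3_zero_closed: "(%B. 0) \<in> tens3 U V W"
  unfolding tens3_def by (rule exI[of _ 0]) (auto simp: T3_def)

lemma tens3_rep_closed:
  assumes "!!i. i < (n::nat) ==> u i \<in> carrier U" "!!i. i < n ==> v i \<in> carrier V"
    "!!i. i < n ==> w i \<in> carrier W"
  shows "T3 U V W (%B. \<Sum>i<n. B (u i) (v i) (w i)) \<in> tens3 U V W"
  unfolding tens3_def using assms by (intro exI[of _ n] exI[of _ u] exI[of _ v] exI[of _ w]) auto

lemma tens3_add_closed:
  assumes s: "s \<in> tens3 U V W" and t: "t \<in> tens3 U V W"
  shows "(%B. s B + t B) \<in> tens3 U V W"
proof -
  obtain n u v w where r: "\<forall>i<n::nat. u i \<in> carrier U" "\<forall>i<n. v i \<in> carrier V"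
    "\<forall>i<n. w i \<in> carrier W" "t = T3 U V W (%T. \<Sum>i<n. T (u i) (v i) (w i))" by (rule tens3E[OF t])
  have "(%B. s B + T3 U V W (%B. \<Sum>i<m. B (u i) (v i) (w i)) B) \<in> tens3 U V W" if "m \<le> n" for m
    using that
  proof (induction m)
    case 0
    then show ?case using s by (simp add: T3_def)
  next
    case (Suc m)
    then have IH: "(%B. s B + T3 U V W (%B. \<Sum>i<m. B (u i) (v i) (w i)) B) \<in> tens3 U V W" by simp
    obtain k c a b where k: "\<forall>i<k::nat. c i \<in> carrier U" "\<forall>i<k. a i \<in> carrier V"
     "\<forall>i<k. b i \<in> carrier W"
     "(%B. s B + T3 U V W (%B. \<Sum>i<m. B (u i) (v i) (w i)) B) = T3 U V W (%B. \<Sum>i<k. B (c i) (a i) (b i))"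
     by (rule tens3E[OF IH])
    have "(%B. s B + T3 U V W (%B. \<Sum>i<Suc m. B (u i) (v i) (w i)) B) =
     T3 U V W (%B. \<Sum>i<Suc k. B ((c(k := u m)) i) ((a(k := v m)) i) ((b(k := w m)) i))"
    proof
     fix B
     show "s B + T3 U V W (%B. \<Sum>i<Suc m. B (u i) (v i) (w i)) B =
      T3 U V W (%B. \<Sum>i<Suc k. B ((c(k := u m)) i) ((a(k := v m)) i) ((b(k := w m)) i)) B"
      using fun_cong[OF k(4), of B] by (auto simp: T3_def split: if_splits)
    qed
    also have "... \<in> tens3 U V W"
     by (rule tens3_rep_closed) (use k r Suc.prems in \<open>auto simp: less_Suc_eq\<close>)
    finally show ?case .
  qed
  from this[of n] show ?thesis by (simp add: r)
qed

lemma tens3_sum_closed: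
  "(!!i. i < (n::nat) ==> t i \<in> tens3 U V W) ==> (%B. \<Sum>i<n. t i B) \<in> tens3 U V W"
  by (induction n) (auto simp: tens3_zero_closed intro: tens3_add_closed)

text \<open>Closure of tensors under extending a family of tensors that depends bilinearly on two
  parameters.\<close>

lemma tens_bind_closed:
  assumes s: "s \<in> tens V W"
    and t: "!!v w. v \<in> carrier V ==> w \<in> carrier W ==> t v w \<in> tens V' W'"
    and lin: "!!B. bilinear_form V' W' B ==> bilinear_form V W (%v w. t v w B)"
  shows "T2 V' W' (%B. s (%v w. t v w B)) \<in> tens V' W'"
proof -
  obtain n v w where r: "\<forall>i<n::nat. v i \<in> carrier V" "\<forall>i<n. w i \<in> carrier W"
    "s = T2 V W (%B. \<Sum>i<n. B (v i) (w i))" by (rule tensE[OF s])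
  have *: "(%B. \<Sum>i<n. t (v i) (w i) B) \<in> tens V' W'"
    using r t by (intro tens_sum_closed) auto
  have "T2 V' W' (%B. s (%v w. t v w B)) = T2 V' W' (%B. \<Sum>i<n. t (v i) (w i) B)"
    unfolding T2_eq_iff by (simp add: r lin)
  then show ?thesis using * tens_T2[OF *] by simp
qed

lemma tens_bind3_closed:
  assumes s: "s \<in> tens V W"
    and t: "!!v w. v \<in> carrier V ==> w \<in> carrier W ==> t v w \<in> tens3 V' W' Y'"
    and lin: "!!B. trilinear_form V' W' Y' B ==> bilinear_form V W (%v w. t v w B)"
  shows "T3 V' W' Y' (%B. s (%v w. t v w B)) \<in> tens3 V' W' Y'"
proof -
  obtain n v w where r: "\<forall>i<n::nat. v i \<in> carrier V" "\<forall>i<n. w i \<in> carrier W"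
    "s = T2 V W (%B. \<Sum>i<n. B (v i) (w i))" by (rule tensE[OF s])
  have *: "(%B. \<Sum>i<n. t (v i) (w i) B) \<in> tens3 V' W' Y'"
    using r t by (intro tens3_sum_closed) auto
  have "T3 V' W' Y' (%B. s (%v w. t v w B)) = T3 V' W' Y' (%B. \<Sum>i<n. t (v i) (w i) B)"
    unfolding T3_eq_iff by (simp add: r lin)
  then show ?thesis using * tens3_T3[OF *] by simp
qed

lemma tens3_bind3_closed:
  assumes s: "s \<in> tens3 U V W"
    and t: "!!u v w. u \<in> carrier U ==> v \<in> carrier V ==> w \<in> carrier W ==> t u v w \<in> tens3 V' W' Y'"
    and lin: "!!B. trilinear_form V' W' Y' B ==> trilinear_form U V W (%u v w. t u v w B)"
  shows "T3 V' W' Y' (%B. s (%u v w. t u v w B)) \<in> tens3 V' W' Y'"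
proof -
  obtain n u v w where r: "\<forall>i<n::nat. u i \<in> carrier U" "\<forall>i<n. v i \<in> carrier V"
    "\<forall>i<n. w i \<in> carrier W" "s = T3 U V W (%T. \<Sum>i<n. T (u i) (v i) (w i))" by (rule tens3E[OF s])
  have *: "(%B. \<Sum>i<n. t (u i) (v i) (w i) B) \<in> tens3 V' W' Y'"
    using r t by (intro tens3_sum_closed) auto
  have "T3 V' W' Y' (%B. s (%u v w. t u v w B)) = T3 V' W' Y' (%B. \<Sum>i<n. t (u i) (v i) (w i) B)"
    unfolding T3_eq_iff by (simp add: r lin)
  then show ?thesis using * tens3_T3[OF *] by simp
qed

lemma tens3_linear:
  assumes Z: "vspace Z" and t: "t \<in> tens3 U V W"
    and F: "!!z. z \<in> carrier Z ==> trilinear_form U V W (F z)"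
    and lin: "!!u v w. u \<in> carrier U ==> v \<in> carrier V ==> w \<in> carrier W ==> linear_form Z (%z. F z u v w)"
  shows "linear_form Z (%z. t (F z))"
proof -
  obtain n u v w where r: "\<forall>i<n::nat. u i \<in> carrier U" "\<forall>i<n. v i \<in> carrier V"
    "\<forall>i<n. w i \<in> carrier W" "t = T3 U V W (%T. \<Sum>i<n. T (u i) (v i) (w i))" by (rule tens3E[OF t])
  have "linear_form Z (%z. \<Sum>i<n. F z (u i) (v i) (w i))"
    using lin r by (intro linear_form_sum) auto
  then show ?thesis
    by (subst linear_form_cong[OF Z, of _ "%z. \<Sum>i<n. F z (u i) (v i) (w i)"]) (simp_all add: r F)
qed

text \<open>Values of a linear map into a tensor product are functionals that depend linearly on the
  argument, whatever they are applied to.\<close>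

lemma linear_map_tens:
  "linear_map Z (tensor_alg V W) \<alpha> \<longleftrightarrow> (\<forall>z\<in>carrier Z. \<alpha> z \<in> tens V W) & (\<forall>B. linear_form Z (%z. \<alpha> z B))"
  by (auto simp: linear_map_def linear_form_def tensor_alg_def fun_eq_iff Pi_def)

lemma linear_map_tens':
  "linear_map Z (tensor_alg V W) \<alpha> \<longleftrightarrow> (\<forall>z\<in>carrier Z. \<alpha> z \<in> tens V W) &
    (\<forall>B. bilinear_form V W B --> linear_form Z (%z. \<alpha> z B))" if Z: "vspace Z"
proof -
  have "linear_form Z (%z. \<alpha> z B)" if "\<forall>z\<in>carrier Z. \<alpha> z \<in> tens V W" "\<not> bilinear_form V W B" for B
  proof (subst linear_form_cong[OF Z])
    show "\<alpha> z B = 0" if "z \<in> carrier Z" for z using that \<open>\<forall>z\<in>carrier Z. \<alpha> z \<in> tens V W\<close>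
     \<open>\<not> bilinear_form V W B\<close> tens_nonbilinear by blast
  qed (simp add: linear_form_def)
  then show ?thesis unfolding linear_map_tens by blast
qed

lemma linear_map_tensD:
  assumes \<alpha>: "linear_map X (tensor_alg V W) \<alpha>"
  shows "x \<in> carrier X ==> \<alpha> x \<in> tens V W"
    and "linear_map Z X m ==> linear_form Z (%z. \<alpha> (m z) B)"
    and "vspace Z ==> x \<in> carrier X ==> (!!z. z \<in> carrier Z ==> bilinear_form V W (F z)) ==>
     (!!v w. v \<in> carrier V ==> w \<in> carrier W ==> linear_form Z (%z. F z v w)) ==> linear_form Z (%z. \<alpha> x (F z))"
  using \<alpha> linear_form_compose[of X "%x. \<alpha> x B" Z m] tens_linear[of Z "\<alpha> x" V W F]
  unfolding linear_map_tens by blast+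

lemma tensor_lift_form:
  assumes Z: "vspace Z" and t: "t \<in> tens V W" and b: "bilinear_map V W Z b"
  shows "tensor_lift V W Z b t \<in> carrier Z"
    and "linear_form Z g ==> g (tensor_lift V W Z b t) = t (%v w. g (b v w))"
proof -
  interpret module scalars Z by fact
  have ev: "(\<Oplus>\<^bsub>Z\<^esub>i\<in>{..<n}. b (v i) (w i)) \<in> carrier Z &
    (\<forall>g. linear_form Z g --> g (\<Oplus>\<^bsub>Z\<^esub>i\<in>{..<n}. b (v i) (w i)) = t (%v w. g (b v w)))"
    if r: "v \<in> {..<n::nat} \<rightarrow> carrier V" "w \<in> {..<n} \<rightarrow> carrier W" "t = T2 V W (%B. \<Sum>i<n. B (v i) (w i))" for n v w
  proof (intro conjI allI impI)
    have bi: "b (v i) (w i) \<in> carrier Z" if "i < n" for i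
     using r that by (intro bilinear_map_closed[OF b]) auto
    then show "(\<Oplus>\<^bsub>Z\<^esub>i\<in>{..<n}. b (v i) (w i)) \<in> carrier Z" by (intro finsum_closed) auto
    fix g assume g: "linear_form Z g"
    have "bilinear_form V W (%v w. g (b v w))"
     by (intro lin linear_form_compose[OF g] bilinear_map_slot[OF b])
    then show "g (\<Oplus>\<^bsub>Z\<^esub>i\<in>{..<n}. b (v i) (w i)) = t (%v w. g (b v w))"
     by (subst linear_form_finsum[OF Z g]) (use bi r in simp_all)
  qed
  obtain n v w where r: "v \<in> {..<n::nat} \<rightarrow> carrier V" "w \<in> {..<n} \<rightarrow> carrier W" "t = T2 V W (%B. \<Sum>i<n. B (v i) (w i))"
    using t unfolding tens_def by (elim exE conjE) (rule that; assumption)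
  have "tensor_lift V W Z b t = (\<Oplus>\<^bsub>Z\<^esub>i\<in>{..<n}. b (v i) (w i))"
    unfolding tensor_lift_def
  proof (rule the_equality)
    show "\<exists>(m::nat) v' w'. v' \<in> {..<m} \<rightarrow> carrier V & w' \<in> {..<m} \<rightarrow> carrier W &
      t = T2 V W (%B. \<Sum>i<m. B (v' i) (w' i)) & (\<Oplus>\<^bsub>Z\<^esub>i\<in>{..<n}. b (v i) (w i)) = (\<Oplus>\<^bsub>Z\<^esub>i\<in>{..<m}. b (v' i) (w' i))"
     using r by blast
    fix z assume "\<exists>(m::nat) v' w'. v' \<in> {..<m} \<rightarrow> carrier V & w' \<in> {..<m} \<rightarrow> carrier W &
      t = T2 V W (%B. \<Sum>i<m. B (v' i) (w' i)) & z = (\<Oplus>\<^bsub>Z\<^esub>i\<in>{..<m}. b (v' i) (w' i))"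
    then have "z \<in> carrier Z & (\<forall>g. linear_form Z g --> g z = t (%v w. g (b v w)))"
     using ev by (elim exE conjE) simp
    then show "z = (\<Oplus>\<^bsub>Z\<^esub>i\<in>{..<n}. b (v i) (w i))"
     using ev[OF r] by (intro forms_separate[OF Z]) auto
  qed
  with ev[OF r] show "tensor_lift V W Z b t \<in> carrier Z"
    and "linear_form Z g ==> g (tensor_lift V W Z b t) = t (%v w. g (b v w))"
    by simp_all
qed

lemma tensor_lift_eqI:
  assumes "vspace Z" "t \<in> tens V W" "bilinear_map V W Z b" "z \<in> carrier Z"
    "!!g. linear_form Z g ==> t (%v w. g (b v w)) = g z"
  shows "tensor_lift V W Z b t = z"
  using assms by (intro forms_separate[of Z]) (simp_all add: tensor_lift_form)

section \<open>Tensor product algebras\<close>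

lemma T2_pure_closed:
  "v \<in> carrier V ==> w \<in> carrier W ==> T2 V W (%B. B v w) \<in> tens V W"
  using pure2_closed[of v V w W] by (simp add: pure2_def)

lemma T3_pure_closed:
  "u \<in> carrier U ==> v \<in> carrier V ==> w \<in> carrier W ==> T3 U V W (%B. B u v w) \<in> tens3 U V W"
  using pure3_closed[of u U v V w W] by (simp add: pure3_def)

lemma T2_bind_closed:
  assumes s: "s \<in> tens V W"
    and t: "!!v w. v \<in> carrier V ==> w \<in> carrier W ==> T2 V' W' (t v w) \<in> tens V' W'"
    and lin: "!!B. bilinear_form V' W' B ==> bilinear_form V W (%v w. t v w B)"
  shows "T2 V' W' (%B. s (%v w. t v w B)) \<in> tens V' W'"
proof -
  have "T2 V' W' (%B. s (%v w. T2 V' W' (t v w) B)) \<in> tens V' W'"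
    by (rule tens_bind_closed[OF s t]) (simp_all add: lin)
  moreover have "T2 V' W' (%B. s (%v w. T2 V' W' (t v w) B)) = T2 V' W' (%B. s (%v w. t v w B))"
    unfolding T2_eq_iff by simp
  ultimately show ?thesis by simp
qed

lemma T3_bind_closed:
  assumes s: "s \<in> tens V W"
    and t: "!!v w. v \<in> carrier V ==> w \<in> carrier W ==> T3 V' W' Y' (t v w) \<in> tens3 V' W' Y'"
    and lin: "!!B. trilinear_form V' W' Y' B ==> bilinear_form V W (%v w. t v w B)"
  shows "T3 V' W' Y' (%B. s (%v w. t v w B)) \<in> tens3 V' W' Y'"
proof -
  have "T3 V' W' Y' (%B. s (%v w. T3 V' W' Y' (t v w) B)) \<in> tens3 V' W' Y'"
    by (rule tens_bind3_closed[OF s t]) (simp_all add: lin)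
  moreover have "T3 V' W' Y' (%B. s (%v w. T3 V' W' Y' (t v w) B)) = T3 V' W' Y' (%B. s (%v w. t v w B))"
    unfolding T3_eq_iff by simp
  ultimately show ?thesis by simp
qed

lemma T3_bind3_closed:
  assumes s: "s \<in> tens3 U V W"
    and t: "!!u v w. u \<in> carrier U ==> v \<in> carrier V ==> w \<in> carrier W ==> T3 V' W' Y' (t u v w) \<in> tens3 V' W' Y'"
    and lin: "!!B. trilinear_form V' W' Y' B ==> trilinear_form U V W (%u v w. t u v w B)"
  shows "T3 V' W' Y' (%B. s (%u v w. t u v w B)) \<in> tens3 V' W' Y'"
proof -
  have "T3 V' W' Y' (%B. s (%u v w. T3 V' W' Y' (t u v w) B)) \<in> tens3 V' W' Y'"
    by (rule tens3_bind3_closed[OF s t]) (simp_all add: lin)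
  moreover have "T3 V' W' Y' (%B. s (%u v w. T3 V' W' Y' (t u v w) B)) = T3 V' W' Y' (%B. s (%u v w. t u v w B))"
    unfolding T3_eq_iff by simp
  ultimately show ?thesis by simp
qed

lemma tensor_alg_mult:
  "bilinear_form A B F ==>
    (s \<otimes>\<^bsub>tensor_alg A B\<^esub> t) F = s (%a b. t (%a' b'. F (a \<otimes>\<^bsub>A\<^esub> a') (b \<otimes>\<^bsub>B\<^esub> b')))"
  and tensor_alg_one: "bilinear_form A B F ==> \<one>\<^bsub>tensor_alg A B\<^esub> F = F \<one>\<^bsub>A\<^esub> \<one>\<^bsub>B\<^esub>"
  by (simp_all add: tensor_alg_def pure2_def)

lemma tensor_alg3_mult:
  "trilinear_form A B C F ==> (s \<otimes>\<^bsub>tensor_alg3 A B C\<^esub> t) F =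
    s (%a b c. t (%a' b' c'. F (a \<otimes>\<^bsub>A\<^esub> a') (b \<otimes>\<^bsub>B\<^esub> b') (c \<otimes>\<^bsub>C\<^esub> c')))"
  and tensor_alg3_one: "trilinear_form A B C F ==> \<one>\<^bsub>tensor_alg3 A B C\<^esub> F = F \<one>\<^bsub>A\<^esub> \<one>\<^bsub>B\<^esub> \<one>\<^bsub>C\<^esub>"
  by (simp_all add: tensor_alg3_def pure3_def)

lemma tensor_alg_mult_closed:
  assumes A: "k_algebra A" and B: "k_algebra B" and s: "s \<in> tens A B" and t: "t \<in> tens A B"
  shows "s \<otimes>\<^bsub>tensor_alg A B\<^esub> t \<in> tens A B"
proof -
  interpret A: ring A using A by (rule k_algebra_ring)
  interpret B: ring B using B by (rule k_algebra_ring)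
  note [simp] = k_algebra_vspace[OF A] k_algebra_vspace[OF B]
  have "T2 A B (%F. s (%a b. t (%a' b'. F (a \<otimes>\<^bsub>A\<^esub> a') (b \<otimes>\<^bsub>B\<^esub> b')))) \<in> tens A B"
  proof (rule T2_bind_closed[OF s], rule T2_bind_closed[OF t])
    fix F assume F: "bilinear_form A B F"
    show "bilinear_form A B (%a b. t (%a' b'. F (a \<otimes>\<^bsub>A\<^esub> a') (b \<otimes>\<^bsub>B\<^esub> b')))"
     by (intro lin tens_linear[OF _ t] bilinear_form_slot[OF F] A B; simp)
    show "bilinear_form A B (%a' b'. F (a \<otimes>\<^bsub>A\<^esub> a') (b \<otimes>\<^bsub>B\<^esub> b'))"
     if "a \<in> carrier A" "b \<in> carrier B" for a b
     by (intro lin bilinear_form_slot[OF F] A B; simp add: that)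
  qed (simp add: T2_pure_closed)
  then show ?thesis by (simp add: tensor_alg_def)
qed

lemma monoid_tensor_alg:
  assumes A: "k_algebra A" and B: "k_algebra B"
  shows "monoid (tensor_alg A B)"
proof -
  interpret A: ring A using A by (rule k_algebra_ring)
  interpret B: ring B using B by (rule k_algebra_ring)
  note v [simp] = k_algebra_vspace[OF A] k_algebra_vspace[OF B]
  note closed = tensor_alg_mult_closed[OF A B]
  have "\<one>\<^bsub>tensor_alg A B\<^esub> = pure2 A B \<one>\<^bsub>A\<^esub> \<one>\<^bsub>B\<^esub>" by (simp add: tensor_alg_def)
  then have one: "\<one>\<^bsub>tensor_alg A B\<^esub> \<in> tens A B" by simp
  show ?thesis
  proof
    fix r s t assume r: "r \<in> tens A B" and s: "s \<in> tens A B" and t: "t \<in> tens A B"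
    show "r \<otimes>\<^bsub>tensor_alg A B\<^esub> s \<otimes>\<^bsub>tensor_alg A B\<^esub> t = r \<otimes>\<^bsub>tensor_alg A B\<^esub> (s \<otimes>\<^bsub>tensor_alg A B\<^esub> t)"
    proof (rule tens_eqI[OF closed[OF closed[OF r s] t] closed[OF r closed[OF s t]]])
     fix F assume F: "bilinear_form A B F"
     have 1: "bilinear_form A B (%a b. t (%a' b'. F (a \<otimes>\<^bsub>A\<^esub> a') (b \<otimes>\<^bsub>B\<^esub> b')))"
      by (intro lin tens_linear[OF _ t] bilinear_form_slot[OF F] A B; simp)
     have 2: "bilinear_form A B (%a' b'. F (a \<otimes>\<^bsub>A\<^esub> a') (b \<otimes>\<^bsub>B\<^esub> b'))" if "a \<in> carrier A" "b \<in> carrier B" for a b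
      by (intro lin tens_linear[OF _ t] bilinear_form_slot[OF F] A B; simp add: that)
     have "(r \<otimes>\<^bsub>tensor_alg A B\<^esub> s \<otimes>\<^bsub>tensor_alg A B\<^esub> t) F =
      r (%a b. s (%a' b'. t (%a'' b''. F (a \<otimes>\<^bsub>A\<^esub> a' \<otimes>\<^bsub>A\<^esub> a'') (b \<otimes>\<^bsub>B\<^esub> b' \<otimes>\<^bsub>B\<^esub> b''))))"
      by (simp add: tensor_alg_mult F 1)
     also have "... = r (%a b. s (%a' b'. t (%a'' b''. F (a \<otimes>\<^bsub>A\<^esub> (a' \<otimes>\<^bsub>A\<^esub> a'')) (b \<otimes>\<^bsub>B\<^esub> (b' \<otimes>\<^bsub>B\<^esub> b'')))))"
      by (rule tens_cong[OF r v], rule tens_cong[OF s v], rule tens_cong[OF t v]) (simp add: A.m_assoc B.m_assoc)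
     also have "... = r (%a b. (s \<otimes>\<^bsub>tensor_alg A B\<^esub> t) (%a' b'. F (a \<otimes>\<^bsub>A\<^esub> a') (b \<otimes>\<^bsub>B\<^esub> b')))"
      by (rule tens_cong[OF r v]) (simp add: tensor_alg_mult 2)
     finally show "(r \<otimes>\<^bsub>tensor_alg A B\<^esub> s \<otimes>\<^bsub>tensor_alg A B\<^esub> t) F = (r \<otimes>\<^bsub>tensor_alg A B\<^esub> (s \<otimes>\<^bsub>tensor_alg A B\<^esub> t)) F"
      by (simp add: tensor_alg_mult F)
    qed
  next
    fix s assume s: "s \<in> tens A B"
    have *: "bilinear_form A B (%a b. F (\<one>\<^bsub>A\<^esub> \<otimes>\<^bsub>A\<^esub> a) (\<one>\<^bsub>B\<^esub> \<otimes>\<^bsub>B\<^esub> b))"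
      "bilinear_form A B (%a b. s (%a' b'. F (a \<otimes>\<^bsub>A\<^esub> a') (b \<otimes>\<^bsub>B\<^esub> b')))" if F: "bilinear_form A B F" for F
     by (intro lin tens_linear[OF _ s] bilinear_form_slot[OF F] A B; simp)+
    show "\<one>\<^bsub>tensor_alg A B\<^esub> \<otimes>\<^bsub>tensor_alg A B\<^esub> s = s"
     by (rule tens_eqI[OF closed[OF one s] s])
      (simp add: tensor_alg_mult tensor_alg_one * cong: tens_cong[OF s v])
    have **: "bilinear_form A B (%a' b'. F (a \<otimes>\<^bsub>A\<^esub> a') (b \<otimes>\<^bsub>B\<^esub> b'))"
     if F: "bilinear_form A B F" and "a \<in> carrier A" "b \<in> carrier B" for F a b
     by (intro lin tens_linear[OF _ s] bilinear_form_slot[OF F] A B; simp add: that)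
    show "s \<otimes>\<^bsub>tensor_alg A B\<^esub> \<one>\<^bsub>tensor_alg A B\<^esub> = s"
     by (rule tens_eqI[OF closed[OF s one] s])
      (simp add: tensor_alg_mult tensor_alg_one ** cong: tens_cong[OF s v])
  qed (use closed one in auto)
qed

lemma tensor_alg3_mult_closed:
  assumes A: "k_algebra A" and B: "k_algebra B" and C: "k_algebra C"
    and s: "s \<in> tens3 A B C" and t: "t \<in> tens3 A B C"
  shows "s \<otimes>\<^bsub>tensor_alg3 A B C\<^esub> t \<in> tens3 A B C"
proof -
  interpret A: ring A using A by (rule k_algebra_ring)
  interpret B: ring B using B by (rule k_algebra_ring)
  interpret C: ring C using C by (rule k_algebra_ring)
  note [simp] = k_algebra_vspace[OF A] k_algebra_vspace[OF B] k_algebra_vspace[OF C]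
  have "T3 A B C (%F. s (%a b c. t (%a' b' c'. F (a \<otimes>\<^bsub>A\<^esub> a') (b \<otimes>\<^bsub>B\<^esub> b') (c \<otimes>\<^bsub>C\<^esub> c')))) \<in> tens3 A B C"
  proof (rule T3_bind3_closed[OF s], rule T3_bind3_closed[OF t])
    fix F assume F: "trilinear_form A B C F"
    show "trilinear_form A B C (%a b c. t (%a' b' c'. F (a \<otimes>\<^bsub>A\<^esub> a') (b \<otimes>\<^bsub>B\<^esub> b') (c \<otimes>\<^bsub>C\<^esub> c')))"
     by (intro lin tens3_linear[OF _ t] trilinear_form_slot[OF F] A B C; simp)
    show "trilinear_form A B C (%a' b' c'. F (a \<otimes>\<^bsub>A\<^esub> a') (b \<otimes>\<^bsub>B\<^esub> b') (c \<otimes>\<^bsub>C\<^esub> c'))"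
     if "a \<in> carrier A" "b \<in> carrier B" "c \<in> carrier C" for a b c
     by (intro lin trilinear_form_slot[OF F] A B C; simp add: that)
  qed (simp add: T3_pure_closed)
  then show ?thesis by (simp add: tensor_alg3_def)
qed

lemma monoid_tensor_alg3:
  assumes A: "k_algebra A" and B: "k_algebra B" and C: "k_algebra C"
  shows "monoid (tensor_alg3 A B C)"
proof -
  interpret A: ring A using A by (rule k_algebra_ring)
  interpret B: ring B using B by (rule k_algebra_ring)
  interpret C: ring C using C by (rule k_algebra_ring)
  note v [simp] = k_algebra_vspace[OF A] k_algebra_vspace[OF B] k_algebra_vspace[OF C]
  note closed = tensor_alg3_mult_closed[OF A B C]
  have "\<one>\<^bsub>tensor_alg3 A B C\<^esub> = pure3 A B C \<one>\<^bsub>A\<^esub> \<one>\<^bsub>B\<^esub> \<one>\<^bsub>C\<^esub>" by (simp add: tensor_alg3_def)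
  then have one: "\<one>\<^bsub>tensor_alg3 A B C\<^esub> \<in> tens3 A B C" by simp
  let ?M = "tensor_alg3 A B C"
  show ?thesis
  proof
    fix r s t assume r: "r \<in> tens3 A B C" and s: "s \<in> tens3 A B C" and t: "t \<in> tens3 A B C"
    show "r \<otimes>\<^bsub>?M\<^esub> s \<otimes>\<^bsub>?M\<^esub> t = r \<otimes>\<^bsub>?M\<^esub> (s \<otimes>\<^bsub>?M\<^esub> t)"
    proof (rule tens3_eqI[OF closed[OF closed[OF r s] t] closed[OF r closed[OF s t]]])
     fix F assume F: "trilinear_form A B C F"
     have 1: "trilinear_form A B C (%a b c. t (%a' b' c'. F (a \<otimes>\<^bsub>A\<^esub> a') (b \<otimes>\<^bsub>B\<^esub> b') (c \<otimes>\<^bsub>C\<^esub> c')))"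
      by (intro lin tens3_linear[OF _ t] trilinear_form_slot[OF F] A B C; simp)
     have 2: "trilinear_form A B C (%a' b' c'. F (a \<otimes>\<^bsub>A\<^esub> a') (b \<otimes>\<^bsub>B\<^esub> b') (c \<otimes>\<^bsub>C\<^esub> c'))"
      if "a \<in> carrier A" "b \<in> carrier B" "c \<in> carrier C" for a b c
      by (intro lin trilinear_form_slot[OF F] A B C; simp add: that)
     have "(r \<otimes>\<^bsub>?M\<^esub> s \<otimes>\<^bsub>?M\<^esub> t) F =
      r (%a b c. s (%a' b' c'. t (%a'' b'' c''. F (a \<otimes>\<^bsub>A\<^esub> a' \<otimes>\<^bsub>A\<^esub> a'') (b \<otimes>\<^bsub>B\<^esub> b' \<otimes>\<^bsub>B\<^esub> b'') (c \<otimes>\<^bsub>C\<^esub> c' \<otimes>\<^bsub>C\<^esub> c''))))"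
      by (simp add: tensor_alg3_mult F 1)
     also have "... = r (%a b c. s (%a' b' c'. t (%a'' b'' c''.
       F (a \<otimes>\<^bsub>A\<^esub> (a' \<otimes>\<^bsub>A\<^esub> a'')) (b \<otimes>\<^bsub>B\<^esub> (b' \<otimes>\<^bsub>B\<^esub> b'')) (c \<otimes>\<^bsub>C\<^esub> (c' \<otimes>\<^bsub>C\<^esub> c'')))))"
      by (rule tens3_cong[OF r v], rule tens3_cong[OF s v], rule tens3_cong[OF t v])
       (simp add: A.m_assoc B.m_assoc C.m_assoc)
     also have "... = r (%a b c. (s \<otimes>\<^bsub>?M\<^esub> t) (%a' b' c'. F (a \<otimes>\<^bsub>A\<^esub> a') (b \<otimes>\<^bsub>B\<^esub> b') (c \<otimes>\<^bsub>C\<^esub> c')))"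
      by (rule tens3_cong[OF r v]) (simp add: tensor_alg3_mult 2)
     finally show "(r \<otimes>\<^bsub>?M\<^esub> s \<otimes>\<^bsub>?M\<^esub> t) F = (r \<otimes>\<^bsub>?M\<^esub> (s \<otimes>\<^bsub>?M\<^esub> t)) F"
      by (simp add: tensor_alg3_mult F)
    qed
  next
    fix s assume s: "s \<in> tens3 A B C"
    have *: "trilinear_form A B C (%a b c. s (%a' b' c'. F (a \<otimes>\<^bsub>A\<^esub> a') (b \<otimes>\<^bsub>B\<^esub> b') (c \<otimes>\<^bsub>C\<^esub> c')))"
     if F: "trilinear_form A B C F" for F
     by (intro lin tens3_linear[OF _ s] trilinear_form_slot[OF F] A B C; simp)
    show "\<one>\<^bsub>?M\<^esub> \<otimes>\<^bsub>?M\<^esub> s = s"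
     by (rule tens3_eqI[OF closed[OF one s] s])
      (simp add: tensor_alg3_mult tensor_alg3_one * cong: tens3_cong[OF s v])
    have **: "trilinear_form A B C (%a' b' c'. F (a \<otimes>\<^bsub>A\<^esub> a') (b \<otimes>\<^bsub>B\<^esub> b') (c \<otimes>\<^bsub>C\<^esub> c'))"
     if F: "trilinear_form A B C F" and "a \<in> carrier A" "b \<in> carrier B" "c \<in> carrier C" for F a b c
     by (intro lin trilinear_form_slot[OF F] A B C; simp add: that)
    show "s \<otimes>\<^bsub>?M\<^esub> \<one>\<^bsub>?M\<^esub> = s"
     by (rule tens3_eqI[OF closed[OF s one] s])
      (simp add: tensor_alg3_mult tensor_alg3_one ** cong: tens3_cong[OF s v])
  qed (use closed one in auto)
qed

text \<open>Conjugation equations without inverses.\<close>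

lemma Ad_eq_iff:
  assumes M: "monoid M" and u: "u \<in> carrier M" "u' \<in> carrier M" "u \<otimes>\<^bsub>M\<^esub> u' = \<one>\<^bsub>M\<^esub>" "u' \<otimes>\<^bsub>M\<^esub> u = \<one>\<^bsub>M\<^esub>"
    and zw: "z \<in> carrier M" "w \<in> carrier M"
  shows "inv\<^bsub>M\<^esub> u = u'"
    and "w = Ad M u z \<longleftrightarrow> w \<otimes>\<^bsub>M\<^esub> u = u \<otimes>\<^bsub>M\<^esub> z"
    and "w = Ad M u z \<longleftrightarrow> u' \<otimes>\<^bsub>M\<^esub> w = z \<otimes>\<^bsub>M\<^esub> u'"
proof -
  interpret monoid M by fact
  show inv: "inv\<^bsub>M\<^esub> u = u'" using inv_unique' u by metis
  have right: "(x \<otimes>\<^bsub>M\<^esub> u) \<otimes>\<^bsub>M\<^esub> u' = x" "(x \<otimes>\<^bsub>M\<^esub> u') \<otimes>\<^bsub>M\<^esub> u = x" if "x \<in> carrier M" for x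
    using that u by (simp_all add: m_assoc)
  have left: "u \<otimes>\<^bsub>M\<^esub> (u' \<otimes>\<^bsub>M\<^esub> x) = x" "u' \<otimes>\<^bsub>M\<^esub> (u \<otimes>\<^bsub>M\<^esub> x) = x" if "x \<in> carrier M" for x
    using that u by (simp_all flip: m_assoc)
  show "w = Ad M u z \<longleftrightarrow> w \<otimes>\<^bsub>M\<^esub> u = u \<otimes>\<^bsub>M\<^esub> z"
    unfolding Ad_def inv using right u zw by (metis m_closed)
  show "w = Ad M u z \<longleftrightarrow> u' \<otimes>\<^bsub>M\<^esub> w = z \<otimes>\<^bsub>M\<^esub> u'"
    unfolding Ad_def inv using left u zw by (metis m_closed m_assoc)
qed

section \<open>Conjugation on triple tensor products\<close>

lemma tens3_scale_sum:
  assumes t: "t \<in> tens3 U V W" and B: "!!i. i \<in> I ==> trilinear_form U V W (B i)"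
  shows "t (%u v w. \<Sum>i\<in>I. B i u v w) = (\<Sum>i\<in>I. t (B i))"
proof -
  obtain n u v w where r: "t = T3 U V W (%T. \<Sum>i<n::nat. T (u i) (v i) (w i))" by (rule tens3E[OF t])
  have "trilinear_form U V W (%u v w. \<Sum>i\<in>I. B i u v w)"
    using B by (intro lin) (auto simp: trilinear_form_def)
  then have "t (%u v w. \<Sum>i\<in>I. B i u v w) = (\<Sum>j<n. \<Sum>i\<in>I. B i (u j) (v j) (w j))" by (simp add: r)
  also have "... = (\<Sum>i\<in>I. t (B i))" by (subst sum.swap) (simp add: r B cong: sum.cong)
  finally show ?thesis .
qed

lemma tens_fubini3:
  assumes s: "s \<in> tens V W" and t: "t \<in> tens3 V' W' Y'"
    and V: "vspace V" "vspace W" "vspace V'" "vspace W'" "vspace Y'"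
    and F: "!!v w. v \<in> carrier V ==> w \<in> carrier W ==> trilinear_form V' W' Y' (F v w)"
    and F': "!!v' w' y'. v' \<in> carrier V' ==> w' \<in> carrier W' ==> y' \<in> carrier Y' ==>
      bilinear_form V W (%v w. F v w v' w' y')"
  shows "s (%v w. t (%v' w' y'. F v w v' w' y')) = t (%v' w' y'. s (%v w. F v w v' w' y'))"
proof -
  obtain n v w where r: "\<forall>i<n::nat. v i \<in> carrier V" "\<forall>i<n. w i \<in> carrier W"
    "s = T2 V W (%B. \<Sum>i<n. B (v i) (w i))" by (rule tensE[OF s])
  have "bilinear_form V W (%v w. t (F v w))"
  proof (rule bilinear_formI)
    show "linear_form W (%w. t (F v w))" if "v \<in> carrier V" for v
     by (rule tens3_linear[OF V(2) t]) (use that F F' in \<open>simp_all add: bilinear_form_def\<close>)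
    show "linear_form V (%v. t (F v w))" if "w \<in> carrier W" for w
     by (rule tens3_linear[OF V(1) t]) (use that F F' in \<open>simp_all add: bilinear_form_def\<close>)
  qed
  then have "s (%v w. t (F v w)) = (\<Sum>i<n. t (F (v i) (w i)))" by (simp add: r)
  also have "... = t (%v' w' y'. \<Sum>i<n. F (v i) (w i) v' w' y')"
    by (rule tens3_scale_sum[OF t, symmetric]) (use F r in auto)
  also have "... = t (%v' w' y'. s (%v w. F v w v' w' y'))"
    by (rule tens3_cong[OF t V(3-5)]) (simp add: r(3) F')
  finally show ?thesis .
qed

text \<open>The placement of a tensor in some legs of a triple tensor product, the remaining leg being
  filled with the unit, is an algebra homomorphism. The three placements are treated
  simultaneously: f, g and h describe the entries of the legs of a pure tensor.\<close>

definition leg ::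
  "('k::field, 'a, 'z) module_scheme => ('k, 'b, 'y) module_scheme => ('k, 'c, 'w) module_scheme
    => ('d => 'e => 'a) => ('d => 'e => 'b) => ('d => 'e => 'c)
    => ('k, 'd, 'e) tensor => ('k, 'a, 'b, 'c) tensor3" where
  "leg P Q R f g h t = T3 P Q R (%T. t (%a b. T (f a b) (g a b) (h a b)))"

locale leg_placement =
  fixes A :: "('k::field, 'd, 'v) module_scheme" and B :: "('k, 'e, 'u) module_scheme"
    and P :: "('k, 'a, 'z) module_scheme" and Q :: "('k, 'b, 'y) module_scheme"
    and R :: "('k, 'c, 'w) module_scheme"
    and f g h
  assumes AB: "k_algebra A" "k_algebra B" and PQR: "k_algebra P" "k_algebra Q" "k_algebra R"
    and place: "!!T. trilinear_form P Q R T ==> bilinear_form A B (%a b. T (f a b) (g a b) (h a b))"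
    and closed: "!!a b. a \<in> carrier A ==> b \<in> carrier B ==>
     f a b \<in> carrier P & g a b \<in> carrier Q & h a b \<in> carrier R"
    and mult: "!!a b a' b'. a \<in> carrier A ==> b \<in> carrier B ==> a' \<in> carrier A ==> b' \<in> carrier B ==>
     f (a \<otimes>\<^bsub>A\<^esub> a') (b \<otimes>\<^bsub>B\<^esub> b') = f a b \<otimes>\<^bsub>P\<^esub> f a' b' &
     g (a \<otimes>\<^bsub>A\<^esub> a') (b \<otimes>\<^bsub>B\<^esub> b') = g a b \<otimes>\<^bsub>Q\<^esub> g a' b' &
     h (a \<otimes>\<^bsub>A\<^esub> a') (b \<otimes>\<^bsub>B\<^esub> b') = h a b \<otimes>\<^bsub>R\<^esub> h a' b'"
    and one: "f \<one>\<^bsub>A\<^esub> \<one>\<^bsub>B\<^esub> = \<one>\<^bsub>P\<^esub>" "g \<one>\<^bsub>A\<^esub> \<one>\<^bsub>B\<^esub> = \<one>\<^bsub>Q\<^esub>" "h \<one>\<^bsub>A\<^esub> \<one>\<^bsub>B\<^esub> = \<one>\<^bsub>R\<^esub>"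
begin

sublocale A: ring A using AB by (simp add: k_algebra_ring)
sublocale B: ring B using AB by (simp add: k_algebra_ring)
sublocale P: ring P using PQR by (simp add: k_algebra_ring)
sublocale Q: ring Q using PQR by (simp add: k_algebra_ring)
sublocale R: ring R using PQR by (simp add: k_algebra_ring)

lemmas vAB [simp] = AB[THEN k_algebra_vspace]
lemmas vPQR [simp] = PQR[THEN k_algebra_vspace]

lemma leg_closed: "t \<in> tens A B ==> leg P Q R f g h t \<in> tens3 P Q R"
  unfolding leg_def
  by (rule T3_bind_closed) (auto simp: closed place intro: T3_pure_closed)

lemma trilinear_translate:
  assumes T: "trilinear_form P Q R T" and xyz: "x \<in> carrier P" "y \<in> carrier Q" "z \<in> carrier R"
  shows "trilinear_form P Q R (%x' y' z'. T (x \<otimes>\<^bsub>P\<^esub> x') (y \<otimes>\<^bsub>Q\<^esub> y') (z \<otimes>\<^bsub>R\<^esub> z'))"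
    and "trilinear_form P Q R (%x' y' z'. T (x' \<otimes>\<^bsub>P\<^esub> x) (y' \<otimes>\<^bsub>Q\<^esub> y) (z' \<otimes>\<^bsub>R\<^esub> z))"
  by (intro lin trilinear_form_slot[OF T] PQR; simp add: xyz)+

lemma leg_mult_left:
  assumes t: "t \<in> tens3 P Q R" and T: "trilinear_form P Q R T"
  shows "(leg P Q R f g h s \<otimes>\<^bsub>tensor_alg3 P Q R\<^esub> t) T =
    s (%a b. t (%x y z. T (f a b \<otimes>\<^bsub>P\<^esub> x) (g a b \<otimes>\<^bsub>Q\<^esub> y) (h a b \<otimes>\<^bsub>R\<^esub> z)))"
proof -
  have "trilinear_form P Q R (%a b c. t (%x y z. T (a \<otimes>\<^bsub>P\<^esub> x) (b \<otimes>\<^bsub>Q\<^esub> y) (c \<otimes>\<^bsub>R\<^esub> z)))"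
    by (intro lin tens3_linear[OF _ t] trilinear_form_slot[OF T] PQR; simp)
  then show ?thesis by (simp add: tensor_alg3_mult[OF T] leg_def)
qed

lemma leg_mult_right:
  assumes t: "t \<in> tens3 P Q R" and T: "trilinear_form P Q R T"
  shows "(t \<otimes>\<^bsub>tensor_alg3 P Q R\<^esub> leg P Q R f g h s) T =
    t (%x y z. s (%a b. T (x \<otimes>\<^bsub>P\<^esub> f a b) (y \<otimes>\<^bsub>Q\<^esub> g a b) (z \<otimes>\<^bsub>R\<^esub> h a b)))"
  unfolding tensor_alg3_mult[OF T]
  by (rule tens3_cong[OF t vPQR]) (simp add: leg_def trilinear_translate[OF T])

lemma leg_hom:
  assumes s: "s \<in> tens A B" and t: "t \<in> tens A B"
  shows "leg P Q R f g h s \<otimes>\<^bsub>tensor_alg3 P Q R\<^esub> leg P Q R f g h t = leg P Q R f g h (s \<otimes>\<^bsub>tensor_alg A B\<^esub> t)"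
proof (rule tens3_eqI[OF tensor_alg3_mult_closed[OF PQR] leg_closed])
  fix T assume T: "trilinear_form P Q R T"
  have "(leg P Q R f g h s \<otimes>\<^bsub>tensor_alg3 P Q R\<^esub> leg P Q R f g h t) T =
    s (%a b. leg P Q R f g h t (%x y z. T (f a b \<otimes>\<^bsub>P\<^esub> x) (g a b \<otimes>\<^bsub>Q\<^esub> y) (h a b \<otimes>\<^bsub>R\<^esub> z)))"
    by (rule leg_mult_left[OF leg_closed[OF t] T])
  also have "... = s (%a b. t (%a' b'. T (f (a \<otimes>\<^bsub>A\<^esub> a') (b \<otimes>\<^bsub>B\<^esub> b')) (g (a \<otimes>\<^bsub>A\<^esub> a') (b \<otimes>\<^bsub>B\<^esub> b')) (h (a \<otimes>\<^bsub>A\<^esub> a') (b \<otimes>\<^bsub>B\<^esub> b'))))"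
  proof (rule tens_cong[OF s vAB])
    fix a b assume ab: "a \<in> carrier A" "b \<in> carrier B"
    have "leg P Q R f g h t (%x y z. T (f a b \<otimes>\<^bsub>P\<^esub> x) (g a b \<otimes>\<^bsub>Q\<^esub> y) (h a b \<otimes>\<^bsub>R\<^esub> z)) =
     t (%a' b'. T (f a b \<otimes>\<^bsub>P\<^esub> f a' b') (g a b \<otimes>\<^bsub>Q\<^esub> g a' b') (h a b \<otimes>\<^bsub>R\<^esub> h a' b'))"
     unfolding leg_def by (rule T3_apply[OF trilinear_translate(1)[OF T]]) (use closed[OF ab] in auto)
    also have "... = t (%a' b'. T (f (a \<otimes>\<^bsub>A\<^esub> a') (b \<otimes>\<^bsub>B\<^esub> b')) (g (a \<otimes>\<^bsub>A\<^esub> a') (b \<otimes>\<^bsub>B\<^esub> b')) (h (a \<otimes>\<^bsub>A\<^esub> a') (b \<otimes>\<^bsub>B\<^esub> b')))"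
     by (rule tens_cong[OF t vAB]) (simp add: mult ab)
    finally show "leg P Q R f g h t (%x y z. T (f a b \<otimes>\<^bsub>P\<^esub> x) (g a b \<otimes>\<^bsub>Q\<^esub> y) (h a b \<otimes>\<^bsub>R\<^esub> z)) = ..." .
  qed
  also have "... = (s \<otimes>\<^bsub>tensor_alg A B\<^esub> t) (%a b. T (f a b) (g a b) (h a b))"
    by (rule tensor_alg_mult[OF place[OF T], symmetric])
  finally show "(leg P Q R f g h s \<otimes>\<^bsub>tensor_alg3 P Q R\<^esub> leg P Q R f g h t) T =
    leg P Q R f g h (s \<otimes>\<^bsub>tensor_alg A B\<^esub> t) T" by (simp add: leg_def T)
qed (use s t tensor_alg_mult_closed[OF AB] in \<open>auto intro: leg_closed\<close>)

lemma leg_one: "leg P Q R f g h \<one>\<^bsub>tensor_alg A B\<^esub> = \<one>\<^bsub>tensor_alg3 P Q R\<^esub>"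
proof -
  have "\<one>\<^bsub>tensor_alg3 P Q R\<^esub> = pure3 P Q R \<one>\<^bsub>P\<^esub> \<one>\<^bsub>Q\<^esub> \<one>\<^bsub>R\<^esub>" by (simp add: tensor_alg3_def)
  also have "... = leg P Q R f g h \<one>\<^bsub>tensor_alg A B\<^esub>"
    by (simp add: leg_def pure3_def T3_eq_iff tensor_alg_one place one)
  finally show ?thesis by simp
qed

context
  fixes u u'
  assumes u: "u \<in> tens A B" "u' \<in> tens A B"
    and inv: "u \<otimes>\<^bsub>tensor_alg A B\<^esub> u' = \<one>\<^bsub>tensor_alg A B\<^esub>" "u' \<otimes>\<^bsub>tensor_alg A B\<^esub> u = \<one>\<^bsub>tensor_alg A B\<^esub>"
begin

lemma leg_inverse: "inv\<^bsub>tensor_alg3 P Q R\<^esub> (leg P Q R f g h u) = leg P Q R f g h u'"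
  using Ad_eq_iff(1)[OF monoid_tensor_alg3[OF PQR], of "leg P Q R f g h u" "leg P Q R f g h u'"
     "leg P Q R f g h u" "leg P Q R f g h u"]
  by (simp add: leg_closed u leg_hom inv leg_one)

lemma Ad_leg_iff:
  assumes z: "z \<in> tens3 P Q R" and w: "w \<in> tens3 P Q R"
  shows "w = Ad (tensor_alg3 P Q R) (leg P Q R f g h u) z \<longleftrightarrow>
     (\<forall>T. trilinear_form P Q R T -->
      w (%x y z. u (%a b. T (x \<otimes>\<^bsub>P\<^esub> f a b) (y \<otimes>\<^bsub>Q\<^esub> g a b) (z \<otimes>\<^bsub>R\<^esub> h a b))) =
      u (%a b. z (%x y z. T (f a b \<otimes>\<^bsub>P\<^esub> x) (g a b \<otimes>\<^bsub>Q\<^esub> y) (h a b \<otimes>\<^bsub>R\<^esub> z))))"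
    and "w = Ad (tensor_alg3 P Q R) (leg P Q R f g h u) z \<longleftrightarrow>
     (\<forall>T. trilinear_form P Q R T -->
      u' (%a b. w (%x y z. T (f a b \<otimes>\<^bsub>P\<^esub> x) (g a b \<otimes>\<^bsub>Q\<^esub> y) (h a b \<otimes>\<^bsub>R\<^esub> z))) =
      z (%x y z. u' (%a b. T (x \<otimes>\<^bsub>P\<^esub> f a b) (y \<otimes>\<^bsub>Q\<^esub> g a b) (z \<otimes>\<^bsub>R\<^esub> h a b))))"
proof -
  note c = tensor_alg3_mult_closed[OF PQR]
  note l = leg_closed[OF u(1)] leg_closed[OF u(2)]
  have eq: "s = t \<longleftrightarrow> (\<forall>T. trilinear_form P Q R T --> s T = t T)" if "s \<in> tens3 P Q R" "t \<in> tens3 P Q R" for s t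
    using tens3_eqI[OF that] by auto
  note Ad = Ad_eq_iff[OF monoid_tensor_alg3[OF PQR] l _ _ z w, unfolded leg_hom[OF u(1,2)] leg_hom[OF u(2,1)] inv leg_one]
  show "w = Ad (tensor_alg3 P Q R) (leg P Q R f g h u) z \<longleftrightarrow>
     (\<forall>T. trilinear_form P Q R T -->
      w (%x y z. u (%a b. T (x \<otimes>\<^bsub>P\<^esub> f a b) (y \<otimes>\<^bsub>Q\<^esub> g a b) (z \<otimes>\<^bsub>R\<^esub> h a b))) =
      u (%a b. z (%x y z. T (f a b \<otimes>\<^bsub>P\<^esub> x) (g a b \<otimes>\<^bsub>Q\<^esub> y) (h a b \<otimes>\<^bsub>R\<^esub> z))))"
    unfolding Ad(2)[OF refl refl] eq[OF c[OF w l(1)] c[OF l(1) z]]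
    by (simp add: leg_mult_left[OF z] leg_mult_right[OF w])
  show "w = Ad (tensor_alg3 P Q R) (leg P Q R f g h u) z \<longleftrightarrow>
     (\<forall>T. trilinear_form P Q R T -->
      u' (%a b. w (%x y z. T (f a b \<otimes>\<^bsub>P\<^esub> x) (g a b \<otimes>\<^bsub>Q\<^esub> y) (h a b \<otimes>\<^bsub>R\<^esub> z))) =
      z (%x y z. u' (%a b. T (x \<otimes>\<^bsub>P\<^esub> f a b) (y \<otimes>\<^bsub>Q\<^esub> g a b) (z \<otimes>\<^bsub>R\<^esub> h a b))))"
    unfolding Ad(3)[OF refl refl] eq[OF c[OF l(2) w] c[OF z l(2)]]
    by (simp add: leg_mult_left[OF w] leg_mult_right[OF z])
qed

end

end

lemma leg_placement_13:
  assumes A: "k_algebra A" and B: "k_algebra B" and C: "k_algebra C"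
  shows "leg_placement A C A B C (%a c. a) (%a c. \<one>\<^bsub>B\<^esub>) (%a c. c)"
proof -
  interpret B: ring B using B by (rule k_algebra_ring)
  show ?thesis
  proof (rule leg_placement.intro)
    fix T assume T: "trilinear_form A B C T"
    show "bilinear_form A C (%a c. T a \<one>\<^bsub>B\<^esub> c)" by (intro lin trilinear_form_slot[OF T]; simp)
  qed (use A B C in auto)
qed

lemma leg_placement_12:
  assumes A: "k_algebra A" and B: "k_algebra B" and C: "k_algebra C"
  shows "leg_placement A B A B C (%a b. a) (%a b. b) (%a b. \<one>\<^bsub>C\<^esub>)"
proof -
  interpret C: ring C using C by (rule k_algebra_ring)
  show ?thesis
  proof (rule leg_placement.intro)
    fix T assume T: "trilinear_form A B C T"
    show "bilinear_form A B (%a b. T a b \<one>\<^bsub>C\<^esub>)" by (intro lin trilinear_form_slot[OF T]; simp)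
  qed (use A B C in auto)
qed

lemma leg_placement_23:
  assumes A: "k_algebra A" and B: "k_algebra B" and C: "k_algebra C"
  shows "leg_placement B C A B C (%b c. \<one>\<^bsub>A\<^esub>) (%b c. b) (%b c. c)"
proof -
  interpret A: ring A using A by (rule k_algebra_ring)
  show ?thesis
  proof (rule leg_placement.intro)
    fix T assume T: "trilinear_form A B C T"
    show "bilinear_form B C (%b c. T \<one>\<^bsub>A\<^esub> b c)" by (intro lin trilinear_form_slot[OF T]; simp)
  qed (use A B C in auto)
qed

lemma Ad_pure:
  assumes A: "k_algebra A" and B: "k_algebra B"
    and u: "u \<in> tens A B" "u' \<in> tens A B" "inv\<^bsub>tensor_alg A B\<^esub> u = u'"
    and ab: "a \<in> carrier A" "b \<in> carrier B" and F: "bilinear_form A B F"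
  shows "Ad (tensor_alg A B) u (pure2 A B a b) F =
    u (%c d. u' (%c' d'. F (c \<otimes>\<^bsub>A\<^esub> a \<otimes>\<^bsub>A\<^esub> c') (d \<otimes>\<^bsub>B\<^esub> b \<otimes>\<^bsub>B\<^esub> d')))"
proof -
  interpret A: ring A using A by (rule k_algebra_ring)
  interpret B: ring B using B by (rule k_algebra_ring)
  note v [simp] = k_algebra_vspace[OF A] k_algebra_vspace[OF B]
  have 1: "bilinear_form A B (%a b. u' (%a' b'. F (a \<otimes>\<^bsub>A\<^esub> a') (b \<otimes>\<^bsub>B\<^esub> b')))"
    by (intro lin tens_linear[OF _ u(2)] bilinear_form_slot[OF F] A B; simp)
  have 2: "bilinear_form A B (%x y. u' (%a' b'. F (c \<otimes>\<^bsub>A\<^esub> x \<otimes>\<^bsub>A\<^esub> a') (d \<otimes>\<^bsub>B\<^esub> y \<otimes>\<^bsub>B\<^esub> b')))"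
    if "c \<in> carrier A" "d \<in> carrier B" for c d
    by (intro lin tens_linear[OF _ u(2)] bilinear_form_slot[OF F] A B; simp add: that)
  show ?thesis unfolding Ad_def u(3) tensor_alg_mult[OF F] tensor_alg_mult[OF 1]
    by (rule tens_cong[OF u(1) v]) (simp add: pure2_def 2)
qed

lemma Ad_leg12:
  assumes A: "k_algebra A" and B: "k_algebra B" and C: "k_algebra C"
    and u: "u \<in> tens A B" "u' \<in> tens A B"
    and inv: "u \<otimes>\<^bsub>tensor_alg A B\<^esub> u' = \<one>\<^bsub>tensor_alg A B\<^esub>" "u' \<otimes>\<^bsub>tensor_alg A B\<^esub> u = \<one>\<^bsub>tensor_alg A B\<^esub>"
    and t: "t \<in> tens3 A B C"
  shows "on12 A B C (Ad (tensor_alg A B) u) t =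
    Ad (tensor_alg3 A B C) (leg A B C (%a b. a) (%a b. b) (%a b. \<one>\<^bsub>C\<^esub>) u) t"
proof -
  interpret leg_placement A B A B C "%a b. a" "%a b. b" "%a b. \<one>\<^bsub>C\<^esub>" by (rule leg_placement_12[OF A B C])
  have inv': "inv\<^bsub>tensor_alg A B\<^esub> u = u'" using Ad_eq_iff(1)[OF monoid_tensor_alg[OF A B] u inv u] .
  let ?l = "leg A B C (%a b. a) (%a b. b) (%a b. \<one>\<^bsub>C\<^esub>)"
  have "Ad (tensor_alg3 A B C) (?l u) t = (?l u \<otimes>\<^bsub>tensor_alg3 A B C\<^esub> t) \<otimes>\<^bsub>tensor_alg3 A B C\<^esub> ?l u'"
    unfolding Ad_def leg_inverse[OF u inv] ..
  also have "... = T3 A B C (%T. t (%a b c. Ad (tensor_alg A B) u (pure2 A B a b) (%a' b'. T a' b' c)))"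
  proof
    fix T
    note cl = tensor_alg3_mult_closed[OF A B C leg_closed[OF u(1)] t]
    show "(?l u \<otimes>\<^bsub>tensor_alg3 A B C\<^esub> t \<otimes>\<^bsub>tensor_alg3 A B C\<^esub> ?l u') T =
     T3 A B C (%T. t (%a b c. Ad (tensor_alg A B) u (pure2 A B a b) (%a' b'. T a' b' c))) T"
    proof (cases "trilinear_form A B C T")
     case False
     then show ?thesis
      using tens3_nontrilinear[OF tensor_alg3_mult_closed[OF A B C cl leg_closed[OF u(2)]]] by (simp add: T3_def)
    next
     case True
     note T = trilinear_form_slot[OF True]
     have 1: "trilinear_form A B C (%x y z. u' (%a b. T (x \<otimes>\<^bsub>A\<^esub> a) (y \<otimes>\<^bsub>B\<^esub> b) (z \<otimes>\<^bsub>C\<^esub> \<one>\<^bsub>C\<^esub>)))"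
      by (intro lin tens_linear[OF _ u(2)] T A B C; simp)
     have 2: "bilinear_form A B (%a b. T a b c)" if "c \<in> carrier C" for c
      by (intro lin T; simp add: that)
     have "(?l u \<otimes>\<^bsub>tensor_alg3 A B C\<^esub> t \<otimes>\<^bsub>tensor_alg3 A B C\<^esub> ?l u') T =
      u (%c d. t (%a b x. u' (%c' d'. T (c \<otimes>\<^bsub>A\<^esub> a \<otimes>\<^bsub>A\<^esub> c') (d \<otimes>\<^bsub>B\<^esub> b \<otimes>\<^bsub>B\<^esub> d') (\<one>\<^bsub>C\<^esub> \<otimes>\<^bsub>C\<^esub> x \<otimes>\<^bsub>C\<^esub> \<one>\<^bsub>C\<^esub>))))"
      by (simp add: leg_mult_right[OF cl True] leg_mult_left[OF t 1])
     also have "... = t (%a b x. u (%c d. u' (%c' d'. T (c \<otimes>\<^bsub>A\<^esub> a \<otimes>\<^bsub>A\<^esub> c') (d \<otimes>\<^bsub>B\<^esub> b \<otimes>\<^bsub>B\<^esub> d') (\<one>\<^bsub>C\<^esub> \<otimes>\<^bsub>C\<^esub> x \<otimes>\<^bsub>C\<^esub> \<one>\<^bsub>C\<^esub>))))"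
      by (rule tens_fubini3[OF u(1) t vAB vPQR]) (intro lin tens_linear[OF _ u(2)] T A B C; simp)+
     also have "... = t (%a b c. Ad (tensor_alg A B) u (pure2 A B a b) (%a' b'. T a' b' c))"
      by (rule tens3_cong[OF t vPQR]) (simp add: Ad_pure[OF A B u inv'] 2)
     finally show ?thesis by (simp add: True)
    qed
  qed
  finally show ?thesis by (simp add: on12_def)
qed

lemma Ad_leg23:
  assumes A: "k_algebra A" and B: "k_algebra B" and C: "k_algebra C"
    and u: "u \<in> tens B C" "u' \<in> tens B C"
    and inv: "u \<otimes>\<^bsub>tensor_alg B C\<^esub> u' = \<one>\<^bsub>tensor_alg B C\<^esub>" "u' \<otimes>\<^bsub>tensor_alg B C\<^esub> u = \<one>\<^bsub>tensor_alg B C\<^esub>"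
    and t: "t \<in> tens3 A B C"
  shows "on23 A B C (Ad (tensor_alg B C) u) t =
    Ad (tensor_alg3 A B C) (leg A B C (%b c. \<one>\<^bsub>A\<^esub>) (%b c. b) (%b c. c) u) t"
proof -
  interpret leg_placement B C A B C "%b c. \<one>\<^bsub>A\<^esub>" "%b c. b" "%b c. c" by (rule leg_placement_23[OF A B C])
  have inv': "inv\<^bsub>tensor_alg B C\<^esub> u = u'" using Ad_eq_iff(1)[OF monoid_tensor_alg[OF B C] u inv u] .
  let ?l = "leg A B C (%b c. \<one>\<^bsub>A\<^esub>) (%b c. b) (%b c. c)"
  have "Ad (tensor_alg3 A B C) (?l u) t = (?l u \<otimes>\<^bsub>tensor_alg3 A B C\<^esub> t) \<otimes>\<^bsub>tensor_alg3 A B C\<^esub> ?l u'"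
    unfolding Ad_def leg_inverse[OF u inv] ..
  also have "... = T3 A B C (%T. t (%a b c. Ad (tensor_alg B C) u (pure2 B C b c) (%b' c'. T a b' c')))"
  proof
    fix T
    note cl = tensor_alg3_mult_closed[OF A B C leg_closed[OF u(1)] t]
    show "(?l u \<otimes>\<^bsub>tensor_alg3 A B C\<^esub> t \<otimes>\<^bsub>tensor_alg3 A B C\<^esub> ?l u') T =
     T3 A B C (%T. t (%a b c. Ad (tensor_alg B C) u (pure2 B C b c) (%b' c'. T a b' c'))) T"
    proof (cases "trilinear_form A B C T")
     case False
     then show ?thesis
      using tens3_nontrilinear[OF tensor_alg3_mult_closed[OF A B C cl leg_closed[OF u(2)]]] by (simp add: T3_def)
    next
     case True
     note T = trilinear_form_slot[OF True]
     have 1: "trilinear_form A B C (%x y z. u' (%b c. T (x \<otimes>\<^bsub>A\<^esub> \<one>\<^bsub>A\<^esub>) (y \<otimes>\<^bsub>B\<^esub> b) (z \<otimes>\<^bsub>C\<^esub> c)))"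
      by (intro lin tens_linear[OF _ u(2)] T A B C; simp)
     have 2: "bilinear_form B C (%b c. T a b c)" if "a \<in> carrier A" for a
      by (intro lin T; simp add: that)
     have "(?l u \<otimes>\<^bsub>tensor_alg3 A B C\<^esub> t \<otimes>\<^bsub>tensor_alg3 A B C\<^esub> ?l u') T =
      u (%c d. t (%x a b. u' (%c' d'. T (\<one>\<^bsub>A\<^esub> \<otimes>\<^bsub>A\<^esub> x \<otimes>\<^bsub>A\<^esub> \<one>\<^bsub>A\<^esub>) (c \<otimes>\<^bsub>B\<^esub> a \<otimes>\<^bsub>B\<^esub> c') (d \<otimes>\<^bsub>C\<^esub> b \<otimes>\<^bsub>C\<^esub> d'))))"
      by (simp add: leg_mult_right[OF cl True] leg_mult_left[OF t 1])
     also have "... = t (%x a b. u (%c d. u' (%c' d'. T (\<one>\<^bsub>A\<^esub> \<otimes>\<^bsub>A\<^esub> x \<otimes>\<^bsub>A\<^esub> \<one>\<^bsub>A\<^esub>) (c \<otimes>\<^bsub>B\<^esub> a \<otimes>\<^bsub>B\<^esub> c') (d \<otimes>\<^bsub>C\<^esub> b \<otimes>\<^bsub>C\<^esub> d'))))"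
      by (rule tens_fubini3[OF u(1) t vAB vPQR]) (intro lin tens_linear[OF _ u(2)] T A B C; simp)+
     also have "... = t (%a b c. Ad (tensor_alg B C) u (pure2 B C b c) (%b' c'. T a b' c'))"
      by (rule tens3_cong[OF t vPQR]) (simp add: Ad_pure[OF B C u inv'] 2)
     finally show ?thesis by (simp add: True)
    qed
  qed
  finally show ?thesis by (simp add: on23_def)
qed

section \<open>Opposite algebras and algebra homomorphisms\<close>

lemma opp_simps [simp]:
  "carrier (opp A) = carrier A" "\<one>\<^bsub>opp A\<^esub> = \<one>\<^bsub>A\<^esub>" "\<zero>\<^bsub>opp A\<^esub> = \<zero>\<^bsub>A\<^esub>"
  "x \<oplus>\<^bsub>opp A\<^esub> y = x \<oplus>\<^bsub>A\<^esub> y" "c \<odot>\<^bsub>opp A\<^esub> x = c \<odot>\<^bsub>A\<^esub> x" "x \<otimes>\<^bsub>opp A\<^esub> y = y \<otimes>\<^bsub>A\<^esub> x"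
  by (simp_all add: opp_def)

lemma opp_hopf_simps [simp]: "comult (opp K) = comult K" "counit (opp K) = counit K"
  by (simp_all add: opp_def)

lemma linear_form_opp [simp]: "linear_form (opp A) = linear_form A"
  by (simp add: linear_form_def fun_eq_iff)

lemma linear_map_opp [simp]: "linear_map (opp A) V = linear_map A V" "linear_map W (opp A) = linear_map W A"
  by (simp_all add: linear_map_def fun_eq_iff)

lemma multilinear_opp [simp]:
  "bilinear_form (opp A) B = bilinear_form A B" "bilinear_form A' (opp B') = bilinear_form A' B'"
  by (simp_all add: bilinear_form_def fun_eq_iff)

lemma bilinear_map_opp [simp]:
  "bilinear_map (opp A) B C = bilinear_map A B C"
  by (simp add: bilinear_map_def fun_eq_iff)

lemma trilinear_opp1 [simp]: "trilinear_form (opp A) B C = trilinear_form A B C"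
  and trilinear_opp2 [simp]: "trilinear_form A (opp B) C = trilinear_form A B C"
  and trilinear_opp3 [simp]: "trilinear_form A B (opp C) = trilinear_form A B C"
  by (simp_all add: trilinear_form_def fun_eq_iff)

lemma T2_opp [simp]: "T2 (opp A) B = T2 A B" "T2 A' (opp B') = T2 A' B'"
  by (simp_all add: T2_def fun_eq_iff)

lemma T3_opp1 [simp]: "T3 (opp A) B C = T3 A B C"
  and T3_opp2 [simp]: "T3 A (opp B) C = T3 A B C"
  and T3_opp3 [simp]: "T3 A B (opp C) = T3 A B C"
  by (simp_all add: T3_def fun_eq_iff)

lemma tens_opp [simp]: "tens (opp A) B = tens A B" "tens A' (opp B') = tens A' B'"
  by (simp_all add: tensor_alg_def)

lemma k_algebra_opp:
  assumes A: "k_algebra A" shows "k_algebra (opp A)"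
proof -
  interpret A: ring A using A by (rule k_algebra_ring)
  interpret M: module scalars A using k_algebra_vspace[OF A] .
  have neg: "\<exists>y\<in>carrier A. y \<oplus>\<^bsub>A\<^esub> x = \<zero>\<^bsub>A\<^esub>" if "x \<in> carrier A" for x
    using that by (intro bexI[of _ "\<ominus>\<^bsub>A\<^esub> x"]) (simp_all add: A.l_neg)
  have ag: "abelian_group (opp A)"
    by (rule abelian_groupI) (simp_all add: neg A.a_ac)
  moreover have "monoid (opp A)"
    by (rule monoidI) (simp_all add: A.m_assoc)
  ultimately have "ring (opp A)"
    by (intro ringI) (simp_all add: A.l_distr A.r_distr)
  moreover have "vspace (opp A)"
    by (rule moduleI[OF cring_scalars ag]) (simp_all add: vspace_smult[OF k_algebra_vspace[OF A]])
  ultimately show ?thesis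
    unfolding k_algebra_def k_algebra_axioms_def
    using k_algebra.smult_mult_left[OF A] k_algebra.smult_mult_right[OF A] by simp
qed

lemma alg_hom_iff:
  "f \<in> alg_hom A B \<longleftrightarrow> linear_map A B f &
    (\<forall>x\<in>carrier A. \<forall>y\<in>carrier A. f (x \<otimes>\<^bsub>A\<^esub> y) = f x \<otimes>\<^bsub>B\<^esub> f y) & f \<one>\<^bsub>A\<^esub> = \<one>\<^bsub>B\<^esub>"
  by (auto simp: alg_hom_def ring_hom_def linear_map_def)

lemma alg_hom_tens_iff:
  assumes X: "k_algebra X" and A: "k_algebra A" and B: "k_algebra B"
  shows "\<alpha> \<in> alg_hom X (tensor_alg A B) \<longleftrightarrow> linear_map X (tensor_alg A B) \<alpha> &
    (\<forall>x\<in>carrier X. \<forall>y\<in>carrier X. \<forall>F. bilinear_form A B F -->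
      \<alpha> (x \<otimes>\<^bsub>X\<^esub> y) F = \<alpha> x (%a b. \<alpha> y (%a' b'. F (a \<otimes>\<^bsub>A\<^esub> a') (b \<otimes>\<^bsub>B\<^esub> b')))) &
    (\<forall>F. bilinear_form A B F --> \<alpha> \<one>\<^bsub>X\<^esub> F = F \<one>\<^bsub>A\<^esub> \<one>\<^bsub>B\<^esub>)"
proof -
  interpret X: ring X using X by (rule k_algebra_ring)
  have eq: "s = t \<longleftrightarrow> (\<forall>F. bilinear_form A B F --> s F = t F)" if "s \<in> tens A B" "t \<in> tens A B" for s t
    using tens_eqI[OF that] by auto
  have one: "\<one>\<^bsub>tensor_alg A B\<^esub> \<in> tens A B" using monoid_tensor_alg[OF A B] by (rule monoid.one_closed)
  show ?thesis
    unfolding alg_hom_iff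
    using linear_map_tensD(1)[of X A B \<alpha>] tensor_alg_mult_closed[OF A B] one
    by (auto simp: eq tensor_alg_mult tensor_alg_one)
qed

section \<open>Hopf algebras in terms of functionals\<close>

lemma fd_hopf_algebra_iff:
  fixes K :: "('k::field, 'h) hopf"
  shows "fd_hopf_algebra K \<longleftrightarrow> k_algebra K & finite_dim K &
    linear_map K (tensor_alg K K) (comult K) & linear_form K (counit K) & linear_map K K (antipode K) &
    bij_betw (antipode K) (carrier K) (carrier K) &
    (\<forall>h\<in>carrier K. \<forall>k\<in>carrier K. \<forall>F. bilinear_form K K F --> comult K (h \<otimes>\<^bsub>K\<^esub> k) F =
     comult K h (%a b. comult K k (%a' b'. F (a \<otimes>\<^bsub>K\<^esub> a') (b \<otimes>\<^bsub>K\<^esub> b')))) &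
    (\<forall>F. bilinear_form K K F --> comult K \<one>\<^bsub>K\<^esub> F = F \<one>\<^bsub>K\<^esub> \<one>\<^bsub>K\<^esub>) &
    (\<forall>h\<in>carrier K. \<forall>k\<in>carrier K. counit K (h \<otimes>\<^bsub>K\<^esub> k) = counit K h * counit K k) &
    counit K \<one>\<^bsub>K\<^esub> = 1 &
    (\<forall>h\<in>carrier K. \<forall>T. trilinear_form K K K T -->
     comult K h (%x c. comult K x (%a b. T a b c)) = comult K h (%a x. comult K x (%b c. T a b c))) &
    (\<forall>h\<in>carrier K. \<forall>g. linear_form K g --> comult K h (%a b. counit K a * g b) = g h) &
    (\<forall>h\<in>carrier K. \<forall>g. linear_form K g --> comult K h (%a b. counit K b * g a) = g h) &
    (\<forall>h\<in>carrier K. \<forall>g. linear_form K g -->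
     comult K h (%a b. g (antipode K a \<otimes>\<^bsub>K\<^esub> b)) = counit K h * g \<one>\<^bsub>K\<^esub>) &
    (\<forall>h\<in>carrier K. \<forall>g. linear_form K g -->
     comult K h (%a b. g (a \<otimes>\<^bsub>K\<^esub> antipode K b)) = counit K h * g \<one>\<^bsub>K\<^esub>)"
    (is "_ \<longleftrightarrow> _ & ?R")
proof (cases "k_algebra K & linear_map K (tensor_alg K K) (comult K) & linear_form K (counit K) & linear_map K K (antipode K)")
  case False
  then show ?thesis
    unfolding fd_hopf_algebra_def fd_hopf_algebra_axioms_def alg_hom_iff by blast
next
  case True
  then have K: "k_algebra K" and c: "linear_map K (tensor_alg K K) (comult K)"
    and eps: "linear_form K (counit K)" and S: "linear_map K K (antipode K)" by auto
  interpret ring K using K by (rule k_algebra_ring)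
  note vK [simp] = k_algebra_vspace[OF K]
  note ct = linear_map_tensD(1)[OF c]
  have lift: "tensor_lift K K K b (comult K h) = z \<longleftrightarrow> (\<forall>g. linear_form K g --> comult K h (%a b'. g (b a b')) = g z)"
    if h: "h \<in> carrier K" and b: "bilinear_map K K K b" and z: "z \<in> carrier K" for b h z
    using tensor_lift_form[OF vK ct[OF h] b] tensor_lift_eqI[OF vK ct[OF h] b z] by auto
  have b: "bilinear_map K K K (%h1 h2. counit K h1 \<odot>\<^bsub>K\<^esub> h2)" "bilinear_map K K K (%h1 h2. counit K h2 \<odot>\<^bsub>K\<^esub> h1)"
    "bilinear_map K K K (%h1 h2. antipode K h1 \<otimes>\<^bsub>K\<^esub> h2)" "bilinear_map K K K (%h1 h2. h1 \<otimes>\<^bsub>K\<^esub> antipode K h2)"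
    by (intro lin K vK eps S; simp add: linear_map_closed[OF S])+
  have g: "comult K h (%a b. g (counit K a \<odot>\<^bsub>K\<^esub> b)) = comult K h (%a b. counit K a * g b)"
    "comult K h (%a b. g (counit K b \<odot>\<^bsub>K\<^esub> a)) = comult K h (%a b. counit K b * g a)"
    if "linear_form K g" "h \<in> carrier K" for g h
    using that by (auto intro!: tens_cong[OF ct] simp: linear_form_smult)
  have z: "c \<odot>\<^bsub>K\<^esub> \<one>\<^bsub>K\<^esub> \<in> carrier K" for c using vspace_smult(1)[OF vK] by simp
  have g1: "g (c \<odot>\<^bsub>K\<^esub> \<one>\<^bsub>K\<^esub>) = c * g \<one>\<^bsub>K\<^esub>" if "linear_form K g" for g c
    using linear_form_smult[OF that] by simp
  have lifts:
    "(\<forall>h. h \<in> carrier K --> tensor_lift K K K (%h1 h2. counit K h1 \<odot>\<^bsub>K\<^esub> h2) (comult K h) = h) \<longleftrightarrow>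
     (\<forall>h\<in>carrier K. \<forall>g. linear_form K g --> comult K h (%a b. counit K a * g b) = g h)"
    "(\<forall>h. h \<in> carrier K --> tensor_lift K K K (%h1 h2. counit K h2 \<odot>\<^bsub>K\<^esub> h1) (comult K h) = h) \<longleftrightarrow>
     (\<forall>h\<in>carrier K. \<forall>g. linear_form K g --> comult K h (%a b. counit K b * g a) = g h)"
    "(\<forall>h. h \<in> carrier K --> tensor_lift K K K (%h1 h2. antipode K h1 \<otimes>\<^bsub>K\<^esub> h2) (comult K h) = counit K h \<odot>\<^bsub>K\<^esub> \<one>\<^bsub>K\<^esub>) \<longleftrightarrow>
     (\<forall>h\<in>carrier K. \<forall>g. linear_form K g --> comult K h (%a b. g (antipode K a \<otimes>\<^bsub>K\<^esub> b)) = counit K h * g \<one>\<^bsub>K\<^esub>)"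
    "(\<forall>h. h \<in> carrier K --> tensor_lift K K K (%h1 h2. h1 \<otimes>\<^bsub>K\<^esub> antipode K h2) (comult K h) = counit K h \<odot>\<^bsub>K\<^esub> \<one>\<^bsub>K\<^esub>) \<longleftrightarrow>
     (\<forall>h\<in>carrier K. \<forall>g. linear_form K g --> comult K h (%a b. g (a \<otimes>\<^bsub>K\<^esub> antipode K b)) = counit K h * g \<one>\<^bsub>K\<^esub>)"
    by (auto simp: lift[OF _ b(1)] lift[OF _ b(2)] lift[OF _ b(3) z] lift[OF _ b(4) z] g g1)
  show ?thesis
    unfolding fd_hopf_algebra_def fd_hopf_algebra_axioms_def alg_hom_tens_iff[OF K K K]
     map_left_def map_right_def T3_eq_iff lifts
    by (rule iffI; elim conjE; intro conjI; (assumption | simp))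
qed

context fd_hopf_algebra
begin

lemma alg: "k_algebra K" by (rule k_algebra_axioms)

lemma vK [simp]: "vspace K" using alg by (rule k_algebra_vspace)

lemma mult_assoc:
  "x \<in> carrier K ==> y \<in> carrier K ==> z \<in> carrier K ==> x \<otimes> y \<otimes> z = x \<otimes> (y \<otimes> z)"
  by (rule monoid.m_assoc[OF ring.is_monoid[OF k_algebra_ring[OF alg]]])

lemmas functional = fd_hopf_algebra_iff[of K, THEN iffD1, OF fd_hopf_algebra_axioms]

lemma comult_linear: "linear_map K (tensor_alg K K) (comult K)"
  using functional by (elim conjE)

lemmas comult_closed [simp] = linear_map_tensD(1)[OF comult_linear]

lemma counit_form: "linear_form K (counit K)"
  using functional by (elim conjE)

lemma antipode_map: "linear_map K K (antipode K)"
  using functional by (elim conjE)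

lemma antipode_closed [simp]: "h \<in> carrier K ==> antipode K h \<in> carrier K"
  by (rule linear_map_closed[OF antipode_map])

lemmas hopf_lin = lin alg linear_map_tensD(2,3)[OF comult_linear] linear_form_compose[OF counit_form]
  linear_map_compose[OF antipode_map]

lemma comult_mult:
  "h \<in> carrier K ==> k \<in> carrier K ==> bilinear_form K K F ==> comult K (h \<otimes> k) F =
     comult K h (%a b. comult K k (%a' b'. F (a \<otimes> a') (b \<otimes> b')))"
  and comult_one: "bilinear_form K K F ==> comult K \<one> F = F \<one> \<one>"
  and coassoc_form: "h \<in> carrier K ==> trilinear_form K K K T ==>
     comult K h (%x c. comult K x (%a b. T a b c)) = comult K h (%a x. comult K x (%b c. T a b c))"
  and counit_left_form: "h \<in> carrier K ==> linear_form K g ==> comult K h (%a b. counit K a * g b) = g h"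
  and counit_right_form: "h \<in> carrier K ==> linear_form K g ==> comult K h (%a b. counit K b * g a) = g h"
  and antipode_left_form: "h \<in> carrier K ==> linear_form K g ==>
     comult K h (%a b. g (antipode K a \<otimes> b)) = counit K h * g \<one>"
  and antipode_right_form: "h \<in> carrier K ==> linear_form K g ==>
     comult K h (%a b. g (a \<otimes> antipode K b)) = counit K h * g \<one>"
  using functional by blast+

lemmas comult_cong = tens_cong[OF comult_closed vK vK]

lemma counit_antipode: "h \<in> carrier K ==> counit K (antipode K h) = counit K h"
proof -
  assume h: "h \<in> carrier K"
  have g: "linear_form K (%a. counit K (antipode K a))" by (intro hopf_lin)
  have "counit K (antipode K h) = comult K h (%a b. counit K b * counit K (antipode K a))"
    by (rule counit_right_form[OF h g, symmetric])
  also have "... = comult K h (%a b. counit K (antipode K a \<otimes> b))"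
    by (rule comult_cong[OF h]) (simp add: counit_mult)
  also have "... = counit K h" by (simp add: antipode_left_form[OF h counit_form] counit_one)
  finally show ?thesis .
qed

lemma antipode_one: "antipode K \<one> = \<one>"
proof (rule forms_separate[OF vK])
  fix g assume g: "linear_form K g"
  have F: "bilinear_form K K (%a b. g (antipode K a \<otimes> b))"
    by (intro hopf_lin linear_form_compose[OF g]; simp)
  show "g (antipode K \<one>) = g \<one>"
    using antipode_left_form[OF _ g, of "\<one>"] comult_one[OF F] by (simp add: counit_one)
qed simp_all

text \<open>The maps that send h and k to the antipode of their product and to the product of their
  antipodes in reverse order are a left and a right convolution inverse of multiplication;
  hence they agree.\<close>

lemma antipode_mult:
  assumes hk: "h \<in> carrier K" "k \<in> carrier K"
  shows "antipode K (h \<otimes> k) = antipode K k \<otimes> antipode K h"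
proof (rule forms_separate[OF vK])
  let ?S = "antipode K" and ?e = "counit K" and ?D = "comult K"
  have left: "?D x (%a b. ?D x' (%a' b'. g (?S (a \<otimes> a') \<otimes> (b \<otimes> b')))) = ?e x * ?e x' * g \<one>"
    if g: "linear_form K g" and x: "x \<in> carrier K" "x' \<in> carrier K" for g x x'
  proof -
    have "bilinear_form K K (%a b. g (?S a \<otimes> b))" by (intro hopf_lin linear_form_compose[OF g]; simp)
    from comult_mult[OF x this] show ?thesis using x by (simp add: antipode_left_form[OF _ g] counit_mult)
  qed
  have right: "?D x (%b c. ?D x' (%b' c'. g ((b \<otimes> b') \<otimes> (?S c' \<otimes> ?S c)))) = ?e x * ?e x' * g \<one>"
    if g: "linear_form K g" and x: "x \<in> carrier K" "x' \<in> carrier K" for g x x'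
  proof -
    have "?D x (%b c. ?D x' (%b' c'. g ((b \<otimes> b') \<otimes> (?S c' \<otimes> ?S c)))) =
     ?D x (%b c. ?D x' (%b' c'. g (b \<otimes> (b' \<otimes> ?S c') \<otimes> ?S c)))"
     by (rule comult_cong[OF x(1)], rule comult_cong[OF x(2)]) (simp add: mult_assoc)
    also have "... = ?D x (%b c. ?e x' * g (b \<otimes> ?S c))"
    proof (rule comult_cong[OF x(1)])
     fix b c assume bc: "b \<in> carrier K" "c \<in> carrier K"
     have "linear_form K (%y. g (b \<otimes> y \<otimes> ?S c))"
      by (intro hopf_lin linear_form_compose[OF g]; simp add: bc)
     from antipode_right_form[OF x(2) this]
     show "?D x' (%b' c'. g (b \<otimes> (b' \<otimes> ?S c') \<otimes> ?S c)) = ?e x' * g (b \<otimes> ?S c)" using bc by simp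
    qed
    also have "... = ?e x * ?e x' * g \<one>"
     by (simp add: tens_scale[OF comult_closed[OF x(1)]] antipode_right_form[OF x(1) g])
    finally show ?thesis .
  qed
  fix g assume g: "linear_form K g"
  note gl = linear_form_compose[OF g]
  have "g (?S (h \<otimes> k)) = ?D h (%a x. ?e x * g (?S (a \<otimes> k)))"
    by (rule counit_right_form[OF hk(1), symmetric]) (intro hopf_lin gl; simp add: hk)
  also have "... = ?D h (%a x. ?e x * ?D k (%a' x'. ?e x' * g (?S (a \<otimes> a'))))"
  proof (rule comult_cong[OF hk(1)], rule arg_cong[where f = "%y. _ * y"])
    fix a x assume "a \<in> carrier K" "x \<in> carrier K"
    then show "g (?S (a \<otimes> k)) = ?D k (%a' x'. ?e x' * g (?S (a \<otimes> a')))"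
     by (intro counit_right_form[OF hk(2), symmetric] hopf_lin gl; simp)
  qed
  also have "... = ?D h (%a x. ?D k (%a' x'. ?D x (%b c. ?D x' (%b' c'.
     g (?S (a \<otimes> a') \<otimes> ((b \<otimes> b') \<otimes> (?S c' \<otimes> ?S c)))))))"
  proof (rule comult_cong[OF hk(1)], unfold tens_scale(1)[OF comult_closed[OF hk(2)], symmetric], rule comult_cong[OF hk(2)])
    fix a x a' x' assume c: "a \<in> carrier K" "x \<in> carrier K" "a' \<in> carrier K" "x' \<in> carrier K"
    have "linear_form K (%y. g (?S (a \<otimes> a') \<otimes> y))" by (intro hopf_lin gl; simp add: c)
    from right[OF this c(2,4)] c show "?e x * (?e x' * g (?S (a \<otimes> a'))) = ?D x (%b c. ?D x' (%b' c'.
     g (?S (a \<otimes> a') \<otimes> ((b \<otimes> b') \<otimes> (?S c' \<otimes> ?S c)))))" by simp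
  qed
  also have "... = ?D h (%a x. ?D x (%b c. ?D k (%a' x'. ?D x' (%b' c'.
     g (?S (a \<otimes> a') \<otimes> ((b \<otimes> b') \<otimes> (?S c' \<otimes> ?S c)))))))"
    by (intro comult_cong[OF hk(1)] tens_fubini[OF comult_closed comult_closed] hopf_lin gl; simp add: hk)
  also have "... = ?D h (%x c. ?D x (%a b. ?D k (%a' x'. ?D x' (%b' c'.
     g (?S (a \<otimes> a') \<otimes> ((b \<otimes> b') \<otimes> (?S c' \<otimes> ?S c)))))))"
    by (intro coassoc_form[OF hk(1), symmetric] hopf_lin gl; simp add: hk)
  also have "... = ?D h (%x c. ?D x (%a b. ?D k (%x' c'. ?D x' (%a' b'.
     g (?S (a \<otimes> a') \<otimes> ((b \<otimes> b') \<otimes> (?S c' \<otimes> ?S c)))))))"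
    by (rule comult_cong[OF hk(1)], rule comult_cong, assumption)
     (intro coassoc_form[OF hk(2), symmetric] hopf_lin gl; simp add: hk)
  also have "... = ?D h (%x c. ?D k (%x' c'. ?D x (%a b. ?D x' (%a' b'.
     g (?S (a \<otimes> a') \<otimes> ((b \<otimes> b') \<otimes> (?S c' \<otimes> ?S c)))))))"
    by (intro comult_cong[OF hk(1)] tens_fubini[OF comult_closed comult_closed] hopf_lin gl; simp add: hk)
  also have "... = ?D h (%x c. ?D k (%x' c'. ?D x (%a b. ?D x' (%a' b'.
     g (?S (a \<otimes> a') \<otimes> (b \<otimes> b') \<otimes> (?S c' \<otimes> ?S c))))))"
    by (rule comult_cong[OF hk(1)], rule comult_cong[OF hk(2)], rule comult_cong, assumption, rule comult_cong, assumption)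
     (simp add: mult_assoc)
  also have "... = ?D h (%x c. ?D k (%x' c'. ?e x * (?e x' * g (?S c' \<otimes> ?S c))))"
  proof (rule comult_cong[OF hk(1)], rule comult_cong[OF hk(2)])
    fix c x c' x' assume c: "c \<in> carrier K" "x \<in> carrier K" "c' \<in> carrier K" "x' \<in> carrier K"
    have "linear_form K (%y. g (y \<otimes> (?S c' \<otimes> ?S c)))" by (intro hopf_lin gl; simp add: c)
    from left[OF this c(2,4)] c show "?D x (%a b. ?D x' (%a' b'.
     g (?S (a \<otimes> a') \<otimes> (b \<otimes> b') \<otimes> (?S c' \<otimes> ?S c)))) = ?e x * (?e x' * g (?S c' \<otimes> ?S c))"
     by simp
  qed
  also have "... = ?D h (%x c. ?e x * g (?S k \<otimes> ?S c))"
  proof (rule comult_cong[OF hk(1)], unfold tens_scale(1)[OF comult_closed[OF hk(2)]], rule arg_cong[where f = "%y. _ * y"])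
    fix c assume c: "c \<in> carrier K"
    show "?D k (%x' c'. ?e x' * g (?S c' \<otimes> ?S c)) = g (?S k \<otimes> ?S c)"
     by (intro counit_left_form[OF hk(2)] hopf_lin gl; simp add: c)
  qed
  also have "... = g (?S k \<otimes> ?S h)"
    by (intro counit_left_form[OF hk(1)] hopf_lin gl; simp add: hk)
  finally show "g (?S (h \<otimes> k)) = g (?S k \<otimes> ?S h)" .
qed (use hk in simp_all)

lemma antipode_inv_closed [simp]: "h \<in> carrier K ==> antipode_inv K h \<in> carrier K"
  unfolding antipode_inv_def using antipode_bij by (metis bij_betw_def inv_into_into)

lemma antipode_antipode_inv [simp]: "h \<in> carrier K ==> antipode K (antipode_inv K h) = h"
  unfolding antipode_inv_def using antipode_bij by (metis bij_betw_def f_inv_into_f)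

lemma antipode_inv_antipode [simp]: "h \<in> carrier K ==> antipode_inv K (antipode K h) = h"
  unfolding antipode_inv_def using antipode_bij by (metis bij_betw_def inv_into_f_f)

lemma antipode_inj:
  "antipode K h = antipode K k ==> h \<in> carrier K ==> k \<in> carrier K ==> h = k"
  by (metis antipode_inv_antipode)

lemma antipode_inv_map: "linear_map K K (antipode_inv K)"
proof (rule linear_mapI)
  fix v w assume vw: "v \<in> carrier K" "w \<in> carrier K"
  show "antipode_inv K (v \<oplus> w) = antipode_inv K v \<oplus> antipode_inv K w"
    by (rule antipode_inj) (simp_all add: vw linear_map_add[OF antipode_map])
next
  fix c v assume v: "v \<in> carrier K"
  show "antipode_inv K (c \<odot> v) = c \<odot> antipode_inv K v"
    by (rule antipode_inj) (simp_all add: v linear_map_smult[OF antipode_map] vspace_smult(1)[OF vK])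
qed simp

lemma antipode_inv_mult:
  "h \<in> carrier K ==> k \<in> carrier K ==>
    antipode_inv K (h \<otimes> k) = antipode_inv K k \<otimes> antipode_inv K h"
  by (rule antipode_inj) (simp_all add: antipode_mult)

lemma antipode_inv_one: "antipode_inv K \<one> = \<one>"
  by (rule antipode_inj) (simp_all add: antipode_one)

lemma counit_antipode_inv: "h \<in> carrier K ==> counit K (antipode_inv K h) = counit K h"
  using counit_antipode[of "antipode_inv K h"] by simp

text \<open>The inverse of the antipode is an antipode for the opposite product.\<close>

lemma antipode_inv_left_form:
  assumes h: "h \<in> carrier K" and g: "linear_form K g"
  shows "comult K h (%a b. g (antipode_inv K b \<otimes> a)) = counit K h * g \<one>"
    and "comult K h (%a b. g (b \<otimes> antipode_inv K a)) = counit K h * g \<one>"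
proof -
  have g': "linear_form K (%a. g (antipode_inv K a))"
    by (intro linear_form_compose[OF g] linear_map_compose[OF antipode_inv_map] lin)
  have "comult K h (%a b. g (antipode_inv K b \<otimes> a)) =
    comult K h (%a b. g (antipode_inv K (antipode K a \<otimes> b)))"
    by (rule comult_cong[OF h]) (simp add: antipode_inv_mult)
  then show "comult K h (%a b. g (antipode_inv K b \<otimes> a)) = counit K h * g \<one>"
    using antipode_left_form[OF h g'] by (simp add: antipode_inv_one)
  have "comult K h (%a b. g (b \<otimes> antipode_inv K a)) =
    comult K h (%a b. g (antipode_inv K (a \<otimes> antipode K b)))"
    by (rule comult_cong[OF h]) (simp add: antipode_inv_mult)
  then show "comult K h (%a b. g (b \<otimes> antipode_inv K a)) = counit K h * g \<one>"
    using antipode_right_form[OF h g'] by (simp add: antipode_inv_one)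
qed

end

section \<open>Dual pairs of Hopf algebras\<close>

lemma vspace_finsum_closed:
  assumes "vspace V" "!!i. i \<in> I ==> v i \<in> carrier V"
  shows "finsum V v I \<in> carrier V"
proof -
  interpret module scalars V by fact
  show ?thesis using assms(2) by (intro finsum_closed) auto
qed

lemma vspace_add_closed: "vspace V ==> v \<in> carrier V ==> w \<in> carrier V ==> v \<oplus>\<^bsub>V\<^esub> w \<in> carrier V"
  by (simp add: abelian_groupE(1) module_def)

locale dual_pair = fd_hopf_algebra K for K :: "('k::field, 'a) hopf" (structure) +
  fixes L :: "('k, 'b) hopf" and p :: "'a => 'b => 'k" and n :: nat and e :: "nat => 'a" and f :: "nat => 'b"
  assumes vspace_L [simp]: "vspace L"
    and pairing: "bilinear_form K L p"
    and e_closed [simp]: "!!i. i < n ==> e i \<in> carrier K"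
    and f_closed [simp]: "!!i. i < n ==> f i \<in> carrier L"
    and dual_basis: "!!i j. i < n ==> j < n ==> p (e i) (f j) = (if i = j then 1 else 0)"
    and expand_K: "!!k g. k \<in> carrier K ==> linear_form K g ==> g k = (\<Sum>i<n. p k (f i) * g (e i))"
    and expand_L: "!!l g. l \<in> carrier L ==> linear_form L g ==> g l = (\<Sum>i<n. p (e i) l * g (f i))"
    and mult_L_closed [simp]: "!!l l'. l \<in> carrier L ==> l' \<in> carrier L ==> l \<otimes>\<^bsub>L\<^esub> l' \<in> carrier L"
    and one_L_closed [simp]: "\<one>\<^bsub>L\<^esub> \<in> carrier L"
    and p_mult_L: "!!k l l'. k \<in> carrier K ==> l \<in> carrier L ==> l' \<in> carrier L ==>
      p k (l \<otimes>\<^bsub>L\<^esub> l') = comult K k (%a b. p a l * p b l')"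
    and p_one_L: "!!k. k \<in> carrier K ==> p k \<one>\<^bsub>L\<^esub> = counit K k"
    and comult_L_closed [simp]: "!!l. l \<in> carrier L ==> comult L l \<in> tens L L"
    and p_mult_K: "!!k k' l. k \<in> carrier K ==> k' \<in> carrier K ==> l \<in> carrier L ==>
      p (k \<otimes>\<^bsub>K\<^esub> k') l = comult L l (%a b. p k a * p k' b)"
    and p_one_K: "!!l. l \<in> carrier L ==> p \<one>\<^bsub>K\<^esub> l = counit L l"
    and antipode_L_closed [simp]: "!!l. l \<in> carrier L ==> antipode L l \<in> carrier L"
    and p_antipode: "!!k l. k \<in> carrier K ==> l \<in> carrier L ==> p (antipode K k) l = p k (antipode L l)"
begin

lemmas p_slot = bilinear_form_slot[OF pairing]

lemma separate_L:
  assumes "l \<in> carrier L" "l' \<in> carrier L" "!!k. k \<in> carrier K ==> p k l = p k l'"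
  shows "l = l'"
  by (rule forms_separate[OF vspace_L])
    (simp_all add: assms expand_L[OF assms(1)] expand_L[OF assms(2)])

lemma p_add: "l \<in> carrier L ==> l' \<in> carrier L ==> k \<in> carrier K ==> p k (l \<oplus>\<^bsub>L\<^esub> l') = p k l + p k l'"
  and p_smult: "l \<in> carrier L ==> k \<in> carrier K ==> p k (c \<odot>\<^bsub>L\<^esub> l) = c * p k l"
  and p_add_K: "l \<in> carrier L ==> k \<in> carrier K ==> k' \<in> carrier K ==> p (k \<oplus>\<^bsub>K\<^esub> k') l = p k l + p k' l"
  and p_smult_K: "l \<in> carrier L ==> k \<in> carrier K ==> p (c \<odot>\<^bsub>K\<^esub> k) l = c * p k l"
  using pairing by (auto simp: bilinear_form_def linear_form_def)

lemma alg_L: "k_algebra L"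
proof -
  note [simp] = vspace_add_closed[OF vspace_L]
  have smc [simp]: "c \<odot>\<^bsub>L\<^esub> l \<in> carrier L" if "l \<in> carrier L" for c l using that vspace_smult(1)[OF vspace_L] by simp
  have assoc: "x \<otimes>\<^bsub>L\<^esub> y \<otimes>\<^bsub>L\<^esub> z = x \<otimes>\<^bsub>L\<^esub> (y \<otimes>\<^bsub>L\<^esub> z)"
    if xyz: "x \<in> carrier L" "y \<in> carrier L" "z \<in> carrier L" for x y z
  proof (rule separate_L)
    fix k assume k: "k \<in> carrier K"
    have "p k (x \<otimes>\<^bsub>L\<^esub> y \<otimes>\<^bsub>L\<^esub> z) = comult K k (%a c. comult K a (%a b. p a x * p b y * p c z))"
     unfolding p_mult_L[OF k mult_L_closed[OF xyz(1,2)] xyz(3)]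
     by (rule comult_cong[OF k]) (simp add: p_mult_L xyz tens_scale[OF comult_closed])
    also have "... = comult K k (%a c. comult K c (%b c. p a x * p b y * p c z))"
     by (rule coassoc_form[OF k]) (intro hopf_lin p_slot; simp add: xyz)
    also have "... = p k (x \<otimes>\<^bsub>L\<^esub> (y \<otimes>\<^bsub>L\<^esub> z))"
     unfolding p_mult_L[OF k xyz(1) mult_L_closed[OF xyz(2,3)]]
     by (rule comult_cong[OF k]) (simp add: p_mult_L xyz mult.assoc tens_scale[OF comult_closed])
    finally show "p k (x \<otimes>\<^bsub>L\<^esub> y \<otimes>\<^bsub>L\<^esub> z) = p k (x \<otimes>\<^bsub>L\<^esub> (y \<otimes>\<^bsub>L\<^esub> z))" .
  qed (use xyz in simp_all)
  have units: "\<one>\<^bsub>L\<^esub> \<otimes>\<^bsub>L\<^esub> x = x" "x \<otimes>\<^bsub>L\<^esub> \<one>\<^bsub>L\<^esub> = x" if x: "x \<in> carrier L" for x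
  proof -
    have lin: "linear_form K (%k. p k x)" by (intro hopf_lin p_slot; simp add: x)
    have "p k (\<one>\<^bsub>L\<^esub> \<otimes>\<^bsub>L\<^esub> x) = p k x" "p k (x \<otimes>\<^bsub>L\<^esub> \<one>\<^bsub>L\<^esub>) = p k x" if k: "k \<in> carrier K" for k
    proof -
     have "comult K k (%a b. p a \<one>\<^bsub>L\<^esub> * p b x) = comult K k (%a b. counit K a * p b x)"
      "comult K k (%a b. p a x * p b \<one>\<^bsub>L\<^esub>) = comult K k (%a b. counit K b * p a x)"
      by (rule comult_cong[OF k]; simp add: p_one_L)+
     then show "p k (\<one>\<^bsub>L\<^esub> \<otimes>\<^bsub>L\<^esub> x) = p k x" "p k (x \<otimes>\<^bsub>L\<^esub> \<one>\<^bsub>L\<^esub>) = p k x"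
      using counit_left_form[OF k lin] counit_right_form[OF k lin] by (simp_all add: p_mult_L k x)
    qed
    then show "\<one>\<^bsub>L\<^esub> \<otimes>\<^bsub>L\<^esub> x = x" "x \<otimes>\<^bsub>L\<^esub> \<one>\<^bsub>L\<^esub> = x" by (auto intro!: separate_L simp: x)
  qed
  have slot: "bilinear_form K K (%a b. p a x * p b y)" if "x \<in> carrier L" "y \<in> carrier L" for x y
    by (intro hopf_lin p_slot; simp add: that)
  have distrib: "(x \<oplus>\<^bsub>L\<^esub> y) \<otimes>\<^bsub>L\<^esub> z = x \<otimes>\<^bsub>L\<^esub> z \<oplus>\<^bsub>L\<^esub> y \<otimes>\<^bsub>L\<^esub> z" "z \<otimes>\<^bsub>L\<^esub> (x \<oplus>\<^bsub>L\<^esub> y) = z \<otimes>\<^bsub>L\<^esub> x \<oplus>\<^bsub>L\<^esub> z \<otimes>\<^bsub>L\<^esub> y"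
    if xyz: "x \<in> carrier L" "y \<in> carrier L" "z \<in> carrier L" for x y z
  proof -
    have "comult K k (%a b. p a (x \<oplus>\<^bsub>L\<^esub> y) * p b z) = comult K k (%a b. p a x * p b z + p a y * p b z)"
     "comult K k (%a b. p a z * p b (x \<oplus>\<^bsub>L\<^esub> y)) = comult K k (%a b. p a z * p b x + p a z * p b y)" if k: "k \<in> carrier K" for k
     by (rule comult_cong[OF k]; simp add: p_add xyz algebra_simps)+
    then show "(x \<oplus>\<^bsub>L\<^esub> y) \<otimes>\<^bsub>L\<^esub> z = x \<otimes>\<^bsub>L\<^esub> z \<oplus>\<^bsub>L\<^esub> y \<otimes>\<^bsub>L\<^esub> z" "z \<otimes>\<^bsub>L\<^esub> (x \<oplus>\<^bsub>L\<^esub> y) = z \<otimes>\<^bsub>L\<^esub> x \<oplus>\<^bsub>L\<^esub> z \<otimes>\<^bsub>L\<^esub> y"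
     using xyz by (auto intro!: separate_L simp: p_add p_mult_L tens_add[OF comult_closed] slot)
  qed
  have sm: "(c \<odot>\<^bsub>L\<^esub> x) \<otimes>\<^bsub>L\<^esub> y = c \<odot>\<^bsub>L\<^esub> (x \<otimes>\<^bsub>L\<^esub> y)" "x \<otimes>\<^bsub>L\<^esub> (c \<odot>\<^bsub>L\<^esub> y) = c \<odot>\<^bsub>L\<^esub> (x \<otimes>\<^bsub>L\<^esub> y)"
    if xy: "x \<in> carrier L" "y \<in> carrier L" for x y c
  proof -
    have "comult K k (%a b. p a (c \<odot>\<^bsub>L\<^esub> x) * p b y) = comult K k (%a b. c * (p a x * p b y))"
     "comult K k (%a b. p a x * p b (c \<odot>\<^bsub>L\<^esub> y)) = comult K k (%a b. c * (p a x * p b y))" if k: "k \<in> carrier K" for k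
     by (rule comult_cong[OF k]; simp add: p_smult xy)+
    then show "(c \<odot>\<^bsub>L\<^esub> x) \<otimes>\<^bsub>L\<^esub> y = c \<odot>\<^bsub>L\<^esub> (x \<otimes>\<^bsub>L\<^esub> y)" "x \<otimes>\<^bsub>L\<^esub> (c \<odot>\<^bsub>L\<^esub> y) = c \<odot>\<^bsub>L\<^esub> (x \<otimes>\<^bsub>L\<^esub> y)"
     using xy by (auto intro!: separate_L simp: p_smult p_mult_L tens_scale[OF comult_closed])
  qed
  have "abelian_group L" using vspace_L by (rule module.axioms)
  then have "ring L"
    by (intro ringI monoidI) (simp_all add: assoc units distrib)
  then show ?thesis
    unfolding k_algebra_def k_algebra_axioms_def by (simp add: sm)
qed

lemma bilinear_expand:
  assumes F: "bilinear_form L L F" and l: "a \<in> carrier L" "b \<in> carrier L"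
  shows "F a b = (\<Sum>i<n. \<Sum>j<n. p (e i) a * p (e j) b * F (f i) (f j))"
proof -
  have "F a b = (\<Sum>i<n. p (e i) a * F (f i) b)"
    by (rule expand_L[OF l(1)]) (intro lin bilinear_form_slot[OF F] l)
  also have "... = (\<Sum>i<n. \<Sum>j<n. p (e i) a * p (e j) b * F (f i) (f j))"
  proof (rule sum.cong[OF refl])
    fix i assume "i \<in> {..<n}"
    then have "F (f i) b = (\<Sum>j<n. p (e j) b * F (f i) (f j))"
     by (intro expand_L[OF l(2)] lin bilinear_form_slot[OF F]) simp
    then show "p (e i) a * F (f i) b = (\<Sum>j<n. p (e i) a * p (e j) b * F (f i) (f j))"
     by (simp add: sum_distrib_left mult.assoc)
  qed
  finally show ?thesis .
qed

lemma tens_L_expand: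
  assumes F: "bilinear_form L L F" and t: "t \<in> tens L L"
  shows "t F = (\<Sum>i<n. \<Sum>j<n. t (%a b. p (e i) a * p (e j) b) * F (f i) (f j))"
proof -
  have "t F = t (%a b. \<Sum>i<n. \<Sum>j<n. p (e i) a * p (e j) b * F (f i) (f j))"
    by (rule tens_cong[OF t vspace_L vspace_L]) (rule bilinear_expand[OF F])
  also have "... = (\<Sum>i<n. t (%a b. \<Sum>j<n. p (e i) a * p (e j) b * F (f i) (f j)))"
    by (rule tens_sum[OF t]) (intro lin p_slot; simp)
  also have "... = (\<Sum>i<n. \<Sum>j<n. t (%a b. p (e i) a * p (e j) b * F (f i) (f j)))"
    by (intro sum.cong[OF refl] tens_sum[OF t] lin p_slot; simp)
  finally show ?thesis by (simp add: tens_scale(2)[OF t])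
qed

lemma comult_L_expand:
  "bilinear_form L L F ==> l \<in> carrier L ==>
    comult L l F = (\<Sum>i<n. \<Sum>j<n. p (e i \<otimes>\<^bsub>K\<^esub> e j) l * F (f i) (f j))"
  by (simp add: tens_L_expand p_mult_K)

lemma comult_L_linear: "linear_map L (tensor_alg L L) (comult L)"
proof (subst linear_map_tens'[OF vspace_L], intro conjI ballI allI impI)
  fix F assume F: "bilinear_form L L F"
  have "linear_form L (%l. \<Sum>i<n. \<Sum>j<n. p (e i \<otimes>\<^bsub>K\<^esub> e j) l * F (f i) (f j))"
    by (intro lin p_slot; simp)
  then show "linear_form L (%l. comult L l F)"
    using linear_form_cong[OF vspace_L, of "%l. comult L l F"] comult_L_expand[OF F] by fastforce
qed simp

lemma antipode_L_map: "linear_map L L (antipode L)"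
proof -
  have [simp]: "c \<odot>\<^bsub>L\<^esub> l \<in> carrier L" if "l \<in> carrier L" for c l using that vspace_smult(1)[OF vspace_L] by simp
  note [simp] = vspace_add_closed[OF vspace_L]
  show ?thesis
    by (rule linear_mapI; (rule separate_L)?; simp add: p_add p_smult flip: p_antipode)
qed

lemmas pair_lin = hopf_lin alg_L p_slot linear_map_tensD(2,3)[OF comult_L_linear] linear_map_compose[OF antipode_L_map]

text \<open>The coproduct of L is multiplicative because the product of K and the coproduct of K are
  compatible, a condition that is symmetric under duality.\<close>

lemma comult_L_mult_pairing:
  assumes l: "l \<in> carrier L" "l' \<in> carrier L" and k: "k \<in> carrier K" "k' \<in> carrier K"
  shows "comult L l (%a b. comult L l' (%a' b'. p k (a \<otimes>\<^bsub>L\<^esub> a') * p k' (b \<otimes>\<^bsub>L\<^esub> b'))) =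
    p (k \<otimes>\<^bsub>K\<^esub> k') (l \<otimes>\<^bsub>L\<^esub> l')"
proof -
  note [simp] = k l
  note lcong = tens_cong[OF comult_L_closed vspace_L vspace_L]
  have "comult L l (%a b. comult L l' (%a' b'. p k (a \<otimes>\<^bsub>L\<^esub> a') * p k' (b \<otimes>\<^bsub>L\<^esub> b'))) =
    comult L l (%a b. comult L l' (%a' b'. comult K k (%x y. comult K k' (%x' y'. (p x a * p x' b) * (p y a' * p y' b')))))"
  proof (rule lcong[OF l(1)], rule lcong[OF l(2)])
    fix a b a' b' assume c: "a \<in> carrier L" "b \<in> carrier L" "a' \<in> carrier L" "b' \<in> carrier L"
    show "p k (a \<otimes>\<^bsub>L\<^esub> a') * p k' (b \<otimes>\<^bsub>L\<^esub> b') =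
     comult K k (%x y. comult K k' (%x' y'. (p x a * p x' b) * (p y a' * p y' b')))"
    proof -
     have "p k (a \<otimes>\<^bsub>L\<^esub> a') * p k' (b \<otimes>\<^bsub>L\<^esub> b') =
      comult K k (%x y. (p x a * p y a') * comult K k' (%x' y'. p x' b * p y' b'))"
      unfolding p_mult_L[OF k(1) c(1,3)] p_mult_L[OF k(2) c(2,4)] tens_scale(2)[OF comult_closed[OF k(1)]] ..
     also have "... = comult K k (%x y. comult K k' (%x' y'. (p x a * p x' b) * (p y a' * p y' b')))"
      unfolding tens_scale(1)[OF comult_closed[OF k(2)], symmetric] by (simp only: mult_ac)
     finally show ?thesis .
    qed
  qed
  also have "... = comult L l (%a b. comult K k (%x y. comult L l' (%a' b'. comult K k' (%x' y'. (p x a * p x' b) * (p y a' * p y' b')))))"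
    by (rule lcong[OF l(1)], rule tens_fubini[OF comult_L_closed[OF l(2)] comult_closed[OF k(1)]]; (intro pair_lin)?; simp)
  also have "... = comult K k (%x y. comult L l (%a b. comult L l' (%a' b'. comult K k' (%x' y'. (p x a * p x' b) * (p y a' * p y' b')))))"
    by (rule tens_fubini[OF comult_L_closed[OF l(1)] comult_closed[OF k(1)]]; (intro pair_lin)?; simp)
  also have "... = comult K k (%x y. comult L l (%a b. comult K k' (%x' y'. comult L l' (%a' b'. (p x a * p x' b) * (p y a' * p y' b')))))"
    by (rule comult_cong[OF k(1)], rule lcong[OF l(1)],
      rule tens_fubini[OF comult_L_closed[OF l(2)] comult_closed[OF k(2)]]; (intro pair_lin)?; simp)
  also have "... = comult K k (%x y. comult K k' (%x' y'. comult L l (%a b. comult L l' (%a' b'. (p x a * p x' b) * (p y a' * p y' b')))))"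
    by (rule comult_cong[OF k(1)],
      rule tens_fubini[OF comult_L_closed[OF l(1)] comult_closed[OF k(2)]]; (intro pair_lin)?; simp)
  also have "... = comult K k (%x y. comult K k' (%x' y'. p (x \<otimes>\<^bsub>K\<^esub> x') l * p (y \<otimes>\<^bsub>K\<^esub> y') l'))"
    by (rule comult_cong[OF k(1)], rule comult_cong[OF k(2)])
     (simp add: tens_scale[OF comult_L_closed[OF l(1)]] tens_scale[OF comult_L_closed[OF l(2)]] p_mult_K)
  also have "... = p (k \<otimes>\<^bsub>K\<^esub> k') (l \<otimes>\<^bsub>L\<^esub> l')"
  proof -
    have "bilinear_form K K (%a b. p a l * p b l')" by (intro pair_lin; simp)
    then show ?thesis by (simp add: p_mult_L comult_mult)
  qed
  finally show ?thesis .
qed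

lemma tens_L_eqI:
  assumes t: "t \<in> tens L L" and F: "bilinear_form L L F"
    and eq: "!!k k'. k \<in> carrier K ==> k' \<in> carrier K ==> t (%a b. p k a * p k' b) = s (%a b. p k a * p k' b)"
    and s: "s F = (\<Sum>i<n. \<Sum>j<n. s (%a b. p (e i) a * p (e j) b) * F (f i) (f j))"
  shows "t F = s F"
  unfolding tens_L_expand[OF F t] s by (intro sum.cong[OF refl]) (simp add: eq)

theorem dual_fd_hopf_algebra: "fd_hopf_algebra L"
proof -
  interpret L: ring L using alg_L by (rule k_algebra_ring)
  note [simp] = vspace_add_closed[OF vspace_L]
  have smc [simp]: "c \<odot>\<^bsub>L\<^esub> l \<in> carrier L" if "l \<in> carrier L" for c l using that vspace_smult(1)[OF vspace_L] by simp
  note lcong = tens_cong[OF comult_L_closed vspace_L vspace_L]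
  have fin: "finite_dim L"
    unfolding finite_dim_def spans_def
  proof (intro exI conjI ballI)
    show "f \<in> {..<n} \<rightarrow> carrier L" by simp
    fix l assume l: "l \<in> carrier L"
    show "l = (\<Oplus>\<^bsub>L\<^esub>i\<in>{..<n}. p (e i) l \<odot>\<^bsub>L\<^esub> f i)"
    proof (rule forms_separate[OF vspace_L l])
     fix g assume g: "linear_form L g"
     show "g l = g (\<Oplus>\<^bsub>L\<^esub>i\<in>{..<n}. p (e i) l \<odot>\<^bsub>L\<^esub> f i)"
      unfolding expand_L[OF l g]
      by (subst linear_form_finsum[OF vspace_L g]) (auto simp: linear_form_smult[OF g])
    qed (auto intro!: vspace_finsum_closed[OF vspace_L])
  qed
  have eps: "linear_form L (counit L)"
    using linear_form_cong[OF vspace_L, of "counit L" "p \<one>\<^bsub>K\<^esub>"] pairing by (simp add: bilinear_form_def p_one_K)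
  have bij: "bij_betw (antipode L) (carrier L) (carrier L)"
    unfolding bij_betw_def
  proof
    show "inj_on (antipode L) (carrier L)"
    proof (rule inj_onI)
     fix l l' assume *: "l \<in> carrier L" "l' \<in> carrier L" "antipode L l = antipode L l'"
     show "l = l'"
     proof (rule separate_L[OF *(1,2)])
      fix k assume k: "k \<in> carrier K"
      show "p k l = p k l'"
       using p_antipode[of "antipode_inv K k" l] p_antipode[of "antipode_inv K k" l'] k * by simp
     qed
    qed
    have "l \<in> antipode L ` carrier L" if l: "l \<in> carrier L" for l
    proof
     define l' where "l' = (\<Oplus>\<^bsub>L\<^esub>i\<in>{..<n}. p (antipode_inv K (e i)) l \<odot>\<^bsub>L\<^esub> f i)"
     show l': "l' \<in> carrier L" by (auto simp: l'_def intro!: vspace_finsum_closed[OF vspace_L])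
     have pl': "p k l' = p (antipode_inv K k) l" if k: "k \<in> carrier K" for k
     proof -
      have pk: "linear_form L (p k)" by (intro pair_lin k)
      have "p k l' = (\<Sum>i<n. p k (f i) * p (antipode_inv K (e i)) l)"
       unfolding l'_def by (subst linear_form_finsum[OF vspace_L pk]) (simp_all add: p_smult k mult.commute)
      also have "... = p (antipode_inv K k) l"
       by (rule expand_K[OF k, symmetric]) (intro pair_lin linear_map_compose[OF antipode_inv_map] l)
      finally show ?thesis .
     qed
     show "l = antipode L l'"
      by (rule separate_L) (simp_all add: l l' pl' flip: p_antipode)
    qed
    then show "antipode L ` carrier L = carrier L" by auto
  qed
  have mult: "comult L (l \<otimes>\<^bsub>L\<^esub> l') F = comult L l (%a b. comult L l' (%a' b'. F (a \<otimes>\<^bsub>L\<^esub> a') (b \<otimes>\<^bsub>L\<^esub> b')))"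
    if l: "l \<in> carrier L" "l' \<in> carrier L" and F: "bilinear_form L L F" for l l' F
  proof -
    note [simp] = l
    have c: "comult L l \<otimes>\<^bsub>tensor_alg L L\<^esub> comult L l' \<in> tens L L"
     by (rule tensor_alg_mult_closed[OF alg_L alg_L]) simp_all
    have "comult L (l \<otimes>\<^bsub>L\<^esub> l') F = (comult L l \<otimes>\<^bsub>tensor_alg L L\<^esub> comult L l') F"
    proof (rule tens_L_eqI[OF _ F _ tens_L_expand[OF F c]])
     fix k k' assume k: "k \<in> carrier K" "k' \<in> carrier K"
     have b: "bilinear_form L L (%a b. p k a * p k' b)" by (intro pair_lin k; simp)
     show "comult L (l \<otimes>\<^bsub>L\<^esub> l') (%a b. p k a * p k' b) =
      (comult L l \<otimes>\<^bsub>tensor_alg L L\<^esub> comult L l') (%a b. p k a * p k' b)"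
      unfolding tensor_alg_mult[OF b] comult_L_mult_pairing[OF l k] by (simp add: p_mult_K k)
    qed simp
    then show ?thesis by (simp add: tensor_alg_mult F)
  qed
  have one: "comult L \<one>\<^bsub>L\<^esub> F = F \<one>\<^bsub>L\<^esub> \<one>\<^bsub>L\<^esub>" if F: "bilinear_form L L F" for F
    by (simp add: comult_L_expand[OF F] bilinear_expand[OF F, of "\<one>\<^bsub>L\<^esub>" "\<one>\<^bsub>L\<^esub>"] p_one_L counit_mult)
  have coassoc: "comult L l (%x c. comult L x (%a b. T a b c)) = comult L l (%a x. comult L x (%b c. T a b c))"
    if l: "l \<in> carrier L" and T: "trilinear_form L L L T" for l T
  proof -
    note Ts = trilinear_form_slot[OF T]
    have 1: "bilinear_form L L (%a b. T a b c)" "bilinear_form L L (%a b. T c a b)" if "c \<in> carrier L" for c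
     by (intro pair_lin Ts; simp add: that)+
    have 2: "bilinear_form L L (%x c. comult L x (%a b. T a b c))" "bilinear_form L L (%a x. comult L x (%b c. T a b c))"
     by (intro pair_lin Ts; simp)+
    have exp: "(\<Sum>i<n. p (e i \<otimes>\<^bsub>K\<^esub> c) l * p a (f i)) = p (a \<otimes>\<^bsub>K\<^esub> c) l"
      "(\<Sum>i<n. p (c \<otimes>\<^bsub>K\<^esub> e i) l * p a (f i)) = p (c \<otimes>\<^bsub>K\<^esub> a) l"
     if a: "a \<in> carrier K" and c: "c \<in> carrier K" for a c
    proof -
     have "linear_form K (%a. p (a \<otimes>\<^bsub>K\<^esub> c) l)" "linear_form K (%a. p (c \<otimes>\<^bsub>K\<^esub> a) l)"
      by (intro pair_lin l c)+
     then show "(\<Sum>i<n. p (e i \<otimes>\<^bsub>K\<^esub> c) l * p a (f i)) = p (a \<otimes>\<^bsub>K\<^esub> c) l"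
      "(\<Sum>i<n. p (c \<otimes>\<^bsub>K\<^esub> e i) l * p a (f i)) = p (c \<otimes>\<^bsub>K\<^esub> a) l"
      using expand_K[OF a, of "%a. p (a \<otimes>\<^bsub>K\<^esub> c) l"] expand_K[OF a, of "%a. p (c \<otimes>\<^bsub>K\<^esub> a) l"]
      by (simp_all add: mult.commute)
    qed
    have "comult L l (%x c. comult L x (%a b. T a b c)) =
      (\<Sum>i<n. \<Sum>j<n. \<Sum>r<n. \<Sum>s<n. p (e i \<otimes>\<^bsub>K\<^esub> e j) l * (p (e r \<otimes>\<^bsub>K\<^esub> e s) (f i) * T (f r) (f s) (f j)))"
     by (simp add: comult_L_expand[OF 2(1) l] comult_L_expand[OF 1(1)] sum_distrib_left)
    also have "... = (\<Sum>j<n. \<Sum>r<n. \<Sum>s<n. \<Sum>i<n. p (e i \<otimes>\<^bsub>K\<^esub> e j) l * p (e r \<otimes>\<^bsub>K\<^esub> e s) (f i) * T (f r) (f s) (f j))"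
     by (subst sum.swap, rule sum.cong[OF refl], subst sum.swap, rule sum.cong[OF refl], subst sum.swap) (simp add: mult.assoc)
    also have "... = (\<Sum>j<n. \<Sum>r<n. \<Sum>s<n. p (e r \<otimes>\<^bsub>K\<^esub> e s \<otimes>\<^bsub>K\<^esub> e j) l * T (f r) (f s) (f j))"
     by (intro sum.cong[OF refl], subst sum_distrib_right[symmetric]) (simp add: exp)
    finally have L: "comult L l (%x c. comult L x (%a b. T a b c)) =
     (\<Sum>j<n. \<Sum>r<n. \<Sum>s<n. p (e r \<otimes>\<^bsub>K\<^esub> e s \<otimes>\<^bsub>K\<^esub> e j) l * T (f r) (f s) (f j))" .
    have "comult L l (%a x. comult L x (%b c. T a b c)) =
      (\<Sum>r<n. \<Sum>j<n. \<Sum>s<n. \<Sum>i<n. p (e r \<otimes>\<^bsub>K\<^esub> e j) l * (p (e s \<otimes>\<^bsub>K\<^esub> e i) (f j) * T (f r) (f s) (f i)))"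
     by (simp add: comult_L_expand[OF 2(2) l] comult_L_expand[OF 1(2)] sum_distrib_left)
    also have "... = (\<Sum>r<n. \<Sum>s<n. \<Sum>i<n. \<Sum>j<n. p (e r \<otimes>\<^bsub>K\<^esub> e j) l * p (e s \<otimes>\<^bsub>K\<^esub> e i) (f j) * T (f r) (f s) (f i))"
     by (rule sum.cong[OF refl], subst sum.swap, rule sum.cong[OF refl], subst sum.swap) (simp add: mult.assoc)
    also have "... = (\<Sum>r<n. \<Sum>s<n. \<Sum>i<n. p (e r \<otimes>\<^bsub>K\<^esub> (e s \<otimes>\<^bsub>K\<^esub> e i)) l * T (f r) (f s) (f i))"
     by (intro sum.cong[OF refl], subst sum_distrib_right[symmetric]) (simp add: exp)
    also have "... = (\<Sum>i<n. \<Sum>r<n. \<Sum>s<n. p (e r \<otimes>\<^bsub>K\<^esub> e s \<otimes>\<^bsub>K\<^esub> e i) l * T (f r) (f s) (f i))"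
     by (subst (2) sum.swap, subst sum.swap) (simp add: mult_assoc)
    finally show ?thesis by (simp add: L)
  qed
  have counit: "comult L l (%a b. counit L a * g b) = g l" "comult L l (%a b. counit L b * g a) = g l"
    if l: "l \<in> carrier L" and g: "linear_form L g" for l g
  proof -
    have b: "bilinear_form L L (%a b. counit L a * g b)" "bilinear_form L L (%a b. counit L b * g a)"
     by (intro pair_lin linear_form_compose[OF g] linear_form_compose[OF eps]; simp)+
    have 1: "(\<Sum>i<n. p (e i \<otimes>\<^bsub>K\<^esub> e j) l * counit L (f i)) = p (e j) l" if j: "j < n" for j
     using expand_K[of "\<one>\<^bsub>K\<^esub>" "%x. p (x \<otimes>\<^bsub>K\<^esub> e j) l"] l j
     by (simp add: p_one_K[symmetric] mult.commute pair_lin)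
    have 2: "(\<Sum>i<n. p (e j \<otimes>\<^bsub>K\<^esub> e i) l * counit L (f i)) = p (e j) l" if j: "j < n" for j
     using expand_K[of "\<one>\<^bsub>K\<^esub>" "%x. p (e j \<otimes>\<^bsub>K\<^esub> x) l"] l j
     by (simp add: p_one_K[symmetric] mult.commute pair_lin)
    have "comult L l (%a b. counit L a * g b) = (\<Sum>j<n. \<Sum>i<n. p (e i \<otimes>\<^bsub>K\<^esub> e j) l * counit L (f i) * g (f j))"
     unfolding comult_L_expand[OF b(1) l] by (subst sum.swap) (simp add: mult.assoc)
    also have "... = g l" by (simp add: 1 expand_L[OF l g] flip: sum_distrib_right)
    finally show "comult L l (%a b. counit L a * g b) = g l" .
    have "comult L l (%a b. counit L b * g a) = (\<Sum>j<n. \<Sum>i<n. p (e j \<otimes>\<^bsub>K\<^esub> e i) l * counit L (f i) * g (f j))"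
     unfolding comult_L_expand[OF b(2) l] by (simp add: mult.assoc)
    also have "... = g l" by (simp add: 2 expand_L[OF l g] flip: sum_distrib_right)
    finally show "comult L l (%a b. counit L b * g a) = g l" .
  qed
  have antipode: "comult L l (%a b. g (antipode L a \<otimes>\<^bsub>L\<^esub> b)) = counit L l * g \<one>\<^bsub>L\<^esub>"
     "comult L l (%a b. g (a \<otimes>\<^bsub>L\<^esub> antipode L b)) = counit L l * g \<one>\<^bsub>L\<^esub>"
    if l: "l \<in> carrier L" and g: "linear_form L g" for l g
  proof -
    have pair: "comult L l (%a b. p k (antipode L a \<otimes>\<^bsub>L\<^esub> b)) = p k \<one>\<^bsub>L\<^esub> * counit L l"
     "comult L l (%a b. p k (a \<otimes>\<^bsub>L\<^esub> antipode L b)) = p k \<one>\<^bsub>L\<^esub> * counit L l" if k: "k \<in> carrier K" for k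
    proof -
     have pl: "linear_form K (%x. p x l)" by (intro pair_lin l)
     have "comult L l (%a b. p k (antipode L a \<otimes>\<^bsub>L\<^esub> b)) =
      comult L l (%a b. comult K k (%x y. p (antipode K x) a * p y b))"
      by (rule lcong[OF l]) (simp add: p_mult_L k p_antipode cong: comult_cong[OF k])
     also have "... = comult K k (%x y. comult L l (%a b. p (antipode K x) a * p y b))"
      by (rule tens_fubini[OF comult_L_closed[OF l] comult_closed[OF k]]; (intro pair_lin)?; simp)
     also have "... = comult K k (%x y. p (antipode K x \<otimes>\<^bsub>K\<^esub> y) l)"
      by (rule comult_cong[OF k]) (simp add: p_mult_K l)
     finally show "comult L l (%a b. p k (antipode L a \<otimes>\<^bsub>L\<^esub> b)) = p k \<one>\<^bsub>L\<^esub> * counit L l"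
      using antipode_left_form[OF k pl] by (simp add: p_one_K p_one_L k l)
     have "comult L l (%a b. p k (a \<otimes>\<^bsub>L\<^esub> antipode L b)) =
      comult L l (%a b. comult K k (%x y. p x a * p (antipode K y) b))"
      by (rule lcong[OF l]) (simp add: p_mult_L k p_antipode cong: comult_cong[OF k])
     also have "... = comult K k (%x y. comult L l (%a b. p x a * p (antipode K y) b))"
      by (rule tens_fubini[OF comult_L_closed[OF l] comult_closed[OF k]]; (intro pair_lin)?; simp)
     also have "... = comult K k (%x y. p (x \<otimes>\<^bsub>K\<^esub> antipode K y) l)"
      by (rule comult_cong[OF k]) (simp add: p_mult_K l)
     finally show "comult L l (%a b. p k (a \<otimes>\<^bsub>L\<^esub> antipode L b)) = p k \<one>\<^bsub>L\<^esub> * counit L l"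
      using antipode_right_form[OF k pl] by (simp add: p_one_K p_one_L k l)
    qed
    have exp: "comult L l (%a b. g (m a b)) = (\<Sum>i<n. comult L l (%a b. p (e i) (m a b)) * g (f i))"
     if m: "bilinear_map L L L m" for m
    proof -
     have "comult L l (%a b. g (m a b)) = comult L l (%a b. \<Sum>i<n. p (e i) (m a b) * g (f i))"
      by (rule lcong[OF l]) (rule expand_L[OF bilinear_map_closed[OF m] g])
     also have "... = (\<Sum>i<n. comult L l (%a b. p (e i) (m a b) * g (f i)))"
      by (rule tens_sum[OF comult_L_closed[OF l]]) (intro pair_lin bilinear_map_slot[OF m]; simp)
     finally show ?thesis by (simp add: tens_scale(2)[OF comult_L_closed[OF l]])
    qed
    have m: "bilinear_map L L L (%a b. antipode L a \<otimes>\<^bsub>L\<^esub> b)" "bilinear_map L L L (%a b. a \<otimes>\<^bsub>L\<^esub> antipode L b)"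
     by (intro pair_lin; simp)+
    show "comult L l (%a b. g (antipode L a \<otimes>\<^bsub>L\<^esub> b)) = counit L l * g \<one>\<^bsub>L\<^esub>"
     "comult L l (%a b. g (a \<otimes>\<^bsub>L\<^esub> antipode L b)) = counit L l * g \<one>\<^bsub>L\<^esub>"
     unfolding exp[OF m(1)] exp[OF m(2)] expand_L[OF one_L_closed g]
     by (simp_all add: pair sum_distrib_left mult_ac)
  qed
  have counit_mult: "counit L (l \<otimes>\<^bsub>L\<^esub> l') = counit L l * counit L l'"
    if l: "l \<in> carrier L" "l' \<in> carrier L" for l l'
  proof -
    have "bilinear_form K K (%a b. p a l * p b l')" by (intro pair_lin; simp add: l)
    then show ?thesis using l by (simp add: p_mult_L comult_one flip: p_one_K)
  qed
  have counit_one: "counit L \<one>\<^bsub>L\<^esub> = 1"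
    by (simp add: p_one_L counit_one flip: p_one_K)
  show ?thesis
    unfolding fd_hopf_algebra_iff
    by (intro conjI ballI allI impI alg_L fin comult_L_linear eps antipode_L_map bij mult one
      coassoc counit antipode counit_mult counit_one; assumption)
qed

end

context dual_pair
begin

lemma swap: "dual_pair L K (%l k. p k l) n f e"
proof -
  interpret L: fd_hopf_algebra L by (rule dual_fd_hopf_algebra)
  show ?thesis
    by unfold_locales
     (use pairing in \<open>auto simp: bilinear_form_def dual_basis p_mult_L p_mult_K p_one_L p_one_K p_antipode
       intro: expand_K expand_L mult_assoc\<close>)
qed

lemma dual_bases: "dual_bases K L p n e f"
proof -
  have "\<exists>c. k = (\<Oplus>\<^bsub>K\<^esub>i\<in>{..<n}. c i \<odot> e i)" if k: "k \<in> carrier K" for k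
  proof (rule exI, rule forms_separate[OF vK k])
    fix g assume g: "linear_form K g"
    show "g k = g (\<Oplus>\<^bsub>K\<^esub>i\<in>{..<n}. p k (f i) \<odot> e i)"
     unfolding expand_K[OF k g]
     by (subst linear_form_finsum[OF vK g]) (auto simp: linear_form_smult[OF g] vspace_smult(1)[OF vK])
  qed (auto intro!: vspace_finsum_closed[OF vK] vspace_smult(1)[OF vK])
  moreover have "\<exists>c. l = (\<Oplus>\<^bsub>L\<^esub>i\<in>{..<n}. c i \<odot>\<^bsub>L\<^esub> f i)" if l: "l \<in> carrier L" for l
  proof (rule exI, rule forms_separate[OF vspace_L l])
    fix g assume g: "linear_form L g"
    show "g l = g (\<Oplus>\<^bsub>L\<^esub>i\<in>{..<n}. p (e i) l \<odot>\<^bsub>L\<^esub> f i)"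
     unfolding expand_L[OF l g]
     by (subst linear_form_finsum[OF vspace_L g]) (auto simp: linear_form_smult[OF g] vspace_smult(1)[OF vspace_L])
  qed (auto intro!: vspace_finsum_closed[OF vspace_L] vspace_smult(1)[OF vspace_L])
  ultimately show ?thesis
    unfolding dual_bases_def spans_def by (auto simp: dual_basis)
qed

text \<open>The antipode reverses the coproduct because the antipode of the dual reverses the product.\<close>

lemma comult_antipode_L:
  assumes l: "l \<in> carrier L" and F: "bilinear_form L L F"
  shows "comult L (antipode L l) F = comult L l (%a b. F (antipode L b) (antipode L a))"
proof -
  let ?s = "T2 L L (%F. comult L l (%a b. F (antipode L b) (antipode L a)))"
  have s: "?s \<in> tens L L"
  proof (rule T2_bind_closed[OF comult_L_closed[OF l]])
    fix F assume F: "bilinear_form L L F"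
    show "bilinear_form L L (%a b. F (antipode L b) (antipode L a))"
     by (intro pair_lin bilinear_form_slot[OF F]; simp)
  qed (simp add: T2_pure_closed)
  have "comult L (antipode L l) F = ?s F"
  proof (rule tens_L_eqI[OF _ F _ tens_L_expand[OF F s]])
    fix k k' assume k: "k \<in> carrier K" "k' \<in> carrier K"
    have b: "bilinear_form L L (%a b. p k a * p k' b)" by (intro pair_lin k; simp)
    show "comult L (antipode L l) (%a b. p k a * p k' b) = ?s (%a b. p k a * p k' b)"
    proof -
     have "comult L (antipode L l) (%a b. p k a * p k' b) = p (antipode K (k \<otimes> k')) l"
      using k l by (simp add: p_antipode flip: p_mult_K)
     also have "... = comult L l (%a b. p (antipode K k') a * p (antipode K k) b)"
      using k l by (simp add: antipode_mult p_mult_K)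
     also have "... = comult L l (%a b. p k (antipode L b) * p k' (antipode L a))"
      by (rule tens_cong[OF comult_L_closed[OF l] vspace_L vspace_L]) (simp add: p_antipode k mult.commute)
     finally show ?thesis by (simp add: b)
    qed
  qed (simp add: l)
  then show ?thesis by (simp add: F)
qed

lemma comult_antipode_inv_L:
  assumes l: "l \<in> carrier L" and F: "bilinear_form L L F"
  shows "comult L (antipode_inv L l) F = comult L l (%a b. F (antipode_inv L b) (antipode_inv L a))"
proof -
  interpret L: fd_hopf_algebra L by (rule dual_fd_hopf_algebra)
  have b: "bilinear_form L L (%a b. F (antipode_inv L b) (antipode_inv L a))"
    by (intro pair_lin bilinear_form_slot[OF F] linear_map_compose[OF L.antipode_inv_map]; simp)
  have "comult L l (%a b. F (antipode_inv L b) (antipode_inv L a)) =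
    comult L (antipode L (antipode_inv L l)) (%a b. F (antipode_inv L b) (antipode_inv L a))"
    using l by simp
  also have "... = comult L (antipode_inv L l) F"
    unfolding comult_antipode_L[OF L.antipode_inv_closed[OF l] b]
    by (rule L.comult_cong) (simp_all add: l)
  finally show ?thesis ..
qed

lemmas comult_antipode_K = dual_pair.comult_antipode_L[OF swap]
lemmas comult_antipode_inv_K = dual_pair.comult_antipode_inv_L[OF swap]
lemmas comult_K_expand = dual_pair.comult_L_expand[OF swap]

text \<open>A tensor with one leg in L is determined by pairing that leg with the elements of K.\<close>

lemma tens_right_expand:
  assumes V: "vspace V" and t: "t \<in> tens V L" and F: "bilinear_form V L F"
  shows "t F = (\<Sum>i<n. t (%v l. F v (f i) * p (e i) l))"
proof -
  have "t F = t (%v l. \<Sum>i<n. F v (f i) * p (e i) l)"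
  proof (rule tens_cong[OF t V vspace_L])
    fix v l assume "v \<in> carrier V" "l \<in> carrier L"
    then show "F v l = (\<Sum>i<n. F v (f i) * p (e i) l)"
     using expand_L[of l "F v"] F by (simp add: bilinear_form_def mult.commute)
  qed
  also have "... = (\<Sum>i<n. t (%v l. F v (f i) * p (e i) l))"
    by (rule tens_sum[OF t]) (intro lin p_slot bilinear_form_slot[OF F]; simp)
  finally show ?thesis .
qed

lemma tens_left_expand:
  assumes V: "vspace V" and t: "t \<in> tens L V" and F: "bilinear_form L V F"
  shows "t F = (\<Sum>i<n. t (%l v. p (e i) l * F (f i) v))"
proof -
  have "t F = t (%l v. \<Sum>i<n. p (e i) l * F (f i) v)"
  proof (rule tens_cong[OF t vspace_L V])
    fix v l assume "v \<in> carrier V" "l \<in> carrier L"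
    then show "F l v = (\<Sum>i<n. p (e i) l * F (f i) v)"
     using expand_L[of l "%l. F l v"] F by (simp add: bilinear_form_def)
  qed
  also have "... = (\<Sum>i<n. t (%l v. p (e i) l * F (f i) v))"
    by (rule tens_sum[OF t]) (intro lin p_slot bilinear_form_slot[OF F]; simp)
  finally show ?thesis .
qed

lemma tens_right_eqI:
  assumes V: "vspace V" and st: "s \<in> tens V L" "t \<in> tens V L"
    and eq: "!!k g. k \<in> carrier K ==> linear_form V g ==> s (%v l. g v * p k l) = t (%v l. g v * p k l)"
  shows "s = t"
proof (rule tens_eqI[OF st])
  fix F assume F: "bilinear_form V L F"
  show "s F = t F"
    unfolding tens_right_expand[OF V st(1) F] tens_right_expand[OF V st(2) F]
    by (rule sum.cong[OF refl], rule eq) (use F in \<open>auto simp: bilinear_form_def\<close>)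
qed

lemma tens_left_eqI:
  assumes V: "vspace V" and st: "s \<in> tens L V" "t \<in> tens L V"
    and eq: "!!k g. k \<in> carrier K ==> linear_form V g ==> s (%l v. p k l * g v) = t (%l v. p k l * g v)"
  shows "s = t"
proof (rule tens_eqI[OF st])
  fix F assume F: "bilinear_form L V F"
  show "s F = t F"
    unfolding tens_left_expand[OF V st(1) F] tens_left_expand[OF V st(2) F]
    by (rule sum.cong[OF refl], rule eq) (use F in \<open>auto simp: bilinear_form_def\<close>)
qed

lemma copairing_eq: "copairing K L p = T2 K L (%B. \<Sum>i<n. B (e i) (f i))"
proof -
  have "\<exists>m e' f'. dual_bases K L p m e' f' & copairing K L p = T2 K L (%B. \<Sum>i<m. B (e' i) (f' i))"
  proof -
    have "\<exists>u m e' f'. dual_bases K L p m e' f' & u = T2 K L (%B. \<Sum>i<m. B (e' i) (f' i))"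
     using dual_bases by blast
    from someI_ex[OF this] show ?thesis unfolding copairing_def .
  qed
  then obtain m e' f' where b: "dual_bases K L p m e' f'"
    and c: "copairing K L p = T2 K L (%B. \<Sum>i<m. B (e' i) (f' i))" by blast
  have e': "e' j \<in> carrier K" and f': "f' j \<in> carrier L" if "j < m" for j
    using b that by (auto simp: dual_bases_def spans_def)
  have exp: "g l = (\<Sum>j<m. p (e' j) l * g (f' j))" if l: "l \<in> carrier L" and g: "linear_form L g" for l g
  proof -
    have f's: "c \<odot>\<^bsub>L\<^esub> f' j \<in> carrier L" if "j < m" for c j using vspace_smult(1)[OF vspace_L f'[OF that]] .
    obtain c where c: "l = (\<Oplus>\<^bsub>L\<^esub>i\<in>{..<m}. c i \<odot>\<^bsub>L\<^esub> f' i)"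
     using b l unfolding dual_bases_def spans_def by blast
    have fs: "h l = (\<Sum>j<m. c j * h (f' j))" if h: "linear_form L h" for h
     unfolding c by (subst linear_form_finsum[OF vspace_L h]) (auto simp: f's f' linear_form_smult[OF h])
    have "p (e' j) l = c j" if j: "j < m" for j
    proof -
     have "p (e' j) l = (\<Sum>i<m. c i * p (e' j) (f' i))"
      by (rule fs) (intro pair_lin e' j)
     also have "... = (\<Sum>i<m. if i = j then c i else 0)"
      using b j by (intro sum.cong) (auto simp: dual_bases_def)
     finally show ?thesis using j by simp
    qed
    then show ?thesis by (simp add: fs[OF g])
  qed
  show ?thesis
    unfolding c T2_eq_iff
  proof (intro allI impI)
    fix B assume B: "bilinear_form K L B"
    have "(\<Sum>j<m. B (e' j) (f' j)) = (\<Sum>j<m. \<Sum>i<n. p (e' j) (f i) * B (e i) (f' j))"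
     by (intro sum.cong[OF refl] expand_K) (use e' f' B in \<open>auto simp: bilinear_form_def\<close>)
    also have "... = (\<Sum>i<n. B (e i) (f i))"
     by (subst sum.swap, intro sum.cong[OF refl] exp[symmetric]) (use e' f' B in \<open>auto simp: bilinear_form_def\<close>)
    finally show "(\<Sum>j<m. B (e' j) (f' j)) = (\<Sum>i<n. B (e i) (f i))" .
  qed
qed

lemma sum_pure_closed:
  "(!!i. i < n ==> a i \<in> carrier V) ==> (!!i. i < n ==> b i \<in> carrier W) ==>
    T2 V W (%B. \<Sum>i<n. B (a i) (b i)) \<in> tens V W"
  by (rule tens_rep_closed)

text \<open>The inverse of the copairing is obtained by applying the antipode to the first leg. For the
  opposite of K, the inverse of the antipode takes the place of the antipode.\<close>

lemma copairing_product:
  assumes A: "k_algebra A" "carrier A = carrier K" "linear_form A = linear_form K" "\<one>\<^bsub>A\<^esub> = \<one>"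
    and st: "linear_map K K s" "linear_map K K t"
    and conv: "!!k g. k \<in> carrier K ==> linear_form K g ==>
     bilinear_form K K (%a b. g (s a \<otimes>\<^bsub>A\<^esub> t b)) & comult K k (%a b. g (s a \<otimes>\<^bsub>A\<^esub> t b)) = counit K k * g \<one>"
  shows "T2 A L (%B. \<Sum>i<n. B (s (e i)) (f i)) \<otimes>\<^bsub>tensor_alg A L\<^esub> T2 A L (%B. \<Sum>i<n. B (t (e i)) (f i)) = \<one>\<^bsub>tensor_alg A L\<^esub>"
    (is "?u \<otimes>\<^bsub>_\<^esub> ?v = _")
proof (rule tens_right_eqI)
  note [simp] = A(2,4) linear_map_closed[OF st(1)] linear_map_closed[OF st(2)]
  show vA: "vspace A" using A(1) by (rule k_algebra_vspace)
  have uv: "?u \<in> tens A L" "?v \<in> tens A L" by (auto intro!: sum_pure_closed)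
  show "?u \<otimes>\<^bsub>tensor_alg A L\<^esub> ?v \<in> tens A L" by (rule tensor_alg_mult_closed[OF A(1) alg_L uv])
  show "\<one>\<^bsub>tensor_alg A L\<^esub> \<in> tens A L" using monoid_tensor_alg[OF A(1) alg_L] by (rule monoid.one_closed)
  fix k g assume k: "k \<in> carrier K" and g: "linear_form A g"
  then have gK: "linear_form K g" by (simp add: A)
  have F: "bilinear_form A L (%v l. g v * p k l)" by (intro pair_lin linear_form_compose[OF g] k)
  have b1: "bilinear_form A L (%a b. \<Sum>i<n. g (a \<otimes>\<^bsub>A\<^esub> t (e i)) * p k (b \<otimes>\<^bsub>L\<^esub> f i))"
    by (intro pair_lin linear_form_compose[OF g] k A(1); simp)
  have b2: "bilinear_form A L (%a' b'. g (a \<otimes>\<^bsub>A\<^esub> a') * p k (b \<otimes>\<^bsub>L\<^esub> b'))" if "a \<in> carrier K" "b \<in> carrier L" for a b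
    by (intro pair_lin linear_form_compose[OF g] k A(1); simp add: that)
  have "(?u \<otimes>\<^bsub>tensor_alg A L\<^esub> ?v) (%v l. g v * p k l) =
    ?u (%a b. \<Sum>i<n. g (a \<otimes>\<^bsub>A\<^esub> t (e i)) * p k (b \<otimes>\<^bsub>L\<^esub> f i))"
    unfolding tensor_alg_mult[OF F] by (rule tens_cong[OF uv(1) vA vspace_L]) (simp add: b2)
  also have "... = (\<Sum>i<n. \<Sum>j<n. p k (f i \<otimes>\<^bsub>L\<^esub> f j) * g (s (e i) \<otimes>\<^bsub>A\<^esub> t (e j)))"
    by (simp add: b1 mult.commute)
  also have "... = comult K k (%a b. g (s a \<otimes>\<^bsub>A\<^esub> t b))"
    by (rule comult_K_expand[symmetric]) (use conv[OF k gK] k in simp_all)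
  finally show "(?u \<otimes>\<^bsub>tensor_alg A L\<^esub> ?v) (%v l. g v * p k l) = \<one>\<^bsub>tensor_alg A L\<^esub> (%v l. g v * p k l)"
    using conv[OF k gK] by (simp add: tensor_alg_one[OF F] p_one_L k)
qed

definition "copair = T2 K L (%B. \<Sum>i<n. B (e i) (f i))"
definition "copair_inv = T2 K L (%B. \<Sum>i<n. B (antipode K (e i)) (f i))"
definition "copair_op_inv = T2 K L (%B. \<Sum>i<n. B (antipode_inv K (e i)) (f i))"

lemma copair_closed: "copair \<in> tens K L" "copair_inv \<in> tens K L" "copair_op_inv \<in> tens K L"
  by (auto simp: copair_def copair_inv_def copair_op_inv_def intro!: sum_pure_closed)

lemma copair_inverse:
  "copair \<otimes>\<^bsub>tensor_alg K L\<^esub> copair_inv = \<one>\<^bsub>tensor_alg K L\<^esub>"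
  "copair_inv \<otimes>\<^bsub>tensor_alg K L\<^esub> copair = \<one>\<^bsub>tensor_alg K L\<^esub>"
proof -
  have "bilinear_form K K (%a b. g (a \<otimes> antipode K b))" "bilinear_form K K (%a b. g (antipode K a \<otimes> b))"
    if g: "linear_form K g" for g
    by (intro hopf_lin linear_form_compose[OF g]; simp)+
  then show "copair \<otimes>\<^bsub>tensor_alg K L\<^esub> copair_inv = \<one>\<^bsub>tensor_alg K L\<^esub>"
    "copair_inv \<otimes>\<^bsub>tensor_alg K L\<^esub> copair = \<one>\<^bsub>tensor_alg K L\<^esub>"
    using copairing_product[OF alg refl refl refl linear_map_id antipode_map]
     copairing_product[OF alg refl refl refl antipode_map linear_map_id]
    by (simp_all add: copair_def copair_inv_def antipode_left_form antipode_right_form)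
qed

lemma copair_op_inverse:
  "copair \<otimes>\<^bsub>tensor_alg (opp K) L\<^esub> copair_op_inv = \<one>\<^bsub>tensor_alg (opp K) L\<^esub>"
  "copair_op_inv \<otimes>\<^bsub>tensor_alg (opp K) L\<^esub> copair = \<one>\<^bsub>tensor_alg (opp K) L\<^esub>"
proof -
  have "bilinear_form K K (%a b. g (antipode_inv K b \<otimes> a))" "bilinear_form K K (%a b. g (b \<otimes> antipode_inv K a))"
    if g: "linear_form K g" for g
    by (intro hopf_lin linear_form_compose[OF g] linear_map_compose[OF antipode_inv_map]; simp)+
  then show "copair \<otimes>\<^bsub>tensor_alg (opp K) L\<^esub> copair_op_inv = \<one>\<^bsub>tensor_alg (opp K) L\<^esub>"
    "copair_op_inv \<otimes>\<^bsub>tensor_alg (opp K) L\<^esub> copair = \<one>\<^bsub>tensor_alg (opp K) L\<^esub>"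
    using copairing_product[OF k_algebra_opp[OF alg] _ _ _ linear_map_id antipode_inv_map]
     copairing_product[OF k_algebra_opp[OF alg] _ _ _ antipode_inv_map linear_map_id]
    by (simp_all add: copair_def copair_op_inv_def antipode_inv_left_form)
qed

lemma copairing_copair: "copairing K L p = copair" "copairing_op K L p = copair"
  by (simp_all add: copairing_op_def copairing_eq copair_def tens_T2[OF copair_closed(1), unfolded copair_def])

lemma copair_apply:
  "bilinear_form K L B ==> copair B = (\<Sum>i<n. B (e i) (f i))"
  "bilinear_form K L B ==> copair_inv B = (\<Sum>i<n. B (antipode K (e i)) (f i))"
  "bilinear_form K L B ==> copair_op_inv B = (\<Sum>i<n. B (antipode_inv K (e i)) (f i))"
  by (simp_all add: copair_def copair_inv_def copair_op_inv_def)

lemma inv_copairing: "inv\<^bsub>tensor_alg K L\<^esub> (copairing K L p) = copair_inv"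
  "inv\<^bsub>tensor_alg (opp K) L\<^esub> (copairing_op K L p) = copair_op_inv"
  using Ad_eq_iff(1)[OF monoid_tensor_alg[OF alg alg_L] copair_closed(1,2) copair_inverse copair_closed(1) copair_closed(1)]
    Ad_eq_iff(1)[OF monoid_tensor_alg[OF k_algebra_opp[OF alg] alg_L] _ _ copair_op_inverse, of copair copair]
    copair_closed by (simp_all add: copairing_copair)

lemma flip_copair_inv: "flip L K copair_inv = dual_pair.copair_inv L K n f e"
  unfolding flip_def dual_pair.copair_inv_def[OF swap] T2_eq_iff
proof (intro allI impI)
  fix B assume B: "bilinear_form L K B"
  have "bilinear_form K L (%a b. B b a)" using B by (simp add: bilinear_form_def)
  then have "copair_inv (%a b. B b a) = (\<Sum>i<n. B (f i) (antipode K (e i)))" by (simp add: copair_apply)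
  also have "... = (\<Sum>i<n. \<Sum>j<n. p (antipode K (e i)) (f j) * B (f i) (e j))"
    by (intro sum.cong[OF refl] expand_K) (use B in \<open>auto simp: bilinear_form_def\<close>)
  also have "... = (\<Sum>j<n. \<Sum>i<n. p (e i) (antipode L (f j)) * B (f i) (e j))"
    by (subst sum.swap) (simp add: p_antipode)
  also have "... = (\<Sum>j<n. B (antipode L (f j)) (e j))"
    by (intro sum.cong[OF refl] expand_L[symmetric]) (use B in \<open>auto simp: bilinear_form_def\<close>)
  finally show "copair_inv (%w v. B v w) = (\<Sum>j<n. B (antipode L (f j)) (e j))" .
qed

end

section \<open>The dual Hopf algebra\<close>

lemma dual_hopf_simps:
  "carrier (dual_hopf H) = {\<theta>. linear_form H \<theta> & \<theta> \<in> extensional (carrier H)}"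
  "\<theta> \<otimes>\<^bsub>dual_hopf H\<^esub> \<theta>' = (\<lambda>h\<in>carrier H. comult H h (%h1 h2. \<theta> h1 * \<theta>' h2))"
  "\<one>\<^bsub>dual_hopf H\<^esub> = restrict (counit H) (carrier H)"
  "\<zero>\<^bsub>dual_hopf H\<^esub> = (\<lambda>h\<in>carrier H. 0)"
  "\<theta> \<oplus>\<^bsub>dual_hopf H\<^esub> \<theta>' = (\<lambda>h\<in>carrier H. \<theta> h + \<theta>' h)"
  "c \<odot>\<^bsub>dual_hopf H\<^esub> \<theta> = (\<lambda>h\<in>carrier H. c * \<theta> h)"
  "comult (dual_hopf H) = dual_comult H" "counit (dual_hopf H) = (%\<theta>. \<theta> \<one>\<^bsub>H\<^esub>)"
  "antipode (dual_hopf H) = (%\<theta>. (\<lambda>h\<in>carrier H. \<theta> (antipode H h)))"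
  by (simp_all add: dual_hopf_def module.extend_def hopf.fields_def dual_alg_def)

lemma dual_pair_dual_hopf:
  assumes H: "fd_hopf_algebra H"
  obtains n e f where "dual_pair H (dual_hopf H) (%h \<theta>. \<theta> h) n e f"
proof -
  interpret fd_hopf_algebra H by fact
  let ?D = "dual_hopf H"
  note simps = dual_hopf_simps[of H]
  obtain n e f0 where *: "e \<in> {..<n::nat} \<rightarrow> carrier H" "\<forall>i<n. linear_form H (f0 i)"
    "\<forall>i<n. \<forall>j<n. f0 i (e j) = (if i = j then 1 else 0)"
    "\<forall>v\<in>carrier H. v = (\<Oplus>\<^bsub>H\<^esub>i\<in>{..<n}. f0 i v \<odot>\<^bsub>H\<^esub> e i)"
    by (rule dual_coordinates[OF vK finite_dim])
  note e = *(1)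
  have f0: "!!i. i < n ==> linear_form H (f0 i)"
    and f0e: "!!i j. i < n ==> j < n ==> f0 i (e j) = (if i = j then 1 else 0)"
    using *(2,3) by auto
  have rep: "!!v. v \<in> carrier H ==> v = (\<Oplus>\<^bsub>H\<^esub>i\<in>{..<n}. f0 i v \<odot>\<^bsub>H\<^esub> e i)"
    by (rule bspec[OF *(4)])
  define f where "f i = restrict (f0 i) (carrier H)" for i
  have add [simp]: "h \<in> carrier H ==> k \<in> carrier H ==> h \<oplus>\<^bsub>H\<^esub> k \<in> carrier H" for h k
    using vspace_add_closed[OF vK] .
  have sm [simp]: "h \<in> carrier H ==> c \<odot>\<^bsub>H\<^esub> h \<in> carrier H" for h c using vspace_smult(1)[OF vK] .
  have restr: "restrict g (carrier H) \<in> carrier ?D \<longleftrightarrow> linear_form H g" for g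
    by (simp add: simps linear_form_cong[OF vK, of "restrict g (carrier H)" g])
  have ec [simp]: "e i \<in> carrier H" if "i < n" for i using e that by auto
  have fc [simp]: "f i \<in> carrier ?D" if "i < n" for i using f0[OF that] by (simp add: f_def restr)
  have D_lin: "linear_form H \<theta>" if "\<theta> \<in> carrier ?D" for \<theta> using that by (simp add: simps)
  have D_eqI: "\<theta> = \<theta>'" if "\<theta> \<in> carrier ?D" "\<theta>' \<in> carrier ?D" "!!h. h \<in> carrier H ==> \<theta> h = \<theta>' h" for \<theta> \<theta>'
    using that by (auto simp: simps intro: extensionalityI)
  have D_restrict: "restrict \<theta> (carrier H) = \<theta>" if "\<theta> \<in> carrier ?D" for \<theta>
    using that by (simp add: simps extensional_restrict)
  have zeroD: "\<zero>\<^bsub>?D\<^esub> \<in> carrier ?D" unfolding simps(4) restr by (simp add: linear_form_def)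
  have addD: "\<theta> \<oplus>\<^bsub>?D\<^esub> \<theta>' \<in> carrier ?D" if "\<theta> \<in> carrier ?D" "\<theta>' \<in> carrier ?D" for \<theta> \<theta>'
    using D_lin[OF that(1)] D_lin[OF that(2)] unfolding simps(5) restr by (simp add: linear_form_def algebra_simps)
  have smD: "c \<odot>\<^bsub>?D\<^esub> \<theta> \<in> carrier ?D" if "\<theta> \<in> carrier ?D" for \<theta> c
    using D_lin[OF that] unfolding simps(6) restr by (simp add: linear_form_def algebra_simps)
  have ag: "abelian_group ?D"
  proof (rule abelian_groupI)
    fix x assume x: "x \<in> carrier ?D"
    show "\<exists>y\<in>carrier ?D. y \<oplus>\<^bsub>?D\<^esub> x = \<zero>\<^bsub>?D\<^esub>"
    proof (rule bexI[OF _ smD[OF x]])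
     show "(- 1) \<odot>\<^bsub>?D\<^esub> x \<oplus>\<^bsub>?D\<^esub> x = \<zero>\<^bsub>?D\<^esub>"
      by (auto simp: simps(4-6) restrict_def fun_eq_iff)
    qed
    show "\<zero>\<^bsub>?D\<^esub> \<oplus>\<^bsub>?D\<^esub> x = x" using D_restrict[OF x] by (simp add: simps(4,5) cong: restrict_cong)
  qed ((rule addD zeroD; assumption) | auto simp: simps(5) restrict_def fun_eq_iff add.assoc add.commute)+
  have vD: "vspace ?D"
  proof (rule moduleI[OF cring_scalars ag])
    show "\<one>\<^bsub>scalars\<^esub> \<odot>\<^bsub>?D\<^esub> x = x" if "x \<in> carrier ?D" for x
     using D_restrict[OF that] by (simp add: simps(6) cong: restrict_cong)
  qed ((rule smD; assumption) | auto simp: simps(5,6) restrict_def fun_eq_iff algebra_simps)+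
  have ev: "bilinear_form H ?D (%h \<theta>. \<theta> h)"
    by (intro bilinear_formI) (use D_lin in \<open>auto simp: linear_form_def simps(5,6)\<close>)
  note evs = bilinear_form_slot[OF ev]
  have expH: "g h = (\<Sum>i<n. f i h * g (e i))" if h: "h \<in> carrier H" and g: "linear_form H g" for h g
    by (subst rep[OF h], subst linear_form_finsum[OF vK g])
     (auto simp: linear_form_smult[OF g] f_def h)
  have expD: "G \<theta> = (\<Sum>i<n. \<theta> (e i) * G (f i))" if \<theta>: "\<theta> \<in> carrier ?D" and G: "linear_form ?D G" for \<theta> G
  proof -
    define s where "s m = (\<lambda>h\<in>carrier H. \<Sum>i<m. \<theta> (e i) * f i h)" for m
    have "s m \<in> carrier ?D & G (s m) = (\<Sum>i<m. \<theta> (e i) * G (f i))" if "m \<le> n" for m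
     using that
    proof (induction m)
     case 0
     have "s 0 = \<zero>\<^bsub>?D\<^esub>" by (auto simp: s_def simps(4) restrict_def)
     then show ?case using zeroD linear_form_zero[OF vD G] by simp
    next
     case (Suc m)
     have "s (Suc m) = s m \<oplus>\<^bsub>?D\<^esub> \<theta> (e m) \<odot>\<^bsub>?D\<^esub> f m"
      by (auto simp: s_def simps(5,6) restrict_def fun_eq_iff)
     then show ?case using Suc smD addD linear_form_add[OF G] linear_form_smult[OF G] by simp
    qed
    from this[of n] have s: "s n \<in> carrier ?D" "G (s n) = (\<Sum>i<n. \<theta> (e i) * G (f i))" by auto
    have "s n = \<theta>"
    proof (rule D_eqI[OF s(1) \<theta>])
     fix h assume h: "h \<in> carrier H"
     show "s n h = \<theta> h" using expH[OF h D_lin[OF \<theta>]] h by (simp add: s_def mult.commute)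
    qed
    then show ?thesis using s(2) by simp
  qed
  have da: "carrier (dual_alg H) = carrier ?D" "linear_form (dual_alg H) = linear_form ?D"
     "tens (dual_alg H) (dual_alg H) = tens ?D ?D"
    by (simp_all add: simps dual_alg_def linear_form_def fun_eq_iff tensor_alg_def T2_def bilinear_form_def)
  have comult: "dual_comult H \<theta> \<in> tens ?D ?D &
     (\<forall>h\<in>carrier H. \<forall>k\<in>carrier H. dual_comult H \<theta> (%\<theta>1 \<theta>2. \<theta>1 h * \<theta>2 k) = \<theta> (h \<otimes>\<^bsub>H\<^esub> k))"
    if \<theta>: "\<theta> \<in> carrier ?D" for \<theta>
  proof -
    let ?u = "%B. \<Sum>i<n. (\<Sum>j<n. T2 ?D ?D (%B. B (\<theta> (e i \<otimes>\<^bsub>H\<^esub> e j) \<odot>\<^bsub>?D\<^esub> f i) (f j)) B)"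
    have bil: "bilinear_form ?D ?D (%\<theta>1 \<theta>2. \<theta>1 h * \<theta>2 k)" if "h \<in> carrier H" "k \<in> carrier H" for h k
     by (intro lin evs that)
    have "\<exists>!u. u \<in> tens ?D ?D & (\<forall>h\<in>carrier H. \<forall>k\<in>carrier H. u (%\<theta>1 \<theta>2. \<theta>1 h * \<theta>2 k) = \<theta> (h \<otimes>\<^bsub>H\<^esub> k))"
    proof (rule ex1I[of _ ?u], intro conjI ballI)
     show "?u \<in> tens ?D ?D"
      by (intro tens_sum_closed T2_pure_closed smD) auto
     fix h k assume hk: "h \<in> carrier H" "k \<in> carrier H"
     have 1: "linear_form H (%h. \<theta> (h \<otimes>\<^bsub>H\<^esub> k))" "linear_form H (%k. \<theta> (e i \<otimes>\<^bsub>H\<^esub> k))" if "i < n" for i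
      by (intro linear_form_compose[OF D_lin[OF \<theta>]] hopf_lin hk; simp add: that)+
     have lin1: "linear_form H (%h. \<theta> (h \<otimes>\<^bsub>H\<^esub> k))"
      by (intro linear_form_compose[OF D_lin[OF \<theta>]] hopf_lin hk)
     have "?u (%\<theta>1 \<theta>2. \<theta>1 h * \<theta>2 k) = (\<Sum>i<n. f i h * (\<Sum>j<n. f j k * \<theta> (e i \<otimes>\<^bsub>H\<^esub> e j)))"
      by (simp add: bil[OF hk] simps(6) hk sum_distrib_left mult_ac)
     also have "... = \<theta> (h \<otimes>\<^bsub>H\<^esub> k)"
      by (simp add: expH[OF hk(1) lin1] expH[OF hk(2) 1(2)])
     finally show "?u (%\<theta>1 \<theta>2. \<theta>1 h * \<theta>2 k) = \<theta> (h \<otimes>\<^bsub>H\<^esub> k)" .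
    next
     have exp: "u B = (\<Sum>i<n. \<Sum>j<n. u (%\<theta>1 \<theta>2. \<theta>1 (e i) * \<theta>2 (e j)) * B (f i) (f j))"
      if u: "u \<in> tens ?D ?D" and B: "bilinear_form ?D ?D B" for u B
     proof -
      have "u B = u (%\<theta>1 \<theta>2. \<Sum>i<n. \<Sum>j<n. \<theta>1 (e i) * \<theta>2 (e j) * B (f i) (f j))"
      proof (rule tens_cong[OF u vD vD])
       fix \<theta>1 \<theta>2 assume t: "\<theta>1 \<in> carrier ?D" "\<theta>2 \<in> carrier ?D"
       have "B \<theta>1 \<theta>2 = (\<Sum>i<n. \<theta>1 (e i) * B (f i) \<theta>2)"
        by (rule expD[OF t(1)]) (use B t in \<open>simp add: bilinear_form_def\<close>)
       also have "... = (\<Sum>i<n. \<theta>1 (e i) * (\<Sum>j<n. \<theta>2 (e j) * B (f i) (f j)))"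
        by (rule sum.cong[OF refl], rule arg_cong[where f = "%y. _ * y"], rule expD[OF t(2)])
         (use B t in \<open>simp add: bilinear_form_def\<close>)
       finally show "B \<theta>1 \<theta>2 = (\<Sum>i<n. \<Sum>j<n. \<theta>1 (e i) * \<theta>2 (e j) * B (f i) (f j))"
        by (simp add: sum_distrib_left mult.assoc)
      qed
      also have "... = (\<Sum>i<n. u (%\<theta>1 \<theta>2. \<Sum>j<n. \<theta>1 (e i) * \<theta>2 (e j) * B (f i) (f j)))"
       by (rule tens_sum[OF u]) (intro lin evs; simp)
      also have "... = (\<Sum>i<n. \<Sum>j<n. u (%\<theta>1 \<theta>2. \<theta>1 (e i) * \<theta>2 (e j) * B (f i) (f j)))"
       by (intro sum.cong[OF refl] tens_sum[OF u] lin evs; simp)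
      finally show ?thesis by (simp add: tens_scale(2)[OF u])
     qed
     fix u assume u: "u \<in> tens ?D ?D & (\<forall>h\<in>carrier H. \<forall>k\<in>carrier H. u (%\<theta>1 \<theta>2. \<theta>1 h * \<theta>2 k) = \<theta> (h \<otimes>\<^bsub>H\<^esub> k))"
     show "u = ?u"
     proof (rule tens_eqI)
      show "?u \<in> tens ?D ?D" by (intro tens_sum_closed T2_pure_closed smD) auto
      fix B assume B: "bilinear_form ?D ?D B"
      have "B (c \<odot>\<^bsub>?D\<^esub> f i) (f j) = c * B (f i) (f j)" if "i < n" "j < n" for i j c
       using B that by (simp add: bilinear_form_def linear_form_def)
      then show "u B = ?u B" using exp[OF _ B, of u] u by (simp add: B)
     qed (use u in simp)
    qed
    from theI'[OF this] show ?thesis unfolding dual_comult_def da .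
  qed
  have "dual_pair H ?D (%h \<theta>. \<theta> h) n e f"
  proof (intro dual_pair.intro[OF H] dual_pair_axioms.intro)
    fix h \<theta> \<theta>' assume c: "h \<in> carrier H" "\<theta> \<in> carrier ?D" "\<theta>' \<in> carrier ?D"
    show "(\<theta> \<otimes>\<^bsub>?D\<^esub> \<theta>') h = comult H h (%a b. \<theta> a * \<theta>' b)" using c by (simp add: simps(2))
  next
    fix \<theta> \<theta>' assume c: "\<theta> \<in> carrier ?D" "\<theta>' \<in> carrier ?D"
    show "\<theta> \<otimes>\<^bsub>?D\<^esub> \<theta>' \<in> carrier ?D" unfolding simps(2) restr
     by (intro hopf_lin linear_form_compose[OF D_lin[OF c(1)]] linear_form_compose[OF D_lin[OF c(2)]])
  next
    show "\<one>\<^bsub>?D\<^esub> \<in> carrier ?D" unfolding simps(3) restr by (rule counit_form)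
  next
    fix \<theta> assume c: "\<theta> \<in> carrier ?D"
    show "antipode ?D \<theta> \<in> carrier ?D" unfolding simps(9) restr
     by (intro hopf_lin linear_form_compose[OF D_lin[OF c]])
  next
    fix i j assume "i < n" "j < n"
    then show "f j (e i) = (if i = j then 1 else 0)" by (auto simp: f_def f0e)
  qed (use vD ev expH expD comult in \<open>auto simp: simps(3,7-9)\<close>)
  then show thesis by (rule that)
qed

section \<open>Coactions and actions in terms of functionals\<close>

lemma tensor_lift_eq_iff:
  assumes Z: "vspace Z" and t: "t \<in> tens V W" and b: "bilinear_map V W Z b" and z: "z \<in> carrier Z"
  shows "z = tensor_lift V W Z b t \<longleftrightarrow> (\<forall>g. linear_form Z g --> g z = t (%v w. g (b v w)))"
proof
  assume "z = tensor_lift V W Z b t"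
  then show "\<forall>g. linear_form Z g --> g z = t (%v w. g (b v w))"
    by (simp add: tensor_lift_form(2)[OF Z t b])
next
  assume "\<forall>g. linear_form Z g --> g z = t (%v w. g (b v w))"
  then show "z = tensor_lift V W Z b t"
    by (intro forms_separate[OF Z z tensor_lift_form(1)[OF Z t b]]) (simp add: tensor_lift_form(2)[OF Z t b])
qed

definition coalg :: "('k::field, 'h) hopf => bool" where
  "coalg C \<longleftrightarrow> k_algebra C & linear_map C (tensor_alg C C) (comult C) & linear_form C (counit C)"

lemma (in fd_hopf_algebra) coalg: "coalg K" "coalg (opp K)"
  using comult_linear alg counit_form k_algebra_opp[OF alg]
  by (auto simp: coalg_def linear_map_def tensor_alg_def)

lemma left_coaction_iff:
  assumes C: "coalg C" and X: "k_algebra X"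
  shows "left_coaction C X \<alpha> \<longleftrightarrow> \<alpha> \<in> extensional (carrier X) & linear_map X (tensor_alg C X) \<alpha> &
    (\<forall>x\<in>carrier X. \<forall>y\<in>carrier X. \<forall>F. bilinear_form C X F -->
     \<alpha> (x \<otimes>\<^bsub>X\<^esub> y) F = \<alpha> x (%c x'. \<alpha> y (%c' y'. F (c \<otimes>\<^bsub>C\<^esub> c') (x' \<otimes>\<^bsub>X\<^esub> y')))) &
    (\<forall>F. bilinear_form C X F --> \<alpha> \<one>\<^bsub>X\<^esub> F = F \<one>\<^bsub>C\<^esub> \<one>\<^bsub>X\<^esub>) &
    (\<forall>x\<in>carrier X. \<forall>T. trilinear_form C C X T -->
     \<alpha> x (%c y. comult C c (%a b. T a b y)) = \<alpha> x (%a y. \<alpha> y (%b z. T a b z))) &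
    (\<forall>x\<in>carrier X. \<forall>g. linear_form X g --> \<alpha> x (%c y. counit C c * g y) = g x)"
proof -
  have c: "k_algebra C" "linear_map C (tensor_alg C C) (comult C)" "linear_form C (counit C)"
    using C by (auto simp: coalg_def)
  have vX: "vspace X" "vspace C" using X c by (auto intro: k_algebra_vspace)
  have b: "bilinear_map C X X (%c x'. counit C c \<odot>\<^bsub>X\<^esub> x')" by (intro lin vX c linear_form_compose[OF c(3)])
  have lift: "tensor_lift C X X (%c x'. counit C c \<odot>\<^bsub>X\<^esub> x') (\<alpha> x) = x \<longleftrightarrow>
     (\<forall>g. linear_form X g --> \<alpha> x (%c y. counit C c * g y) = g x)"
    if x: "x \<in> carrier X" and t: "\<alpha> x \<in> tens C X" for x
  proof -
    have "\<alpha> x (%v w. g (counit C v \<odot>\<^bsub>X\<^esub> w)) = \<alpha> x (%c y. counit C c * g y)" if "linear_form X g" for g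
     by (rule tens_cong[OF t vX(2,1)]) (simp add: linear_form_smult[OF that])
    then show ?thesis
     using tensor_lift_form(2)[OF vX(1) t b] tensor_lift_eqI[OF vX(1) t b x] by force
  qed
  have "(\<forall>x\<in>carrier X. tensor_lift C X X (%c x'. counit C c \<odot>\<^bsub>X\<^esub> x') (\<alpha> x) = x) \<longleftrightarrow>
    (\<forall>x\<in>carrier X. \<forall>g. linear_form X g --> \<alpha> x (%c y. counit C c * g y) = g x)"
    if "linear_map X (tensor_alg C X) \<alpha>"
    using lift linear_map_tensD(1)[OF that] by simp
  then show ?thesis
    unfolding left_coaction_def Int_iff alg_hom_tens_iff[OF X c(1) X] map_left_def map_right_def T3_eq_iff
    by blast
qed

lemma right_coaction_iff:
  assumes C: "coalg C" and X: "k_algebra X"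
  shows "right_coaction C X \<alpha> \<longleftrightarrow> \<alpha> \<in> extensional (carrier X) & linear_map X (tensor_alg X C) \<alpha> &
    (\<forall>x\<in>carrier X. \<forall>y\<in>carrier X. \<forall>F. bilinear_form X C F -->
     \<alpha> (x \<otimes>\<^bsub>X\<^esub> y) F = \<alpha> x (%x' c. \<alpha> y (%y' c'. F (x' \<otimes>\<^bsub>X\<^esub> y') (c \<otimes>\<^bsub>C\<^esub> c')))) &
    (\<forall>F. bilinear_form X C F --> \<alpha> \<one>\<^bsub>X\<^esub> F = F \<one>\<^bsub>X\<^esub> \<one>\<^bsub>C\<^esub>) &
    (\<forall>x\<in>carrier X. \<forall>T. trilinear_form X C C T -->
     \<alpha> x (%y c. comult C c (%a b. T y a b)) = \<alpha> x (%y b. \<alpha> y (%z a. T z a b))) &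
    (\<forall>x\<in>carrier X. \<forall>g. linear_form X g --> \<alpha> x (%y c. counit C c * g y) = g x)"
proof -
  have c: "k_algebra C" "linear_map C (tensor_alg C C) (comult C)" "linear_form C (counit C)"
    using C by (auto simp: coalg_def)
  have vX: "vspace X" "vspace C" using X c by (auto intro: k_algebra_vspace)
  have b: "bilinear_map X C X (%x' c. counit C c \<odot>\<^bsub>X\<^esub> x')" by (intro lin vX c linear_form_compose[OF c(3)])
  have lift: "tensor_lift X C X (%x' c. counit C c \<odot>\<^bsub>X\<^esub> x') (\<alpha> x) = x \<longleftrightarrow>
     (\<forall>g. linear_form X g --> \<alpha> x (%y c. counit C c * g y) = g x)"
    if x: "x \<in> carrier X" and t: "\<alpha> x \<in> tens X C" for x
  proof -
    have "\<alpha> x (%w v. g (counit C v \<odot>\<^bsub>X\<^esub> w)) = \<alpha> x (%y c. counit C c * g y)" if "linear_form X g" for g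
     by (rule tens_cong[OF t vX]) (simp add: linear_form_smult[OF that])
    then show ?thesis
     using tensor_lift_form(2)[OF vX(1) t b] tensor_lift_eqI[OF vX(1) t b x] by force
  qed
  have "(\<forall>x\<in>carrier X. tensor_lift X C X (%x' c. counit C c \<odot>\<^bsub>X\<^esub> x') (\<alpha> x) = x) \<longleftrightarrow>
    (\<forall>x\<in>carrier X. \<forall>g. linear_form X g --> \<alpha> x (%y c. counit C c * g y) = g x)"
    if "linear_map X (tensor_alg X C) \<alpha>"
    using lift linear_map_tensD(1)[OF that] by simp
  then show ?thesis
    unfolding right_coaction_def Int_iff alg_hom_tens_iff[OF X X c(1)] map_left_def map_right_def T3_eq_iff
    by blast
qed

lemma (in fd_hopf_algebra) right_action_iff:
  assumes X: "k_algebra X"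
  shows "right_action K X a \<longleftrightarrow>
    (a \<in> extensional (carrier X) & (\<forall>x\<in>carrier X. a x \<in> extensional (carrier K))) &
    bilinear_map X K X a &
    (\<forall>x\<in>carrier X. a x \<one>\<^bsub>K\<^esub> = x) &
    (\<forall>k\<in>carrier K. \<forall>k'\<in>carrier K. \<forall>x\<in>carrier X. a x (k \<otimes>\<^bsub>K\<^esub> k') = a (a x k) k') &
    (\<forall>k\<in>carrier K. \<forall>x\<in>carrier X. \<forall>y\<in>carrier X. \<forall>g. linear_form X g -->
      g (a (x \<otimes>\<^bsub>X\<^esub> y) k) = comult K k (%k1 k2. g (a x k1 \<otimes>\<^bsub>X\<^esub> a y k2))) &
    (\<forall>k\<in>carrier K. a \<one>\<^bsub>X\<^esub> k = counit K k \<odot>\<^bsub>X\<^esub> \<one>\<^bsub>X\<^esub>)"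
proof (cases "bilinear_map X K X a")
  case a: True
  interpret X: ring X using X by (rule k_algebra_ring)
  note vX [simp] = k_algebra_vspace[OF X]
  note ac [simp] = bilinear_map_closed[OF a]
  have b: "bilinear_map K K X (%k1 k2. a x k1 \<otimes>\<^bsub>X\<^esub> a y k2)" if "x \<in> carrier X" "y \<in> carrier X" for x y
    by (intro lin X bilinear_map_slot[OF a]; simp add: that)
  have "a (x \<otimes>\<^bsub>X\<^esub> y) k = tensor_lift K K X (%k1 k2. a x k1 \<otimes>\<^bsub>X\<^esub> a y k2) (comult K k) \<longleftrightarrow>
    (\<forall>g. linear_form X g --> g (a (x \<otimes>\<^bsub>X\<^esub> y) k) = comult K k (%k1 k2. g (a x k1 \<otimes>\<^bsub>X\<^esub> a y k2)))"
    if "k \<in> carrier K" "x \<in> carrier X" "y \<in> carrier X" for k x y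
    by (rule tensor_lift_eq_iff[OF vX comult_closed[OF that(1)] b[OF that(2,3)]]) (simp add: that)
  then show ?thesis unfolding right_action_def by (simp cong: ball_cong conj_cong)
qed (auto simp: right_action_def)

lemma (in fd_hopf_algebra) left_action_iff:
  assumes X: "k_algebra X"
  shows "left_action K X a \<longleftrightarrow>
    (a \<in> extensional (carrier K) & (\<forall>k\<in>carrier K. a k \<in> extensional (carrier X))) &
    bilinear_map K X X a &
    (\<forall>x\<in>carrier X. a \<one>\<^bsub>K\<^esub> x = x) &
    (\<forall>k\<in>carrier K. \<forall>k'\<in>carrier K. \<forall>x\<in>carrier X. a (k \<otimes>\<^bsub>K\<^esub> k') x = a k (a k' x)) &
    (\<forall>k\<in>carrier K. \<forall>x\<in>carrier X. \<forall>y\<in>carrier X. \<forall>g. linear_form X g -->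
      g (a k (x \<otimes>\<^bsub>X\<^esub> y)) = comult K k (%k1 k2. g (a k1 x \<otimes>\<^bsub>X\<^esub> a k2 y))) &
    (\<forall>k\<in>carrier K. a k \<one>\<^bsub>X\<^esub> = counit K k \<odot>\<^bsub>X\<^esub> \<one>\<^bsub>X\<^esub>)"
proof (cases "bilinear_map K X X a")
  case a: True
  interpret X: ring X using X by (rule k_algebra_ring)
  note vX [simp] = k_algebra_vspace[OF X]
  note ac [simp] = bilinear_map_closed[OF a]
  have b: "bilinear_map K K X (%k1 k2. a k1 x \<otimes>\<^bsub>X\<^esub> a k2 y)" if "x \<in> carrier X" "y \<in> carrier X" for x y
    by (intro lin X bilinear_map_slot[OF a]; simp add: that)
  have "a k (x \<otimes>\<^bsub>X\<^esub> y) = tensor_lift K K X (%k1 k2. a k1 x \<otimes>\<^bsub>X\<^esub> a k2 y) (comult K k) \<longleftrightarrow>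
    (\<forall>g. linear_form X g --> g (a k (x \<otimes>\<^bsub>X\<^esub> y)) = comult K k (%k1 k2. g (a k1 x \<otimes>\<^bsub>X\<^esub> a k2 y)))"
    if "k \<in> carrier K" "x \<in> carrier X" "y \<in> carrier X" for k x y
    by (rule tensor_lift_eq_iff[OF vX comult_closed[OF that(1)] b[OF that(2,3)]]) (simp add: that)
  then show ?thesis unfolding left_action_def by (simp cong: ball_cong conj_cong)
qed (auto simp: left_action_def)

section \<open>Coactions of L are actions of K\<close>

context dual_pair
begin

text \<open>Triple tensors with a leg in L are determined by pairing this leg with the elements of K.\<close>

lemma tens3_expand:
  shows "t1 \<in> tens3 L V1 W1 ==> trilinear_form L V1 W1 G1 ==> vspace V1 ==> vspace W1 ==>
     t1 G1 = (\<Sum>i<n. t1 (%l v w. p (e i) l * G1 (f i) v w))"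
    and "t2 \<in> tens3 U2 L W2 ==> trilinear_form U2 L W2 G2 ==> vspace U2 ==> vspace W2 ==>
     t2 G2 = (\<Sum>i<n. t2 (%u l w. p (e i) l * G2 u (f i) w))"
    and "t3 \<in> tens3 U3 V3 L ==> trilinear_form U3 V3 L G3 ==> vspace U3 ==> vspace V3 ==>
     t3 G3 = (\<Sum>i<n. t3 (%u v l. p (e i) l * G3 u v (f i)))"
proof -
  assume t: "t1 \<in> tens3 L V1 W1" and T: "trilinear_form L V1 W1 G1" and V: "vspace V1" "vspace W1"
  have "t1 G1 = t1 (%l v w. \<Sum>i<n. p (e i) l * G1 (f i) v w)"
    by (rule tens3_cong[OF t vspace_L V], rule expand_L) (use T in \<open>simp_all add: trilinear_form_def\<close>)
  also have "... = (\<Sum>i<n. t1 (%l v w. p (e i) l * G1 (f i) v w))"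
    by (rule tens3_scale_sum[OF t]) (intro pair_lin trilinear_form_slot[OF T]; simp)
  finally show "t1 G1 = (\<Sum>i<n. t1 (%l v w. p (e i) l * G1 (f i) v w))" .
next
  assume t: "t2 \<in> tens3 U2 L W2" and T: "trilinear_form U2 L W2 G2" and V: "vspace U2" "vspace W2"
  have "t2 G2 = t2 (%u l w. \<Sum>i<n. p (e i) l * G2 u (f i) w)"
    by (rule tens3_cong[OF t V(1) vspace_L V(2)], rule expand_L[where g = "%l. G2 _ l _"]) (use T in \<open>simp_all add: trilinear_form_def\<close>)
  also have "... = (\<Sum>i<n. t2 (%u l w. p (e i) l * G2 u (f i) w))"
    by (rule tens3_scale_sum[OF t]) (intro pair_lin trilinear_form_slot[OF T]; simp)
  finally show "t2 G2 = (\<Sum>i<n. t2 (%u l w. p (e i) l * G2 u (f i) w))" .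
next
  assume t: "t3 \<in> tens3 U3 V3 L" and T: "trilinear_form U3 V3 L G3" and V: "vspace U3" "vspace V3"
  have "t3 G3 = t3 (%u v l. \<Sum>i<n. p (e i) l * G3 u v (f i))"
    by (rule tens3_cong[OF t V vspace_L], rule expand_L) (use T in \<open>simp_all add: trilinear_form_def\<close>)
  also have "... = (\<Sum>i<n. t3 (%u v l. p (e i) l * G3 u v (f i)))"
    by (rule tens3_scale_sum[OF t]) (intro pair_lin trilinear_form_slot[OF T]; simp)
  finally show "t3 G3 = (\<Sum>i<n. t3 (%u v l. p (e i) l * G3 u v (f i)))" .
qed

lemma coalg_L: "coalg L"
  using fd_hopf_algebra.coalg(1)[OF dual_fd_hopf_algebra] .

definition ract_of :: "('k, 'x, 'z) module_scheme => ('x => ('k, 'b, 'x) tensor) => ('x => 'a => 'x) => bool" where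
  "ract_of X \<beta> a \<longleftrightarrow> \<beta> \<in> extensional (carrier X) & linear_map X (tensor_alg L X) \<beta> &
    (a \<in> extensional (carrier X) & (\<forall>x\<in>carrier X. a x \<in> extensional (carrier K))) & bilinear_map X K X a &
    (\<forall>x\<in>carrier X. \<forall>k\<in>carrier K. \<forall>g. linear_form X g --> g (a x k) = \<beta> x (%l y. p k l * g y))"

definition lact_of :: "('k, 'x, 'z) module_scheme => ('x => ('k, 'x, 'b) tensor) => ('a => 'x => 'x) => bool" where
  "lact_of X \<beta> a \<longleftrightarrow> \<beta> \<in> extensional (carrier X) & linear_map X (tensor_alg X L) \<beta> &
    (a \<in> extensional (carrier K) & (\<forall>k\<in>carrier K. a k \<in> extensional (carrier X))) & bilinear_map K X X a &
    (\<forall>x\<in>carrier X. \<forall>k\<in>carrier K. \<forall>g. linear_form X g --> g (a k x) = \<beta> x (%y l. p k l * g y))"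

lemma ract_ofD:
  assumes "ract_of X \<beta> a"
  shows "linear_map X (tensor_alg L X) \<beta>" "bilinear_map X K X a"
    and "x \<in> carrier X ==> k \<in> carrier K ==> linear_form X g ==> g (a x k) = \<beta> x (%l y. p k l * g y)"
  using assms by (auto simp: ract_of_def)

lemma lact_ofD:
  assumes "lact_of X \<beta> a"
  shows "linear_map X (tensor_alg X L) \<beta>" "bilinear_map K X X a"
    and "x \<in> carrier X ==> k \<in> carrier K ==> linear_form X g ==> g (a k x) = \<beta> x (%y l. p k l * g y)"
  using assms by (auto simp: lact_of_def)

lemma ract_of_induced:
  assumes X: "k_algebra X" and \<beta>: "\<beta> \<in> extensional (carrier X)" "linear_map X (tensor_alg L X) \<beta>"
  shows "ract_of X \<beta> (induced_ract K L p X \<beta>)"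
proof -
  note vX [simp] = k_algebra_vspace[OF X]
  have b: "bilinear_map L X X (%l x'. p k l \<odot>\<^bsub>X\<^esub> x')" if "k \<in> carrier K" for k
    by (intro pair_lin vX that)
  note lift = tensor_lift_form[OF vX linear_map_tensD(1)[OF \<beta>(2)] b]
  let ?a = "induced_ract K L p X \<beta>"
  have form: "g (?a x k) = \<beta> x (%l y. p k l * g y)" if "x \<in> carrier X" "k \<in> carrier K" "linear_form X g" for x k g
    unfolding induced_ract_def using that
    by (simp add: lift(2)) (rule tens_cong[OF linear_map_tensD(1)[OF \<beta>(2)] vspace_L vX], simp_all add: linear_form_smult)
  have closed: "?a x k \<in> carrier X" if "x \<in> carrier X" "k \<in> carrier K" for x k
    unfolding induced_ract_def using that lift(1) by simp
  have ring: "ring X" using X by (rule k_algebra_ring)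
  note [simp] = vspace_add_closed[OF vX] vspace_smult(1)[OF vX] vspace_add_closed[OF vK] vspace_smult(1)[OF vK]
  have bil: "bilinear_map X K X ?a"
  proof (intro bilinear_mapI linear_mapI)
    fix x y k assume c: "x \<in> carrier X" "y \<in> carrier X" "k \<in> carrier K"
    show "?a (x \<oplus>\<^bsub>X\<^esub> y) k = ?a x k \<oplus>\<^bsub>X\<^esub> ?a y k"
     by (rule forms_separate[OF vX])
      (simp_all add: c closed form linear_form_add linear_form_add[OF linear_map_tensD(2)[OF \<beta>(2) linear_map_id]])
  next
    fix x c k assume c: "x \<in> carrier X" "k \<in> carrier K"
    show "?a (c \<odot>\<^bsub>X\<^esub> x) k = c \<odot>\<^bsub>X\<^esub> ?a x k"
     by (rule forms_separate[OF vX])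
      (simp_all add: c closed form linear_form_smult linear_form_smult[OF linear_map_tensD(2)[OF \<beta>(2) linear_map_id]])
  next
    fix x k k' assume c: "x \<in> carrier X" "k \<in> carrier K" "k' \<in> carrier K"
    show "?a x (k \<oplus> k') = ?a x k \<oplus>\<^bsub>X\<^esub> ?a x k'"
    proof (rule forms_separate[OF vX])
     fix g assume g: "linear_form X g"
     have lk: "linear_form K (%k. \<beta> x (%l y. p k l * g y))"
      by (intro linear_map_tensD(3)[OF \<beta>(2)] pair_lin linear_form_compose[OF g]; simp add: c)
     show "g (?a x (k \<oplus> k')) = g (?a x k \<oplus>\<^bsub>X\<^esub> ?a x k')"
      using linear_form_add[OF lk c(2,3)] by (simp add: c closed form g linear_form_add[OF g])
    qed (simp_all add: c closed)
  next
    fix x k c assume c: "x \<in> carrier X" "k \<in> carrier K"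
    show "?a x (c \<odot> k) = c \<odot>\<^bsub>X\<^esub> ?a x k"
    proof (rule forms_separate[OF vX])
     fix g assume g: "linear_form X g"
     have lk: "linear_form K (%k. \<beta> x (%l y. p k l * g y))"
      by (intro linear_map_tensD(3)[OF \<beta>(2)] pair_lin linear_form_compose[OF g]; simp add: c)
     show "g (?a x (c \<odot> k)) = g (c \<odot>\<^bsub>X\<^esub> ?a x k)"
      using linear_form_smult[OF lk c(2)] by (simp add: c closed form g linear_form_smult[OF g])
    qed (simp_all add: c closed)
  qed (simp_all add: closed)
  then show ?thesis
    unfolding ract_of_def using \<beta> form by (auto simp: induced_ract_def)
qed

lemma lact_of_induced:
  assumes X: "k_algebra X" and \<beta>: "\<beta> \<in> extensional (carrier X)" "linear_map X (tensor_alg X L) \<beta>"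
  shows "lact_of X \<beta> (induced_lact K L p X \<beta>)"
proof -
  note vX [simp] = k_algebra_vspace[OF X]
  have b: "bilinear_map X L X (%x' l. p k l \<odot>\<^bsub>X\<^esub> x')" if "k \<in> carrier K" for k
    by (intro pair_lin vX that)
  note lift = tensor_lift_form[OF vX linear_map_tensD(1)[OF \<beta>(2)] b]
  let ?a = "induced_lact K L p X \<beta>"
  have form: "g (?a k x) = \<beta> x (%y l. p k l * g y)" if "x \<in> carrier X" "k \<in> carrier K" "linear_form X g" for x k g
    unfolding induced_lact_def using that
    by (simp add: lift(2)) (rule tens_cong[OF linear_map_tensD(1)[OF \<beta>(2)] vX vspace_L], simp_all add: linear_form_smult)
  have closed: "?a k x \<in> carrier X" if "x \<in> carrier X" "k \<in> carrier K" for x k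
    unfolding induced_lact_def using that lift(1) by simp
  note [simp] = vspace_add_closed[OF vX] vspace_smult(1)[OF vX] vspace_add_closed[OF vK] vspace_smult(1)[OF vK]
  have bil: "bilinear_map K X X ?a"
  proof (intro bilinear_mapI linear_mapI)
    fix x y k assume c: "x \<in> carrier X" "y \<in> carrier X" "k \<in> carrier K"
    show "?a k (x \<oplus>\<^bsub>X\<^esub> y) = ?a k x \<oplus>\<^bsub>X\<^esub> ?a k y"
     by (rule forms_separate[OF vX])
      (simp_all add: c closed form linear_form_add linear_form_add[OF linear_map_tensD(2)[OF \<beta>(2) linear_map_id]])
  next
    fix x c k assume c: "x \<in> carrier X" "k \<in> carrier K"
    show "?a k (c \<odot>\<^bsub>X\<^esub> x) = c \<odot>\<^bsub>X\<^esub> ?a k x"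
     by (rule forms_separate[OF vX])
      (simp_all add: c closed form linear_form_smult linear_form_smult[OF linear_map_tensD(2)[OF \<beta>(2) linear_map_id]])
  next
    fix x k k' assume c: "x \<in> carrier X" "k \<in> carrier K" "k' \<in> carrier K"
    show "?a (k \<oplus> k') x = ?a k x \<oplus>\<^bsub>X\<^esub> ?a k' x"
    proof (rule forms_separate[OF vX])
     fix g assume g: "linear_form X g"
     have lk: "linear_form K (%k. \<beta> x (%y l. p k l * g y))"
      by (intro linear_map_tensD(3)[OF \<beta>(2)] pair_lin linear_form_compose[OF g]; simp add: c)
     show "g (?a (k \<oplus> k') x) = g (?a k x \<oplus>\<^bsub>X\<^esub> ?a k' x)"
      using linear_form_add[OF lk c(2,3)] by (simp add: c closed form g linear_form_add[OF g])
    qed (simp_all add: c closed)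
  next
    fix x k c assume c: "x \<in> carrier X" "k \<in> carrier K"
    show "?a (c \<odot> k) x = c \<odot>\<^bsub>X\<^esub> ?a k x"
    proof (rule forms_separate[OF vX])
     fix g assume g: "linear_form X g"
     have lk: "linear_form K (%k. \<beta> x (%y l. p k l * g y))"
      by (intro linear_map_tensD(3)[OF \<beta>(2)] pair_lin linear_form_compose[OF g]; simp add: c)
     show "g (?a (c \<odot> k) x) = g (c \<odot>\<^bsub>X\<^esub> ?a k x)"
      using linear_form_smult[OF lk c(2)] by (simp add: c closed form g linear_form_smult[OF g])
    qed (simp_all add: c closed)
  qed (simp_all add: closed)
  then show ?thesis
    unfolding lact_of_def using \<beta> form by (auto simp: induced_lact_def)
qed

lemma ract_of_unique:
  assumes X: "vspace X" and r: "ract_of X \<beta> a" "ract_of X \<beta>' a'"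
  shows "\<beta> = \<beta>' \<longleftrightarrow> a = a'"
proof
  assume eq: "\<beta> = \<beta>'"
  show "a = a'"
  proof (rule extensionalityI)
    fix x assume x: "x \<in> carrier X"
    show "a x = a' x"
    proof (rule extensionalityI)
     show "a x \<in> extensional (carrier K)" "a' x \<in> extensional (carrier K)" using r x by (auto simp: ract_of_def)
     fix k assume k: "k \<in> carrier K"
     show "a x k = a' x k"
      by (rule forms_separate[OF X])
       (use x k in \<open>simp_all add: eq ract_ofD(3)[OF r(1)] ract_ofD(3)[OF r(2)]
        bilinear_map_closed[OF ract_ofD(2)[OF r(1)]] bilinear_map_closed[OF ract_ofD(2)[OF r(2)]]\<close>)
    qed
  qed (use r in \<open>auto simp: ract_of_def\<close>)
next
  assume eq: "a = a'"
  show "\<beta> = \<beta>'"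
  proof (rule extensionalityI)
    fix x assume x: "x \<in> carrier X"
    show "\<beta> x = \<beta>' x"
    proof (rule tens_left_eqI[OF X])
     show "\<beta> x \<in> tens L X" "\<beta>' x \<in> tens L X" using r x by (auto simp: ract_of_def linear_map_tensD(1))
     fix k g assume "k \<in> carrier K" "linear_form X g"
     then have "g (a x k) = \<beta> x (%l y. p k l * g y)" "g (a' x k) = \<beta>' x (%l y. p k l * g y)"
      using r x unfolding ract_of_def by blast+
     then show "\<beta> x (%l v. p k l * g v) = \<beta>' x (%l v. p k l * g v)" by (simp add: eq)
    qed
  qed (use r in \<open>auto simp: ract_of_def\<close>)
qed

lemma lact_of_unique:
  assumes X: "vspace X" and r: "lact_of X \<beta> a" "lact_of X \<beta>' a'"
  shows "\<beta> = \<beta>' \<longleftrightarrow> a = a'"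
proof
  assume eq: "\<beta> = \<beta>'"
  show "a = a'"
  proof (rule extensionalityI)
    fix k assume k: "k \<in> carrier K"
    show "a k = a' k"
    proof (rule extensionalityI)
     show "a k \<in> extensional (carrier X)" "a' k \<in> extensional (carrier X)" using r k by (auto simp: lact_of_def)
     fix x assume x: "x \<in> carrier X"
     show "a k x = a' k x"
      by (rule forms_separate[OF X])
       (use x k in \<open>simp_all add: eq lact_ofD(3)[OF r(1)] lact_ofD(3)[OF r(2)]
        bilinear_map_closed[OF lact_ofD(2)[OF r(1)]] bilinear_map_closed[OF lact_ofD(2)[OF r(2)]]\<close>)
    qed
  qed (use r in \<open>auto simp: lact_of_def\<close>)
next
  assume eq: "a = a'"
  show "\<beta> = \<beta>'"
  proof (rule extensionalityI)
    fix x assume x: "x \<in> carrier X"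
    show "\<beta> x = \<beta>' x"
    proof (rule tens_right_eqI[OF X])
     show "\<beta> x \<in> tens X L" "\<beta>' x \<in> tens X L" using r x by (auto simp: lact_of_def linear_map_tensD(1))
     fix k g assume "k \<in> carrier K" "linear_form X g"
     then have "g (a k x) = \<beta> x (%y l. p k l * g y)" "g (a' k x) = \<beta>' x (%y l. p k l * g y)"
      using r x unfolding lact_of_def by blast+
     then show "\<beta> x (%v l. g v * p k l) = \<beta>' x (%v l. g v * p k l)" by (simp add: eq mult.commute)
    qed
  qed (use r in \<open>auto simp: lact_of_def\<close>)
qed

lemma ract_of_exists:
  assumes X: "k_algebra X" and a: "a \<in> extensional (carrier X)" "\<forall>x\<in>carrier X. a x \<in> extensional (carrier K)"
    "bilinear_map X K X a"
  shows "\<exists>\<beta>. ract_of X \<beta> a"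
proof
  note vX [simp] = k_algebra_vspace[OF X]
  note ac [simp] = bilinear_map_closed[OF a(3)]
  let ?b = "\<lambda>x\<in>carrier X. T2 L X (%B. \<Sum>i<n. B (f i) (a x (e i)))"
  have "linear_form X (%x. ?b x B)" if B: "bilinear_form L X B" for B
  proof (subst linear_form_cong[OF vX])
    show "linear_form X (%x. \<Sum>i<n. B (f i) (a x (e i)))"
     by (intro lin bilinear_form_slot[OF B] bilinear_map_slot[OF a(3)]; simp)
  qed (simp add: B)
  then have "linear_map X (tensor_alg L X) ?b"
    unfolding linear_map_tens'[OF vX] by (auto intro!: tens_rep_closed)
  moreover have "g (a x k) = ?b x (%l y. p k l * g y)"
    if "x \<in> carrier X" "k \<in> carrier K" and g: "linear_form X g" for x k g
  proof -
    have "bilinear_form L X (%l y. p k l * g y)" by (intro pair_lin linear_form_compose[OF g] that)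
    moreover have "linear_form K (%k. g (a x k))" by (intro linear_form_compose[OF g] bilinear_map_slot[OF a(3)] lin that)
    ultimately show ?thesis using that expand_K[of k "%k. g (a x k)"] by simp
  qed
  ultimately show "ract_of X ?b a" using a unfolding ract_of_def by auto
qed

lemma lact_of_exists:
  assumes X: "k_algebra X" and a: "a \<in> extensional (carrier K)" "\<forall>k\<in>carrier K. a k \<in> extensional (carrier X)"
    "bilinear_map K X X a"
  shows "\<exists>\<beta>. lact_of X \<beta> a"
proof
  note vX [simp] = k_algebra_vspace[OF X]
  note ac [simp] = bilinear_map_closed[OF a(3)]
  let ?b = "\<lambda>x\<in>carrier X. T2 X L (%B. \<Sum>i<n. B (a (e i) x) (f i))"
  have "linear_form X (%x. ?b x B)" if B: "bilinear_form X L B" for B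
  proof (subst linear_form_cong[OF vX])
    show "linear_form X (%x. \<Sum>i<n. B (a (e i) x) (f i))"
     by (intro lin bilinear_form_slot[OF B] bilinear_map_slot[OF a(3)]; simp)
  qed (simp add: B)
  then have "linear_map X (tensor_alg X L) ?b"
    unfolding linear_map_tens'[OF vX] by (auto intro!: tens_rep_closed)
  moreover have "g (a k x) = ?b x (%y l. p k l * g y)"
    if "x \<in> carrier X" "k \<in> carrier K" and g: "linear_form X g" for x k g
  proof -
    have "bilinear_form X L (%y l. p k l * g y)" by (intro pair_lin linear_form_compose[OF g] that)
    moreover have "linear_form K (%k. g (a k x))" by (intro linear_form_compose[OF g] bilinear_map_slot[OF a(3)] lin that)
    ultimately show ?thesis using that expand_K[of k "%k. g (a k x)"] by simp
  qed
  ultimately show "lact_of X ?b a" using a unfolding lact_of_def by auto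
qed

end

lemma map_left_closed:
  assumes f: "linear_map D (tensor_alg U V) f" and t: "t \<in> tens D W" and v: "vspace D" "vspace U" "vspace V" "vspace W"
  shows "map_left U V W f t \<in> tens3 U V W"
  unfolding map_left_def
proof (rule T3_bind_closed[OF t])
  fix d w assume d: "d \<in> carrier D" "w \<in> carrier W"
  show "T3 U V W (%T. f d (%u v. T u v w)) \<in> tens3 U V W"
  proof (rule T3_bind_closed[OF linear_map_tensD(1)[OF f d(1)]])
    fix T assume T: "trilinear_form U V W T"
    show "bilinear_form U V (%u v. T u v w)" by (intro lin trilinear_form_slot[OF T] d)
  qed (simp add: T3_pure_closed d)
next
  fix T assume T: "trilinear_form U V W T"
  show "bilinear_form D W (%d w. f d (%u v. T u v w))"
    by (intro lin linear_map_tensD(2,3)[OF f] trilinear_form_slot[OF T] v; simp)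
qed

lemma map_right_closed:
  assumes f: "linear_map D (tensor_alg V W) f" and t: "t \<in> tens U D" and v: "vspace D" "vspace U" "vspace V" "vspace W"
  shows "map_right U V W f t \<in> tens3 U V W"
  unfolding map_right_def
proof (rule T3_bind_closed[OF t])
  fix d u assume d: "u \<in> carrier U" "d \<in> carrier D"
  show "T3 U V W (%T. f d (%v w. T u v w)) \<in> tens3 U V W"
  proof (rule T3_bind_closed[OF linear_map_tensD(1)[OF f d(2)]])
    fix T assume T: "trilinear_form U V W T"
    show "bilinear_form V W (%v w. T u v w)" by (intro lin trilinear_form_slot[OF T] d)
  qed (simp add: T3_pure_closed d)
next
  fix T assume T: "trilinear_form U V W T"
  show "bilinear_form U D (%u d. f d (%v w. T u v w))"
    by (intro lin linear_map_tensD(2,3)[OF f] trilinear_form_slot[OF T] v; simp)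
qed

lemma map_left_apply: "trilinear_form U V W T ==> map_left U V W f t T = t (%d w. f d (%u v. T u v w))"
  and map_right_apply: "trilinear_form U V W T ==> map_right U V W g s T = s (%u d. g d (%v w. T u v w))"
  by (simp_all add: map_left_def map_right_def)

lemma (in fd_hopf_algebra) one_K_closed [simp]: "\<one>\<^bsub>K\<^esub> \<in> carrier K"
  by (rule monoid.one_closed[OF ring.is_monoid[OF k_algebra_ring[OF alg]]])

context dual_pair
begin

lemma tens3_LLV_eqI:
  assumes V: "vspace V" and st: "s \<in> tens3 L L V" "t \<in> tens3 L L V"
    and eq: "!!k k' g. k \<in> carrier K ==> k' \<in> carrier K ==> linear_form V g ==>
     s (%a b y. p k' b * (p k a * g y)) = t (%a b y. p k' b * (p k a * g y))"
  shows "s = t"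
proof (rule tens3_eqI[OF st])
  fix T assume T: "trilinear_form L L V T"
  have exp: "r T = (\<Sum>i<n. \<Sum>j<n. r (%a b y. p (e j) b * (p (e i) a * T (f i) (f j) y)))" if r: "r \<in> tens3 L L V" for r
  proof -
    have "trilinear_form L L V (%l v w. p (e i) l * T (f i) v w)" if "i < n" for i
     by (intro pair_lin trilinear_form_slot[OF T]; simp add: that)
    then show ?thesis using tens3_expand(1)[OF r T vspace_L V] tens3_expand(2)[OF r _ vspace_L V] by simp
  qed
  show "s T = t T" unfolding exp[OF st(1)] exp[OF st(2)]
    by (intro sum.cong[OF refl] eq) (use T in \<open>auto simp: trilinear_form_def\<close>)
qed

lemma tens3_VLL_eqI:
  assumes V: "vspace V" and st: "s \<in> tens3 V L L" "t \<in> tens3 V L L"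
    and eq: "!!k k' g. k \<in> carrier K ==> k' \<in> carrier K ==> linear_form V g ==>
     s (%y a b. p k' b * (p k a * g y)) = t (%y a b. p k' b * (p k a * g y))"
  shows "s = t"
proof (rule tens3_eqI[OF st])
  fix T assume T: "trilinear_form V L L T"
  have exp: "r T = (\<Sum>i<n. \<Sum>j<n. r (%y a b. p (e j) b * (p (e i) a * T y (f i) (f j))))" if r: "r \<in> tens3 V L L" for r
  proof -
    have "trilinear_form V L L (%w l v. p (e i) l * T w (f i) v)" if "i < n" for i
     by (intro pair_lin trilinear_form_slot[OF T]; simp add: that)
    then show ?thesis using tens3_expand(2)[OF r T V vspace_L] tens3_expand(3)[OF r _ V vspace_L] by simp
  qed
  show "s T = t T" unfolding exp[OF st(1)] exp[OF st(2)]
    by (intro sum.cong[OF refl] eq) (use T in \<open>auto simp: trilinear_form_def\<close>)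
qed

text \<open>Each axiom of a coaction of L, evaluated against the functionals that pair the legs in L with
  elements of K, is the corresponding axiom of an action of K.\<close>

lemma left_coaction_iff_right_action:
  assumes X: "k_algebra X" and r: "ract_of X \<beta> a"
  shows "left_coaction L X \<beta> \<longleftrightarrow> right_action K X a"
proof -
  interpret X: ring X using X by (rule k_algebra_ring)
  note vX [simp] = k_algebra_vspace[OF X]
  note \<beta> = ract_ofD(1)[OF r] and a = ract_ofD(2)[OF r] and form = ract_ofD(3)[OF r]
  note \<beta>t [simp] = linear_map_tensD(1)[OF \<beta>]
  note ac [simp] = bilinear_map_closed[OF a]
  note xlin = pair_lin X linear_map_tensD(2,3)[OF \<beta>] bilinear_map_slot[OF a]
  note bcong = tens_cong[OF \<beta>t vspace_L vX]
  have bxy: "\<beta> x \<otimes>\<^bsub>tensor_alg L X\<^esub> \<beta> y \<in> tens L X" if "x \<in> carrier X" "y \<in> carrier X" for x y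
    using that by (intro tensor_alg_mult_closed[OF alg_L X]) simp_all
  have one: "\<one>\<^bsub>tensor_alg L X\<^esub> \<in> tens L X" using monoid_tensor_alg[OF alg_L X] by (rule monoid.one_closed)
  have eq2: "s = t \<longleftrightarrow> (\<forall>k\<in>carrier K. \<forall>g. linear_form X g --> s (%l y. p k l * g y) = t (%l y. p k l * g y))"
    if "s \<in> tens L X" "t \<in> tens L X" for s t using tens_left_eqI[OF vX that] by auto
  have eqX: "u = v \<longleftrightarrow> (\<forall>g. linear_form X g --> g u = g v)" if "u \<in> carrier X" "v \<in> carrier X" for u v
    using forms_separate[OF vX that] by auto
  have test: "bilinear_form L X (%l y. p k l * g y)" if "k \<in> carrier K" "linear_form X g" for k g
    by (intro xlin linear_form_compose[OF that(2)] that)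
  have mult: "(\<forall>F. bilinear_form L X F -->
     \<beta> (x \<otimes>\<^bsub>X\<^esub> y) F = \<beta> x (%c x'. \<beta> y (%c' y'. F (c \<otimes>\<^bsub>L\<^esub> c') (x' \<otimes>\<^bsub>X\<^esub> y')))) \<longleftrightarrow>
    (\<forall>k\<in>carrier K. \<forall>g. linear_form X g -->
      g (a (x \<otimes>\<^bsub>X\<^esub> y) k) = comult K k (%k1 k2. g (a x k1 \<otimes>\<^bsub>X\<^esub> a y k2)))"
    if xy [simp]: "x \<in> carrier X" "y \<in> carrier X" for x y
  proof -
    have calc: "(\<beta> x \<otimes>\<^bsub>tensor_alg L X\<^esub> \<beta> y) (%l y. p k l * g y) = comult K k (%k1 k2. g (a x k1 \<otimes>\<^bsub>X\<^esub> a y k2))"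
     if k: "k \<in> carrier K" and g: "linear_form X g" for k g
    proof -
     note gl = linear_form_compose[OF g]
     have "(\<beta> x \<otimes>\<^bsub>tensor_alg L X\<^esub> \<beta> y) (%l y. p k l * g y) =
      \<beta> x (%l x'. \<beta> y (%l' y'. comult K k (%k1 k2. p k1 l * (p k2 l' * g (x' \<otimes>\<^bsub>X\<^esub> y')))))"
      unfolding tensor_alg_mult[OF test[OF k g]]
      by (rule bcong[OF xy(1)], rule bcong[OF xy(2)])
       (simp add: p_mult_L k mult.assoc flip: tens_scale(2)[OF comult_closed[OF k]])
     also have "... = \<beta> x (%l x'. comult K k (%k1 k2. \<beta> y (%l' y'. p k1 l * (p k2 l' * g (x' \<otimes>\<^bsub>X\<^esub> y')))))"
      by (rule bcong[OF xy(1)], rule tens_fubini[OF \<beta>t[OF xy(2)] comult_closed[OF k]]; (intro xlin gl)?; simp)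
     also have "... = comult K k (%k1 k2. \<beta> x (%l x'. \<beta> y (%l' y'. p k1 l * (p k2 l' * g (x' \<otimes>\<^bsub>X\<^esub> y')))))"
      by (rule tens_fubini[OF \<beta>t[OF xy(1)] comult_closed[OF k]]; (intro xlin gl)?; simp)
     also have "... = comult K k (%k1 k2. g (a x k1 \<otimes>\<^bsub>X\<^esub> a y k2))"
     proof (rule comult_cong[OF k])
      fix k1 k2 assume [simp]: "k1 \<in> carrier K" "k2 \<in> carrier K"
      have 1: "linear_form X (%y'. g (x' \<otimes>\<^bsub>X\<^esub> y'))" if "x' \<in> carrier X" for x' by (intro xlin gl that)
      have 2: "linear_form X (%x'. g (x' \<otimes>\<^bsub>X\<^esub> a y k2))" by (intro xlin gl; simp)
      have "\<beta> x (%l x'. \<beta> y (%l' y'. p k1 l * (p k2 l' * g (x' \<otimes>\<^bsub>X\<^esub> y')))) =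
       \<beta> x (%l x'. p k1 l * g (x' \<otimes>\<^bsub>X\<^esub> a y k2))"
       by (rule bcong[OF xy(1)]) (simp add: tens_scale[OF \<beta>t[OF xy(2)]] form[OF xy(2) _ 1])
      then show "\<beta> x (%l x'. \<beta> y (%l' y'. p k1 l * (p k2 l' * g (x' \<otimes>\<^bsub>X\<^esub> y')))) = g (a x k1 \<otimes>\<^bsub>X\<^esub> a y k2)"
       by (simp add: form[OF xy(1) _ 2])
     qed
     finally show ?thesis .
    qed
    have "(\<forall>F. bilinear_form L X F -->
     \<beta> (x \<otimes>\<^bsub>X\<^esub> y) F = \<beta> x (%c x'. \<beta> y (%c' y'. F (c \<otimes>\<^bsub>L\<^esub> c') (x' \<otimes>\<^bsub>X\<^esub> y')))) \<longleftrightarrow>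
     \<beta> (x \<otimes>\<^bsub>X\<^esub> y) = \<beta> x \<otimes>\<^bsub>tensor_alg L X\<^esub> \<beta> y"
     using tens_eqI[OF \<beta>t[OF X.m_closed[OF xy]] bxy[OF xy]] by (auto simp: tensor_alg_mult)
    also have "... \<longleftrightarrow> (\<forall>k\<in>carrier K. \<forall>g. linear_form X g -->
      g (a (x \<otimes>\<^bsub>X\<^esub> y) k) = comult K k (%k1 k2. g (a x k1 \<otimes>\<^bsub>X\<^esub> a y k2)))"
     by (simp add: eq2 bxy calc form)
    finally show ?thesis .
  qed
  have unit: "(\<forall>F. bilinear_form L X F --> \<beta> \<one>\<^bsub>X\<^esub> F = F \<one>\<^bsub>L\<^esub> \<one>\<^bsub>X\<^esub>) \<longleftrightarrow>
     (\<forall>k\<in>carrier K. a \<one>\<^bsub>X\<^esub> k = counit K k \<odot>\<^bsub>X\<^esub> \<one>\<^bsub>X\<^esub>)"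
  proof -
    have "(\<forall>F. bilinear_form L X F --> \<beta> \<one>\<^bsub>X\<^esub> F = F \<one>\<^bsub>L\<^esub> \<one>\<^bsub>X\<^esub>) \<longleftrightarrow> \<beta> \<one>\<^bsub>X\<^esub> = \<one>\<^bsub>tensor_alg L X\<^esub>"
     using tens_eqI[OF \<beta>t[OF X.one_closed] one] by (auto simp: tensor_alg_one)
    also have "... \<longleftrightarrow> (\<forall>k\<in>carrier K. a \<one>\<^bsub>X\<^esub> k = counit K k \<odot>\<^bsub>X\<^esub> \<one>\<^bsub>X\<^esub>)"
     by (simp add: eq2 one eqX vspace_smult(1)[OF vX] tensor_alg_one test form linear_form_smult p_one_L)
    finally show ?thesis .
  qed
  have coassoc: "(\<forall>T. trilinear_form L L X T -->
     \<beta> x (%c y. comult L c (%a b. T a b y)) = \<beta> x (%a y. \<beta> y (%b z. T a b z))) \<longleftrightarrow>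
    (\<forall>k\<in>carrier K. \<forall>k'\<in>carrier K. a x (k \<otimes> k') = a (a x k) k')"
    if x [simp]: "x \<in> carrier X" for x
  proof -
    let ?l = "map_left L L X (comult L) (\<beta> x)" and ?r = "map_right L L X \<beta> (\<beta> x)"
    have c: "?l \<in> tens3 L L X" "?r \<in> tens3 L L X"
     by (auto intro: map_left_closed[OF comult_L_linear] map_right_closed[OF \<beta>])
    have T: "trilinear_form L L X (%a b y. p k' b * (p k a * g y))"
     if "k \<in> carrier K" "k' \<in> carrier K" "linear_form X g" for k k' g
     by (intro xlin linear_form_compose[OF that(3)] that)
    have left: "?l (%a b y. p k' b * (p k a * g y)) = g (a x (k \<otimes> k'))"
     if k: "k \<in> carrier K" "k' \<in> carrier K" and g: "linear_form X g" for k k' g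
    proof -
     have "?l (%a b y. p k' b * (p k a * g y)) = \<beta> x (%c y. p (k \<otimes> k') c * g y)"
      unfolding map_left_apply[OF T[OF k g]]
      by (rule bcong[OF x]) (simp add: p_mult_K k mult_ac tens_scale(1)[OF comult_L_closed])
     then show ?thesis by (simp add: form[OF x _ g] k)
    qed
    have right: "?r (%a b y. p k' b * (p k a * g y)) = g (a (a x k) k')"
     if k [simp]: "k \<in> carrier K" "k' \<in> carrier K" and g: "linear_form X g" for k k' g
    proof -
     have ga: "linear_form X (%y. g (a y k'))" by (intro xlin linear_form_compose[OF g]; simp)
     have "?r (%a b y. p k' b * (p k a * g y)) = \<beta> x (%c y. p k c * g (a y k'))"
      unfolding map_right_apply[OF T[OF k g]]
     proof (rule bcong[OF x])
      fix c y assume y: "c \<in> carrier L" "y \<in> carrier X"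
      have "\<beta> y (%b z. p k' b * (p k c * g z)) = \<beta> y (%b z. p k c * (p k' b * g z))"
       by (simp add: mult.left_commute)
      also have "... = p k c * g (a y k')"
       unfolding tens_scale(1)[OF \<beta>t[OF y(2)]] form[OF y(2) k(2) g] ..
      finally show "\<beta> y (%b z. p k' b * (p k c * g z)) = p k c * g (a y k')" .
     qed
     then show ?thesis by (simp add: form[OF x _ ga])
    qed
    have "(\<forall>T. trilinear_form L L X T -->
     \<beta> x (%c y. comult L c (%a b. T a b y)) = \<beta> x (%a y. \<beta> y (%b z. T a b z))) \<longleftrightarrow> ?l = ?r"
     by (simp add: map_left_def map_right_def T3_eq_iff)
    also have "... \<longleftrightarrow> (\<forall>k\<in>carrier K. \<forall>k'\<in>carrier K. \<forall>g. linear_form X g -->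
      ?l (%a b y. p k' b * (p k a * g y)) = ?r (%a b y. p k' b * (p k a * g y)))"
     using tens3_LLV_eqI[OF vX c] by auto
    also have "... \<longleftrightarrow> (\<forall>k\<in>carrier K. \<forall>k'\<in>carrier K. \<forall>g. linear_form X g -->
      g (a x (k \<otimes> k')) = g (a (a x k) k'))"
     by (simp add: left right)
    finally show ?thesis by (simp add: eqX)
  qed
  have counit: "(\<forall>g. linear_form X g --> \<beta> x (%c y. counit L c * g y) = g x) \<longleftrightarrow> a x \<one> = x"
    if x [simp]: "x \<in> carrier X" for x
  proof -
    have "\<beta> x (%c y. counit L c * g y) = g (a x \<one>)" if g: "linear_form X g" for g
     unfolding form[OF x one_K_closed g] by (rule bcong[OF x]) (simp add: p_one_K)
    then show ?thesis by (simp add: eqX)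
  qed
  show ?thesis
    unfolding left_coaction_iff[OF coalg_L X] right_action_iff[OF X]
    using r unfolding ract_of_def
    by (simp add: mult unit coassoc counit cong: ball_cong) blast
qed

lemma right_coaction_iff_left_action:
  assumes X: "k_algebra X" and r: "lact_of X \<beta> a"
  shows "right_coaction L X \<beta> \<longleftrightarrow> left_action K X a"
proof -
  interpret X: ring X using X by (rule k_algebra_ring)
  note vX [simp] = k_algebra_vspace[OF X]
  note \<beta> = lact_ofD(1)[OF r] and a = lact_ofD(2)[OF r] and form = lact_ofD(3)[OF r]
  note \<beta>t [simp] = linear_map_tensD(1)[OF \<beta>]
  note ac [simp] = bilinear_map_closed[OF a]
  note xlin = pair_lin X linear_map_tensD(2,3)[OF \<beta>] bilinear_map_slot[OF a]
  note bcong = tens_cong[OF \<beta>t vX vspace_L]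
  have bxy: "\<beta> x \<otimes>\<^bsub>tensor_alg X L\<^esub> \<beta> y \<in> tens X L" if "x \<in> carrier X" "y \<in> carrier X" for x y
    using that by (intro tensor_alg_mult_closed[OF X alg_L]) simp_all
  have one: "\<one>\<^bsub>tensor_alg X L\<^esub> \<in> tens X L" using monoid_tensor_alg[OF X alg_L] by (rule monoid.one_closed)
  have eq2: "s = t \<longleftrightarrow> (\<forall>k\<in>carrier K. \<forall>g. linear_form X g --> s (%y l. p k l * g y) = t (%y l. p k l * g y))"
    if "s \<in> tens X L" "t \<in> tens X L" for s t using tens_right_eqI[OF vX that] by (auto simp: mult.commute)
  have eqX: "u = v \<longleftrightarrow> (\<forall>g. linear_form X g --> g u = g v)" if "u \<in> carrier X" "v \<in> carrier X" for u v
    using forms_separate[OF vX that] by auto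
  have test: "bilinear_form X L (%y l. p k l * g y)" if "k \<in> carrier K" "linear_form X g" for k g
    by (intro xlin linear_form_compose[OF that(2)] that)
  have mult: "(\<forall>F. bilinear_form X L F -->
     \<beta> (x \<otimes>\<^bsub>X\<^esub> y) F = \<beta> x (%x' c. \<beta> y (%y' c'. F (x' \<otimes>\<^bsub>X\<^esub> y') (c \<otimes>\<^bsub>L\<^esub> c')))) \<longleftrightarrow>
    (\<forall>k\<in>carrier K. \<forall>g. linear_form X g -->
      g (a k (x \<otimes>\<^bsub>X\<^esub> y)) = comult K k (%k1 k2. g (a k1 x \<otimes>\<^bsub>X\<^esub> a k2 y)))"
    if xy [simp]: "x \<in> carrier X" "y \<in> carrier X" for x y
  proof -
    have calc: "(\<beta> x \<otimes>\<^bsub>tensor_alg X L\<^esub> \<beta> y) (%y l. p k l * g y) = comult K k (%k1 k2. g (a k1 x \<otimes>\<^bsub>X\<^esub> a k2 y))"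
     if k: "k \<in> carrier K" and g: "linear_form X g" for k g
    proof -
     note gl = linear_form_compose[OF g]
     have "(\<beta> x \<otimes>\<^bsub>tensor_alg X L\<^esub> \<beta> y) (%y l. p k l * g y) =
      \<beta> x (%x' l. \<beta> y (%y' l'. comult K k (%k1 k2. p k1 l * (p k2 l' * g (x' \<otimes>\<^bsub>X\<^esub> y')))))"
      unfolding tensor_alg_mult[OF test[OF k g]]
      by (rule bcong[OF xy(1)], rule bcong[OF xy(2)])
       (simp add: p_mult_L k mult.assoc flip: tens_scale(2)[OF comult_closed[OF k]])
     also have "... = \<beta> x (%x' l. comult K k (%k1 k2. \<beta> y (%y' l'. p k1 l * (p k2 l' * g (x' \<otimes>\<^bsub>X\<^esub> y')))))"
      by (rule bcong[OF xy(1)], rule tens_fubini[OF \<beta>t[OF xy(2)] comult_closed[OF k]]; (intro xlin gl)?; simp)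
     also have "... = comult K k (%k1 k2. \<beta> x (%x' l. \<beta> y (%y' l'. p k1 l * (p k2 l' * g (x' \<otimes>\<^bsub>X\<^esub> y')))))"
      by (rule tens_fubini[OF \<beta>t[OF xy(1)] comult_closed[OF k]]; (intro xlin gl)?; simp)
     also have "... = comult K k (%k1 k2. g (a k1 x \<otimes>\<^bsub>X\<^esub> a k2 y))"
     proof (rule comult_cong[OF k])
      fix k1 k2 assume [simp]: "k1 \<in> carrier K" "k2 \<in> carrier K"
      have 1: "linear_form X (%y'. g (x' \<otimes>\<^bsub>X\<^esub> y'))" if "x' \<in> carrier X" for x' by (intro xlin gl that)
      have 2: "linear_form X (%x'. g (x' \<otimes>\<^bsub>X\<^esub> a k2 y))" by (intro xlin gl; simp)
      have "\<beta> x (%x' l. \<beta> y (%y' l'. p k1 l * (p k2 l' * g (x' \<otimes>\<^bsub>X\<^esub> y')))) =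
       \<beta> x (%x' l. p k1 l * g (x' \<otimes>\<^bsub>X\<^esub> a k2 y))"
       by (rule bcong[OF xy(1)]) (simp add: tens_scale[OF \<beta>t[OF xy(2)]] form[OF xy(2) _ 1])
      then show "\<beta> x (%x' l. \<beta> y (%y' l'. p k1 l * (p k2 l' * g (x' \<otimes>\<^bsub>X\<^esub> y')))) = g (a k1 x \<otimes>\<^bsub>X\<^esub> a k2 y)"
       by (simp add: form[OF xy(1) _ 2])
     qed
     finally show ?thesis .
    qed
    have "(\<forall>F. bilinear_form X L F -->
     \<beta> (x \<otimes>\<^bsub>X\<^esub> y) F = \<beta> x (%x' c. \<beta> y (%y' c'. F (x' \<otimes>\<^bsub>X\<^esub> y') (c \<otimes>\<^bsub>L\<^esub> c')))) \<longleftrightarrow>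
     \<beta> (x \<otimes>\<^bsub>X\<^esub> y) = \<beta> x \<otimes>\<^bsub>tensor_alg X L\<^esub> \<beta> y"
     using tens_eqI[OF \<beta>t[OF X.m_closed[OF xy]] bxy[OF xy]] by (auto simp: tensor_alg_mult)
    also have "... \<longleftrightarrow> (\<forall>k\<in>carrier K. \<forall>g. linear_form X g -->
      g (a k (x \<otimes>\<^bsub>X\<^esub> y)) = comult K k (%k1 k2. g (a k1 x \<otimes>\<^bsub>X\<^esub> a k2 y)))"
     by (simp add: eq2 bxy calc form)
    finally show ?thesis .
  qed
  have unit: "(\<forall>F. bilinear_form X L F --> \<beta> \<one>\<^bsub>X\<^esub> F = F \<one>\<^bsub>X\<^esub> \<one>\<^bsub>L\<^esub>) \<longleftrightarrow>
     (\<forall>k\<in>carrier K. a k \<one>\<^bsub>X\<^esub> = counit K k \<odot>\<^bsub>X\<^esub> \<one>\<^bsub>X\<^esub>)"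
  proof -
    have "(\<forall>F. bilinear_form X L F --> \<beta> \<one>\<^bsub>X\<^esub> F = F \<one>\<^bsub>X\<^esub> \<one>\<^bsub>L\<^esub>) \<longleftrightarrow> \<beta> \<one>\<^bsub>X\<^esub> = \<one>\<^bsub>tensor_alg X L\<^esub>"
     using tens_eqI[OF \<beta>t[OF X.one_closed] one] by (auto simp: tensor_alg_one)
    also have "... \<longleftrightarrow> (\<forall>k\<in>carrier K. a k \<one>\<^bsub>X\<^esub> = counit K k \<odot>\<^bsub>X\<^esub> \<one>\<^bsub>X\<^esub>)"
     by (simp add: eq2 one eqX vspace_smult(1)[OF vX] tensor_alg_one test form linear_form_smult p_one_L)
    finally show ?thesis .
  qed
  have coassoc: "(\<forall>T. trilinear_form X L L T -->
     \<beta> x (%y c. comult L c (%a b. T y a b)) = \<beta> x (%y b. \<beta> y (%z a. T z a b))) \<longleftrightarrow>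
    (\<forall>k\<in>carrier K. \<forall>k'\<in>carrier K. a (k \<otimes> k') x = a k (a k' x))"
    if x [simp]: "x \<in> carrier X" for x
  proof -
    let ?l = "map_right X L L (comult L) (\<beta> x)" and ?r = "map_left X L L \<beta> (\<beta> x)"
    have c: "?l \<in> tens3 X L L" "?r \<in> tens3 X L L"
     by (auto intro: map_right_closed[OF comult_L_linear] map_left_closed[OF \<beta>])
    have T: "trilinear_form X L L (%y a b. p k' b * (p k a * g y))"
     if "k \<in> carrier K" "k' \<in> carrier K" "linear_form X g" for k k' g
     by (intro xlin linear_form_compose[OF that(3)] that)
    have left: "?l (%y a b. p k' b * (p k a * g y)) = g (a (k \<otimes> k') x)"
     if k: "k \<in> carrier K" "k' \<in> carrier K" and g: "linear_form X g" for k k' g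
    proof -
     have "?l (%y a b. p k' b * (p k a * g y)) = \<beta> x (%y c. p (k \<otimes> k') c * g y)"
      unfolding map_right_apply[OF T[OF k g]]
      by (rule bcong[OF x]) (simp add: p_mult_K k mult_ac tens_scale(1)[OF comult_L_closed])
     then show ?thesis by (simp add: form[OF x _ g] k)
    qed
    have right: "?r (%y a b. p k' b * (p k a * g y)) = g (a k (a k' x))"
     if k [simp]: "k \<in> carrier K" "k' \<in> carrier K" and g: "linear_form X g" for k k' g
    proof -
     have ga: "linear_form X (%y. g (a k y))" by (intro xlin linear_form_compose[OF g]; simp)
     have "?r (%y a b. p k' b * (p k a * g y)) = \<beta> x (%y c. p k' c * g (a k y))"
      unfolding map_left_apply[OF T[OF k g]]
      by (rule bcong[OF x]) (simp add: form[OF _ _ g] tens_scale(1)[OF \<beta>t])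
     then show ?thesis by (simp add: form[OF x _ ga])
    qed
    have "(\<forall>T. trilinear_form X L L T -->
     \<beta> x (%y c. comult L c (%a b. T y a b)) = \<beta> x (%y b. \<beta> y (%z a. T z a b))) \<longleftrightarrow> ?l = ?r"
     by (simp add: map_right_def map_left_def T3_eq_iff)
    also have "... \<longleftrightarrow> (\<forall>k\<in>carrier K. \<forall>k'\<in>carrier K. \<forall>g. linear_form X g -->
      ?l (%y a b. p k' b * (p k a * g y)) = ?r (%y a b. p k' b * (p k a * g y)))"
     using tens3_VLL_eqI[OF vX c] by auto
    also have "... \<longleftrightarrow> (\<forall>k\<in>carrier K. \<forall>k'\<in>carrier K. \<forall>g. linear_form X g -->
      g (a (k \<otimes> k') x) = g (a k (a k' x)))"
     by (simp add: left right)
    finally show ?thesis by (simp add: eqX)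
  qed
  have counit: "(\<forall>g. linear_form X g --> \<beta> x (%y c. counit L c * g y) = g x) \<longleftrightarrow> a \<one> x = x"
    if x [simp]: "x \<in> carrier X" for x
  proof -
    have "\<beta> x (%y c. counit L c * g y) = g (a \<one> x)" if g: "linear_form X g" for g
     unfolding form[OF x one_K_closed g] by (rule bcong[OF x]) (simp add: p_one_K)
    then show ?thesis by (simp add: eqX)
  qed
  show ?thesis
    unfolding right_coaction_iff[OF coalg_L X] left_action_iff[OF X]
    using r unfolding lact_of_def
    by (simp add: mult unit coassoc counit cong: ball_cong) blast
qed

end

section \<open>Changing the side of a coaction\<close>

definition coact_to_left ::
  "('a => 'b) => ('k::field, 'b, 'z) module_scheme => ('k, 'x, 'y) module_scheme
    => ('x => ('k, 'x, 'a) tensor) => 'x => ('k, 'b, 'x) tensor" where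
  "coact_to_left \<sigma> D X \<alpha> = (\<lambda>x\<in>carrier X. T2 D X (%F. \<alpha> x (%y c. F (\<sigma> c) y)))"

definition coact_to_right ::
  "('a => 'b) => ('k::field, 'b, 'z) module_scheme => ('k, 'x, 'y) module_scheme
    => ('x => ('k, 'a, 'x) tensor) => 'x => ('k, 'x, 'b) tensor" where
  "coact_to_right \<sigma> D X \<alpha> = (\<lambda>x\<in>carrier X. T2 X D (%F. \<alpha> x (%c y. F y (\<sigma> c))))"

text \<open>A bialgebra map that preserves products and reverses coproducts.\<close>

locale anti_comult_map =
  fixes C D :: "('k::field, 'h) hopf" and \<sigma> :: "'h => 'h"
  assumes C: "coalg C" and D: "coalg D" and map: "linear_map C D \<sigma>"
    and mult: "!!c c'. c \<in> carrier C ==> c' \<in> carrier C ==> \<sigma> (c \<otimes>\<^bsub>C\<^esub> c') = \<sigma> c \<otimes>\<^bsub>D\<^esub> \<sigma> c'"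
    and one: "\<sigma> \<one>\<^bsub>C\<^esub> = \<one>\<^bsub>D\<^esub>"
    and comult: "!!c F. c \<in> carrier C ==> bilinear_form D D F ==> comult D (\<sigma> c) F = comult C c (%a b. F (\<sigma> b) (\<sigma> a))"
    and counit: "!!c. c \<in> carrier C ==> counit D (\<sigma> c) = counit C c"
begin

lemma algs: "k_algebra C" "k_algebra D" "linear_map C (tensor_alg C C) (comult C)" "linear_map D (tensor_alg D D) (comult D)"
    "linear_form D (counit D)"
  using C D by (auto simp: coalg_def)

lemma vs [simp]: "vspace C" "vspace D"
  using algs by (auto intro: k_algebra_vspace)

lemma D_mult_closed [simp]: "d \<in> carrier D ==> d' \<in> carrier D ==> d \<otimes>\<^bsub>D\<^esub> d' \<in> carrier D"
  using monoid.m_closed[OF ring.is_monoid[OF k_algebra_ring[OF algs(2)]]] .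

lemmas closed [simp] = linear_map_closed[OF map]
lemmas smap = linear_map_compose[OF map]
lemmas dlin = lin smap algs(1,2) linear_map_tensD(2,3)[OF algs(3)] linear_map_tensD(2,3)[OF algs(4)] linear_form_compose[OF algs(5)]

lemma coact_to_left_linear:
  assumes X: "k_algebra X" and \<alpha>: "linear_map X (tensor_alg X C) \<alpha>"
  shows "linear_map X (tensor_alg D X) (coact_to_left \<sigma> D X \<alpha>)"
    and "x \<in> carrier X ==> bilinear_form D X F ==> coact_to_left \<sigma> D X \<alpha> x F = \<alpha> x (%y c. F (\<sigma> c) y)"
proof -
  note vX [simp] = k_algebra_vspace[OF X]
  show ap: "coact_to_left \<sigma> D X \<alpha> x F = \<alpha> x (%y c. F (\<sigma> c) y)" if "x \<in> carrier X" "bilinear_form D X F" for x F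
    using that by (simp add: coact_to_left_def)
  show "linear_map X (tensor_alg D X) (coact_to_left \<sigma> D X \<alpha>)"
    unfolding linear_map_tens'[OF vX]
  proof (intro conjI ballI allI impI)
    fix x assume x: "x \<in> carrier X"
    have "T2 D X (%F. \<alpha> x (%y c. F (\<sigma> c) y)) \<in> tens D X"
    proof (rule T2_bind_closed[OF linear_map_tensD(1)[OF \<alpha> x]])
     fix F assume F: "bilinear_form D X F"
     show "bilinear_form X C (%y c. F (\<sigma> c) y)" by (intro dlin bilinear_form_slot[OF F]; simp)
    qed (simp add: T2_pure_closed)
    then show "coact_to_left \<sigma> D X \<alpha> x \<in> tens D X" by (simp add: coact_to_left_def x)
  next
    fix F assume F: "bilinear_form D X F"
    have "linear_form X (%x. \<alpha> x (%y c. F (\<sigma> c) y))" by (intro linear_map_tensD(2)[OF \<alpha>] lin)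
    then show "linear_form X (%x. coact_to_left \<sigma> D X \<alpha> x F)"
     using linear_form_cong[OF vX, of "%x. coact_to_left \<sigma> D X \<alpha> x F"] ap[OF _ F] by fastforce
  qed
qed

lemma coact_to_right_linear:
  assumes X: "k_algebra X" and \<alpha>: "linear_map X (tensor_alg C X) \<alpha>"
  shows "linear_map X (tensor_alg X D) (coact_to_right \<sigma> D X \<alpha>)"
    and "x \<in> carrier X ==> bilinear_form X D F ==> coact_to_right \<sigma> D X \<alpha> x F = \<alpha> x (%c y. F y (\<sigma> c))"
proof -
  note vX [simp] = k_algebra_vspace[OF X]
  show ap: "coact_to_right \<sigma> D X \<alpha> x F = \<alpha> x (%c y. F y (\<sigma> c))" if "x \<in> carrier X" "bilinear_form X D F" for x F
    using that by (simp add: coact_to_right_def)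
  show "linear_map X (tensor_alg X D) (coact_to_right \<sigma> D X \<alpha>)"
    unfolding linear_map_tens'[OF vX]
  proof (intro conjI ballI allI impI)
    fix x assume x: "x \<in> carrier X"
    have "T2 X D (%F. \<alpha> x (%c y. F y (\<sigma> c))) \<in> tens X D"
    proof (rule T2_bind_closed[OF linear_map_tensD(1)[OF \<alpha> x]])
     fix F assume F: "bilinear_form X D F"
     show "bilinear_form C X (%c y. F y (\<sigma> c))" by (intro dlin bilinear_form_slot[OF F]; simp)
    qed (simp add: T2_pure_closed)
    then show "coact_to_right \<sigma> D X \<alpha> x \<in> tens X D" by (simp add: coact_to_right_def x)
  next
    fix F assume F: "bilinear_form X D F"
    have "linear_form X (%x. \<alpha> x (%c y. F y (\<sigma> c)))" by (intro linear_map_tensD(2)[OF \<alpha>] lin)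
    then show "linear_form X (%x. coact_to_right \<sigma> D X \<alpha> x F)"
     using linear_form_cong[OF vX, of "%x. coact_to_right \<sigma> D X \<alpha> x F"] ap[OF _ F] by fastforce
  qed
qed

lemma left_coaction_coact_to_left:
  assumes X: "k_algebra X" and co: "right_coaction C X \<alpha>"
  shows "left_coaction D X (coact_to_left \<sigma> D X \<alpha>)"
proof -
  interpret X: ring X using X by (rule k_algebra_ring)
  note vX [simp] = k_algebra_vspace[OF X]
  let ?b = "coact_to_left \<sigma> D X \<alpha>"
  note co = co[unfolded right_coaction_iff[OF C X]]
  have \<alpha>: "linear_map X (tensor_alg X C) \<alpha>" using co by simp
  note b = coact_to_left_linear[OF X \<alpha>]
  note at [simp] = linear_map_tensD(1)[OF \<alpha>]
  note acong = tens_cong[OF at vX vs(1)]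
  note xlin = dlin X linear_map_tensD(2,3)[OF \<alpha>] linear_map_tensD(2,3)[OF b(1)]
  show ?thesis
    unfolding left_coaction_iff[OF D X]
  proof (intro conjI ballI allI impI)
    show "?b \<in> extensional (carrier X)" by (simp add: coact_to_left_def)
    show "linear_map X (tensor_alg D X) ?b" by (rule b(1))
  next
    fix x y F assume xy [simp]: "x \<in> carrier X" "y \<in> carrier X" and F: "bilinear_form D X F"
    note Fs = bilinear_form_slot[OF F]
    have 1: "bilinear_form X C (%y c. F (\<sigma> c) y)" by (intro xlin Fs; simp)
    have 2: "bilinear_form D X (%c x'. ?b y (%c' y'. F (c \<otimes>\<^bsub>D\<^esub> c') (x' \<otimes>\<^bsub>X\<^esub> y')))"
     by (intro xlin Fs; simp)
    have 3: "bilinear_form D X (%c' y'. F (c \<otimes>\<^bsub>D\<^esub> c') (x' \<otimes>\<^bsub>X\<^esub> y'))" if "c \<in> carrier D" "x' \<in> carrier X" for c x'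
     by (intro xlin Fs; simp add: that)
    have "?b (x \<otimes>\<^bsub>X\<^esub> y) F = \<alpha> x (%x' c. \<alpha> y (%y' c'. F (\<sigma> (c \<otimes>\<^bsub>C\<^esub> c')) (x' \<otimes>\<^bsub>X\<^esub> y')))"
     using co 1 by (simp add: b(2) F)
    also have "... = \<alpha> x (%x' c. ?b y (%c' y'. F (\<sigma> c \<otimes>\<^bsub>D\<^esub> c') (x' \<otimes>\<^bsub>X\<^esub> y')))"
    proof (rule acong[OF xy(1)])
     fix x' c assume c: "x' \<in> carrier X" "c \<in> carrier C"
     show "\<alpha> y (%y' c'. F (\<sigma> (c \<otimes>\<^bsub>C\<^esub> c')) (x' \<otimes>\<^bsub>X\<^esub> y')) = ?b y (%c' y'. F (\<sigma> c \<otimes>\<^bsub>D\<^esub> c') (x' \<otimes>\<^bsub>X\<^esub> y'))"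
      by (simp add: b(2) 3 c) (rule acong[OF xy(2)], simp add: mult c)
    qed
    also have "... = ?b x (%c x'. ?b y (%c' y'. F (c \<otimes>\<^bsub>D\<^esub> c') (x' \<otimes>\<^bsub>X\<^esub> y')))"
     by (simp add: b(2)[OF xy(1) 2])
    finally show "?b (x \<otimes>\<^bsub>X\<^esub> y) F = ..." .
  next
    fix F assume F: "bilinear_form D X F"
    note Fs = bilinear_form_slot[OF F]
    have 1: "bilinear_form X C (%y c. F (\<sigma> c) y)" by (intro xlin Fs; simp)
    show "?b \<one>\<^bsub>X\<^esub> F = F \<one>\<^bsub>D\<^esub> \<one>\<^bsub>X\<^esub>" using co 1 by (simp add: b(2) F one)
  next
    fix x T assume x [simp]: "x \<in> carrier X" and T: "trilinear_form D D X T"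
    note Ts = trilinear_form_slot[OF T]
    have 1: "bilinear_form D X (%c y. comult D c (%a b. T a b y))" by (intro xlin Ts; simp)
    have 2: "bilinear_form D X (%a y. ?b y (%b z. T a b z))" by (intro xlin Ts; simp)
    have 3: "bilinear_form D D (%a b. T a b y)" if "y \<in> carrier X" for y
     by (intro xlin Ts; simp add: that)
    have 5: "bilinear_form D X (%b z. T c b z)" if "c \<in> carrier D" for c
     by (intro xlin Ts; simp add: that)
    have 4: "trilinear_form X C C (%y a b. T (\<sigma> b) (\<sigma> a) y)" by (intro xlin Ts; simp)
    have "?b x (%c y. comult D c (%a b. T a b y)) = \<alpha> x (%y c. comult C c (%a b. T (\<sigma> b) (\<sigma> a) y))"
     unfolding b(2)[OF x 1] by (rule acong[OF x]) (simp add: comult 3)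
    also have "... = \<alpha> x (%y b. \<alpha> y (%z a. T (\<sigma> b) (\<sigma> a) z))"
     using co 4 by simp
    also have "... = ?b x (%a y. ?b y (%b z. T a b z))"
     unfolding b(2)[OF x 2] by (rule acong[OF x]) (simp add: b(2) 5)
    finally show "?b x (%c y. comult D c (%a b. T a b y)) = ..." .
  next
    fix x g assume x [simp]: "x \<in> carrier X" and g: "linear_form X g"
    have 1: "bilinear_form D X (%c y. counit D c * g y)" by (intro xlin linear_form_compose[OF g])
    have "?b x (%c y. counit D c * g y) = \<alpha> x (%y c. counit C c * g y)"
     unfolding b(2)[OF x 1] by (rule acong[OF x]) (simp add: counit)
    then show "?b x (%c y. counit D c * g y) = g x" using co g by simp
  qed
qed

lemma right_coaction_coact_to_right:
  assumes X: "k_algebra X" and co: "left_coaction C X \<alpha>"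
  shows "right_coaction D X (coact_to_right \<sigma> D X \<alpha>)"
proof -
  interpret X: ring X using X by (rule k_algebra_ring)
  note vX [simp] = k_algebra_vspace[OF X]
  let ?b = "coact_to_right \<sigma> D X \<alpha>"
  note co = co[unfolded left_coaction_iff[OF C X]]
  have \<alpha>: "linear_map X (tensor_alg C X) \<alpha>" using co by simp
  note b = coact_to_right_linear[OF X \<alpha>]
  note at [simp] = linear_map_tensD(1)[OF \<alpha>]
  note acong = tens_cong[OF at vs(1) vX]
  note xlin = dlin X linear_map_tensD(2,3)[OF \<alpha>] linear_map_tensD(2,3)[OF b(1)]
  show ?thesis
    unfolding right_coaction_iff[OF D X]
  proof (intro conjI ballI allI impI)
    show "?b \<in> extensional (carrier X)" by (simp add: coact_to_right_def)
    show "linear_map X (tensor_alg X D) ?b" by (rule b(1))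
  next
    fix x y F assume xy [simp]: "x \<in> carrier X" "y \<in> carrier X" and F: "bilinear_form X D F"
    note Fs = bilinear_form_slot[OF F]
    have 1: "bilinear_form C X (%c y. F y (\<sigma> c))" by (intro xlin Fs; simp)
    have 2: "bilinear_form X D (%x' c. ?b y (%y' c'. F (x' \<otimes>\<^bsub>X\<^esub> y') (c \<otimes>\<^bsub>D\<^esub> c')))"
     by (intro xlin Fs; simp)
    have 3: "bilinear_form X D (%y' c'. F (x' \<otimes>\<^bsub>X\<^esub> y') (c \<otimes>\<^bsub>D\<^esub> c'))" if "c \<in> carrier D" "x' \<in> carrier X" for c x'
     by (intro xlin Fs; simp add: that)
    have "?b (x \<otimes>\<^bsub>X\<^esub> y) F = \<alpha> x (%c x'. \<alpha> y (%c' y'. F (x' \<otimes>\<^bsub>X\<^esub> y') (\<sigma> (c \<otimes>\<^bsub>C\<^esub> c'))))"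
     using co 1 by (simp add: b(2) F)
    also have "... = \<alpha> x (%c x'. ?b y (%y' c'. F (x' \<otimes>\<^bsub>X\<^esub> y') (\<sigma> c \<otimes>\<^bsub>D\<^esub> c')))"
    proof (rule acong[OF xy(1)])
     fix x' c assume c: "c \<in> carrier C" "x' \<in> carrier X"
     show "\<alpha> y (%c' y'. F (x' \<otimes>\<^bsub>X\<^esub> y') (\<sigma> (c \<otimes>\<^bsub>C\<^esub> c'))) = ?b y (%y' c'. F (x' \<otimes>\<^bsub>X\<^esub> y') (\<sigma> c \<otimes>\<^bsub>D\<^esub> c'))"
      by (simp add: b(2) 3 c) (rule acong[OF xy(2)], simp add: mult c)
    qed
    also have "... = ?b x (%x' c. ?b y (%y' c'. F (x' \<otimes>\<^bsub>X\<^esub> y') (c \<otimes>\<^bsub>D\<^esub> c')))"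
     by (simp add: b(2)[OF xy(1) 2])
    finally show "?b (x \<otimes>\<^bsub>X\<^esub> y) F = ..." .
  next
    fix F assume F: "bilinear_form X D F"
    note Fs = bilinear_form_slot[OF F]
    have 1: "bilinear_form C X (%c y. F y (\<sigma> c))" by (intro xlin Fs; simp)
    show "?b \<one>\<^bsub>X\<^esub> F = F \<one>\<^bsub>X\<^esub> \<one>\<^bsub>D\<^esub>" using co 1 by (simp add: b(2) F one)
  next
    fix x T assume x [simp]: "x \<in> carrier X" and T: "trilinear_form X D D T"
    note Ts = trilinear_form_slot[OF T]
    have 1: "bilinear_form X D (%y c. comult D c (%a b. T y a b))" by (intro xlin Ts; simp)
    have 2: "bilinear_form X D (%y b. ?b y (%z a. T z a b))" by (intro xlin Ts; simp)
    have 3: "bilinear_form D D (%a b. T y a b)" if "y \<in> carrier X" for y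
     by (intro xlin Ts; simp add: that)
    have 5: "bilinear_form X D (%z b. T z b c)" if "c \<in> carrier D" for c
     by (intro xlin Ts; simp add: that)
    have 4: "trilinear_form C C X (%a b y. T y (\<sigma> b) (\<sigma> a))" by (intro xlin Ts; simp)
    have "?b x (%y c. comult D c (%a b. T y a b)) = \<alpha> x (%c y. comult C c (%a b. T y (\<sigma> b) (\<sigma> a)))"
     unfolding b(2)[OF x 1] by (rule acong[OF x]) (simp add: comult 3)
    also have "... = \<alpha> x (%a y. \<alpha> y (%b z. T z (\<sigma> b) (\<sigma> a)))"
     using co 4 by simp
    also have "... = ?b x (%y b. ?b y (%z a. T z a b))"
     unfolding b(2)[OF x 2] by (rule acong[OF x]) (simp add: b(2) 5)
    finally show "?b x (%y c. comult D c (%a b. T y a b)) = ..." .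
  next
    fix x g assume x [simp]: "x \<in> carrier X" and g: "linear_form X g"
    have 1: "bilinear_form X D (%y c. counit D c * g y)" by (intro xlin linear_form_compose[OF g])
    have "?b x (%y c. counit D c * g y) = \<alpha> x (%c y. counit C c * g y)"
     unfolding b(2)[OF x 1] by (rule acong[OF x]) (simp add: counit)
    then show "?b x (%y c. counit D c * g y) = g x" using co g by simp
  qed
qed

lemma lcoact_equivariant_coact_to_left:
  assumes X: "k_algebra X" "k_algebra Y" and \<alpha>: "linear_map X (tensor_alg X C) \<alpha>" "linear_map Y (tensor_alg Y C) \<alpha>'"
    and f: "linear_map X Y f" and eq: "rcoact_equivariant C X Y \<alpha> \<alpha>' f"
  shows "lcoact_equivariant D X Y (coact_to_left \<sigma> D X \<alpha>) (coact_to_left \<sigma> D Y \<alpha>') f"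
  unfolding lcoact_equivariant_def
proof
  note v = k_algebra_vspace[OF X(1)] k_algebra_vspace[OF X(2)]
  note b = coact_to_left_linear[OF X(1) \<alpha>(1)] and b' = coact_to_left_linear[OF X(2) \<alpha>(2)]
  fix x assume x: "x \<in> carrier X"
  have fx [simp]: "f z \<in> carrier Y" if "z \<in> carrier X" for z using that by (rule linear_map_closed[OF f])
  have "coact_to_left \<sigma> D Y \<alpha>' (f x) = T2 D Y (coact_to_left \<sigma> D Y \<alpha>' (f x))"
    using tens_T2[OF linear_map_tensD(1)[OF b'(1)]] x by simp
  also have "... = map2 D Y (%c. c) f (coact_to_left \<sigma> D X \<alpha> x)"
    unfolding map2_def T2_eq_iff
  proof (intro allI impI)
    fix F assume F: "bilinear_form D Y F"
    note Fs = bilinear_form_slot[OF F]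
    have 1: "bilinear_form D X (%c d. F c (f d))" by (intro dlin Fs linear_map_compose[OF f]; simp)
    have 2: "bilinear_form Y C (%y c. F (\<sigma> c) y)" by (intro dlin Fs; simp)
    have "coact_to_left \<sigma> D Y \<alpha>' (f x) F = \<alpha>' (f x) (%y c. F (\<sigma> c) y)" by (simp add: b'(2) x F)
    also have "... = map2 Y C f (%c. c) (\<alpha> x) (%y c. F (\<sigma> c) y)"
     using eq x by (simp add: rcoact_equivariant_def)
    also have "... = coact_to_left \<sigma> D X \<alpha> x (%c d. F c (f d))"
     by (simp add: map2_def 2 b(2)[OF x 1])
    finally show "coact_to_left \<sigma> D Y \<alpha>' (f x) F = coact_to_left \<sigma> D X \<alpha> x (%c d. F c (f d))" .
  qed
  finally show "coact_to_left \<sigma> D Y \<alpha>' (f x) = map2 D Y (%c. c) f (coact_to_left \<sigma> D X \<alpha> x)" .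
qed

lemma rcoact_equivariant_coact_to_right:
  assumes X: "k_algebra X" "k_algebra Y" and \<alpha>: "linear_map X (tensor_alg C X) \<alpha>" "linear_map Y (tensor_alg C Y) \<alpha>'"
    and f: "linear_map X Y f" and eq: "lcoact_equivariant C X Y \<alpha> \<alpha>' f"
  shows "rcoact_equivariant D X Y (coact_to_right \<sigma> D X \<alpha>) (coact_to_right \<sigma> D Y \<alpha>') f"
  unfolding rcoact_equivariant_def
proof
  note v = k_algebra_vspace[OF X(1)] k_algebra_vspace[OF X(2)]
  note b = coact_to_right_linear[OF X(1) \<alpha>(1)] and b' = coact_to_right_linear[OF X(2) \<alpha>(2)]
  fix x assume x: "x \<in> carrier X"
  have fx [simp]: "f z \<in> carrier Y" if "z \<in> carrier X" for z using that by (rule linear_map_closed[OF f])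
  have "coact_to_right \<sigma> D Y \<alpha>' (f x) = T2 Y D (coact_to_right \<sigma> D Y \<alpha>' (f x))"
    using tens_T2[OF linear_map_tensD(1)[OF b'(1)]] x by simp
  also have "... = map2 Y D f (%c. c) (coact_to_right \<sigma> D X \<alpha> x)"
    unfolding map2_def T2_eq_iff
  proof (intro allI impI)
    fix F assume F: "bilinear_form Y D F"
    note Fs = bilinear_form_slot[OF F]
    have 1: "bilinear_form X D (%d c. F (f d) c)" by (intro dlin Fs linear_map_compose[OF f]; simp)
    have 2: "bilinear_form C Y (%c y. F y (\<sigma> c))" by (intro dlin Fs; simp)
    have "coact_to_right \<sigma> D Y \<alpha>' (f x) F = \<alpha>' (f x) (%c y. F y (\<sigma> c))" by (simp add: b'(2) x F)
    also have "... = map2 C Y (%c. c) f (\<alpha> x) (%c y. F y (\<sigma> c))"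
     using eq x by (simp add: lcoact_equivariant_def)
    also have "... = coact_to_right \<sigma> D X \<alpha> x (%d c. F (f d) c)"
     by (simp add: map2_def 2 b(2)[OF x 1])
    finally show "coact_to_right \<sigma> D Y \<alpha>' (f x) F = coact_to_right \<sigma> D X \<alpha> x (%c d. F (f c) d)" .
  qed
  finally show "coact_to_right \<sigma> D Y \<alpha>' (f x) = map2 Y D f (%c. c) (coact_to_right \<sigma> D X \<alpha> x)" .
qed

end

lemma coact_to_right_to_left:
  assumes s: "anti_comult_map C D \<sigma>" and t: "anti_comult_map D C \<tau>"
    and inv: "!!c. c \<in> carrier C ==> \<tau> (\<sigma> c) = c"
    and X: "k_algebra X" and \<alpha>: "\<alpha> \<in> extensional (carrier X)" "linear_map X (tensor_alg X C) \<alpha>"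
  shows "coact_to_right \<tau> C X (coact_to_left \<sigma> D X \<alpha>) = \<alpha>"
proof (rule extensionalityI)
  interpret s: anti_comult_map C D \<sigma> by fact
  interpret t: anti_comult_map D C \<tau> by fact
  note vX [simp] = k_algebra_vspace[OF X]
  note b = s.coact_to_left_linear[OF X \<alpha>(2)]
  note c = t.coact_to_right_linear[OF X b(1)]
  fix x assume x: "x \<in> carrier X"
  show "coact_to_right \<tau> C X (coact_to_left \<sigma> D X \<alpha>) x = \<alpha> x"
  proof (rule tens_eqI[OF linear_map_tensD(1)[OF c(1) x] linear_map_tensD(1)[OF \<alpha>(2) x]])
    fix F assume F: "bilinear_form X C F"
    have 1: "bilinear_form D X (%c y. F y (\<tau> c))" by (intro lin t.smap bilinear_form_slot[OF F]; simp)
    show "coact_to_right \<tau> C X (coact_to_left \<sigma> D X \<alpha>) x F = \<alpha> x F"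
     unfolding c(2)[OF x F] b(2)[OF x 1]
     by (rule tens_cong[OF linear_map_tensD(1)[OF \<alpha>(2) x] vX s.vs(1)]) (simp add: inv)
  qed
qed (auto simp: coact_to_right_def \<alpha>)

lemma coact_to_left_to_right:
  assumes s: "anti_comult_map C D \<sigma>" and t: "anti_comult_map D C \<tau>"
    and inv: "!!c. c \<in> carrier C ==> \<tau> (\<sigma> c) = c"
    and X: "k_algebra X" and \<alpha>: "\<alpha> \<in> extensional (carrier X)" "linear_map X (tensor_alg C X) \<alpha>"
  shows "coact_to_left \<tau> C X (coact_to_right \<sigma> D X \<alpha>) = \<alpha>"
proof (rule extensionalityI)
  interpret s: anti_comult_map C D \<sigma> by fact
  interpret t: anti_comult_map D C \<tau> by fact
  note vX [simp] = k_algebra_vspace[OF X]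
  note b = s.coact_to_right_linear[OF X \<alpha>(2)]
  note c = t.coact_to_left_linear[OF X b(1)]
  fix x assume x: "x \<in> carrier X"
  show "coact_to_left \<tau> C X (coact_to_right \<sigma> D X \<alpha>) x = \<alpha> x"
  proof (rule tens_eqI[OF linear_map_tensD(1)[OF c(1) x] linear_map_tensD(1)[OF \<alpha>(2) x]])
    fix F assume F: "bilinear_form C X F"
    have 1: "bilinear_form X D (%y c. F (\<tau> c) y)" by (intro lin t.smap bilinear_form_slot[OF F]; simp)
    show "coact_to_left \<tau> C X (coact_to_right \<sigma> D X \<alpha>) x F = \<alpha> x F"
     unfolding c(2)[OF x F] b(2)[OF x 1]
     by (rule tens_cong[OF linear_map_tensD(1)[OF \<alpha>(2) x] s.vs(1) vX]) (simp add: inv)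
  qed
qed (auto simp: coact_to_left_def \<alpha>)

lemma (in dual_pair) antipode_anti_comult_map:
  "anti_comult_map (opp K) K (antipode K)" "anti_comult_map K (opp K) (antipode_inv K)"
  using coalg antipode_map antipode_inv_map
  by (auto intro!: anti_comult_map.intro simp: antipode_mult antipode_inv_mult antipode_one antipode_inv_one
     comult_antipode_K comult_antipode_inv_K counit_antipode counit_antipode_inv)

lemma (in dual_pair) side_changes:
  assumes X: "k_algebra X"
  shows "linear_map X (tensor_alg X K) \<alpha> ==> right_to_left_op K X \<alpha> = coact_to_left (antipode_inv K) (opp K) X \<alpha>"
    and "linear_map X (tensor_alg (opp K) X) \<beta> ==> left_op_to_right K X \<beta> = coact_to_right (antipode K) K X \<beta>"
    and "linear_map X (tensor_alg K X) \<gamma> ==> left_to_right_op K X \<gamma> = coact_to_right (antipode_inv K) (opp K) X \<gamma>"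
proof -
  note vX [simp] = k_algebra_vspace[OF X]
  have slot: "bilinear_form K X (%c y. F (antipode_inv K c) y)" "bilinear_form K X (%c y. F (antipode K c) y)"
    if "bilinear_form K X F" for F
    by (intro hopf_lin linear_map_compose[OF antipode_inv_map] bilinear_form_slot[OF that]; simp)+
  have slot': "bilinear_form X K (%y c. F y (antipode_inv K c))" if "bilinear_form X K F" for F
    by (intro hopf_lin linear_map_compose[OF antipode_inv_map] bilinear_form_slot[OF that]; simp)
  have swap: "bilinear_form K X (%c y. F y c)" if "bilinear_form X K F" for F
    using that by (simp add: bilinear_form_def)
  show "linear_map X (tensor_alg X K) \<alpha> ==> right_to_left_op K X \<alpha> = coact_to_left (antipode_inv K) (opp K) X \<alpha>"
    unfolding right_to_left_op_def coact_to_left_def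
    by (intro restrict_ext) (simp add: map2_def flip_def T2_eq_iff slot)
  show "linear_map X (tensor_alg (opp K) X) \<beta> ==> left_op_to_right K X \<beta> = coact_to_right (antipode K) K X \<beta>"
    unfolding left_op_to_right_def coact_to_right_def
    by (intro restrict_ext) (simp add: map2_def flip_def T2_eq_iff slot swap)
  show "linear_map X (tensor_alg K X) \<gamma> ==> left_to_right_op K X \<gamma> = coact_to_right (antipode_inv K) (opp K) X \<gamma>"
    unfolding left_to_right_op_def coact_to_right_def
    by (intro restrict_ext) (simp add: map2_def flip_def T2_eq_iff slot')
qed

section \<open>The Yetter--Drinfeld conditions in terms of functionals\<close>

lemma leg13_eq_leg: "leg13 U V W t = leg U V W (%a c. a) (%a c. \<one>\<^bsub>V\<^esub>) (%a c. c) t"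
  by (simp add: leg13_def leg_def)

lemma Ad_inverse_iff:
  assumes M: "monoid M" and u: "u \<in> carrier M" "u' \<in> carrier M" "u \<otimes>\<^bsub>M\<^esub> u' = \<one>\<^bsub>M\<^esub>" "u' \<otimes>\<^bsub>M\<^esub> u = \<one>\<^bsub>M\<^esub>"
    and zw: "z \<in> carrier M" "w \<in> carrier M"
  shows "w = Ad M u z \<longleftrightarrow> z = Ad M u' w"
  using Ad_eq_iff(2)[OF M u zw] Ad_eq_iff(3)[OF M u(2,1,4,3) zw(2,1)] by auto

context dual_pair
begin

lemma slide:
  assumes l: "l \<in> carrier L" and k: "k \<in> carrier K" and G: "linear_form K G"
  shows "(\<Sum>i<n. p k (f i \<otimes>\<^bsub>L\<^esub> l) * G (e i)) = comult K k (%k1 k2. p k2 l * G k1)"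
    and "(\<Sum>i<n. p k (l \<otimes>\<^bsub>L\<^esub> f i) * G (e i)) = comult K k (%k1 k2. p k1 l * G k2)"
proof -
  have G': "bilinear_form K K (%k1 k2. p k2 l * G k1)" "bilinear_form K K (%k1 k2. p k1 l * G k2)"
    by (intro pair_lin linear_form_compose[OF G] l)+
  have exp: "p k l = (\<Sum>j<n. p k (f j) * p (e j) l)" if "k \<in> carrier K" for k
    by (rule expand_K[OF that]) (intro pair_lin l)
  have expl: "p k (f i \<otimes>\<^bsub>L\<^esub> l) = (\<Sum>j<n. p k (f i \<otimes>\<^bsub>L\<^esub> f j) * p (e j) l)"
    "p k (l \<otimes>\<^bsub>L\<^esub> f i) = (\<Sum>j<n. p k (f j \<otimes>\<^bsub>L\<^esub> f i) * p (e j) l)" if "i < n" for i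
  proof -
    have "linear_form L (%l. p k (f i \<otimes>\<^bsub>L\<^esub> l))" "linear_form L (%l. p k (l \<otimes>\<^bsub>L\<^esub> f i))"
     by (intro pair_lin k; simp add: that)+
    then show "p k (f i \<otimes>\<^bsub>L\<^esub> l) = (\<Sum>j<n. p k (f i \<otimes>\<^bsub>L\<^esub> f j) * p (e j) l)"
     "p k (l \<otimes>\<^bsub>L\<^esub> f i) = (\<Sum>j<n. p k (f j \<otimes>\<^bsub>L\<^esub> f i) * p (e j) l)"
     using expand_L[OF l, of "%l. p k (f i \<otimes>\<^bsub>L\<^esub> l)"] expand_L[OF l, of "%l. p k (l \<otimes>\<^bsub>L\<^esub> f i)"]
     by (simp_all add: mult.commute)
  qed
  show "(\<Sum>i<n. p k (f i \<otimes>\<^bsub>L\<^esub> l) * G (e i)) = comult K k (%k1 k2. p k2 l * G k1)"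
    unfolding comult_K_expand[OF G'(1) k] by (simp add: expl sum_distrib_right mult.assoc)
  show "(\<Sum>i<n. p k (l \<otimes>\<^bsub>L\<^esub> f i) * G (e i)) = comult K k (%k1 k2. p k1 l * G k2)"
    unfolding comult_K_expand[OF G'(2) k] by (subst sum.swap) (simp add: expl sum_distrib_right mult.assoc)
qed

text \<open>The four conditions have the same shape once the coactions are brought to a common side; they
  differ in the order of multiplication in the two outer legs. The order in L determines whether
  the coproduct or its opposite appears after pairing with K. This common form is equivalent to
  its pairing with the elements of K, since these separate the points of L.\<close>

lemma YD_standard_form:
  fixes A :: "'x => ('k, 'x, 'a) tensor" and B :: "'x => ('k, 'b, 'x) tensor"
  assumes X: "k_algebra X" and A: "linear_map X (tensor_alg X K) A" and B: "linear_map X (tensor_alg L X) B"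
    and a: "bilinear_map X K X a"
    and form: "!!x k g. x \<in> carrier X ==> k \<in> carrier K ==> linear_form X g ==> g (a x k) = B x (%l y. p k l * g y)"
    and \<mu>: "bilinear_map K K K \<mu>" and \<nu>: "bilinear_map L L L \<nu>"
    and D: "!!k. k \<in> carrier K ==> D k \<in> tens K K"
    and slide1: "!!k l G. k \<in> carrier K ==> l \<in> carrier L ==> linear_form K G ==>
     (\<Sum>i<n. p k (\<nu> (f i) l) * G (e i)) = D k (%k1 k2. p k2 l * G k1)"
    and slide2: "!!k l G. k \<in> carrier K ==> l \<in> carrier L ==> linear_form K G ==>
     (\<Sum>i<n. p k (\<nu> l (f i)) * G (e i)) = D k (%k1 k2. p k1 l * G k2)"
    and x: "x \<in> carrier X"
  shows "(\<forall>T. trilinear_form L X K T -->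
     B x (%l y. A y (%z h. \<Sum>i<n. T (\<nu> (f i) l) z (\<mu> (e i) h))) =
     A x (%y h. B y (%l z. \<Sum>i<n. T (\<nu> l (f i)) z (\<mu> h (e i))))) \<longleftrightarrow>
    (\<forall>k\<in>carrier K. \<forall>F. bilinear_form X K F -->
     D k (%k1 k2. A (a x k2) (%y h. F y (\<mu> k1 h))) = D k (%k1 k2. A x (%y h. F (a y k1) (\<mu> h k2))))"
proof -
  note vX [simp] = k_algebra_vspace[OF X]
  note [simp] = x bilinear_map_closed[OF a] bilinear_map_closed[OF \<mu>] bilinear_map_closed[OF \<nu>]
  note At [simp] = linear_map_tensD(1)[OF A] and Bt [simp] = linear_map_tensD(1)[OF B]
  note xlin = pair_lin X linear_map_tensD(2,3)[OF A] linear_map_tensD(2,3)[OF B] bilinear_map_slot[OF a]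
    bilinear_map_slot[OF \<mu>] bilinear_map_slot[OF \<nu>]
  note Acong = tens_cong[OF At vX vK] and Bcong = tens_cong[OF Bt vspace_L vX]
  note Dcong = tens_cong[OF D vK vK]
  let ?l = "T3 L X K (%T. B x (%l y. A y (%z h. \<Sum>i<n. T (\<nu> (f i) l) z (\<mu> (e i) h))))"
  let ?r = "T3 L X K (%T. A x (%y h. B y (%l z. \<Sum>i<n. T (\<nu> l (f i)) z (\<mu> h (e i)))))"
  have l: "?l \<in> tens3 L X K"
  proof (rule T3_bind_closed[OF Bt[OF x]])
    fix l y assume [simp]: "l \<in> carrier L" "y \<in> carrier X"
    show "T3 L X K (%T. A y (%z h. \<Sum>i<n. T (\<nu> (f i) l) z (\<mu> (e i) h))) \<in> tens3 L X K"
    proof (rule T3_bind_closed[OF At])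
     fix T assume T: "trilinear_form L X K T"
     show "bilinear_form X K (%z h. \<Sum>i<n. T (\<nu> (f i) l) z (\<mu> (e i) h))"
      by (intro xlin trilinear_form_slot[OF T]; simp)
    qed (auto intro!: tens3_rep_closed)
  next
    fix T assume T: "trilinear_form L X K T"
    show "bilinear_form L X (%l y. A y (%z h. \<Sum>i<n. T (\<nu> (f i) l) z (\<mu> (e i) h)))"
     by (intro xlin trilinear_form_slot[OF T]; simp)
  qed
  have r: "?r \<in> tens3 L X K"
  proof (rule T3_bind_closed[OF At[OF x]])
    fix h y assume [simp]: "h \<in> carrier K" "y \<in> carrier X"
    show "T3 L X K (%T. B y (%l z. \<Sum>i<n. T (\<nu> l (f i)) z (\<mu> h (e i)))) \<in> tens3 L X K"
    proof (rule T3_bind_closed[OF Bt])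
     fix T assume T: "trilinear_form L X K T"
     show "bilinear_form L X (%l z. \<Sum>i<n. T (\<nu> l (f i)) z (\<mu> h (e i)))"
      by (intro xlin trilinear_form_slot[OF T]; simp)
    qed (auto intro!: tens3_rep_closed)
  next
    fix T assume T: "trilinear_form L X K T"
    show "bilinear_form X K (%y h. B y (%l z. \<Sum>i<n. T (\<nu> l (f i)) z (\<mu> h (e i))))"
     by (intro xlin trilinear_form_slot[OF T]; simp)
  qed
  have test: "trilinear_form L X K (%l y h. p k l * F y h)" if "k \<in> carrier K" and F: "bilinear_form X K F" for k F
    by (intro xlin bilinear_form_slot[OF F] that)
  have left: "?l (%l y h. p k l * F y h) = D k (%k1 k2. A (a x k2) (%y h. F y (\<mu> k1 h)))"
    if k [simp]: "k \<in> carrier K" and F: "bilinear_form X K F" for k F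
  proof -
    note Fs = bilinear_form_slot[OF F]
    have "?l (%l y h. p k l * F y h) = B x (%l y. A y (%z h. D k (%k1 k2. p k2 l * F z (\<mu> k1 h))))"
     unfolding T3_apply[OF test[OF k F]]
     by (rule Bcong[OF x], rule Acong, assumption, rule slide1[OF k], assumption, (intro xlin Fs; simp))
    also have "... = B x (%l y. D k (%k1 k2. A y (%z h. p k2 l * F z (\<mu> k1 h))))"
     by (rule Bcong[OF x], rule tens_fubini[OF At D[OF k]]; (intro xlin Fs)?; simp)
    also have "... = D k (%k1 k2. B x (%l y. A y (%z h. p k2 l * F z (\<mu> k1 h))))"
     by (rule tens_fubini[OF Bt[OF x] D[OF k]]; (intro xlin Fs)?; simp)
    also have "... = D k (%k1 k2. A (a x k2) (%y h. F y (\<mu> k1 h)))"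
    proof (rule Dcong[OF k])
     fix k1 k2 assume [simp]: "k1 \<in> carrier K" "k2 \<in> carrier K"
     have G: "linear_form X (%y. A y (%z h. F z (\<mu> k1 h)))" by (intro xlin Fs; simp)
     have "B x (%l y. A y (%z h. p k2 l * F z (\<mu> k1 h))) = B x (%l y. p k2 l * A y (%z h. F z (\<mu> k1 h)))"
      by (rule Bcong[OF x]) (simp add: tens_scale(1)[OF At])
     then show "B x (%l y. A y (%z h. p k2 l * F z (\<mu> k1 h))) = A (a x k2) (%y h. F y (\<mu> k1 h))"
      using form[OF x _ G, of k2] by simp
    qed
    finally show ?thesis .
  qed
  have right: "?r (%l y h. p k l * F y h) = D k (%k1 k2. A x (%y h. F (a y k1) (\<mu> h k2)))"
    if k [simp]: "k \<in> carrier K" and F: "bilinear_form X K F" for k F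
  proof -
    note Fs = bilinear_form_slot[OF F]
    have "?r (%l y h. p k l * F y h) = A x (%y h. B y (%l z. D k (%k1 k2. p k1 l * F z (\<mu> h k2))))"
     unfolding T3_apply[OF test[OF k F]]
     by (rule Acong[OF x], rule Bcong, assumption, rule slide2[OF k], assumption, (intro xlin Fs; simp))
    also have "... = A x (%y h. D k (%k1 k2. B y (%l z. p k1 l * F z (\<mu> h k2))))"
     by (rule Acong[OF x], rule tens_fubini[OF Bt D[OF k]]; (intro xlin Fs)?; simp)
    also have "... = D k (%k1 k2. A x (%y h. B y (%l z. p k1 l * F z (\<mu> h k2))))"
     by (rule tens_fubini[OF At[OF x] D[OF k]]; (intro xlin Fs)?; simp)
    also have "... = D k (%k1 k2. A x (%y h. F (a y k1) (\<mu> h k2)))"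
    proof (rule Dcong[OF k], rule Acong[OF x])
     fix k1 k2 y h assume [simp]: "k1 \<in> carrier K" "k2 \<in> carrier K" "y \<in> carrier X" "h \<in> carrier K"
     have G: "linear_form X (%z. F z (\<mu> h k2))" by (intro xlin Fs; simp)
     show "B y (%l z. p k1 l * F z (\<mu> h k2)) = F (a y k1) (\<mu> h k2)"
      using form[OF _ _ G, of y k1] by simp
    qed
    finally show ?thesis .
  qed
  have "?l = ?r \<longleftrightarrow> (\<forall>k\<in>carrier K. \<forall>F. bilinear_form X K F -->
     ?l (%l y h. p k l * F y h) = ?r (%l y h. p k l * F y h))" (is "_ \<longleftrightarrow> ?tests")
  proof
    assume tests: ?tests
    show "?l = ?r"
    proof (rule tens3_eqI[OF l r])
     fix T assume T: "trilinear_form L X K T"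
     show "?l T = ?r T"
      unfolding tens3_expand(1)[OF l T vX vK] tens3_expand(1)[OF r T vX vK]
     proof (rule sum.cong[OF refl])
      fix i assume i: "i \<in> {..<n}"
      have "bilinear_form X K (T (f i))" using T i by (simp add: trilinear_form_def bilinear_form_def)
      then show "?l (%l v w. p (e i) l * T (f i) v w) = ?r (%l v w. p (e i) l * T (f i) v w)"
       using tests i by auto
     qed
    qed
  qed (simp only: simp_thms, blast)
  then show ?thesis by (simp add: left right T3_eq_iff cong: ball_cong)
qed

lemma flip_apply: "bilinear_form V W F ==> flip V W t F = t (%w v. F v w)"
  by (simp add: flip_def)

end

lemma flip_closed:
  assumes t: "t \<in> tens W V"
  shows "flip V W t \<in> tens V W"
  unfolding flip_def by (rule T2_bind_closed[OF t]) (auto simp: T2_pure_closed bilinear_form_def)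

lemma flip_linear:
  assumes X: "vspace X" and \<alpha>: "linear_map X (tensor_alg W V) \<alpha>"
  shows "linear_map X (tensor_alg V W) (%x. flip V W (\<alpha> x))"
  unfolding linear_map_tens'[OF X]
proof (intro conjI ballI allI impI)
  fix B assume "bilinear_form V W B"
  then have "(%x. flip V W (\<alpha> x) B) = (%x. \<alpha> x (%w v. B v w))" by (simp add: flip_def)
  then show "linear_form X (%x. flip V W (\<alpha> x) B)"
    by (simp only: linear_map_tensD(2)[OF \<alpha> linear_map_id])
qed (simp add: flip_closed linear_map_tensD(1)[OF \<alpha>])

lemma trilinear_swap12:
  assumes T: "trilinear_form V U W T"
  shows "trilinear_form U V W (%u v w. T v u w)"
  by (intro lin trilinear_form_slot[OF T]; simp)

lemma trilinear_swap23:
  assumes T: "trilinear_form U W V T"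
  shows "trilinear_form U V W (%u v w. T u w v)"
  by (intro lin trilinear_form_slot[OF T]; simp)

lemma flip12_apply: "trilinear_form U V W T ==> flip12 U V W t T = t (%v u w. T u v w)"
  and flip23_apply: "trilinear_form U V W T ==> flip23 U V W s T = s (%u w v. T u v w)"
  by (simp_all add: flip12_def flip23_def)

lemma flip12_closed:
  assumes t: "t \<in> tens3 V U W"
  shows "flip12 U V W t \<in> tens3 U V W"
  unfolding flip12_def
  by (rule T3_bind3_closed[OF t]) (simp_all only: T3_pure_closed trilinear_swap12[of U V W])

lemma flip23_closed:
  assumes t: "t \<in> tens3 U W V"
  shows "flip23 U V W t \<in> tens3 U V W"
  unfolding flip23_def
  by (rule T3_bind3_closed[OF t]) (simp_all only: T3_pure_closed trilinear_swap23[of U V W])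

lemma flip12_flip12:
  assumes t: "t \<in> tens3 V U W"
  shows "flip12 V U W (flip12 U V W t) = t"
proof (rule tens3_eqI[OF flip12_closed[OF flip12_closed[OF t]] t])
  fix T assume T: "trilinear_form V U W T"
  show "flip12 V U W (flip12 U V W t) T = t T"
    by (simp add: flip12_apply[OF T] flip12_apply[OF trilinear_swap12[OF T]])
qed

lemma flip12_eq_iff:
  assumes "s \<in> tens3 V U W" "t \<in> tens3 U V W"
  shows "s = flip12 V U W t \<longleftrightarrow> flip12 U V W s = t"
  using flip12_flip12[OF assms(1)] flip12_flip12[OF assms(2)] by auto

lemma linear_map_tensor_opp [simp]:
  "linear_map Z (tensor_alg (opp A) B) = linear_map Z (tensor_alg A B)"
  "linear_map Z' (tensor_alg A' (opp B')) = linear_map Z' (tensor_alg A' B')"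
  by (simp_all add: linear_map_tens fun_eq_iff)

lemma tens3_opp [simp]:
  "tens3 (opp A) B C = tens3 A B C" "tens3 A' (opp B') C' = tens3 A' B' C'"
  by (simp_all add: tensor_alg3_def)

lemma (in leg_placement) Ad_leg_sum_iff:
  assumes u: "u \<in> tens A B" "u' \<in> tens A B"
    and inv: "u \<otimes>\<^bsub>tensor_alg A B\<^esub> u' = \<one>\<^bsub>tensor_alg A B\<^esub>" "u' \<otimes>\<^bsub>tensor_alg A B\<^esub> u = \<one>\<^bsub>tensor_alg A B\<^esub>"
    and z: "z \<in> tens3 P Q R" and w: "w \<in> tens3 P Q R"
    and ab: "!!i. i < (n::nat) ==> a i \<in> carrier A" "!!i. i < n ==> b i \<in> carrier B"
  shows "(!!F. bilinear_form A B F ==> u F = (\<Sum>i<n. F (a i) (b i))) ==>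
     w = Ad (tensor_alg3 P Q R) (leg P Q R f g h u) z \<longleftrightarrow>
     (\<forall>T. trilinear_form P Q R T -->
      w (%x y z. \<Sum>i<n. T (x \<otimes>\<^bsub>P\<^esub> f (a i) (b i)) (y \<otimes>\<^bsub>Q\<^esub> g (a i) (b i)) (z \<otimes>\<^bsub>R\<^esub> h (a i) (b i))) =
      z (%x y z. \<Sum>i<n. T (f (a i) (b i) \<otimes>\<^bsub>P\<^esub> x) (g (a i) (b i) \<otimes>\<^bsub>Q\<^esub> y) (h (a i) (b i) \<otimes>\<^bsub>R\<^esub> z)))"
    and "(!!F. bilinear_form A B F ==> u' F = (\<Sum>i<n. F (a i) (b i))) ==>
     w = Ad (tensor_alg3 P Q R) (leg P Q R f g h u) z \<longleftrightarrow>
     (\<forall>T. trilinear_form P Q R T -->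
      w (%x y z. \<Sum>i<n. T (f (a i) (b i) \<otimes>\<^bsub>P\<^esub> x) (g (a i) (b i) \<otimes>\<^bsub>Q\<^esub> y) (h (a i) (b i) \<otimes>\<^bsub>R\<^esub> z)) =
      z (%x y z. \<Sum>i<n. T (x \<otimes>\<^bsub>P\<^esub> f (a i) (b i)) (y \<otimes>\<^bsub>Q\<^esub> g (a i) (b i)) (z \<otimes>\<^bsub>R\<^esub> h (a i) (b i))))"
proof -
  have cl: "f (a i) (b i) \<in> carrier P" "g (a i) (b i) \<in> carrier Q" "h (a i) (b i) \<in> carrier R" if "i < n" for i
    using closed ab that by auto
  have inner: "v (%a b. T (x \<otimes>\<^bsub>P\<^esub> f a b) (y \<otimes>\<^bsub>Q\<^esub> g a b) (z \<otimes>\<^bsub>R\<^esub> h a b)) =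
     (\<Sum>i<n. T (x \<otimes>\<^bsub>P\<^esub> f (a i) (b i)) (y \<otimes>\<^bsub>Q\<^esub> g (a i) (b i)) (z \<otimes>\<^bsub>R\<^esub> h (a i) (b i)))"
    if v: "!!F. bilinear_form A B F ==> v F = (\<Sum>i<n. F (a i) (b i))" and T: "trilinear_form P Q R T"
     and c: "x \<in> carrier P" "y \<in> carrier Q" "z \<in> carrier R" for v T x y z
    by (rule v[OF place[OF trilinear_translate(1)[OF T c]]])
  have outer: "v (%a b. s (%x y z. T (f a b \<otimes>\<^bsub>P\<^esub> x) (g a b \<otimes>\<^bsub>Q\<^esub> y) (h a b \<otimes>\<^bsub>R\<^esub> z))) =
     s (%x y z. \<Sum>i<n. T (f (a i) (b i) \<otimes>\<^bsub>P\<^esub> x) (g (a i) (b i) \<otimes>\<^bsub>Q\<^esub> y) (h (a i) (b i) \<otimes>\<^bsub>R\<^esub> z))"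
    if v: "!!F. bilinear_form A B F ==> v F = (\<Sum>i<n. F (a i) (b i))" and T: "trilinear_form P Q R T"
     and s: "s \<in> tens3 P Q R" for v T s
  proof -
    have "trilinear_form P Q R (%a b c. s (%x y z. T (a \<otimes>\<^bsub>P\<^esub> x) (b \<otimes>\<^bsub>Q\<^esub> y) (c \<otimes>\<^bsub>R\<^esub> z)))"
     by (intro lin tens3_linear[OF _ s] trilinear_form_slot[OF T] PQR; simp)
    from v[OF place[OF this]]
    have "v (%a b. s (%x y z. T (f a b \<otimes>\<^bsub>P\<^esub> x) (g a b \<otimes>\<^bsub>Q\<^esub> y) (h a b \<otimes>\<^bsub>R\<^esub> z))) =
     (\<Sum>i<n. s (%x y z. T (f (a i) (b i) \<otimes>\<^bsub>P\<^esub> x) (g (a i) (b i) \<otimes>\<^bsub>Q\<^esub> y) (h (a i) (b i) \<otimes>\<^bsub>R\<^esub> z)))" .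
    also have "... = s (%x y z. \<Sum>i<n. T (f (a i) (b i) \<otimes>\<^bsub>P\<^esub> x) (g (a i) (b i) \<otimes>\<^bsub>Q\<^esub> y) (h (a i) (b i) \<otimes>\<^bsub>R\<^esub> z))"
     by (rule tens3_scale_sum[OF s, symmetric], rule trilinear_translate(1)[OF T]) (use cl in auto)
    finally show ?thesis .
  qed
  show "w = Ad (tensor_alg3 P Q R) (leg P Q R f g h u) z \<longleftrightarrow>
     (\<forall>T. trilinear_form P Q R T -->
      w (%x y z. \<Sum>i<n. T (x \<otimes>\<^bsub>P\<^esub> f (a i) (b i)) (y \<otimes>\<^bsub>Q\<^esub> g (a i) (b i)) (z \<otimes>\<^bsub>R\<^esub> h (a i) (b i))) =
      z (%x y z. \<Sum>i<n. T (f (a i) (b i) \<otimes>\<^bsub>P\<^esub> x) (g (a i) (b i) \<otimes>\<^bsub>Q\<^esub> y) (h (a i) (b i) \<otimes>\<^bsub>R\<^esub> z)))"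
    if rep: "!!F. bilinear_form A B F ==> u F = (\<Sum>i<n. F (a i) (b i))"
  proof -
    have "w (%x y z. u (%a b. T (x \<otimes>\<^bsub>P\<^esub> f a b) (y \<otimes>\<^bsub>Q\<^esub> g a b) (z \<otimes>\<^bsub>R\<^esub> h a b))) =
      w (%x y z. \<Sum>i<n. T (x \<otimes>\<^bsub>P\<^esub> f (a i) (b i)) (y \<otimes>\<^bsub>Q\<^esub> g (a i) (b i)) (z \<otimes>\<^bsub>R\<^esub> h (a i) (b i)))"
     if T: "trilinear_form P Q R T" for T
     by (rule tens3_cong[OF w vPQR inner[OF rep T]])
    then show ?thesis unfolding Ad_leg_iff(1)[OF u inv z w] using outer[OF rep _ z] by simp
  qed
  show "w = Ad (tensor_alg3 P Q R) (leg P Q R f g h u) z \<longleftrightarrow>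
     (\<forall>T. trilinear_form P Q R T -->
      w (%x y z. \<Sum>i<n. T (f (a i) (b i) \<otimes>\<^bsub>P\<^esub> x) (g (a i) (b i) \<otimes>\<^bsub>Q\<^esub> y) (h (a i) (b i) \<otimes>\<^bsub>R\<^esub> z)) =
      z (%x y z. \<Sum>i<n. T (x \<otimes>\<^bsub>P\<^esub> f (a i) (b i)) (y \<otimes>\<^bsub>Q\<^esub> g (a i) (b i)) (z \<otimes>\<^bsub>R\<^esub> h (a i) (b i))))"
    if rep: "!!F. bilinear_form A B F ==> u' F = (\<Sum>i<n. F (a i) (b i))"
  proof -
    have "z (%x y z. u' (%a b. T (x \<otimes>\<^bsub>P\<^esub> f a b) (y \<otimes>\<^bsub>Q\<^esub> g a b) (z \<otimes>\<^bsub>R\<^esub> h a b))) =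
      z (%x y z. \<Sum>i<n. T (x \<otimes>\<^bsub>P\<^esub> f (a i) (b i)) (y \<otimes>\<^bsub>Q\<^esub> g (a i) (b i)) (z \<otimes>\<^bsub>R\<^esub> h (a i) (b i)))"
     if T: "trilinear_form P Q R T" for T
     by (rule tens3_cong[OF z vPQR inner[OF rep T]])
    then show ?thesis unfolding Ad_leg_iff(2)[OF u inv z w] using outer[OF rep _ w] by simp
  qed
qed

context dual_pair
begin

lemma unit_laws: "l \<in> carrier L ==> \<one>\<^bsub>L\<^esub> \<otimes>\<^bsub>L\<^esub> l = l" "l \<in> carrier L ==> l \<otimes>\<^bsub>L\<^esub> \<one>\<^bsub>L\<^esub> = l"
  using ring.is_monoid[OF k_algebra_ring[OF alg_L]] by (auto simp: monoid.l_one monoid.r_one)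

lemma K_mult_closed: "k \<in> carrier K ==> k' \<in> carrier K ==> k \<otimes> k' \<in> carrier K"
  using monoid.m_closed[OF ring.is_monoid[OF k_algebra_ring[OF alg]]] .

lemma lr_functional:
  assumes X: "k_algebra X" and \<alpha>: "linear_map X (tensor_alg K X) \<alpha>" and \<beta>: "linear_map X (tensor_alg X L) \<beta>"
    and x: "x \<in> carrier X"
  shows "map_left K X L \<alpha> (\<beta> x) =
     Ad (tensor_alg3 K X L) (leg13 K X L (copairing K L p)) (map_right K X L \<beta> (\<alpha> x)) \<longleftrightarrow>
    (\<forall>T. trilinear_form K X L T -->
     \<beta> x (%y l. \<alpha> y (%k z. \<Sum>i<n. T (k \<otimes> e i) z (l \<otimes>\<^bsub>L\<^esub> f i))) =
     \<alpha> x (%k y. \<beta> y (%z l. \<Sum>i<n. T (e i \<otimes> k) z (f i \<otimes>\<^bsub>L\<^esub> l))))"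
proof -
  interpret X: ring X using X by (rule k_algebra_ring)
  note vX [simp] = k_algebra_vspace[OF X]
  interpret lp: leg_placement K L K X L "%a c. a" "%a c. \<one>\<^bsub>X\<^esub>" "%a c. c"
    by (rule leg_placement_13[OF alg X alg_L])
  let ?w = "map_left K X L \<alpha> (\<beta> x)" and ?z = "map_right K X L \<beta> (\<alpha> x)"
  have w: "?w \<in> tens3 K X L" by (rule map_left_closed[OF \<alpha>]) (simp_all add: linear_map_tensD(1)[OF \<beta> x])
  have z: "?z \<in> tens3 K X L" by (rule map_right_closed[OF \<beta>]) (simp_all add: linear_map_tensD(1)[OF \<alpha> x])
  have "?w (%k z l. \<Sum>i<n. T (k \<otimes> e i) (z \<otimes>\<^bsub>X\<^esub> \<one>\<^bsub>X\<^esub>) (l \<otimes>\<^bsub>L\<^esub> f i)) =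
     \<beta> x (%y l. \<alpha> y (%k z. \<Sum>i<n. T (k \<otimes> e i) z (l \<otimes>\<^bsub>L\<^esub> f i)))"
    "?z (%k z l. \<Sum>i<n. T (e i \<otimes> k) (\<one>\<^bsub>X\<^esub> \<otimes>\<^bsub>X\<^esub> z) (f i \<otimes>\<^bsub>L\<^esub> l)) =
     \<alpha> x (%k y. \<beta> y (%z l. \<Sum>i<n. T (e i \<otimes> k) z (f i \<otimes>\<^bsub>L\<^esub> l)))"
    if T: "trilinear_form K X L T" for T
  proof -
    have 1: "trilinear_form K X L (%k z l. \<Sum>i<n. T (k \<otimes> e i) z (l \<otimes>\<^bsub>L\<^esub> f i))"
     "trilinear_form K X L (%k z l. \<Sum>i<n. T (e i \<otimes> k) z (f i \<otimes>\<^bsub>L\<^esub> l))"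
     by (intro pair_lin trilinear_form_slot[OF T]; simp)+
    show "?w (%k z l. \<Sum>i<n. T (k \<otimes> e i) (z \<otimes>\<^bsub>X\<^esub> \<one>\<^bsub>X\<^esub>) (l \<otimes>\<^bsub>L\<^esub> f i)) =
     \<beta> x (%y l. \<alpha> y (%k z. \<Sum>i<n. T (k \<otimes> e i) z (l \<otimes>\<^bsub>L\<^esub> f i)))"
     unfolding map_left_apply[OF 1(1), symmetric] by (rule tens3_cong[OF w]) simp_all
    show "?z (%k z l. \<Sum>i<n. T (e i \<otimes> k) (\<one>\<^bsub>X\<^esub> \<otimes>\<^bsub>X\<^esub> z) (f i \<otimes>\<^bsub>L\<^esub> l)) =
     \<alpha> x (%k y. \<beta> y (%z l. \<Sum>i<n. T (e i \<otimes> k) z (f i \<otimes>\<^bsub>L\<^esub> l)))"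
     unfolding map_right_apply[OF 1(2), symmetric] by (rule tens3_cong[OF z]) simp_all
  qed
  then show ?thesis
    unfolding leg13_eq_leg copairing_copair
    using lp.Ad_leg_sum_iff(1)[OF copair_closed(1,2) copair_inverse z w, of n e f] by (simp add: copair_apply)
qed

lemma rl_iff_lr:
  assumes X: "k_algebra X" and \<alpha>: "linear_map X (tensor_alg X K) \<alpha>" and \<beta>: "linear_map X (tensor_alg L X) \<beta>"
    and x: "x \<in> carrier X"
  shows "map_right L X K \<alpha> (\<beta> x) = Ad (tensor_alg3 L X K)
     (leg13 L X K (flip L K (inv\<^bsub>tensor_alg K L\<^esub> (copairing K L p)))) (map_left L X K \<beta> (\<alpha> x)) \<longleftrightarrow>
    map_left L X K \<beta> (\<alpha> x) = Ad (tensor_alg3 L X K)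
     (leg13 L X K (copairing L K (%l k. p k l))) (map_right L X K \<alpha> (\<beta> x))"
proof -
  interpret sw: dual_pair L K "%l k. p k l" n f e by (rule swap)
  note vX [simp] = k_algebra_vspace[OF X]
  interpret lp: leg_placement L K L X K "%a c. a" "%a c. \<one>\<^bsub>X\<^esub>" "%a c. c"
    by (rule leg_placement_13[OF alg_L X alg])
  have w: "map_right L X K \<alpha> (\<beta> x) \<in> tens3 L X K"
    by (rule map_right_closed[OF \<alpha>]) (simp_all add: linear_map_tensD(1)[OF \<beta> x])
  have z: "map_left L X K \<beta> (\<alpha> x) \<in> tens3 L X K"
    by (rule map_left_closed[OF \<beta>]) (simp_all add: linear_map_tensD(1)[OF \<alpha> x])
  show ?thesis
    unfolding leg13_eq_leg inv_copairing flip_copair_inv sw.copairing_copair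
    by (rule Ad_inverse_iff[OF monoid_tensor_alg3[OF alg_L X alg]])
     (simp_all add: lp.leg_closed sw.copair_closed lp.leg_hom sw.copair_inverse lp.leg_one w z)
qed

lemma ll_functional:
  assumes X: "k_algebra X" and \<alpha>: "linear_map X (tensor_alg K X) \<alpha>" and \<beta>: "linear_map X (tensor_alg L X) \<beta>"
    and x: "x \<in> carrier X"
  shows "map_right L (opp K) X \<alpha> (\<beta> x) = flip12 L (opp K) X
     (on12 (opp K) L X (Ad (tensor_alg (opp K) L) (copairing_op K L p)) (map_right (opp K) L X \<beta> (\<alpha> x))) \<longleftrightarrow>
    (\<forall>T. trilinear_form K L X T -->
     \<beta> x (%l y. \<alpha> y (%k z. \<Sum>i<n. T (e i \<otimes> k) (l \<otimes>\<^bsub>L\<^esub> f i) z)) =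
     \<alpha> x (%k y. \<beta> y (%l z. \<Sum>i<n. T (k \<otimes> e i) (f i \<otimes>\<^bsub>L\<^esub> l) z)))" (is "?YD \<longleftrightarrow> ?U")
    and "map_right L (opp K) X \<alpha> (\<beta> x) = flip12 L (opp K) X
     (on12 (opp K) L X (Ad (tensor_alg (opp K) L) (copairing_op K L p)) (map_right (opp K) L X \<beta> (\<alpha> x))) \<longleftrightarrow>
    (\<forall>T. trilinear_form K L X T -->
     \<beta> x (%l y. \<alpha> y (%k z. \<Sum>i<n. T (k \<otimes> antipode_inv K (e i)) (f i \<otimes>\<^bsub>L\<^esub> l) z)) =
     \<alpha> x (%k y. \<beta> y (%l z. \<Sum>i<n. T (antipode_inv K (e i) \<otimes> k) (l \<otimes>\<^bsub>L\<^esub> f i) z)))" (is "_ \<longleftrightarrow> ?V")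
proof -
  interpret X: ring X using X by (rule k_algebra_ring)
  note vX [simp] = k_algebra_vspace[OF X]
  note algop = k_algebra_opp[OF alg]
  note [simp] = k_algebra_vspace[OF algop]
  interpret lp: leg_placement "opp K" L "opp K" L X "%a b. a" "%a b. b" "%a b. \<one>\<^bsub>X\<^esub>"
    by (rule leg_placement_12[OF algop alg_L X])
  let ?r = "map_right L (opp K) X \<alpha> (\<beta> x)" and ?z = "map_right (opp K) L X \<beta> (\<alpha> x)"
  let ?w = "flip12 (opp K) L X ?r"
  have \<alpha>': "linear_map X (tensor_alg (opp K) X) \<alpha>" using \<alpha> by simp
  have r: "?r \<in> tens3 L (opp K) X"
    by (rule map_right_closed[OF \<alpha>' linear_map_tensD(1)[OF \<beta> x]]) simp_all
  have w: "?w \<in> tens3 (opp K) L X" by (rule flip12_closed[OF r])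
  have z: "?z \<in> tens3 (opp K) L X" by (rule map_right_closed[OF \<beta>]) (simp_all add: linear_map_tensD(1)[OF \<alpha> x])
  have U: "copair \<in> tens (opp K) L" "copair_op_inv \<in> tens (opp K) L" using copair_closed by simp_all
  have Ad: "on12 (opp K) L X (Ad (tensor_alg (opp K) L) copair) ?z =
    Ad (tensor_alg3 (opp K) L X) (leg (opp K) L X (%a b. a) (%a b. b) (%a b. \<one>\<^bsub>X\<^esub>) copair) ?z"
    by (rule Ad_leg12[OF algop alg_L X U copair_op_inverse z])
  have Ad_closed: "Ad (tensor_alg3 (opp K) L X) (leg (opp K) L X (%a b. a) (%a b. b) (%a b. \<one>\<^bsub>X\<^esub>) copair) ?z \<in> tens3 (opp K) L X"
    unfolding Ad_def lp.leg_inverse[OF U copair_op_inverse]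
    by (intro tensor_alg3_mult_closed[OF algop alg_L X] lp.leg_closed U z)
  have YD: "?YD \<longleftrightarrow> ?w = Ad (tensor_alg3 (opp K) L X) (leg (opp K) L X (%a b. a) (%a b. b) (%a b. \<one>\<^bsub>X\<^esub>) copair) ?z"
    unfolding copairing_copair Ad by (rule flip12_eq_iff[OF r Ad_closed])
  have ev: "?w T = \<beta> x (%l y. \<alpha> y (%k z. T k l z))" "?z T = \<alpha> x (%k y. \<beta> y (%l z. T k l z))"
    if T: "trilinear_form K L X T" for T
    using T by (simp_all add: flip12_apply map_right_apply trilinear_swap12[OF T])
  have units: "?w (%k l z. \<Sum>i<n. T (s i k) (t i l) (z \<otimes>\<^bsub>X\<^esub> \<one>\<^bsub>X\<^esub>)) = \<beta> x (%l y. \<alpha> y (%k z. \<Sum>i<n. T (s i k) (t i l) z))"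
    "?w (%k l z. \<Sum>i<n. T (s i k) (t i l) (\<one>\<^bsub>X\<^esub> \<otimes>\<^bsub>X\<^esub> z)) = \<beta> x (%l y. \<alpha> y (%k z. \<Sum>i<n. T (s i k) (t i l) z))"
    "?z (%k l z. \<Sum>i<n. T (s i k) (t i l) (z \<otimes>\<^bsub>X\<^esub> \<one>\<^bsub>X\<^esub>)) = \<alpha> x (%k y. \<beta> y (%l z. \<Sum>i<n. T (s i k) (t i l) z))"
    "?z (%k l z. \<Sum>i<n. T (s i k) (t i l) (\<one>\<^bsub>X\<^esub> \<otimes>\<^bsub>X\<^esub> z)) = \<alpha> x (%k y. \<beta> y (%l z. \<Sum>i<n. T (s i k) (t i l) z))"
    if T: "trilinear_form K L X T" and s: "!!i. i < n ==> linear_map K K (s i)" and t: "!!i. i < n ==> linear_map L L (t i)" for T s t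
  proof -
    have c: "s i k \<in> carrier K" "t i l \<in> carrier L" if "i < n" "k \<in> carrier K" "l \<in> carrier L" for i k l
     using linear_map_closed[OF s] linear_map_closed[OF t] that by auto
    have 1: "trilinear_form K L X (%k l z. \<Sum>i<n. T (s i k) (t i l) z)"
     by (intro trilinear_formI linear_form_sum trilinear_form_slot[OF T] linear_map_id s t) (auto intro: c)
    show "?w (%k l z. \<Sum>i<n. T (s i k) (t i l) (z \<otimes>\<^bsub>X\<^esub> \<one>\<^bsub>X\<^esub>)) = \<beta> x (%l y. \<alpha> y (%k z. \<Sum>i<n. T (s i k) (t i l) z))"
     "?w (%k l z. \<Sum>i<n. T (s i k) (t i l) (\<one>\<^bsub>X\<^esub> \<otimes>\<^bsub>X\<^esub> z)) = \<beta> x (%l y. \<alpha> y (%k z. \<Sum>i<n. T (s i k) (t i l) z))"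
     unfolding ev(1)[OF 1, symmetric] by (rule tens3_cong[OF w]; simp)+
    show "?z (%k l z. \<Sum>i<n. T (s i k) (t i l) (z \<otimes>\<^bsub>X\<^esub> \<one>\<^bsub>X\<^esub>)) = \<alpha> x (%k y. \<beta> y (%l z. \<Sum>i<n. T (s i k) (t i l) z))"
     "?z (%k l z. \<Sum>i<n. T (s i k) (t i l) (\<one>\<^bsub>X\<^esub> \<otimes>\<^bsub>X\<^esub> z)) = \<alpha> x (%k y. \<beta> y (%l z. \<Sum>i<n. T (s i k) (t i l) z))"
     unfolding ev(2)[OF 1, symmetric] by (rule tens3_cong[OF z]; simp)+
  qed
  have maps: "linear_map K K (%k. c \<otimes> k)" "linear_map K K (%k. k \<otimes> c)" if "c \<in> carrier K" for c
    by (intro pair_lin that)+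
  have mapsL: "linear_map L L (%k. c \<otimes>\<^bsub>L\<^esub> k)" "linear_map L L (%k. k \<otimes>\<^bsub>L\<^esub> c)" if "c \<in> carrier L" for c
    by (intro pair_lin that)+
  show "?YD \<longleftrightarrow> ?U"
    unfolding YD
    using lp.Ad_leg_sum_iff(1)[OF U copair_op_inverse z w, of n e f]
    by (simp add: copair_apply maps mapsL
      units(1)[of _ "%i k. e i \<otimes> k" "%i l. l \<otimes>\<^bsub>L\<^esub> f i"]
      units(4)[of _ "%i k. k \<otimes> e i" "%i l. f i \<otimes>\<^bsub>L\<^esub> l"])
  show "?YD \<longleftrightarrow> ?V"
    unfolding YD
    using lp.Ad_leg_sum_iff(2)[OF U copair_op_inverse z w, of n "%i. antipode_inv K (e i)" f]
    by (simp add: copair_apply maps mapsL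
      units(2)[of _ "%i k. k \<otimes> antipode_inv K (e i)" "%i l. f i \<otimes>\<^bsub>L\<^esub> l"]
      units(3)[of _ "%i k. antipode_inv K (e i) \<otimes> k" "%i l. l \<otimes>\<^bsub>L\<^esub> f i"])
qed

lemma rr_functional:
  assumes X: "k_algebra X" and \<alpha>: "linear_map X (tensor_alg X K) \<alpha>" and \<beta>: "linear_map X (tensor_alg X L) \<beta>"
    and x: "x \<in> carrier X"
  shows "map_left X (opp K) L \<alpha> (\<beta> x) = on23 X (opp K) L
     (Ad (tensor_alg (opp K) L) (inv\<^bsub>tensor_alg (opp K) L\<^esub> (copairing_op K L p)))
     (flip23 X (opp K) L (map_left X L (opp K) \<beta> (\<alpha> x))) \<longleftrightarrow>
    (\<forall>T. trilinear_form X K L T -->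
     \<beta> x (%y l. \<alpha> y (%z k. \<Sum>i<n. T z (k \<otimes> e i) (f i \<otimes>\<^bsub>L\<^esub> l))) =
     \<alpha> x (%y k. \<beta> y (%z l. \<Sum>i<n. T z (e i \<otimes> k) (l \<otimes>\<^bsub>L\<^esub> f i))))" (is "?YD \<longleftrightarrow> ?U")
    and "map_left X (opp K) L \<alpha> (\<beta> x) = on23 X (opp K) L
     (Ad (tensor_alg (opp K) L) (inv\<^bsub>tensor_alg (opp K) L\<^esub> (copairing_op K L p)))
     (flip23 X (opp K) L (map_left X L (opp K) \<beta> (\<alpha> x))) \<longleftrightarrow>
    (\<forall>T. trilinear_form X K L T -->
     \<beta> x (%y l. \<alpha> y (%z k. \<Sum>i<n. T z (antipode_inv K (e i) \<otimes> k) (l \<otimes>\<^bsub>L\<^esub> f i))) =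
     \<alpha> x (%y k. \<beta> y (%z l. \<Sum>i<n. T z (k \<otimes> antipode_inv K (e i)) (f i \<otimes>\<^bsub>L\<^esub> l))))" (is "_ \<longleftrightarrow> ?V")
proof -
  interpret X: ring X using X by (rule k_algebra_ring)
  note vX [simp] = k_algebra_vspace[OF X]
  note algop = k_algebra_opp[OF alg]
  note [simp] = k_algebra_vspace[OF algop]
  interpret lp: leg_placement "opp K" L X "opp K" L "%a b. \<one>\<^bsub>X\<^esub>" "%a b. a" "%a b. b"
    by (rule leg_placement_23[OF X algop alg_L])
  let ?w = "map_left X (opp K) L \<alpha> (\<beta> x)" and ?r = "map_left X L (opp K) \<beta> (\<alpha> x)"
  let ?z = "flip23 X (opp K) L ?r"
  let ?l = "leg X (opp K) L (%a b. \<one>\<^bsub>X\<^esub>) (%a b. a) (%a b. b)"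
  have \<alpha>': "linear_map X (tensor_alg X (opp K)) \<alpha>" using \<alpha> by simp
  have w: "?w \<in> tens3 X (opp K) L"
    by (rule map_left_closed[OF \<alpha>' linear_map_tensD(1)[OF \<beta> x]]) simp_all
  have r: "?r \<in> tens3 X L (opp K)"
    by (rule map_left_closed[OF \<beta> linear_map_tensD(1)[OF \<alpha>' x]]) simp_all
  have z: "?z \<in> tens3 X (opp K) L" by (rule flip23_closed[OF r])
  have U: "copair_op_inv \<in> tens (opp K) L" "copair \<in> tens (opp K) L" using copair_closed by simp_all
  note inv = copair_op_inverse(2,1)
  have YD: "?YD \<longleftrightarrow> ?w = Ad (tensor_alg3 X (opp K) L) (?l copair_op_inv) ?z"
    unfolding inv_copairing Ad_leg23[OF X algop alg_L U inv z] ..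
  have ev: "?w T = \<beta> x (%y l. \<alpha> y (%z k. T z k l))" "?z T = \<alpha> x (%y k. \<beta> y (%z l. T z k l))"
    if T: "trilinear_form X K L T" for T
    using T by (simp_all add: flip23_apply map_left_apply trilinear_swap23[OF T])
  have units: "?w (%z k l. \<Sum>i<n. T (z \<otimes>\<^bsub>X\<^esub> \<one>\<^bsub>X\<^esub>) (s i k) (t i l)) = \<beta> x (%y l. \<alpha> y (%z k. \<Sum>i<n. T z (s i k) (t i l)))"
    "?w (%z k l. \<Sum>i<n. T (\<one>\<^bsub>X\<^esub> \<otimes>\<^bsub>X\<^esub> z) (s i k) (t i l)) = \<beta> x (%y l. \<alpha> y (%z k. \<Sum>i<n. T z (s i k) (t i l)))"
    "?z (%z k l. \<Sum>i<n. T (z \<otimes>\<^bsub>X\<^esub> \<one>\<^bsub>X\<^esub>) (s i k) (t i l)) = \<alpha> x (%y k. \<beta> y (%z l. \<Sum>i<n. T z (s i k) (t i l)))"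
    "?z (%z k l. \<Sum>i<n. T (\<one>\<^bsub>X\<^esub> \<otimes>\<^bsub>X\<^esub> z) (s i k) (t i l)) = \<alpha> x (%y k. \<beta> y (%z l. \<Sum>i<n. T z (s i k) (t i l)))"
    if T: "trilinear_form X K L T" and s: "!!i. i < n ==> linear_map K K (s i)" and t: "!!i. i < n ==> linear_map L L (t i)" for T s t
  proof -
    have c: "s i k \<in> carrier K" "t i l \<in> carrier L" if "i < n" "k \<in> carrier K" "l \<in> carrier L" for i k l
     using linear_map_closed[OF s] linear_map_closed[OF t] that by auto
    have 1: "trilinear_form X K L (%z k l. \<Sum>i<n. T z (s i k) (t i l))"
     by (intro trilinear_formI linear_form_sum trilinear_form_slot[OF T] linear_map_id s t) (auto intro: c)
    show "?w (%z k l. \<Sum>i<n. T (z \<otimes>\<^bsub>X\<^esub> \<one>\<^bsub>X\<^esub>) (s i k) (t i l)) = \<beta> x (%y l. \<alpha> y (%z k. \<Sum>i<n. T z (s i k) (t i l)))"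
     "?w (%z k l. \<Sum>i<n. T (\<one>\<^bsub>X\<^esub> \<otimes>\<^bsub>X\<^esub> z) (s i k) (t i l)) = \<beta> x (%y l. \<alpha> y (%z k. \<Sum>i<n. T z (s i k) (t i l)))"
     unfolding ev(1)[OF 1, symmetric] by (rule tens3_cong[OF w]; simp)+
    show "?z (%z k l. \<Sum>i<n. T (z \<otimes>\<^bsub>X\<^esub> \<one>\<^bsub>X\<^esub>) (s i k) (t i l)) = \<alpha> x (%y k. \<beta> y (%z l. \<Sum>i<n. T z (s i k) (t i l)))"
     "?z (%z k l. \<Sum>i<n. T (\<one>\<^bsub>X\<^esub> \<otimes>\<^bsub>X\<^esub> z) (s i k) (t i l)) = \<alpha> x (%y k. \<beta> y (%z l. \<Sum>i<n. T z (s i k) (t i l)))"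
     unfolding ev(2)[OF 1, symmetric] by (rule tens3_cong[OF z]; simp)+
  qed
  have maps: "linear_map K K (%k. c \<otimes> k)" "linear_map K K (%k. k \<otimes> c)" if "c \<in> carrier K" for c
    by (intro pair_lin that)+
  have mapsL: "linear_map L L (%k. c \<otimes>\<^bsub>L\<^esub> k)" "linear_map L L (%k. k \<otimes>\<^bsub>L\<^esub> c)" if "c \<in> carrier L" for c
    by (intro pair_lin that)+
  show "?YD \<longleftrightarrow> ?U"
    unfolding YD
    using lp.Ad_leg_sum_iff(2)[OF U inv z w, of n e f]
    by (simp add: copair_apply maps mapsL
      units(2)[of _ "%i k. k \<otimes> e i" "%i l. f i \<otimes>\<^bsub>L\<^esub> l"]
      units(3)[of _ "%i k. e i \<otimes> k" "%i l. l \<otimes>\<^bsub>L\<^esub> f i"])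
  show "?YD \<longleftrightarrow> ?V"
    unfolding YD
    using lp.Ad_leg_sum_iff(1)[OF U inv z w, of n "%i. antipode_inv K (e i)" f]
    by (simp add: copair_apply maps mapsL
      units(1)[of _ "%i k. antipode_inv K (e i) \<otimes> k" "%i l. l \<otimes>\<^bsub>L\<^esub> f i"]
      units(4)[of _ "%i k. k \<otimes> antipode_inv K (e i)" "%i l. f i \<otimes>\<^bsub>L\<^esub> l"])
qed

end

section \<open>Comparison with the standard form and change of sides\<close>

context dual_pair
begin

text \<open>A version of the common form in which coactions on the other side need not be rewritten with flips:
  the maps A, B and D may be replaced by any maps with the same values on bilinear forms.\<close>

lemma YD_standard_form_flexible:
  fixes A :: "'x => ('k, 'x, 'a) tensor" and B :: "'x => ('k, 'b, 'x) tensor"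
  assumes X: "k_algebra X" and A: "linear_map X (tensor_alg X K) A" and B: "linear_map X (tensor_alg L X) B"
    and A': "!!x F. bilinear_form X K F ==> A x F = A' x F"
    and B': "!!x F. bilinear_form L X F ==> B x F = B' x F"
    and D': "!!k F. bilinear_form K K F ==> D k F = D' k F"
    and a: "bilinear_map X K X a"
    and form: "!!x k g. x \<in> carrier X ==> k \<in> carrier K ==> linear_form X g ==> g (a x k) = B' x (%l y. p k l * g y)"
    and \<mu>: "bilinear_map K K K \<mu>" and \<nu>: "bilinear_map L L L \<nu>"
    and D: "!!k. k \<in> carrier K ==> D k \<in> tens K K"
    and slide1: "!!k l G. k \<in> carrier K ==> l \<in> carrier L ==> linear_form K G ==>
     (\<Sum>i<n. p k (\<nu> (f i) l) * G (e i)) = D' k (%k1 k2. p k2 l * G k1)"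
    and slide2: "!!k l G. k \<in> carrier K ==> l \<in> carrier L ==> linear_form K G ==>
     (\<Sum>i<n. p k (\<nu> l (f i)) * G (e i)) = D' k (%k1 k2. p k1 l * G k2)"
    and x: "x \<in> carrier X"
  shows "(\<forall>T. trilinear_form L X K T -->
     B' x (%l y. A' y (%z h. \<Sum>i<n. T (\<nu> (f i) l) z (\<mu> (e i) h))) =
     A' x (%y h. B' y (%l z. \<Sum>i<n. T (\<nu> l (f i)) z (\<mu> h (e i))))) \<longleftrightarrow>
    (\<forall>k\<in>carrier K. \<forall>F. bilinear_form X K F -->
     D' k (%k1 k2. A' (a x k2) (%y h. F y (\<mu> k1 h))) = D' k (%k1 k2. A' x (%y h. F (a y k1) (\<mu> h k2))))"
proof -
  note vX [simp] = k_algebra_vspace[OF X]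
  note [simp] = x bilinear_map_closed[OF a] bilinear_map_closed[OF \<mu>] bilinear_map_closed[OF \<nu>]
  note At = linear_map_tensD(1)[OF A] and Bt = linear_map_tensD(1)[OF B]
  note xlin = pair_lin X linear_map_tensD(2,3)[OF A] linear_map_tensD(2,3)[OF B] bilinear_map_slot[OF a]
    bilinear_map_slot[OF \<mu>] bilinear_map_slot[OF \<nu>]
  have eqs: "B' x (%l y. A' y (%z h. \<Sum>i<n. T (\<nu> (f i) l) z (\<mu> (e i) h))) =
     B x (%l y. A y (%z h. \<Sum>i<n. T (\<nu> (f i) l) z (\<mu> (e i) h)))"
    "A' x (%y h. B' y (%l z. \<Sum>i<n. T (\<nu> l (f i)) z (\<mu> h (e i)))) =
     A x (%y h. B y (%l z. \<Sum>i<n. T (\<nu> l (f i)) z (\<mu> h (e i))))"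
    if T: "trilinear_form L X K T" for T
  proof -
    have 1: "bilinear_form L X (%l y. A y (%z h. \<Sum>i<n. T (\<nu> (f i) l) z (\<mu> (e i) h)))"
     "bilinear_form X K (%y h. B y (%l z. \<Sum>i<n. T (\<nu> l (f i)) z (\<mu> h (e i))))"
     by (intro xlin trilinear_form_slot[OF T]; simp)+
    have 2: "bilinear_form X K (%z h. \<Sum>i<n. T (\<nu> (f i) l) z (\<mu> (e i) h))" if "l \<in> carrier L" for l
     by (intro xlin trilinear_form_slot[OF T]; simp add: that)
    have 3: "bilinear_form L X (%l z. \<Sum>i<n. T (\<nu> l (f i)) z (\<mu> h (e i)))" if "h \<in> carrier K" for h
     by (intro xlin trilinear_form_slot[OF T]; simp add: that)
    have 4: "bilinear_form L X (%l y. A' y (%z h. \<Sum>i<n. T (\<nu> (f i) l) z (\<mu> (e i) h)))"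
     "bilinear_form X K (%y h. B' y (%l z. \<Sum>i<n. T (\<nu> l (f i)) z (\<mu> h (e i))))"
     using 1 A'[OF 2] B'[OF 3] by (simp_all add: bilinear_form_def cong: linear_form_cong)
    show "B' x (%l y. A' y (%z h. \<Sum>i<n. T (\<nu> (f i) l) z (\<mu> (e i) h))) =
     B x (%l y. A y (%z h. \<Sum>i<n. T (\<nu> (f i) l) z (\<mu> (e i) h)))"
     unfolding B'[OF 4(1), symmetric] by (rule tens_cong[OF Bt[OF x] vspace_L vX], rule A'[OF 2, symmetric])
    show "A' x (%y h. B' y (%l z. \<Sum>i<n. T (\<nu> l (f i)) z (\<mu> h (e i)))) =
     A x (%y h. B y (%l z. \<Sum>i<n. T (\<nu> l (f i)) z (\<mu> h (e i))))"
     unfolding A'[OF 4(2), symmetric] by (rule tens_cong[OF At[OF x] vX vK], rule B'[OF 3, symmetric])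
  qed
  have std: "D' k (%k1 k2. A' (a x k2) (%y h. F y (\<mu> k1 h))) = D k (%k1 k2. A (a x k2) (%y h. F y (\<mu> k1 h)))"
    "D' k (%k1 k2. A' x (%y h. F (a y k1) (\<mu> h k2))) = D k (%k1 k2. A x (%y h. F (a y k1) (\<mu> h k2)))"
    if k: "k \<in> carrier K" and F: "bilinear_form X K F" for k F
  proof -
    note Fs = bilinear_form_slot[OF F]
    have 1: "bilinear_form K K (%k1 k2. A (a x k2) (%y h. F y (\<mu> k1 h)))"
     "bilinear_form K K (%k1 k2. A x (%y h. F (a y k1) (\<mu> h k2)))" by (intro xlin Fs; simp)+
    have 2: "A' z (%y h. F y (\<mu> k1 h)) = A z (%y h. F y (\<mu> k1 h))"
     "A' z (%y h. F (a y k1) (\<mu> h k2)) = A z (%y h. F (a y k1) (\<mu> h k2))"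
     if "k1 \<in> carrier K" "k2 \<in> carrier K" for k1 k2 z
     by (rule A'[symmetric]; intro xlin Fs; simp add: that)+
    have 4: "bilinear_form K K (%k1 k2. A' (a x k2) (%y h. F y (\<mu> k1 h)))"
     "bilinear_form K K (%k1 k2. A' x (%y h. F (a y k1) (\<mu> h k2)))"
     using 1 2 by (simp_all add: bilinear_form_def cong: linear_form_cong)
    show "D' k (%k1 k2. A' (a x k2) (%y h. F y (\<mu> k1 h))) = D k (%k1 k2. A (a x k2) (%y h. F y (\<mu> k1 h)))"
     unfolding D'[OF 4(1), symmetric] by (rule tens_cong[OF D[OF k] vK vK], rule 2(1))
    show "D' k (%k1 k2. A' x (%y h. F (a y k1) (\<mu> h k2))) = D k (%k1 k2. A x (%y h. F (a y k1) (\<mu> h k2)))"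
     unfolding D'[OF 4(2), symmetric] by (rule tens_cong[OF D[OF k] vK vK], rule 2(2))
  qed
  have form': "g (a x k) = B x (%l y. p k l * g y)"
    if c: "x \<in> carrier X" "k \<in> carrier K" and g: "linear_form X g" for x k g
    unfolding form[OF c g] by (rule B'[symmetric]; intro xlin linear_form_compose[OF g] c)
  have slides: "(\<Sum>i<n. p k (\<nu> (f i) l) * G (e i)) = D k (%k1 k2. p k2 l * G k1)"
    "(\<Sum>i<n. p k (\<nu> l (f i)) * G (e i)) = D k (%k1 k2. p k1 l * G k2)"
    if c: "k \<in> carrier K" "l \<in> carrier L" and G: "linear_form K G" for k l G
    unfolding slide1[OF c G] slide2[OF c G]
    by (rule D'[symmetric]; intro pair_lin linear_form_compose[OF G] c)+
  from YD_standard_form[OF X A B a form' \<mu> \<nu> D slides x]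
  show ?thesis by (simp add: eqs std)
qed

text \<open>For the conditions on rl and ll, the algebra L enters with its product, respectively with the
  opposite product; this is why the coproduct of K appears in the order of YD_ract_rcoact and in
  the reversed order of YD_ract_lcoact. The same happens for rr and lr.\<close>

lemma comult_flip: "k \<in> carrier K ==> flip K K (comult K k) \<in> tens K K"
  by (rule flip_closed[OF comult_closed])

lemma mult_bilinear: "bilinear_map K K K (%a b. a \<otimes> b)" "bilinear_map K K K (%a b. b \<otimes> a)"
    "bilinear_map L L L (%a b. a \<otimes>\<^bsub>L\<^esub> b)" "bilinear_map L L L (%a b. b \<otimes>\<^bsub>L\<^esub> a)"
  by (intro pair_lin; assumption)+

lemma bilinear_map_swap: "bilinear_map V W Z b ==> bilinear_map W V Z (%w v. b v w)"
  by (simp add: bilinear_map_def)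

lemma all_transfer:
  assumes "!!T. P T ==> P' (\<phi> T) & (Q' (\<phi> T) --> Q T)" "!!T. P' T ==> P (\<psi> T) & (Q (\<psi> T) --> Q' T)"
  shows "(\<forall>T. P T --> Q T) \<longleftrightarrow> (\<forall>T. P' T --> Q' T)"
  using assms by blast

lemma symmetric_conditions:
  fixes G G' :: "'u => 'v => 'w => 'z"
  shows "(\<forall>x\<in>A. \<forall>k\<in>B. \<forall>F. R F --> G x k F = G' x k F) \<longleftrightarrow> (\<forall>k\<in>B. \<forall>x\<in>A. \<forall>F. R F --> G' x k F = G x k F)"
  by (auto simp: eq_commute)

lemma bilinear_swap_all: "(\<forall>F. bilinear_form V W F --> Q (%w v. F v w)) \<longleftrightarrow> (\<forall>F. bilinear_form W V F --> Q F)"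
  by (rule all_transfer[of _ _ "%F w v. F v w" _ _ "%F v w. F w v"]) (auto simp: bilinear_form_def)

lemma rl_functional:
  assumes X: "k_algebra X" and \<alpha>: "linear_map X (tensor_alg X K) \<alpha>" and \<beta>: "linear_map X (tensor_alg L X) \<beta>"
    and x: "x \<in> carrier X"
  shows "map_right L X K \<alpha> (\<beta> x) = Ad (tensor_alg3 L X K)
     (leg13 L X K (flip L K (inv\<^bsub>tensor_alg K L\<^esub> (copairing K L p)))) (map_left L X K \<beta> (\<alpha> x)) \<longleftrightarrow>
    (\<forall>T. trilinear_form L X K T -->
     \<beta> x (%l y. \<alpha> y (%z k. \<Sum>i<n. T (f i \<otimes>\<^bsub>L\<^esub> l) z (e i \<otimes> k))) =
     \<alpha> x (%y k. \<beta> y (%l z. \<Sum>i<n. T (l \<otimes>\<^bsub>L\<^esub> f i) z (k \<otimes> e i))))"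
proof -
  interpret sw: dual_pair L K "%l k. p k l" n f e by (rule swap)
  show ?thesis unfolding rl_iff_lr[OF X \<alpha> \<beta> x] sw.lr_functional[OF X \<beta> \<alpha> x]
    by (auto simp: eq_commute)
qed

lemma rl_standard:
  assumes X: "k_algebra X" and \<alpha>: "linear_map X (tensor_alg X K) \<alpha>" and r: "ract_of X \<beta> a"
  shows "(\<forall>x\<in>carrier X. map_right L X K \<alpha> (\<beta> x) = Ad (tensor_alg3 L X K)
     (leg13 L X K (flip L K (inv\<^bsub>tensor_alg K L\<^esub> (copairing K L p)))) (map_left L X K \<beta> (\<alpha> x))) \<longleftrightarrow>
    (\<forall>k\<in>carrier K. \<forall>x\<in>carrier X.
     T2 X K (%B. comult K k (%k1 k2. \<alpha> x (%x0 h. B (a x0 k1) (h \<otimes> k2)))) =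
     T2 X K (%B. comult K k (%k1 k2. \<alpha> (a x k2) (%y0 h. B y0 (k1 \<otimes> h)))))"
proof -
  note form = YD_standard_form[OF X \<alpha> ract_ofD(1)[OF r] ract_ofD(2)[OF r] ract_ofD(3)[OF r]
    mult_bilinear(1,3) comult_closed slide, simplified]
  show ?thesis
    unfolding T2_eq_iff
    by (simp add: rl_functional[OF X \<alpha> ract_ofD(1)[OF r]] form cong: ball_cong)
     (rule symmetric_conditions)
qed

lemma ll_standard:
  assumes X: "k_algebra X" and \<alpha>: "linear_map X (tensor_alg K X) \<alpha>" and r: "ract_of X \<beta> a"
  shows "(\<forall>x\<in>carrier X. map_right L (opp K) X \<alpha> (\<beta> x) = flip12 L (opp K) X
     (on12 (opp K) L X (Ad (tensor_alg (opp K) L) (copairing_op K L p)) (map_right (opp K) L X \<beta> (\<alpha> x)))) \<longleftrightarrow>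
    (\<forall>k\<in>carrier K. \<forall>x\<in>carrier X.
     T2 K X (%B. comult K k (%k1 k2. \<alpha> x (%h x0. B (h \<otimes> k1) (a x0 k2)))) =
     T2 K X (%B. comult K k (%k1 k2. \<alpha> (a x k1) (%h y0. B (k2 \<otimes> h) y0))))"
proof -
  note vX [simp] = k_algebra_vspace[OF X]
  have form: "(\<forall>T. trilinear_form L X K T -->
     \<beta> x (%l y. \<alpha> y (%h z. \<Sum>i<n. T (l \<otimes>\<^bsub>L\<^esub> f i) z (e i \<otimes> h))) =
     \<alpha> x (%h y. \<beta> y (%l z. \<Sum>i<n. T (f i \<otimes>\<^bsub>L\<^esub> l) z (h \<otimes> e i)))) \<longleftrightarrow>
    (\<forall>k\<in>carrier K. \<forall>F. bilinear_form X K F -->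
     comult K k (%k2 k1. \<alpha> (a x k2) (%h y. F y (k1 \<otimes> h))) =
     comult K k (%k2 k1. \<alpha> x (%h y. F (a y k1) (h \<otimes> k2))))" if x: "x \<in> carrier X" for x
    by (rule YD_standard_form_flexible[OF X flip_linear[OF vX \<alpha>] ract_ofD(1)[OF r] flip_apply refl flip_apply
     ract_ofD(2)[OF r] ract_ofD(3)[OF r] mult_bilinear(1,4) comult_flip slide(2,1) x]) assumption+
  have U: "(\<forall>T. trilinear_form K L X T -->
     \<beta> x (%l y. \<alpha> y (%k z. \<Sum>i<n. T (e i \<otimes> k) (l \<otimes>\<^bsub>L\<^esub> f i) z)) =
     \<alpha> x (%k y. \<beta> y (%l z. \<Sum>i<n. T (k \<otimes> e i) (f i \<otimes>\<^bsub>L\<^esub> l) z))) \<longleftrightarrow>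
    (\<forall>T. trilinear_form L X K T -->
     \<beta> x (%l y. \<alpha> y (%h z. \<Sum>i<n. T (l \<otimes>\<^bsub>L\<^esub> f i) z (e i \<otimes> h))) =
     \<alpha> x (%h y. \<beta> y (%l z. \<Sum>i<n. T (f i \<otimes>\<^bsub>L\<^esub> l) z (h \<otimes> e i))))" for x
    by (rule all_transfer[of _ _ "%T l z k. T k l z" _ _ "%T k l z. T l z k"]) (simp_all add: trilinear_form_def)
  show ?thesis
    unfolding T2_eq_iff bilinear_swap_all[of X K, symmetric]
    by (simp add: ll_functional(1)[OF X \<alpha> ract_ofD(1)[OF r]] U form cong: ball_cong)
     (rule symmetric_conditions)
qed

lemma lr_standard:
  assumes X: "k_algebra X" and \<alpha>: "linear_map X (tensor_alg K X) \<alpha>" and r: "lact_of X \<beta> a"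
  shows "(\<forall>x\<in>carrier X. map_left K X L \<alpha> (\<beta> x) =
     Ad (tensor_alg3 K X L) (leg13 K X L (copairing K L p)) (map_right K X L \<beta> (\<alpha> x))) \<longleftrightarrow>
    (\<forall>k\<in>carrier K. \<forall>x\<in>carrier X.
     T2 K X (%B. comult K k (%k1 k2. \<alpha> x (%h x0. B (k1 \<otimes> h) (a k2 x0)))) =
     T2 K X (%B. comult K k (%k1 k2. \<alpha> (a k1 x) (%h y0. B (h \<otimes> k2) y0))))"
proof -
  note vX [simp] = k_algebra_vspace[OF X]
  have form: "(\<forall>T. trilinear_form L X K T -->
     \<beta> x (%y l. \<alpha> y (%h z. \<Sum>i<n. T (l \<otimes>\<^bsub>L\<^esub> f i) z (h \<otimes> e i))) =
     \<alpha> x (%h y. \<beta> y (%z l. \<Sum>i<n. T (f i \<otimes>\<^bsub>L\<^esub> l) z (e i \<otimes> h)))) \<longleftrightarrow>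
    (\<forall>k\<in>carrier K. \<forall>F. bilinear_form X K F -->
     comult K k (%k2 k1. \<alpha> (a k2 x) (%h y. F y (h \<otimes> k1))) =
     comult K k (%k2 k1. \<alpha> x (%h y. F (a k1 y) (k2 \<otimes> h))))" if x: "x \<in> carrier X" for x
    by (rule YD_standard_form_flexible[OF X flip_linear[OF vX \<alpha>] flip_linear[OF vX lact_ofD(1)[OF r]] flip_apply flip_apply
     flip_apply bilinear_map_swap[OF lact_ofD(2)[OF r]] lact_ofD(3)[OF r] mult_bilinear(2,4) comult_flip slide(2,1) x])
     assumption+
  have U: "(\<forall>T. trilinear_form K X L T -->
     \<beta> x (%y l. \<alpha> y (%k z. \<Sum>i<n. T (k \<otimes> e i) z (l \<otimes>\<^bsub>L\<^esub> f i))) =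
     \<alpha> x (%k y. \<beta> y (%z l. \<Sum>i<n. T (e i \<otimes> k) z (f i \<otimes>\<^bsub>L\<^esub> l)))) \<longleftrightarrow>
    (\<forall>T. trilinear_form L X K T -->
     \<beta> x (%y l. \<alpha> y (%h z. \<Sum>i<n. T (l \<otimes>\<^bsub>L\<^esub> f i) z (h \<otimes> e i))) =
     \<alpha> x (%h y. \<beta> y (%z l. \<Sum>i<n. T (f i \<otimes>\<^bsub>L\<^esub> l) z (e i \<otimes> h))))" for x
    by (rule all_transfer[of _ _ "%T l z k. T k z l" _ _ "%T k z l. T l z k"]) (simp_all add: trilinear_form_def)
  show ?thesis
    unfolding T2_eq_iff bilinear_swap_all[of X K, symmetric]
    by (simp add: lr_functional[OF X \<alpha> lact_ofD(1)[OF r]] U form cong: ball_cong)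
     (rule symmetric_conditions)
qed

lemma rr_standard:
  assumes X: "k_algebra X" and \<alpha>: "linear_map X (tensor_alg X K) \<alpha>" and r: "lact_of X \<beta> a"
  shows "(\<forall>x\<in>carrier X. map_left X (opp K) L \<alpha> (\<beta> x) = on23 X (opp K) L
     (Ad (tensor_alg (opp K) L) (inv\<^bsub>tensor_alg (opp K) L\<^esub> (copairing_op K L p)))
     (flip23 X (opp K) L (map_left X L (opp K) \<beta> (\<alpha> x)))) \<longleftrightarrow>
    (\<forall>k\<in>carrier K. \<forall>x\<in>carrier X.
     T2 X K (%B. comult K k (%k1 k2. \<alpha> x (%x0 h. B (a k1 x0) (k2 \<otimes> h)))) =
     T2 X K (%B. comult K k (%k1 k2. \<alpha> (a k2 x) (%y0 h. B y0 (h \<otimes> k1)))))"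
proof -
  note vX [simp] = k_algebra_vspace[OF X]
  have form: "(\<forall>T. trilinear_form L X K T -->
     \<beta> x (%y l. \<alpha> y (%z h. \<Sum>i<n. T (f i \<otimes>\<^bsub>L\<^esub> l) z (h \<otimes> e i))) =
     \<alpha> x (%y h. \<beta> y (%z l. \<Sum>i<n. T (l \<otimes>\<^bsub>L\<^esub> f i) z (e i \<otimes> h)))) \<longleftrightarrow>
    (\<forall>k\<in>carrier K. \<forall>F. bilinear_form X K F -->
     comult K k (%k1 k2. \<alpha> (a k2 x) (%y h. F y (h \<otimes> k1))) =
     comult K k (%k1 k2. \<alpha> x (%y h. F (a k1 y) (k2 \<otimes> h))))" if x: "x \<in> carrier X" for x
    by (rule YD_standard_form_flexible[where A = \<alpha> and A' = \<alpha> and B = "%x. flip L X (\<beta> x)" and D = "comult K" and D' = "comult K"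
      and B' = "%x F. \<beta> x (%y l. F l y)" and a = "%x k. a k x" and \<mu> = "%a b. b \<otimes> a" and \<nu> = "%a b. a \<otimes>\<^bsub>L\<^esub> b",
      OF X \<alpha> flip_linear[OF vX lact_ofD(1)[OF r]] refl flip_apply refl
     bilinear_map_swap[OF lact_ofD(2)[OF r]] lact_ofD(3)[OF r] mult_bilinear(2,3) comult_closed slide x]; assumption)
  have U: "(\<forall>T. trilinear_form X K L T -->
     \<beta> x (%y l. \<alpha> y (%z k. \<Sum>i<n. T z (k \<otimes> e i) (f i \<otimes>\<^bsub>L\<^esub> l))) =
     \<alpha> x (%y k. \<beta> y (%z l. \<Sum>i<n. T z (e i \<otimes> k) (l \<otimes>\<^bsub>L\<^esub> f i)))) \<longleftrightarrow>
    (\<forall>T. trilinear_form L X K T -->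
     \<beta> x (%y l. \<alpha> y (%z h. \<Sum>i<n. T (f i \<otimes>\<^bsub>L\<^esub> l) z (h \<otimes> e i))) =
     \<alpha> x (%y h. \<beta> y (%z l. \<Sum>i<n. T (l \<otimes>\<^bsub>L\<^esub> f i) z (e i \<otimes> h))))" for x
    by (rule all_transfer[of _ _ "%T l z k. T z k l" _ _ "%T z k l. T l z k"]) (simp_all add: trilinear_form_def)
  show ?thesis
    unfolding T2_eq_iff
    by (simp add: rr_functional(1)[OF X \<alpha> lact_ofD(1)[OF r]] U form cong: ball_cong)
     (rule symmetric_conditions)
qed

text \<open>The inverse antipode reverses products, so that moving the coaction of K to the other side turns
  products with the legs of the copairing into products in the opposite order with the legs of its
  inverse in the tensor product of opp K and L.\<close>

lemma rl_iff_ll: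
  assumes X: "k_algebra X" and \<alpha>: "linear_map X (tensor_alg X K) \<alpha>" and \<beta>: "linear_map X (tensor_alg L X) \<beta>"
    and x: "x \<in> carrier X"
  shows "map_right L X K \<alpha> (\<beta> x) = Ad (tensor_alg3 L X K)
     (leg13 L X K (flip L K (inv\<^bsub>tensor_alg K L\<^esub> (copairing K L p)))) (map_left L X K \<beta> (\<alpha> x)) \<longleftrightarrow>
    map_right L (opp K) X (right_to_left_op K X \<alpha>) (\<beta> x) = flip12 L (opp K) X
     (on12 (opp K) L X (Ad (tensor_alg (opp K) L) (copairing_op K L p))
      (map_right (opp K) L X \<beta> (right_to_left_op K X \<alpha> x)))"
proof -
  interpret s: anti_comult_map K "opp K" "antipode_inv K" by (rule antipode_anti_comult_map)
  note vX [simp] = k_algebra_vspace[OF X]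
  let ?S = "antipode_inv K" and ?\<alpha> = "right_to_left_op K X \<alpha>"
  have \<alpha>': "linear_map X (tensor_alg K X) ?\<alpha>"
    using s.coact_to_left_linear(1)[OF X \<alpha>] by (simp add: side_changes(1)[OF X \<alpha>])
  have ap: "?\<alpha> y F = \<alpha> y (%z k. F (?S k) z)" if "y \<in> carrier X" "bilinear_form K X F" for y F
    using s.coact_to_left_linear(2)[OF X \<alpha> that(1)] that(2) by (simp add: side_changes(1)[OF X \<alpha>])
  note xlin = pair_lin X linear_map_tensD(2,3)[OF \<beta>] linear_map_compose[OF antipode_inv_map]
  have eqs: "\<beta> x (%l y. ?\<alpha> y (%k z. \<Sum>i<n. T (k \<otimes> ?S (e i)) (f i \<otimes>\<^bsub>L\<^esub> l) z)) =
     \<beta> x (%l y. \<alpha> y (%z k. \<Sum>i<n. T (?S (e i \<otimes> k)) (f i \<otimes>\<^bsub>L\<^esub> l) z))"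
    "?\<alpha> x (%k y. \<beta> y (%l z. \<Sum>i<n. T (?S (e i) \<otimes> k) (l \<otimes>\<^bsub>L\<^esub> f i) z)) =
     \<alpha> x (%y k. \<beta> y (%l z. \<Sum>i<n. T (?S (k \<otimes> e i)) (l \<otimes>\<^bsub>L\<^esub> f i) z))"
    if T: "trilinear_form K L X T" for T
  proof -
    show "\<beta> x (%l y. ?\<alpha> y (%k z. \<Sum>i<n. T (k \<otimes> ?S (e i)) (f i \<otimes>\<^bsub>L\<^esub> l) z)) =
     \<beta> x (%l y. \<alpha> y (%z k. \<Sum>i<n. T (?S (e i \<otimes> k)) (f i \<otimes>\<^bsub>L\<^esub> l) z))"
    proof (rule tens_cong[OF linear_map_tensD(1)[OF \<beta> x] vspace_L vX])
     fix l y assume c: "l \<in> carrier L" "y \<in> carrier X"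
     have "bilinear_form K X (%k z. \<Sum>i<n. T (k \<otimes> ?S (e i)) (f i \<otimes>\<^bsub>L\<^esub> l) z)"
      by (intro xlin trilinear_form_slot[OF T]; simp add: c)
     note ap[OF c(2) this]
     also have "\<alpha> y (%z k. \<Sum>i<n. T (?S k \<otimes> ?S (e i)) (f i \<otimes>\<^bsub>L\<^esub> l) z) =
       \<alpha> y (%z k. \<Sum>i<n. T (?S (e i \<otimes> k)) (f i \<otimes>\<^bsub>L\<^esub> l) z)"
      by (rule tens_cong[OF linear_map_tensD(1)[OF \<alpha> c(2)] vX vK]) (simp add: antipode_inv_mult)
     finally show "?\<alpha> y (%k z. \<Sum>i<n. T (k \<otimes> ?S (e i)) (f i \<otimes>\<^bsub>L\<^esub> l) z) =
       \<alpha> y (%z k. \<Sum>i<n. T (?S (e i \<otimes> k)) (f i \<otimes>\<^bsub>L\<^esub> l) z)" .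
    qed
    have "bilinear_form K X (%k y. \<beta> y (%l z. \<Sum>i<n. T (?S (e i) \<otimes> k) (l \<otimes>\<^bsub>L\<^esub> f i) z))"
     by (intro xlin trilinear_form_slot[OF T]; simp)
    note ap[OF x this]
    also have "\<alpha> x (%y k. \<beta> y (%l z. \<Sum>i<n. T (?S (e i) \<otimes> ?S k) (l \<otimes>\<^bsub>L\<^esub> f i) z)) =
      \<alpha> x (%y k. \<beta> y (%l z. \<Sum>i<n. T (?S (k \<otimes> e i)) (l \<otimes>\<^bsub>L\<^esub> f i) z))"
     by (rule tens_cong[OF linear_map_tensD(1)[OF \<alpha> x] vX vK]) (simp add: antipode_inv_mult)
    finally show "?\<alpha> x (%k y. \<beta> y (%l z. \<Sum>i<n. T (?S (e i) \<otimes> k) (l \<otimes>\<^bsub>L\<^esub> f i) z)) =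
     \<alpha> x (%y k. \<beta> y (%l z. \<Sum>i<n. T (?S (k \<otimes> e i)) (l \<otimes>\<^bsub>L\<^esub> f i) z))" .
  qed
  have tri: "trilinear_form L X K (%l z k. T (?S k) l z)" if T: "trilinear_form K L X T" for T
    by (intro xlin trilinear_form_slot[OF T]; simp)
  have tri': "trilinear_form K L X (%k l z. T l z (antipode K k))" if T: "trilinear_form L X K T" for T
    by (intro xlin linear_map_compose[OF antipode_map] trilinear_form_slot[OF T]; simp)
  have inv: "\<beta> x (%l y. \<alpha> y (%z k. \<Sum>i<n. T (f i \<otimes>\<^bsub>L\<^esub> l) z (antipode K (?S (e i \<otimes> k))))) =
     \<beta> x (%l y. \<alpha> y (%z k. \<Sum>i<n. T (f i \<otimes>\<^bsub>L\<^esub> l) z (e i \<otimes> k)))"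
    "\<alpha> x (%y k. \<beta> y (%l z. \<Sum>i<n. T (l \<otimes>\<^bsub>L\<^esub> f i) z (antipode K (?S (k \<otimes> e i))))) =
     \<alpha> x (%y k. \<beta> y (%l z. \<Sum>i<n. T (l \<otimes>\<^bsub>L\<^esub> f i) z (k \<otimes> e i)))" for T
    by (intro tens_cong[OF linear_map_tensD(1)[OF \<beta>] vspace_L vX] tens_cong[OF linear_map_tensD(1)[OF \<alpha>] vX vK] x;
      simp add: K_mult_closed)+
  show ?thesis
    unfolding rl_functional[OF X \<alpha> \<beta> x] ll_functional(2)[OF X \<alpha>' \<beta> x]
  proof (rule all_transfer[of _ _ "%T k l z. T l z (antipode K k)" _ _ "%T l z k. T (?S k) l z"], goal_cases)
    case (1 T)
    then show ?case unfolding eqs[OF tri'[OF 1]] inv using tri'[OF 1] by blast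
  next
    case (2 T)
    then show ?case unfolding eqs[OF 2] using tri[OF 2] by blast
  qed
qed

lemma lr_iff_rr:
  assumes X: "k_algebra X" and \<alpha>: "linear_map X (tensor_alg K X) \<alpha>" and \<beta>: "linear_map X (tensor_alg X L) \<beta>"
    and x: "x \<in> carrier X"
  shows "map_left K X L \<alpha> (\<beta> x) =
     Ad (tensor_alg3 K X L) (leg13 K X L (copairing K L p)) (map_right K X L \<beta> (\<alpha> x)) \<longleftrightarrow>
    map_left X (opp K) L (left_to_right_op K X \<alpha>) (\<beta> x) = on23 X (opp K) L
     (Ad (tensor_alg (opp K) L) (inv\<^bsub>tensor_alg (opp K) L\<^esub> (copairing_op K L p)))
     (flip23 X (opp K) L (map_left X L (opp K) \<beta> (left_to_right_op K X \<alpha> x)))"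
proof -
  interpret s: anti_comult_map K "opp K" "antipode_inv K" by (rule antipode_anti_comult_map)
  note vX [simp] = k_algebra_vspace[OF X]
  let ?S = "antipode_inv K" and ?\<alpha> = "left_to_right_op K X \<alpha>"
  have \<alpha>': "linear_map X (tensor_alg X K) ?\<alpha>"
    using s.coact_to_right_linear(1)[OF X \<alpha>] by (simp add: side_changes(3)[OF X \<alpha>])
  have ap: "?\<alpha> y F = \<alpha> y (%k z. F z (?S k))" if "y \<in> carrier X" "bilinear_form X K F" for y F
    using s.coact_to_right_linear(2)[OF X \<alpha> that(1)] that(2) by (simp add: side_changes(3)[OF X \<alpha>])
  note xlin = pair_lin X linear_map_tensD(2,3)[OF \<beta>] linear_map_compose[OF antipode_inv_map]
  have eqs: "\<beta> x (%y l. ?\<alpha> y (%z k. \<Sum>i<n. T z (?S (e i) \<otimes> k) (l \<otimes>\<^bsub>L\<^esub> f i))) =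
     \<beta> x (%y l. \<alpha> y (%k z. \<Sum>i<n. T z (?S (k \<otimes> e i)) (l \<otimes>\<^bsub>L\<^esub> f i)))"
    "?\<alpha> x (%y k. \<beta> y (%z l. \<Sum>i<n. T z (k \<otimes> ?S (e i)) (f i \<otimes>\<^bsub>L\<^esub> l))) =
     \<alpha> x (%k y. \<beta> y (%z l. \<Sum>i<n. T z (?S (e i \<otimes> k)) (f i \<otimes>\<^bsub>L\<^esub> l)))"
    if T: "trilinear_form X K L T" for T
  proof -
    show "\<beta> x (%y l. ?\<alpha> y (%z k. \<Sum>i<n. T z (?S (e i) \<otimes> k) (l \<otimes>\<^bsub>L\<^esub> f i))) =
     \<beta> x (%y l. \<alpha> y (%k z. \<Sum>i<n. T z (?S (k \<otimes> e i)) (l \<otimes>\<^bsub>L\<^esub> f i)))"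
    proof (rule tens_cong[OF linear_map_tensD(1)[OF \<beta> x] vX vspace_L])
     fix y l assume c: "y \<in> carrier X" "l \<in> carrier L"
     have "bilinear_form X K (%z k. \<Sum>i<n. T z (?S (e i) \<otimes> k) (l \<otimes>\<^bsub>L\<^esub> f i))"
      by (intro xlin trilinear_form_slot[OF T]; simp add: c)
     note ap[OF c(1) this]
     also have "\<alpha> y (%k z. \<Sum>i<n. T z (?S (e i) \<otimes> ?S k) (l \<otimes>\<^bsub>L\<^esub> f i)) =
       \<alpha> y (%k z. \<Sum>i<n. T z (?S (k \<otimes> e i)) (l \<otimes>\<^bsub>L\<^esub> f i))"
      by (rule tens_cong[OF linear_map_tensD(1)[OF \<alpha> c(1)] vK vX]) (simp add: antipode_inv_mult)
     finally show "?\<alpha> y (%z k. \<Sum>i<n. T z (?S (e i) \<otimes> k) (l \<otimes>\<^bsub>L\<^esub> f i)) =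
       \<alpha> y (%k z. \<Sum>i<n. T z (?S (k \<otimes> e i)) (l \<otimes>\<^bsub>L\<^esub> f i))" .
    qed
    have "bilinear_form X K (%y k. \<beta> y (%z l. \<Sum>i<n. T z (k \<otimes> ?S (e i)) (f i \<otimes>\<^bsub>L\<^esub> l)))"
     by (intro xlin trilinear_form_slot[OF T]; simp)
    note ap[OF x this]
    also have "\<alpha> x (%k y. \<beta> y (%z l. \<Sum>i<n. T z (?S k \<otimes> ?S (e i)) (f i \<otimes>\<^bsub>L\<^esub> l))) =
      \<alpha> x (%k y. \<beta> y (%z l. \<Sum>i<n. T z (?S (e i \<otimes> k)) (f i \<otimes>\<^bsub>L\<^esub> l)))"
     by (rule tens_cong[OF linear_map_tensD(1)[OF \<alpha> x] vK vX]) (simp add: antipode_inv_mult)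
    finally show "?\<alpha> x (%y k. \<beta> y (%z l. \<Sum>i<n. T z (k \<otimes> ?S (e i)) (f i \<otimes>\<^bsub>L\<^esub> l))) =
     \<alpha> x (%k y. \<beta> y (%z l. \<Sum>i<n. T z (?S (e i \<otimes> k)) (f i \<otimes>\<^bsub>L\<^esub> l)))" .
  qed
  have tri: "trilinear_form K X L (%k z l. T z (?S k) l)" if T: "trilinear_form X K L T" for T
    by (intro xlin trilinear_form_slot[OF T]; simp)
  have tri': "trilinear_form X K L (%z k l. T (antipode K k) z l)" if T: "trilinear_form K X L T" for T
    by (intro xlin linear_map_compose[OF antipode_map] trilinear_form_slot[OF T]; simp)
  have inv: "\<beta> x (%y l. \<alpha> y (%k z. \<Sum>i<n. T (antipode K (?S (k \<otimes> e i))) z (l \<otimes>\<^bsub>L\<^esub> f i))) =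
     \<beta> x (%y l. \<alpha> y (%k z. \<Sum>i<n. T (k \<otimes> e i) z (l \<otimes>\<^bsub>L\<^esub> f i)))"
    "\<alpha> x (%k y. \<beta> y (%z l. \<Sum>i<n. T (antipode K (?S (e i \<otimes> k))) z (f i \<otimes>\<^bsub>L\<^esub> l))) =
     \<alpha> x (%k y. \<beta> y (%z l. \<Sum>i<n. T (e i \<otimes> k) z (f i \<otimes>\<^bsub>L\<^esub> l)))" for T
    by (intro tens_cong[OF linear_map_tensD(1)[OF \<beta>] vX vspace_L] tens_cong[OF linear_map_tensD(1)[OF \<alpha>] vK vX] x;
      simp add: K_mult_closed)+
  show ?thesis
    unfolding lr_functional[OF X \<alpha> \<beta> x] rr_functional(2)[OF X \<alpha>' \<beta> x]
  proof (rule all_transfer[of _ _ "%T z k l. T (antipode K k) z l" _ _ "%T k z l. T z (?S k) l"], goal_cases)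
    case (1 T)
    then show ?case unfolding eqs[OF tri'[OF 1]] inv using tri'[OF 1] by blast
  next
    case (2 T)
    then show ?case unfolding eqs[OF 2] using tri[OF 2] by blast
  qed
qed

end

section \<open>Isomorphisms of categories\<close>

text \<open>All functors of the theorem do not change underlying maps. Such a functor that is bijective on
  objects and identifies the morphism sets, identities and compositions is an isomorphism of
  categories, and it is an equivalence.\<close>

definition cat_iso :: "('o, 'm) category => ('o2, 'm) category => ('o => 'o2) => bool" where
  "cat_iso C D \<Phi> \<longleftrightarrow> bij_betw \<Phi> (Obj C) (Obj D) &
    (\<forall>a\<in>Obj C. Ident D (\<Phi> a) = Ident C a) &
    (\<forall>a\<in>Obj C. \<forall>b\<in>Obj C. Hom D (\<Phi> a) (\<Phi> b) = Hom C a b) &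
    (\<forall>a\<in>Obj C. \<forall>b\<in>Obj C. \<forall>c\<in>Obj C. Comp D (\<Phi> a) (\<Phi> b) (\<Phi> c) = Comp C a b c)"

lemma cat_isoD:
  assumes "cat_iso C D \<Phi>"
  shows "bij_betw \<Phi> (Obj C) (Obj D)" and "a \<in> Obj C ==> \<Phi> a \<in> Obj D"
    and "a \<in> Obj C ==> Ident D (\<Phi> a) = Ident C a"
    and "a \<in> Obj C ==> b \<in> Obj C ==> Hom D (\<Phi> a) (\<Phi> b) = Hom C a b"
    and "a \<in> Obj C ==> b \<in> Obj C ==> c \<in> Obj C ==> Comp D (\<Phi> a) (\<Phi> b) (\<Phi> c) = Comp C a b c"
  using assms by (auto simp: cat_iso_def dest: bij_betwE)

lemma cat_iso_compose:
  assumes "cat_iso C D \<Phi>" "cat_iso D E \<Psi>"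
  shows "cat_iso C E (%a. \<Psi> (\<Phi> a))"
  using bij_betw_trans[OF cat_isoD(1)[OF assms(1)] cat_isoD(1)[OF assms(2)]]
  by (simp add: cat_iso_def comp_def cat_isoD[OF assms(1)] cat_isoD[OF assms(2)])

lemma bij_betw_obtains:
  assumes "bij_betw \<Phi> A B" "b \<in> B"
  obtains a where "a \<in> A" "b = \<Phi> a"
  using assms by (auto simp: bij_betw_def)

text \<open>Two out of three: this gives the isomorphisms that occur as the last side of a commuting square.\<close>

lemma cat_iso_cancel:
  assumes \<Phi>: "cat_iso C D \<Phi>" and X: "cat_iso C E X" and eq: "!!a. a \<in> Obj C ==> \<Psi> (\<Phi> a) = X a"
  shows "cat_iso D E \<Psi>"
proof -
  have D: "Obj D = \<Phi> ` Obj C" using cat_isoD(1)[OF \<Phi>] by (simp add: bij_betw_def)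
  have "bij_betw (%a. \<Psi> (\<Phi> a)) (Obj C) (Obj E)"
    using cat_isoD(1)[OF X] by (simp add: eq cong: bij_betw_cong)
  then have "bij_betw \<Psi> (Obj D) (Obj E)"
    using bij_betw_comp_iff[OF cat_isoD(1)[OF \<Phi>], of \<Psi> "Obj E"] by (simp add: comp_def)
  then show ?thesis
    unfolding cat_iso_def D by (simp add: eq cat_isoD[OF \<Phi>] cat_isoD[OF X])
qed

lemma cat_iso_inverse:
  assumes "cat_iso C D \<Phi>"
  shows "cat_iso D C (inv_into (Obj C) \<Phi>)"
proof (rule cat_iso_cancel[OF assms])
  show "cat_iso C C (%a. a)" by (simp add: cat_iso_def bij_betw_def)
qed (use bij_betw_inv_into_left[OF cat_isoD(1)[OF assms]] in simp)

lemma cat_iso_category: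
  assumes C: "category C" and \<Phi>: "cat_iso C D \<Phi>"
  shows "category D"
proof -
  interpret category C by fact
  have D: "Obj D = \<Phi> ` Obj C" using cat_isoD(1)[OF \<Phi>] by (simp add: bij_betw_def)
  note \<Phi>D = cat_isoD(2-5)[OF \<Phi>]
  show ?thesis
  proof (rule category.intro)
    fix a assume "a \<in> Obj D"
    then show "Ident D a \<in> Hom D a a" by (auto simp: D \<Phi>D(2,3) Ident_in)
  next
    fix a b c f g assume "a \<in> Obj D" "b \<in> Obj D" "c \<in> Obj D" "f \<in> Hom D a b" "g \<in> Hom D b c"
    then show "Comp D a b c g f \<in> Hom D a c" by (auto simp: D \<Phi>D(3,4) Comp_in)
  next
    fix a b f assume "a \<in> Obj D" "b \<in> Obj D" "f \<in> Hom D a b"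
    then show "Comp D a a b f (Ident D a) = f" "Comp D a b b (Ident D b) f = f"
     by (auto simp: D \<Phi>D(2-4) Comp_Ident Ident_Comp)
  next
    fix a b c d f g h assume "a \<in> Obj D" "b \<in> Obj D" "c \<in> Obj D" "d \<in> Obj D"
     "f \<in> Hom D a b" "g \<in> Hom D b c" "h \<in> Hom D c d"
    then show "Comp D a b d (Comp D b c d h g) f = Comp D a c d h (Comp D a b c g f)"
     unfolding D by (elim imageE) (simp only: \<Phi>D(3,4) Comp_assoc)
  qed
qed

lemma cat_iso_functor:
  assumes C: "category C" and \<Phi>: "cat_iso C D \<Phi>"
  shows "is_functor C D (id_on_morphisms \<Phi>)"
  unfolding is_functor_def id_on_morphisms_def
  using C cat_iso_category[OF assms] by (auto simp: cat_isoD[OF \<Phi>])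

lemma cat_iso_equivalence:
  assumes C: "category C" and \<Phi>: "cat_iso C D \<Phi>"
  shows "is_equivalence C D (id_on_morphisms \<Phi>)"
proof -
  let ?\<Psi> = "inv_into (Obj C) \<Phi>"
  have D: "category D" by (rule cat_iso_category[OF assms])
  have id: "is_iso E a a (Ident E a)" if "category E" "a \<in> Obj E" for E :: "('x, 'm) category" and a
    using that category.Ident_in[OF that(1,2)] category.Comp_Ident[OF that(1,2,2)]
    unfolding is_iso_def by fastforce
  have inv: "?\<Psi> (\<Phi> a) = a" if "a \<in> Obj C" for a
    using bij_betw_inv_into_left[OF cat_isoD(1)[OF \<Phi>] that] .
  have inv': "\<Phi> (?\<Psi> b) = b" if "b \<in> Obj D" for b
    using bij_betw_inv_into_right[OF cat_isoD(1)[OF \<Phi>] that] .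
  have "natural_iso C C id_functor (comp_functor (id_on_morphisms ?\<Psi>) (id_on_morphisms \<Phi>)) (Ident C)"
    unfolding natural_iso_def using category.Comp_Ident[OF C] category.Ident_Comp[OF C]
    by (simp add: id_functor_def comp_functor_def id_on_morphisms_def inv id C)
  moreover have "natural_iso D D (comp_functor (id_on_morphisms \<Phi>) (id_on_morphisms ?\<Psi>)) id_functor (Ident D)"
    unfolding natural_iso_def using category.Comp_Ident[OF D] category.Ident_Comp[OF D]
    by (simp add: id_functor_def comp_functor_def id_on_morphisms_def inv' id D)
  ultimately show ?thesis
    unfolding is_equivalence_def
    using cat_iso_functor[OF assms] cat_iso_functor[OF D cat_iso_inverse[OF \<Phi>]] by blast
qed

text \<open>Since underlying algebras and maps do not change, only the structure and the equivariance of linear maps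
  have to be compared.\<close>

lemma structured_algebras_iso:
  assumes fst: "!!a. fst (\<Phi> a) = fst a"
    and P: "!!a. k_algebra (fst a) ==> P a ==> P' (\<Phi> a)"
    and inj: "!!a b. k_algebra (fst a) ==> fst a = fst b ==> P a ==> P b ==> \<Phi> a = \<Phi> b ==> a = b"
    and surj: "!!b. k_algebra (fst b) ==> P' b ==> \<exists>a. P a & \<Phi> a = b"
    and M: "!!a b g. k_algebra (fst a) ==> k_algebra (fst b) ==> P a ==> P b ==> linear_map (fst a) (fst b) g ==>
     M a b g \<longleftrightarrow> M' (\<Phi> a) (\<Phi> b) g"
  shows "cat_iso (structured_algebras P M) (structured_algebras P' M') \<Phi>"
proof -
  have "inj_on \<Phi> {a. k_algebra (fst a) & P a}"
  proof (rule inj_onI)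
    fix a b assume "a \<in> {a. k_algebra (fst a) & P a}" "b \<in> {a. k_algebra (fst a) & P a}" "\<Phi> a = \<Phi> b"
    then show "a = b" using inj[of a b] fst[of a] fst[of b] by simp
  qed
  moreover have "\<Phi> ` {a. k_algebra (fst a) & P a} = {b. k_algebra (fst b) & P' b}"
  proof (intro equalityI subsetI)
    fix b assume b: "b \<in> {b. k_algebra (fst b) & P' b}"
    then obtain a where "P a" "\<Phi> a = b" using surj by blast
    then show "b \<in> \<Phi> ` {a. k_algebra (fst a) & P a}" using b fst[of a] by auto
  qed (auto simp: fst P)
  ultimately show ?thesis
    unfolding cat_iso_def structured_algebras_def bij_betw_def
    using M by (auto simp: fst alg_hom_iff)
qed

section \<open>The equivalences of categories\<close>

lemma coactionD:
  "left_coaction C X \<alpha> ==> linear_map X (tensor_alg C X) \<alpha>" "left_coaction C X \<alpha> ==> \<alpha> \<in> extensional (carrier X)"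
  "right_coaction C X \<beta> ==> linear_map X (tensor_alg X C) \<beta>" "right_coaction C X \<beta> ==> \<beta> \<in> extensional (carrier X)"
  by (auto simp: left_coaction_def right_coaction_def alg_hom_iff)

lemma map2_closed:
  assumes t: "t \<in> tens V W" and f: "linear_map V V' f" and g: "linear_map W W' g"
  shows "map2 V' W' f g t \<in> tens V' W'"
  unfolding map2_def
proof (rule T2_bind_closed[OF t])
  fix B assume B: "bilinear_form V' W' B"
  show "bilinear_form V W (%c d. B (f c) (g d))"
    by (intro bilinear_formI bilinear_form_slot[OF B] f g linear_map_closed[OF f] linear_map_closed[OF g]; assumption)
qed (simp add: T2_pure_closed linear_map_closed[OF f] linear_map_closed[OF g])

text \<open>Identities and composites of equivariant maps are equivariant; maps between objects are
  extensional, whence the restrictions.\<close>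

lemma rcoact_equivariant_category:
  assumes C: "vspace C"
  shows "vspace X ==> linear_map X (tensor_alg X C) \<alpha> ==> rcoact_equivariant C X X \<alpha> \<alpha> (\<lambda>x\<in>carrier X. x)"
    and "vspace X ==> linear_map X (tensor_alg X C) \<alpha> ==> linear_map X Y g ==> linear_map Y Z h ==>
     rcoact_equivariant C X Y \<alpha> \<alpha>' g ==> rcoact_equivariant C Y Z \<alpha>' \<alpha>'' h ==>
     rcoact_equivariant C X Z \<alpha> \<alpha>'' (compose (carrier X) h g)"
proof -
  assume X: "vspace X" and \<alpha>: "linear_map X (tensor_alg X C) \<alpha>"
  note t = linear_map_tensD(1)[OF \<alpha>]
  show "rcoact_equivariant C X X \<alpha> \<alpha> (\<lambda>x\<in>carrier X. x)"
    unfolding rcoact_equivariant_def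
  proof
    fix x assume x: "x \<in> carrier X"
    have "\<alpha> x = T2 X C (\<alpha> x)" using tens_T2[OF t[OF x]] ..
    also have "... = T2 X C (%B. \<alpha> x (%y c. B (restrict (%x. x) (carrier X) y) c))"
     unfolding T2_eq_iff by (intro allI impI tens_cong[OF t[OF x] X C]) simp
    finally show "\<alpha> (restrict (%x. x) (carrier X) x) = map2 X C (\<lambda>x\<in>carrier X. x) (%c. c) (\<alpha> x)"
     by (simp add: x map2_def)
  qed
  assume g: "linear_map X Y g" and h: "linear_map Y Z h"
    and eq: "rcoact_equivariant C X Y \<alpha> \<alpha>' g" "rcoact_equivariant C Y Z \<alpha>' \<alpha>'' h"
  show "rcoact_equivariant C X Z \<alpha> \<alpha>'' (compose (carrier X) h g)"
    unfolding rcoact_equivariant_def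
  proof
    fix x assume x: "x \<in> carrier X"
    have "\<alpha>'' (h (g x)) = map2 Z C h (%c. c) (map2 Y C g (%c. c) (\<alpha> x))"
     using eq x linear_map_closed[OF g x] by (simp add: rcoact_equivariant_def)
    also have "... = map2 Z C (compose (carrier X) h g) (%c. c) (\<alpha> x)"
     unfolding map2_def T2_eq_iff
    proof (intro allI impI)
     fix B assume B: "bilinear_form Z C B"
     have "bilinear_form Y C (%y c. B (h y) c)" by (intro lin bilinear_form_slot[OF B] h) (simp_all add: linear_map_closed[OF h])
     then show "T2 Y C (%B. \<alpha> x (%c d. B (g c) d)) (%c d. B (h c) d) = \<alpha> x (%c. B (compose (carrier X) h g c))"
      by (simp, intro tens_cong[OF t[OF x] X C]) (simp add: compose_eq)
    qed
    finally show "\<alpha>'' (compose (carrier X) h g x) = map2 Z C (compose (carrier X) h g) (%c. c) (\<alpha> x)"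
     by (simp add: compose_eq x)
  qed
qed

lemma lcoact_equivariant_category:
  assumes C: "vspace C"
  shows "vspace X ==> linear_map X (tensor_alg C X) \<alpha> ==> lcoact_equivariant C X X \<alpha> \<alpha> (\<lambda>x\<in>carrier X. x)"
    and "vspace X ==> linear_map X (tensor_alg C X) \<alpha> ==> linear_map X Y g ==> linear_map Y Z h ==>
     lcoact_equivariant C X Y \<alpha> \<alpha>' g ==> lcoact_equivariant C Y Z \<alpha>' \<alpha>'' h ==>
     lcoact_equivariant C X Z \<alpha> \<alpha>'' (compose (carrier X) h g)"
proof -
  assume X: "vspace X" and \<alpha>: "linear_map X (tensor_alg C X) \<alpha>"
  note t = linear_map_tensD(1)[OF \<alpha>]
  show "lcoact_equivariant C X X \<alpha> \<alpha> (\<lambda>x\<in>carrier X. x)"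
    unfolding lcoact_equivariant_def
  proof
    fix x assume x: "x \<in> carrier X"
    have "\<alpha> x = T2 C X (\<alpha> x)" using tens_T2[OF t[OF x]] ..
    also have "... = T2 C X (%B. \<alpha> x (%c y. B c (restrict (%x. x) (carrier X) y)))"
     unfolding T2_eq_iff by (intro allI impI tens_cong[OF t[OF x] C X]) simp
    finally show "\<alpha> (restrict (%x. x) (carrier X) x) = map2 C X (%c. c) (\<lambda>x\<in>carrier X. x) (\<alpha> x)"
     by (simp add: x map2_def)
  qed
  assume g: "linear_map X Y g" and h: "linear_map Y Z h"
    and eq: "lcoact_equivariant C X Y \<alpha> \<alpha>' g" "lcoact_equivariant C Y Z \<alpha>' \<alpha>'' h"
  show "lcoact_equivariant C X Z \<alpha> \<alpha>'' (compose (carrier X) h g)"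
    unfolding lcoact_equivariant_def
  proof
    fix x assume x: "x \<in> carrier X"
    have "\<alpha>'' (h (g x)) = map2 C Z (%c. c) h (map2 C Y (%c. c) g (\<alpha> x))"
     using eq x linear_map_closed[OF g x] by (simp add: lcoact_equivariant_def)
    also have "... = map2 C Z (%c. c) (compose (carrier X) h g) (\<alpha> x)"
     unfolding map2_def T2_eq_iff
    proof (intro allI impI)
     fix B assume B: "bilinear_form C Z B"
     have "bilinear_form C Y (%c y. B c (h y))" by (intro lin bilinear_form_slot[OF B] h) (simp_all add: linear_map_closed[OF h])
     then show "T2 C Y (%B. \<alpha> x (%c d. B c (g d))) (%c d. B c (h d)) = \<alpha> x (%c d. B c (compose (carrier X) h g d))"
      by (simp, intro tens_cong[OF t[OF x] C X]) (simp add: compose_eq)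
    qed
    finally show "\<alpha>'' (compose (carrier X) h g x) = map2 C Z (%c. c) (compose (carrier X) h g) (\<alpha> x)"
     by (simp add: compose_eq x)
  qed
qed

lemma structured_algebras_category:
  assumes id: "!!a. k_algebra (fst a) ==> P a ==> M a a (\<lambda>x\<in>carrier (fst a). x)"
    and comp: "!!a b c g h. k_algebra (fst a) ==> P a ==> linear_map (fst a) (fst b) g ==> linear_map (fst b) (fst c) h ==>
     M a b g ==> M b c h ==> M a c (compose (carrier (fst a)) h g)"
  shows "category (structured_algebras P M)"
proof
  fix a assume a: "a \<in> Obj (structured_algebras P M)"
  then interpret k_algebra "fst a" by (simp add: structured_algebras_def)
  show "Ident (structured_algebras P M) a \<in> Hom (structured_algebras P M) a a"
    using a id[of a] by (auto simp: structured_algebras_def alg_hom_def ring_hom_def)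
next
  fix a b c g h
  assume obj: "a \<in> Obj (structured_algebras P M)" and gh: "g \<in> Hom (structured_algebras P M) a b"
    "h \<in> Hom (structured_algebras P M) b c"
  then interpret k_algebra "fst a" by (simp add: structured_algebras_def)
  have gc: "g x \<in> carrier (fst b)" if "x \<in> carrier (fst a)" for x
    using gh that by (auto simp: structured_algebras_def alg_hom_def ring_hom_def)
  have "compose (carrier (fst a)) h g \<in> alg_hom (fst a) (fst c)"
    using gh gc by (auto simp: structured_algebras_def alg_hom_def ring_hom_def compose_eq)
  then show "Comp (structured_algebras P M) a b c h g \<in> Hom (structured_algebras P M) a c"
    using obj gh comp[of a b g c h] by (simp add: structured_algebras_def alg_hom_iff)
qed (auto simp: structured_algebras_def alg_hom_def ring_hom_def compose_def extensional_def fun_eq_iff)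

context dual_pair
begin

lemma category_YD_rl: "category (YD_rl K L p)"
  unfolding YD_rl_def
proof (rule structured_algebras_category, goal_cases)
  case (1 a)
  obtain X \<alpha> \<beta> where a: "a = (X, \<alpha>, \<beta>)" by (cases a)
  show ?case
    using 1 unfolding a
    by (simp add: rcoact_equivariant_category(1) lcoact_equivariant_category(1) vspace_L coactionD k_algebra_vspace)
next
  case (2 a b c g h)
  obtain X \<alpha> \<beta> Y \<alpha>' \<beta>' Z \<alpha>'' \<beta>'' where abc: "a = (X, \<alpha>, \<beta>)" "b = (Y, \<alpha>', \<beta>')" "c = (Z, \<alpha>'', \<beta>'')"
    by (cases a, cases b, cases c)
  have c: "right_coaction K X \<alpha>" "left_coaction L X \<beta>" and v: "vspace X" using 2 abc by (simp_all add: k_algebra_vspace)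
  note gh = 2(3-6)[unfolded abc, simplified]
  show ?case
    unfolding abc using rcoact_equivariant_category(2)[OF vK v coactionD(3)[OF c(1)] gh(1,2) gh(3)[THEN conjunct1] gh(4)[THEN conjunct1]]
     lcoact_equivariant_category(2)[OF vspace_L v coactionD(1)[OF c(2)] gh(1,2) gh(3)[THEN conjunct2] gh(4)[THEN conjunct2]]
    by simp
qed

text \<open>The elements of K, acting as forms on L, separate tensors with a leg in L, so that equivariance for a
  coaction of L can be tested on the induced action.\<close>

lemma rcoact_equivariant_iff_lact:
  assumes X: "k_algebra X" "k_algebra Y" and r: "lact_of X \<beta> a" "lact_of Y \<beta>' a'" and g: "linear_map X Y g"
  shows "rcoact_equivariant L X Y \<beta> \<beta>' g \<longleftrightarrow> lact_equivariant K X a a' g"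
proof -
  note v [simp] = k_algebra_vspace[OF X(1)] k_algebra_vspace[OF X(2)]
  note gc [simp] = linear_map_closed[OF g]
  note ac [simp] = bilinear_map_closed[OF lact_ofD(2)[OF r(1)]] bilinear_map_closed[OF lact_ofD(2)[OF r(2)]]
  have m: "map2 Y L g (%c. c) (\<beta> x) (%y l. u y * p k l) = u (g (a k x))"
    "\<beta>' (g x) (%y l. u y * p k l) = u (a' k (g x))"
    if c [simp]: "x \<in> carrier X" "k \<in> carrier K" and u: "linear_form Y u" for x k u
  proof -
    have "bilinear_form Y L (%y l. u y * p k l)" by (intro pair_lin linear_form_compose[OF u] c)
    then show "map2 Y L g (%c. c) (\<beta> x) (%y l. u y * p k l) = u (g (a k x))"
     using lact_ofD(3)[OF r(1) c linear_form_compose[OF u g]] by (simp add: map2_def mult.commute)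
    show "\<beta>' (g x) (%y l. u y * p k l) = u (a' k (g x))"
     using lact_ofD(3)[OF r(2) gc[OF c(1)] c(2) u] by (simp add: mult.commute)
  qed
  have "\<beta>' (g x) = map2 Y L g (%c. c) (\<beta> x) \<longleftrightarrow> (\<forall>k\<in>carrier K. g (a k x) = a' k (g x))" if x [simp]: "x \<in> carrier X" for x
  proof
    assume eq: "\<beta>' (g x) = map2 Y L g (%c. c) (\<beta> x)"
    show "\<forall>k\<in>carrier K. g (a k x) = a' k (g x)"
    proof
     fix k assume k [simp]: "k \<in> carrier K"
     show "g (a k x) = a' k (g x)"
     proof (rule forms_separate[OF v(2)])
      fix u assume "linear_form Y u"
      from m[OF x k this] show "u (g (a k x)) = u (a' k (g x))" by (simp only: eq)
     qed simp_all
    qed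
  next
    assume eq: "\<forall>k\<in>carrier K. g (a k x) = a' k (g x)"
    show "\<beta>' (g x) = map2 Y L g (%c. c) (\<beta> x)"
    proof (rule tens_right_eqI[OF v(2)])
     fix k u assume k: "k \<in> carrier K" and u: "linear_form Y u"
     show "\<beta>' (g x) (%y l. u y * p k l) = map2 Y L g (%c. c) (\<beta> x) (%y l. u y * p k l)"
      unfolding m[OF x k u] using eq k by simp
    qed (rule linear_map_tensD(1)[OF lact_ofD(1)[OF r(2)] gc[OF x]], rule map2_closed[OF linear_map_tensD(1)[OF lact_ofD(1)[OF r(1)] x] g linear_map_id])
  qed
  then have "(\<forall>x\<in>carrier X. \<beta>' (g x) = map2 Y L g (%c. c) (\<beta> x)) \<longleftrightarrow>
     (\<forall>x\<in>carrier X. (\<forall>k\<in>carrier K. g (a k x) = a' k (g x)))"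
    by (rule ball_cong[OF refl])
  then show ?thesis unfolding rcoact_equivariant_def lact_equivariant_def by blast
qed

lemma lcoact_equivariant_iff_ract:
  assumes X: "k_algebra X" "k_algebra Y" and r: "ract_of X \<beta> a" "ract_of Y \<beta>' a'" and g: "linear_map X Y g"
  shows "lcoact_equivariant L X Y \<beta> \<beta>' g \<longleftrightarrow> ract_equivariant K X a a' g"
proof -
  note v [simp] = k_algebra_vspace[OF X(1)] k_algebra_vspace[OF X(2)]
  note gc [simp] = linear_map_closed[OF g]
  note ac [simp] = bilinear_map_closed[OF ract_ofD(2)[OF r(1)]] bilinear_map_closed[OF ract_ofD(2)[OF r(2)]]
  have m: "map2 L Y (%c. c) g (\<beta> x) (%l y. p k l * u y) = u (g (a x k))"
    "\<beta>' (g x) (%l y. p k l * u y) = u (a' (g x) k)"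
    if c [simp]: "x \<in> carrier X" "k \<in> carrier K" and u: "linear_form Y u" for x k u
  proof -
    have "bilinear_form L Y (%l y. p k l * u y)" by (intro pair_lin linear_form_compose[OF u] c)
    then show "map2 L Y (%c. c) g (\<beta> x) (%l y. p k l * u y) = u (g (a x k))"
     using ract_ofD(3)[OF r(1) c linear_form_compose[OF u g]] by (simp add: map2_def)
    show "\<beta>' (g x) (%l y. p k l * u y) = u (a' (g x) k)"
     using ract_ofD(3)[OF r(2) gc[OF c(1)] c(2) u] by simp
  qed
  have "\<beta>' (g x) = map2 L Y (%c. c) g (\<beta> x) \<longleftrightarrow> (\<forall>k\<in>carrier K. g (a x k) = a' (g x) k)" if x [simp]: "x \<in> carrier X" for x
  proof
    assume eq: "\<beta>' (g x) = map2 L Y (%c. c) g (\<beta> x)"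
    show "\<forall>k\<in>carrier K. g (a x k) = a' (g x) k"
    proof
     fix k assume k [simp]: "k \<in> carrier K"
     show "g (a x k) = a' (g x) k"
     proof (rule forms_separate[OF v(2)])
      fix u assume "linear_form Y u"
      from m[OF x k this] show "u (g (a x k)) = u (a' (g x) k)" by (simp only: eq)
     qed simp_all
    qed
  next
    assume eq: "\<forall>k\<in>carrier K. g (a x k) = a' (g x) k"
    show "\<beta>' (g x) = map2 L Y (%c. c) g (\<beta> x)"
    proof (rule tens_left_eqI[OF v(2)])
     fix k u assume k: "k \<in> carrier K" and u: "linear_form Y u"
     show "\<beta>' (g x) (%l y. p k l * u y) = map2 L Y (%c. c) g (\<beta> x) (%l y. p k l * u y)"
      unfolding m[OF x k u] using eq k by simp
    qed (rule linear_map_tensD(1)[OF ract_ofD(1)[OF r(2)] gc[OF x]], rule map2_closed[OF linear_map_tensD(1)[OF ract_ofD(1)[OF r(1)] x] linear_map_id g])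
  qed
  then have "(\<forall>x\<in>carrier X. \<beta>' (g x) = map2 L Y (%c. c) g (\<beta> x)) \<longleftrightarrow>
     (\<forall>x\<in>carrier X. (\<forall>k\<in>carrier K. g (a x k) = a' (g x) k))"
    by (rule ball_cong[OF refl])
  then show ?thesis unfolding lcoact_equivariant_def ract_equivariant_def by blast
qed

end

context dual_pair
begin

lemma iso_rl_lr: "cat_iso (YD_rl K L p) (YD_lr L K (%l k. p k l)) (%(X, \<alpha>, \<beta>). (X, \<beta>, \<alpha>))"
  unfolding YD_rl_def YD_lr_def
proof (rule structured_algebras_iso, goal_cases)
  case (2 a)
  obtain X \<alpha> \<beta> where a: "a = (X, \<alpha>, \<beta>)" by (cases a)
  note hyp2 = 2[unfolded a prod.case fst_conv]
  have c: "right_coaction K X \<alpha>" "left_coaction L X \<beta>" using hyp2 by blast+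
  show ?case unfolding a prod.case
    using hyp2 rl_iff_lr[OF hyp2(1) coactionD(3)[OF c(1)] coactionD(1)[OF c(2)]] by blast
next
  case (4 b)
  obtain X \<beta> \<alpha> where b: "b = (X, \<beta>, \<alpha>)" by (cases b)
  note hyp4 = 4[unfolded b prod.case fst_conv]
  have c: "right_coaction K X \<alpha>" "left_coaction L X \<beta>" using hyp4 by blast+
  show ?case unfolding b
    by (rule exI[of _ "(X, \<alpha>, \<beta>)"], unfold prod.case)
     (use hyp4 rl_iff_lr[OF hyp4(1) coactionD(3)[OF c(1)] coactionD(1)[OF c(2)]] in blast)
qed (auto split: prod.splits)

lemma coaction_side_changes:
  assumes X: "k_algebra X"
  shows "right_coaction K X \<alpha> ==> left_coaction (opp K) X (right_to_left_op K X \<alpha>)"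
    and "right_coaction K X \<alpha> ==> left_op_to_right K X (right_to_left_op K X \<alpha>) = \<alpha>"
    and "left_coaction (opp K) X \<alpha>' ==> right_coaction K X (left_op_to_right K X \<alpha>')"
    and "left_coaction (opp K) X \<alpha>' ==> right_to_left_op K X (left_op_to_right K X \<alpha>') = \<alpha>'"
    and "left_coaction K X \<gamma> ==> right_coaction (opp K) X (left_to_right_op K X \<gamma>)"
    and "left_coaction K X \<gamma> ==> coact_to_left (antipode K) K X (left_to_right_op K X \<gamma>) = \<gamma>"
    and "right_coaction (opp K) X \<gamma>' ==> left_coaction K X (coact_to_left (antipode K) K X \<gamma>')"
    and "right_coaction (opp K) X \<gamma>' ==> left_to_right_op K X (coact_to_left (antipode K) K X \<gamma>') = \<gamma>'"
proof -
  note s = antipode_anti_comult_map(2) and t = antipode_anti_comult_map(1)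
  interpret s: anti_comult_map K "opp K" "antipode_inv K" by (rule s)
  interpret t: anti_comult_map "opp K" K "antipode K" by (rule t)
  {
    assume \<alpha>: "right_coaction K X \<alpha>"
    have l: "left_coaction (opp K) X (coact_to_left (antipode_inv K) (opp K) X \<alpha>)"
     by (rule s.left_coaction_coact_to_left[OF X \<alpha>])
    note eq = side_changes(1)[OF X coactionD(3)[OF \<alpha>]]
    show "left_coaction (opp K) X (right_to_left_op K X \<alpha>)" using l eq by simp
    show "left_op_to_right K X (right_to_left_op K X \<alpha>) = \<alpha>"
     unfolding eq side_changes(2)[OF X coactionD(1)[OF l]]
     by (rule coact_to_right_to_left[OF s t _ X coactionD(4,3)[OF \<alpha>]]) simp
  next
    assume \<alpha>: "left_coaction (opp K) X \<alpha>'"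
    have r: "right_coaction K X (coact_to_right (antipode K) K X \<alpha>')"
     by (rule t.right_coaction_coact_to_right[OF X \<alpha>])
    note eq = side_changes(2)[OF X coactionD(1)[OF \<alpha>]]
    show "right_coaction K X (left_op_to_right K X \<alpha>')" using r eq by simp
    show "right_to_left_op K X (left_op_to_right K X \<alpha>') = \<alpha>'"
     unfolding eq side_changes(1)[OF X coactionD(3)[OF r]]
     by (rule coact_to_left_to_right[OF t s _ X coactionD(2,1)[OF \<alpha>]]) simp
  next
    assume \<gamma>: "left_coaction K X \<gamma>"
    note eq = side_changes(3)[OF X coactionD(1)[OF \<gamma>]]
    show "right_coaction (opp K) X (left_to_right_op K X \<gamma>)"
     unfolding eq by (rule s.right_coaction_coact_to_right[OF X \<gamma>])
    show "coact_to_left (antipode K) K X (left_to_right_op K X \<gamma>) = \<gamma>"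
     unfolding eq by (rule coact_to_left_to_right[OF s t _ X coactionD(2,1)[OF \<gamma>]]) simp
  next
    assume \<gamma>: "right_coaction (opp K) X \<gamma>'"
    show l: "left_coaction K X (coact_to_left (antipode K) K X \<gamma>')"
     by (rule t.left_coaction_coact_to_left[OF X \<gamma>])
    show "left_to_right_op K X (coact_to_left (antipode K) K X \<gamma>') = \<gamma>'"
     unfolding side_changes(3)[OF X coactionD(1)[OF l]]
     by (rule coact_to_right_to_left[OF t s _ X coactionD(4,3)[OF \<gamma>]]) simp
  }
qed

lemma right_to_left_op_equivariant:
  assumes X: "k_algebra X" "k_algebra Y" and \<alpha>: "right_coaction K X \<alpha>" "right_coaction K Y \<alpha>'" and g: "linear_map X Y g"
  shows "lcoact_equivariant (opp K) X Y (right_to_left_op K X \<alpha>) (right_to_left_op K Y \<alpha>') g \<longleftrightarrow>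
    rcoact_equivariant K X Y \<alpha> \<alpha>' g"
proof -
  interpret s: anti_comult_map K "opp K" "antipode_inv K" by (rule antipode_anti_comult_map)
  interpret t: anti_comult_map "opp K" K "antipode K" by (rule antipode_anti_comult_map)
  note eq = side_changes(1)[OF X(1) coactionD(3)[OF \<alpha>(1)]] side_changes(1)[OF X(2) coactionD(3)[OF \<alpha>(2)]]
  note l = coaction_side_changes(1)[OF X(1) \<alpha>(1)] coaction_side_changes(1)[OF X(2) \<alpha>(2)]
  have inv: "coact_to_right (antipode K) K X (right_to_left_op K X \<alpha>) = \<alpha>"
    "coact_to_right (antipode K) K Y (right_to_left_op K Y \<alpha>') = \<alpha>'"
    using coaction_side_changes(2)[OF X(1) \<alpha>(1)] coaction_side_changes(2)[OF X(2) \<alpha>(2)]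
    by (simp_all add: side_changes(2)[OF X(1) coactionD(1)[OF l(1)]] side_changes(2)[OF X(2) coactionD(1)[OF l(2)]])
  show ?thesis
    using s.lcoact_equivariant_coact_to_left[OF X coactionD(3)[OF \<alpha>(1)] coactionD(3)[OF \<alpha>(2)] g, folded eq]
     t.rcoact_equivariant_coact_to_right[OF X coactionD(1)[OF l(1)] coactionD(1)[OF l(2)] g, unfolded inv] by blast
qed

lemma left_to_right_op_equivariant:
  assumes X: "k_algebra X" "k_algebra Y" and \<alpha>: "left_coaction K X \<alpha>" "left_coaction K Y \<alpha>'" and g: "linear_map X Y g"
  shows "rcoact_equivariant (opp K) X Y (left_to_right_op K X \<alpha>) (left_to_right_op K Y \<alpha>') g \<longleftrightarrow>
    lcoact_equivariant K X Y \<alpha> \<alpha>' g"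
proof -
  interpret s: anti_comult_map K "opp K" "antipode_inv K" by (rule antipode_anti_comult_map)
  interpret t: anti_comult_map "opp K" K "antipode K" by (rule antipode_anti_comult_map)
  note eq = side_changes(3)[OF X(1) coactionD(1)[OF \<alpha>(1)]] side_changes(3)[OF X(2) coactionD(1)[OF \<alpha>(2)]]
  note r = coaction_side_changes(5)[OF X(1) \<alpha>(1)] coaction_side_changes(5)[OF X(2) \<alpha>(2)]
  note inv = coaction_side_changes(6)[OF X(1) \<alpha>(1)] coaction_side_changes(6)[OF X(2) \<alpha>(2)]
  show ?thesis
    using s.rcoact_equivariant_coact_to_right[OF X coactionD(1)[OF \<alpha>(1)] coactionD(1)[OF \<alpha>(2)] g, folded eq]
     t.lcoact_equivariant_coact_to_left[OF X coactionD(3)[OF r(1)] coactionD(3)[OF r(2)] g, unfolded inv] by blast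
qed

lemma iso_rl_ll: "cat_iso (YD_rl K L p) (YD_ll K L p) (%(X, \<alpha>, \<beta>). (X, right_to_left_op K X \<alpha>, \<beta>))"
  unfolding YD_rl_def YD_ll_def
proof (rule structured_algebras_iso, goal_cases)
  case (1 a)
  show ?case by (cases a) simp
next
  case (2 a)
  obtain X \<alpha> \<beta> where a: "a = (X, \<alpha>, \<beta>)" by (cases a)
  note hyp2 = 2[unfolded a prod.case fst_conv]
  have c: "right_coaction K X \<alpha>" "left_coaction L X \<beta>" using hyp2 by blast+
  show ?case unfolding a prod.case
    using hyp2 rl_iff_ll[OF hyp2(1) coactionD(3)[OF c(1)] coactionD(1)[OF c(2)]] coaction_side_changes(1)[OF hyp2(1) c(1)] by blast
next
  case (3 a b)
  obtain X \<alpha> \<beta> Y \<alpha>' \<beta>' where ab: "a = (X, \<alpha>, \<beta>)" "b = (Y, \<alpha>', \<beta>')" by (cases a, cases b)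
  have "\<alpha> = \<alpha>'" using 3 coaction_side_changes(2)[of X \<alpha>] coaction_side_changes(2)[of X \<alpha>'] by (simp add: ab)
  then show ?case using 3 by (simp add: ab)
next
  case (4 b)
  obtain X \<alpha> \<beta> where b: "b = (X, \<alpha>, \<beta>)" by (cases b)
  have X: "k_algebra X" and c: "left_coaction (opp K) X \<alpha>" using 4 by (simp_all add: b)
  note r = coaction_side_changes(3,4)[OF X c]
  show ?case
    by (rule exI[of _ "(X, left_op_to_right K X \<alpha>, \<beta>)"])
     (use 4 in \<open>simp add: b r rl_iff_ll[OF X coactionD(3)[OF r(1)]] coactionD(1)\<close>)
next
  case (5 a b g)
  obtain X \<alpha> \<beta> Y \<alpha>' \<beta>' where ab: "a = (X, \<alpha>, \<beta>)" "b = (Y, \<alpha>', \<beta>')" by (cases a, cases b)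
  show ?case using 5 by (simp add: ab right_to_left_op_equivariant)
qed

lemma iso_lr_rr: "cat_iso (YD_lr K L p) (YD_rr K L p) (%(X, \<alpha>, \<beta>). (X, left_to_right_op K X \<alpha>, \<beta>))"
  unfolding YD_lr_def YD_rr_def
proof (rule structured_algebras_iso, goal_cases)
  case (1 a)
  show ?case by (cases a) simp
next
  case (2 a)
  obtain X \<alpha> \<beta> where a: "a = (X, \<alpha>, \<beta>)" by (cases a)
  note hyp2 = 2[unfolded a prod.case fst_conv]
  have c: "left_coaction K X \<alpha>" "right_coaction L X \<beta>" using hyp2 by blast+
  show ?case unfolding a prod.case
    using hyp2 lr_iff_rr[OF hyp2(1) coactionD(1)[OF c(1)] coactionD(3)[OF c(2)]] coaction_side_changes(5)[OF hyp2(1) c(1)] by blast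
next
  case (3 a b)
  obtain X \<alpha> \<beta> Y \<alpha>' \<beta>' where ab: "a = (X, \<alpha>, \<beta>)" "b = (Y, \<alpha>', \<beta>')" by (cases a, cases b)
  have "\<alpha> = \<alpha>'" using 3 coaction_side_changes(6)[of X \<alpha>] coaction_side_changes(6)[of X \<alpha>'] by (simp add: ab)
  then show ?case using 3 by (simp add: ab)
next
  case (4 b)
  obtain X \<alpha> \<beta> where b: "b = (X, \<alpha>, \<beta>)" by (cases b)
  have X: "k_algebra X" and c: "right_coaction (opp K) X \<alpha>" using 4 by (simp_all add: b)
  note r = coaction_side_changes(7,8)[OF X c]
  show ?case
    by (rule exI[of _ "(X, coact_to_left (antipode K) K X \<alpha>, \<beta>)"])
     (use 4 in \<open>simp add: b r lr_iff_rr[OF X coactionD(1)[OF r(1)]] coactionD(3)\<close>)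
next
  case (5 a b g)
  obtain X \<alpha> \<beta> Y \<alpha>' \<beta>' where ab: "a = (X, \<alpha>, \<beta>)" "b = (Y, \<alpha>', \<beta>')" by (cases a, cases b)
  show ?case using 5 by (simp add: ab left_to_right_op_equivariant)
qed

lemma induced_ract_coaction:
  assumes X: "k_algebra X" and \<beta>: "left_coaction L X \<beta>"
  shows "ract_of X \<beta> (induced_ract K L p X \<beta>)" "right_action K X (induced_ract K L p X \<beta>)"
  using ract_of_induced[OF X coactionD(2,1)[OF \<beta>]] \<beta> left_coaction_iff_right_action[OF X] by blast+

lemma induced_lact_coaction:
  assumes X: "k_algebra X" and \<beta>: "right_coaction L X \<beta>"
  shows "lact_of X \<beta> (induced_lact K L p X \<beta>)" "left_action K X (induced_lact K L p X \<beta>)"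
  using lact_of_induced[OF X coactionD(4,3)[OF \<beta>]] \<beta> right_coaction_iff_left_action[OF X] by blast+

lemma ract_of_coaction_exists:
  assumes X: "k_algebra X" and a: "right_action K X a"
  shows "\<exists>\<beta>. ract_of X \<beta> a & left_coaction L X \<beta> & induced_ract K L p X \<beta> = a"
proof -
  obtain \<beta> where \<beta>: "ract_of X \<beta> a"
    using ract_of_exists[OF X, of a] a by (auto simp: right_action_def)
  then have c: "left_coaction L X \<beta>" using left_coaction_iff_right_action[OF X \<beta>] a by simp
  have "induced_ract K L p X \<beta> = a"
    using ract_of_unique[OF k_algebra_vspace[OF X] induced_ract_coaction(1)[OF X c] \<beta>] by simp
  then show ?thesis using \<beta> c by blast
qed

lemma lact_of_coaction_exists:
  assumes X: "k_algebra X" and a: "left_action K X a"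
  shows "\<exists>\<beta>. lact_of X \<beta> a & right_coaction L X \<beta> & induced_lact K L p X \<beta> = a"
proof -
  obtain \<beta> where \<beta>: "lact_of X \<beta> a"
    using lact_of_exists[OF X, of a] a by (auto simp: left_action_def)
  then have c: "right_coaction L X \<beta>" using right_coaction_iff_left_action[OF X \<beta>] a by simp
  have "induced_lact K L p X \<beta> = a"
    using lact_of_unique[OF k_algebra_vspace[OF X] induced_lact_coaction(1)[OF X c] \<beta>] by simp
  then show ?thesis using \<beta> c by blast
qed

text \<open>A linear map into the tensor product with L is determined by the bilinear map that it induces, which
  makes the definite description in coact_of_ract meaningful.\<close>

lemma coact_of_ract_induced:
  assumes X: "k_algebra X" and \<beta>: "left_coaction L X \<beta>"
  shows "coact_of_ract K L p X (induced_ract K L p X \<beta>) = \<beta>"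
  unfolding coact_of_ract_def
proof (rule the_equality)
  fix \<beta>' assume "left_coaction L X \<beta>' & induced_ract K L p X \<beta>' = induced_ract K L p X \<beta>"
  then show "\<beta>' = \<beta>"
    using ract_of_unique[OF k_algebra_vspace[OF X] induced_ract_coaction(1)[OF X] induced_ract_coaction(1)[OF X \<beta>]] by blast
qed (simp add: \<beta>)

lemma induced_ract_inj:
  assumes X: "k_algebra X" and \<beta>: "left_coaction L X \<beta>" "left_coaction L X \<beta>'"
    and eq: "induced_ract K L p X \<beta> = induced_ract K L p X \<beta>'"
  shows "\<beta> = \<beta>'"
  using ract_of_unique[OF k_algebra_vspace[OF X] induced_ract_coaction(1)[OF X \<beta>(1)] induced_ract_coaction(1)[OF X \<beta>(2)]] eq
  by simp

lemma iso_std_rl: "cat_iso (YD_rl K L p) (YD_ract_rcoact K) (%(X, \<alpha>, \<beta>). (X, induced_ract K L p X \<beta>, \<alpha>))"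
  unfolding YD_rl_def YD_ract_rcoact_def
proof (rule structured_algebras_iso, goal_cases)
  case (1 a)
  show ?case by (cases a) simp
next
  case (2 a)
  obtain X \<alpha> \<beta> where a: "a = (X, \<alpha>, \<beta>)" by (cases a)
  have c: "k_algebra X" "right_coaction K X \<alpha>" "left_coaction L X \<beta>" using 2 by (simp_all add: a)
  note i = induced_ract_coaction[OF c(1,3)]
  show ?case using 2 rl_standard[OF c(1) coactionD(3)[OF c(2)] i(1)] i(2) by (simp add: a)
next
  case (3 a b)
  obtain X \<alpha> \<beta> Y \<alpha>' \<beta>' where ab: "a = (X, \<alpha>, \<beta>)" "b = (Y, \<alpha>', \<beta>')" by (cases a, cases b)
  show ?case using 3 induced_ract_inj[of X \<beta> \<beta>'] by (auto simp: ab)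
next
  case (4 b)
  obtain X a \<alpha> where b: "b = (X, a, \<alpha>)" by (cases b)
  have c: "k_algebra X" "right_coaction K X \<alpha>" "right_action K X a" using 4 by (simp_all add: b)
  obtain \<beta> where \<beta>: "ract_of X \<beta> a" "left_coaction L X \<beta>" "induced_ract K L p X \<beta> = a"
    using ract_of_coaction_exists[OF c(1,3)] by blast
  show ?case
    by (rule exI[of _ "(X, \<alpha>, \<beta>)"]) (use 4 \<beta> rl_standard[OF c(1) coactionD(3)[OF c(2)] \<beta>(1)] in \<open>simp add: b\<close>)
next
  case (5 a b g)
  obtain X \<alpha> \<beta> Y \<alpha>' \<beta>' where ab: "a = (X, \<alpha>, \<beta>)" "b = (Y, \<alpha>', \<beta>')" by (cases a, cases b)
  note hyp5 = 5[unfolded ab prod.case fst_conv]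
  have c: "left_coaction L X \<beta>" "left_coaction L Y \<beta>'" using hyp5 by blast+
  show ?case unfolding ab prod.case
    using lcoact_equivariant_iff_ract[OF hyp5(1,2) induced_ract_coaction(1)[OF hyp5(1) c(1)] induced_ract_coaction(1)[OF hyp5(2) c(2)] hyp5(5)] by blast
qed

lemma iso_std_ll: "cat_iso (YD_ll K L p) (YD_ract_lcoact K) (%(X, \<alpha>, \<beta>). (X, induced_ract K L p X \<beta>, \<alpha>))"
  unfolding YD_ll_def YD_ract_lcoact_def
proof (rule structured_algebras_iso, goal_cases)
  case (1 a)
  show ?case by (cases a) simp
next
  case (2 a)
  obtain X \<alpha> \<beta> where a: "a = (X, \<alpha>, \<beta>)" by (cases a)
  have c: "k_algebra X" "left_coaction (opp K) X \<alpha>" "left_coaction L X \<beta>" using 2 by (simp_all add: a)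
  have \<alpha>: "linear_map X (tensor_alg K X) \<alpha>" using coactionD(1)[OF c(2)] by simp
  note i = induced_ract_coaction[OF c(1,3)]
  show ?case using 2 ll_standard[OF c(1) \<alpha> i(1)] i(2) by (simp add: a)
next
  case (3 a b)
  obtain X \<alpha> \<beta> Y \<alpha>' \<beta>' where ab: "a = (X, \<alpha>, \<beta>)" "b = (Y, \<alpha>', \<beta>')" by (cases a, cases b)
  show ?case using 3 induced_ract_inj[of X \<beta> \<beta>'] by (auto simp: ab)
next
  case (4 b)
  obtain X a \<alpha> where b: "b = (X, a, \<alpha>)" by (cases b)
  have c: "k_algebra X" "left_coaction (opp K) X \<alpha>" "right_action K X a" using 4 by (simp_all add: b)
  have \<alpha>: "linear_map X (tensor_alg K X) \<alpha>" using coactionD(1)[OF c(2)] by simp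
  obtain \<beta> where \<beta>: "ract_of X \<beta> a" "left_coaction L X \<beta>" "induced_ract K L p X \<beta> = a"
    using ract_of_coaction_exists[OF c(1,3)] by blast
  show ?case
    by (rule exI[of _ "(X, \<alpha>, \<beta>)"]) (use 4 \<beta> ll_standard[OF c(1) \<alpha> \<beta>(1)] in \<open>simp add: b\<close>)
next
  case (5 a b g)
  obtain X \<alpha> \<beta> Y \<alpha>' \<beta>' where ab: "a = (X, \<alpha>, \<beta>)" "b = (Y, \<alpha>', \<beta>')" by (cases a, cases b)
  note hyp5 = 5[unfolded ab prod.case fst_conv]
  have c: "left_coaction L X \<beta>" "left_coaction L Y \<beta>'" using hyp5 by blast+
  show ?case unfolding ab prod.case
    using lcoact_equivariant_iff_ract[OF hyp5(1,2) induced_ract_coaction(1)[OF hyp5(1) c(1)] induced_ract_coaction(1)[OF hyp5(2) c(2)] hyp5(5)] by blast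
qed

lemma induced_lact_inj:
  assumes X: "k_algebra X" and \<beta>: "right_coaction L X \<beta>" "right_coaction L X \<beta>'"
    and eq: "induced_lact K L p X \<beta> = induced_lact K L p X \<beta>'"
  shows "\<beta> = \<beta>'"
  using lact_of_unique[OF k_algebra_vspace[OF X] induced_lact_coaction(1)[OF X \<beta>(1)] induced_lact_coaction(1)[OF X \<beta>(2)]] eq
  by simp

lemma iso_std_lr: "cat_iso (YD_lr K L p) (YD_lact_lcoact K) (%(X, \<alpha>, \<beta>). (X, induced_lact K L p X \<beta>, \<alpha>))"
  unfolding YD_lr_def YD_lact_lcoact_def
proof (rule structured_algebras_iso, goal_cases)
  case (1 a)
  show ?case by (cases a) simp
next
  case (2 a)
  obtain X \<alpha> \<beta> where a: "a = (X, \<alpha>, \<beta>)" by (cases a)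
  have c: "k_algebra X" "left_coaction K X \<alpha>" "right_coaction L X \<beta>" using 2 by (simp_all add: a)
  note i = induced_lact_coaction[OF c(1,3)]
  show ?case using 2 lr_standard[OF c(1) coactionD(1)[OF c(2)] i(1)] i(2) by (simp add: a)
next
  case (3 a b)
  obtain X \<alpha> \<beta> Y \<alpha>' \<beta>' where ab: "a = (X, \<alpha>, \<beta>)" "b = (Y, \<alpha>', \<beta>')" by (cases a, cases b)
  show ?case using 3 induced_lact_inj[of X \<beta> \<beta>'] by (auto simp: ab)
next
  case (4 b)
  obtain X a \<alpha> where b: "b = (X, a, \<alpha>)" by (cases b)
  have c: "k_algebra X" "left_coaction K X \<alpha>" "left_action K X a" using 4 by (simp_all add: b)
  obtain \<beta> where \<beta>: "lact_of X \<beta> a" "right_coaction L X \<beta>" "induced_lact K L p X \<beta> = a"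
    using lact_of_coaction_exists[OF c(1,3)] by blast
  show ?case
    by (rule exI[of _ "(X, \<alpha>, \<beta>)"]) (use 4 \<beta> lr_standard[OF c(1) coactionD(1)[OF c(2)] \<beta>(1)] in \<open>simp add: b\<close>)
next
  case (5 a b g)
  obtain X \<alpha> \<beta> Y \<alpha>' \<beta>' where ab: "a = (X, \<alpha>, \<beta>)" "b = (Y, \<alpha>', \<beta>')" by (cases a, cases b)
  note hyp5 = 5[unfolded ab prod.case fst_conv]
  have c: "right_coaction L X \<beta>" "right_coaction L Y \<beta>'" using hyp5 by blast+
  show ?case unfolding ab prod.case
    using rcoact_equivariant_iff_lact[OF hyp5(1,2) induced_lact_coaction(1)[OF hyp5(1) c(1)] induced_lact_coaction(1)[OF hyp5(2) c(2)] hyp5(5)] by blast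
qed

lemma iso_std_rr: "cat_iso (YD_rr K L p) (YD_lact_rcoact K) (%(X, \<alpha>, \<beta>). (X, induced_lact K L p X \<beta>, \<alpha>))"
  unfolding YD_rr_def YD_lact_rcoact_def
proof (rule structured_algebras_iso, goal_cases)
  case (1 a)
  show ?case by (cases a) simp
next
  case (2 a)
  obtain X \<alpha> \<beta> where a: "a = (X, \<alpha>, \<beta>)" by (cases a)
  have c: "k_algebra X" "right_coaction (opp K) X \<alpha>" "right_coaction L X \<beta>" using 2 by (simp_all add: a)
  have \<alpha>: "linear_map X (tensor_alg X K) \<alpha>" using coactionD(3)[OF c(2)] by simp
  note i = induced_lact_coaction[OF c(1,3)]
  show ?case using 2 rr_standard[OF c(1) \<alpha> i(1)] i(2) by (simp add: a)
next
  case (3 a b)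
  obtain X \<alpha> \<beta> Y \<alpha>' \<beta>' where ab: "a = (X, \<alpha>, \<beta>)" "b = (Y, \<alpha>', \<beta>')" by (cases a, cases b)
  show ?case using 3 induced_lact_inj[of X \<beta> \<beta>'] by (auto simp: ab)
next
  case (4 b)
  obtain X a \<alpha> where b: "b = (X, a, \<alpha>)" by (cases b)
  have c: "k_algebra X" "right_coaction (opp K) X \<alpha>" "left_action K X a" using 4 by (simp_all add: b)
  have \<alpha>: "linear_map X (tensor_alg X K) \<alpha>" using coactionD(3)[OF c(2)] by simp
  obtain \<beta> where \<beta>: "lact_of X \<beta> a" "right_coaction L X \<beta>" "induced_lact K L p X \<beta> = a"
    using lact_of_coaction_exists[OF c(1,3)] by blast
  show ?case
    by (rule exI[of _ "(X, \<alpha>, \<beta>)"]) (use 4 \<beta> rr_standard[OF c(1) \<alpha> \<beta>(1)] in \<open>simp add: b\<close>)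
next
  case (5 a b g)
  obtain X \<alpha> \<beta> Y \<alpha>' \<beta>' where ab: "a = (X, \<alpha>, \<beta>)" "b = (Y, \<alpha>', \<beta>')" by (cases a, cases b)
  note hyp5 = 5[unfolded ab prod.case fst_conv]
  have c: "right_coaction L X \<beta>" "right_coaction L Y \<beta>'" using hyp5 by blast+
  show ?case unfolding ab prod.case
    using rcoact_equivariant_iff_lact[OF hyp5(1,2) induced_lact_coaction(1)[OF hyp5(1) c(1)] induced_lact_coaction(1)[OF hyp5(2) c(2)] hyp5(5)] by blast
qed

end

section \<open>Braided commutativity\<close>

lemma vspace_tensor:
  assumes V: "vspace V"
  shows "vspace (tensor_alg V W)"
proof (rule module.intro)
  have scale: "(%B. c * t B) \<in> tens V W" if "t \<in> tens V W" for c t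
  proof (rule tensE[OF that])
    fix n v w assume r: "\<forall>i<n::nat. v i \<in> carrier V" "\<forall>i<n. w i \<in> carrier W" "t = T2 V W (%B. \<Sum>i<n. B (v i) (w i))"
    have "(%B. c * t B) = T2 V W (%B. \<Sum>i<n. B (c \<odot>\<^bsub>V\<^esub> v i) (w i))"
     unfolding r(3) using r(1,2) by (auto simp: T2_def fun_eq_iff sum_distrib_left bilinear_form_def linear_form_def)
    then show "(%B. c * t B) \<in> tens V W"
     using r(1,2) vspace_smult(1)[OF V] by (simp add: tens_rep_closed)
  qed
  show "abelian_group (tensor_alg V W)"
  proof (rule abelian_groupI)
    fix x assume x: "x \<in> tens V W"
    show "\<exists>y\<in>tens V W. y \<oplus>\<^bsub>tensor_alg V W\<^esub> x = \<zero>\<^bsub>tensor_alg V W\<^esub>"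
     by (rule bexI[OF _ scale[OF x, of "-1"]]) (simp add: tensor_alg_def)
  next
    fix x y assume "x \<in> tens V W" "y \<in> tens V W"
    then show "x \<oplus>\<^bsub>tensor_alg V W\<^esub> y \<in> tens V W"
     using tens_add_closed[of x V W y] by (simp add: tensor_alg_def)
  next
    show "\<zero>\<^bsub>tensor_alg V W\<^esub> \<in> tens V W"
     using tens_zero_closed[of V W] by (simp add: tensor_alg_def)
  qed (simp_all add: tensor_alg_def ac_simps)
  show "module_axioms scalars (tensor_alg V W)"
    using scale by unfold_locales (auto simp: tensor_alg_def algebra_simps)
qed (rule cring_scalars)

lemma form_on_tensor:
  assumes V: "vspace V" and W: "vspace W" and G: "linear_form (tensor_alg V W) G" and t: "t \<in> tens V W"
  shows "G t = t (%v w. G (pure2 V W v w))"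
proof (rule tensE[OF t])
  fix n v w assume r: "\<forall>i<n::nat. v i \<in> carrier V" "\<forall>i<n. w i \<in> carrier W" "t = T2 V W (%B. \<Sum>i<n. B (v i) (w i))"
  have lin: "linear_form V (%v. G (pure2 V W v w))" if w: "w \<in> carrier W" for w
    by (rule linear_form_compose[OF G], unfold linear_map_tens'[OF V])
     (auto simp: w pure2_def bilinear_form_def intro: T2_pure_closed)
  have lin': "linear_form W (%w. G (pure2 V W v w))" if v: "v \<in> carrier V" for v
    by (rule linear_form_compose[OF G], unfold linear_map_tens'[OF W])
     (auto simp: v pure2_def bilinear_form_def intro: T2_pure_closed)
  have "G (%B. \<Sum>i<m. pure2 V W (v i) (w i) B) = (\<Sum>i<m. G (pure2 V W (v i) (w i)))" if "m \<le> n" for m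
    using that
  proof (induction m)
    case 0
    have "(%B. 0 * 0) = 0 \<odot>\<^bsub>tensor_alg V W\<^esub> (%B. 0)" by (simp add: tensor_alg_def)
    then show ?case using linear_form_smult[OF G tens_zero_closed, of 0] by simp
  next
    case (Suc m)
    have c: "(%B. \<Sum>i<m. pure2 V W (v i) (w i) B) \<in> tens V W" "pure2 V W (v m) (w m) \<in> tens V W"
     using r(1,2) Suc.prems by (auto intro: tens_sum_closed)
    have "(%B. \<Sum>i<Suc m. pure2 V W (v i) (w i) B) =
      (%B. \<Sum>i<m. pure2 V W (v i) (w i) B) \<oplus>\<^bsub>tensor_alg V W\<^esub> pure2 V W (v m) (w m)"
     by (simp add: tensor_alg_def)
    then show ?case using linear_form_add[OF G c] Suc by simp
  qed
  from this[of n] have "G (%B. \<Sum>i<n. pure2 V W (v i) (w i) B) = (\<Sum>i<n. G (pure2 V W (v i) (w i)))" by simp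
  moreover have "(%B. \<Sum>i<n. pure2 V W (v i) (w i) B) = t" by (auto simp: r(3) pure2_def T2_def fun_eq_iff)
  moreover have "t (%v w. G (pure2 V W v w)) = (\<Sum>i<n. G (pure2 V W (v i) (w i)))"
    using lin lin' by (simp add: r(3) bilinear_form_def)
  ultimately show "G t = t (%v w. G (pure2 V W v w))" by simp
qed

lemma swapped_functionals_eq: "s = t \<longleftrightarrow> (\<forall>F. s (%a x. F x a) = t (%a x. F x a))"
proof
  assume *: "\<forall>F. s (%a x. F x a) = t (%a x. F x a)"
  show "s = t"
  proof
    fix F show "s F = t F" using *[rule_format, of "%x a. F a x"] by simp
  qed
qed simp

text \<open>Reversing the order of the two factors of an algebra does not affect commuting.\<close>

lemma commuting_flip:
  "commuting (tensor_alg X A) (T2 X A \<phi>) (T2 X A \<psi>) \<longleftrightarrow>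
   commuting (tensor_alg A X) (T2 A X (%F. \<phi> (%x a. F a x))) (T2 A X (%F. \<psi> (%x a. F a x)))"
proof -
  have swap: "T2 X A \<phi> F = T2 A X (%F. \<phi> (%x a. F a x)) (%a x. F x a)" for \<phi> F
    by (auto simp: T2_def bilinear_form_def)
  have mult: "(T2 X A \<phi> \<otimes>\<^bsub>tensor_alg X A\<^esub> T2 X A \<psi>) F =
     (T2 A X (%F. \<phi> (%x a. F a x)) \<otimes>\<^bsub>tensor_alg A X\<^esub> T2 A X (%F. \<psi> (%x a. F a x))) (%a x. F x a)" for \<phi> \<psi> F
  proof (cases "bilinear_form X A F")
    case True
    then have "bilinear_form A X (%a x. F x a)" by (simp add: bilinear_form_def)
    then show ?thesis
     by (simp only: tensor_alg_mult[OF True] tensor_alg_mult swap[of \<phi>] swap[of \<psi>])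
  next
    case False
    then have "\<not> bilinear_form A X (%a x. F x a)" by (auto simp: bilinear_form_def)
    with False show ?thesis by (simp add: tensor_alg_def T2_def)
  qed
  show ?thesis
    unfolding commuting_def fun_eq_iff[of "_ \<otimes>\<^bsub>tensor_alg X A\<^esub> _"] mult
    by (rule swapped_functionals_eq[symmetric])
qed

text \<open>A tensor that is zero on forms that are not bilinear can be evaluated on an intermediate functional only
  after the latter is known to be bilinear, whence the hypotheses on the maps a and b.\<close>

lemma mult_placed:
  assumes A: "vspace A" "bilinear_map A A A (%a b. a \<otimes>\<^bsub>A\<^esub> b)" and X: "k_algebra X" and UV: "vspace U" "vspace V"
    and a: "linear_map U A a" and b: "linear_map V A b" and \<mu>: "\<mu> \<in> tens U X" and \<nu>: "\<nu> \<in> tens V X"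
    and F: "bilinear_form A X F"
  shows "(T2 A X (%F. \<mu> (%u x. F (a u) x)) \<otimes>\<^bsub>tensor_alg A X\<^esub> T2 A X (%F. \<nu> (%v y. F (b v) y))) F =
    \<mu> (%u x. \<nu> (%v y. F (a u \<otimes>\<^bsub>A\<^esub> b v) (x \<otimes>\<^bsub>X\<^esub> y)))"
proof -
  interpret X: ring X using X by (rule k_algebra_ring)
  note vX [simp] = k_algebra_vspace[OF X]
  note [simp] = bilinear_map_closed[OF A(2)] linear_map_closed[OF a] linear_map_closed[OF b]
  note slin = lin X bilinear_form_slot[OF F] bilinear_map_slot[OF A(2)] tens_linear[OF _ \<nu>] A(1)
    linear_map_compose[OF a] linear_map_compose[OF b]
  let ?t = "T2 A X (%F. \<nu> (%v y. F (b v) y))"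
  have inner: "?t (%a' x'. F (c \<otimes>\<^bsub>A\<^esub> a') (x \<otimes>\<^bsub>X\<^esub> x')) = \<nu> (%v y. F (c \<otimes>\<^bsub>A\<^esub> b v) (x \<otimes>\<^bsub>X\<^esub> y))"
    if "c \<in> carrier A" "x \<in> carrier X" for c x
    by (rule T2_apply; intro slin; simp add: that)
  have outer: "bilinear_form A X (%c x. \<nu> (%v y. F (c \<otimes>\<^bsub>A\<^esub> b v) (x \<otimes>\<^bsub>X\<^esub> y)))"
    by (intro slin; simp)
  then have "bilinear_form A X (%c x. ?t (%a' x'. F (c \<otimes>\<^bsub>A\<^esub> a') (x \<otimes>\<^bsub>X\<^esub> x')))"
    using bilinear_form_cong[OF A(1) vX inner] by simp
  then show ?thesis
    unfolding tensor_alg_mult[OF F]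
    by simp (rule tens_cong[OF \<mu> UV(1) vX], simp add: inner)
qed

lemma commuting_sym: "commuting A u v \<longleftrightarrow> commuting A v u"
  by (auto simp: commuting_def)

context dual_pair
begin

abbreviation heis where "heis == heisenberg K L p"

lemma heis_linear [simp]:
  "carrier heis = tens K L" "linear_map Z heis = linear_map Z (tensor_alg K L)"
  "linear_form heis = linear_form (tensor_alg K L)" "linear_map heis Y = linear_map (tensor_alg K L) Y"
  by (simp_all add: heisenberg_def linear_map_def linear_form_def fun_eq_iff)

lemma heis_vspace: "vspace heis"
proof -
  have "module_axioms scalars heis" "abelian_group heis"
    using vspace_tensor[OF vK, of L]
    by (simp_all add: heisenberg_def module_def module_axioms_def abelian_group_def abelian_monoid_def
      abelian_group_axioms_def)
  then show ?thesis by (simp add: module_def cring_scalars)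
qed

lemma heis_mult: "bilinear_form K L F ==> (s \<otimes>\<^bsub>heis\<^esub> t) F = s (%k \<theta>. t (%k' \<theta>'.
    comult K k' (%k1 k2. comult L \<theta> (%\<theta>1 \<theta>2. p k2 \<theta>1 * F (k \<otimes> k1) (\<theta>2 \<otimes>\<^bsub>L\<^esub> \<theta>')))))"
  by (simp add: heisenberg_def)

lemma heis_pure:
  assumes [simp]: "k \<in> carrier K" "\<theta> \<in> carrier L" "k' \<in> carrier K" "\<theta>' \<in> carrier L" and F: "bilinear_form K L F"
  shows "(pure2 K L k \<theta> \<otimes>\<^bsub>heis\<^esub> pure2 K L k' \<theta>') F =
    comult K k' (%k1 k2. comult L \<theta> (%\<theta>1 \<theta>2. p k2 \<theta>1 * F (k \<otimes> k1) (\<theta>2 \<otimes>\<^bsub>L\<^esub> \<theta>')))"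
proof -
  note Fs = bilinear_form_slot[OF F]
  have 1: "bilinear_form K L (%k' \<theta>'. comult K k' (%k1 k2. comult L \<theta> (%\<theta>1 \<theta>2.
     p k2 \<theta>1 * F (k \<otimes> k1) (\<theta>2 \<otimes>\<^bsub>L\<^esub> \<theta>'))))" if "\<theta> \<in> carrier L" "k \<in> carrier K" for \<theta> k
    by (intro pair_lin Fs; simp add: that)
  have t: "pure2 K L k' \<theta>' \<in> tens K L" by simp
  have 2: "bilinear_form K L (%k \<theta>. pure2 K L k' \<theta>' (%k' \<theta>'. comult K k' (%k1 k2. comult L \<theta> (%\<theta>1 \<theta>2.
     p k2 \<theta>1 * F (k \<otimes> k1) (\<theta>2 \<otimes>\<^bsub>L\<^esub> \<theta>')))))"
    by (intro pair_lin tens_linear[OF _ t] Fs; simp)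
  show ?thesis
    unfolding heis_mult[OF F] pure2_def[of K L k] T2_apply[OF 2] by (simp add: pure2_def 1)
qed

lemma heis_mult_bilinear: "bilinear_map heis heis heis (%s t. s \<otimes>\<^bsub>heis\<^esub> t)"
proof -
  note [simp] = heis_vspace vspace_tensor[OF vK]
  have ev: "linear_form (tensor_alg K L) (%t. t G)" for G by (simp add: linear_form_def tensor_alg_def)
  have closed: "s \<otimes>\<^bsub>heis\<^esub> t \<in> tens K L" if s: "s \<in> tens K L" and t: "t \<in> tens K L" for s t
  proof -
    have "T2 K L (%F. s (%k \<theta>. t (%k' \<theta>'. comult K k' (%k1 k2. comult L \<theta> (%\<theta>1 \<theta>2.
      p k2 \<theta>1 * F (k \<otimes> k1) (\<theta>2 \<otimes>\<^bsub>L\<^esub> \<theta>')))))) \<in> tens K L"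
    proof (rule T2_bind_closed[OF s], rule T2_bind_closed[OF t], rule T2_bind_closed[OF comult_closed],
      assumption, rule T2_bind_closed[OF comult_L_closed], assumption)
     fix k \<theta> k' \<theta>' k1 k2 \<theta>1 \<theta>2
     assume c: "k \<in> carrier K" "\<theta> \<in> carrier L" "k' \<in> carrier K" "\<theta>' \<in> carrier L"
      "k1 \<in> carrier K" "k2 \<in> carrier K" "\<theta>1 \<in> carrier L" "\<theta>2 \<in> carrier L"
     have "T2 K L (%F. p k2 \<theta>1 * F (k \<otimes> k1) (\<theta>2 \<otimes>\<^bsub>L\<^esub> \<theta>')) =
       T2 K L (%F. F (p k2 \<theta>1 \<odot> (k \<otimes> k1)) (\<theta>2 \<otimes>\<^bsub>L\<^esub> \<theta>'))"
      using c by (auto simp: T2_eq_iff bilinear_form_def linear_form_def K_mult_closed)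
     then show "T2 K L (%F. p k2 \<theta>1 * F (k \<otimes> k1) (\<theta>2 \<otimes>\<^bsub>L\<^esub> \<theta>')) \<in> tens K L"
      using c by (simp add: T2_pure_closed vspace_smult(1)[OF vK])
    next
     fix k \<theta> k' \<theta>' k1 k2 F
     assume c: "k \<in> carrier K" "\<theta> \<in> carrier L" "k' \<in> carrier K" "\<theta>' \<in> carrier L"
      "k1 \<in> carrier K" "k2 \<in> carrier K" and F: "bilinear_form K L F"
     show "bilinear_form L L (%\<theta>1 \<theta>2. p k2 \<theta>1 * F (k \<otimes> k1) (\<theta>2 \<otimes>\<^bsub>L\<^esub> \<theta>'))"
      by (intro pair_lin bilinear_form_slot[OF F] c; simp add: c)
    next
     fix k \<theta> k' \<theta>' F
     assume c: "k \<in> carrier K" "\<theta> \<in> carrier L" "k' \<in> carrier K" "\<theta>' \<in> carrier L" and F: "bilinear_form K L F"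
     show "bilinear_form K K (%k1 k2. comult L \<theta> (%\<theta>1 \<theta>2. p k2 \<theta>1 * F (k \<otimes> k1) (\<theta>2 \<otimes>\<^bsub>L\<^esub> \<theta>')))"
      by (intro pair_lin bilinear_form_slot[OF F]; simp add: c)
    next
     fix k \<theta> F
     assume c: "k \<in> carrier K" "\<theta> \<in> carrier L" and F: "bilinear_form K L F"
     show "bilinear_form K L (%k' \<theta>'. comult K k' (%k1 k2. comult L \<theta> (%\<theta>1 \<theta>2.
       p k2 \<theta>1 * F (k \<otimes> k1) (\<theta>2 \<otimes>\<^bsub>L\<^esub> \<theta>'))))"
      by (intro pair_lin bilinear_form_slot[OF F]; simp add: c)
    next
     fix F assume F: "bilinear_form K L F"
     show "bilinear_form K L (%k \<theta>. t (%k' \<theta>'. comult K k' (%k1 k2. comult L \<theta> (%\<theta>1 \<theta>2.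
       p k2 \<theta>1 * F (k \<otimes> k1) (\<theta>2 \<otimes>\<^bsub>L\<^esub> \<theta>')))))"
      by (intro pair_lin tens_linear[OF _ t] bilinear_form_slot[OF F]; simp)
    qed
    then show ?thesis by (simp add: heisenberg_def)
  qed
  have slot: "bilinear_form K L (%k \<theta>. t (%k' \<theta>'. comult K k' (%k1 k2. comult L \<theta> (%\<theta>1 \<theta>2.
     p k2 \<theta>1 * F (k \<otimes> k1) (\<theta>2 \<otimes>\<^bsub>L\<^esub> \<theta>')))))" if t: "t \<in> tens K L" and F: "bilinear_form K L F" for t F
    by (intro pair_lin tens_linear[OF _ t] bilinear_form_slot[OF F]; simp)
  have "linear_map (tensor_alg K L) (tensor_alg K L) (%t. s \<otimes>\<^bsub>heis\<^esub> t)"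
    "linear_map (tensor_alg K L) (tensor_alg K L) (%t. t \<otimes>\<^bsub>heis\<^esub> s)" if s: "s \<in> tens K L" for s
    unfolding linear_map_tens'[OF vspace_tensor[OF vK]]
  proof safe
    fix F assume F: "bilinear_form K L F"
    show "linear_form (tensor_alg K L) (%t. (s \<otimes>\<^bsub>heis\<^esub> t) F)"
     unfolding heis_mult[OF F]
     by (rule tens_linear[OF vspace_tensor[OF vK] s slot[OF _ F] ev])
    show "linear_form (tensor_alg K L) (%t. (t \<otimes>\<^bsub>heis\<^esub> s) F)"
     unfolding heis_mult[OF F] by (rule ev)
  qed (simp_all add: closed s)
  then show ?thesis by (simp add: bilinear_map_def)
qed

text \<open>The commutation relation in terms of the two coaction values alone. Its right-hand side contains
  the smash product rule for moving an element of L past an element of K; in the other order the product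
  is the pure tensor.\<close>

definition heis_commute ::
  "('k, 'x, 'z) module_scheme => ('k, 'a, 'x) tensor => ('k, 'b, 'x) tensor => bool" where
  "heis_commute X \<mu> \<nu> \<longleftrightarrow> (\<forall>T. trilinear_form K L X T -->
    \<mu> (%k x. \<nu> (%l y. T k l (x \<otimes>\<^bsub>X\<^esub> y))) =
    \<nu> (%l y. \<mu> (%k x. comult K k (%k1 k2. comult L l (%l1 l2. p k2 l1 * T k1 l2 (y \<otimes>\<^bsub>X\<^esub> x))))))"

lemma commuting_heisenberg:
  assumes X: "k_algebra X" and \<mu>: "\<mu> \<in> tens K X" and \<nu>: "\<nu> \<in> tens L X"
  shows "commuting (tensor_alg heis X) (T2 heis X (%F. \<mu> (%k x. F (pure2 K L k \<one>\<^bsub>L\<^esub>) x)))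
     (T2 heis X (%F. \<nu> (%l y. F (pure2 K L \<one> l) y))) \<longleftrightarrow> heis_commute X \<mu> \<nu>"
proof -
  interpret X: ring X using X by (rule k_algebra_ring)
  note vX [simp] = k_algebra_vspace[OF X]
  have one_L [simp]: "\<one>\<^bsub>L\<^esub> \<in> carrier L"
    using monoid.one_closed[OF ring.is_monoid[OF k_algebra_ring[OF alg_L]]] .
  interpret Lh: fd_hopf_algebra L by (rule dual_fd_hopf_algebra)
  let ?a = "%k. pure2 K L k \<one>\<^bsub>L\<^esub>" and ?b = "%l. pure2 K L \<one> l"
  have pure_maps: "!!l. l \<in> carrier L ==> linear_map K heis (%k. pure2 K L k l)"
    "!!k. k \<in> carrier K ==> linear_map L heis (%l. pure2 K L k l)"
    by (auto simp: linear_map_tens'[OF vK] linear_map_tens'[OF vspace_L] pure2_def bilinear_form_def T2_pure_closed)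
  note a = pure_maps(1)[OF one_L] and b = pure_maps(2)[OF one_K_closed]
  note placed = mult_placed[OF heis_vspace heis_mult_bilinear X vK vspace_L a b \<mu> \<nu>]
    mult_placed[OF heis_vspace heis_mult_bilinear X vspace_L vK b a \<nu> \<mu>]
  have ab: "?a k \<otimes>\<^bsub>heis\<^esub> ?b l = pure2 K L k l" if [simp]: "k \<in> carrier K" "l \<in> carrier L" for k l
  proof (rule tens_eqI)
    show "?a k \<otimes>\<^bsub>heis\<^esub> ?b l \<in> tens K L" using bilinear_map_closed[OF heis_mult_bilinear, of "?a k" "?b l"] by simp
    fix F assume F: "bilinear_form K L F"
    note Fs = bilinear_form_slot[OF F]
    have 3: "bilinear_form K K (%k1 k2. comult L \<one>\<^bsub>L\<^esub> (%\<theta>1 \<theta>2. p k2 \<theta>1 * F (k \<otimes> k1) (\<theta>2 \<otimes>\<^bsub>L\<^esub> l)))"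
     by (intro pair_lin Fs; simp)
    have 4: "bilinear_form L L (%\<theta>1 \<theta>2. p \<one> \<theta>1 * F (k \<otimes> \<one>) (\<theta>2 \<otimes>\<^bsub>L\<^esub> l))"
     by (intro pair_lin Fs; simp add: K_mult_closed)
    have "k \<otimes> \<one> = k"
     using ring.is_monoid[OF k_algebra_ring[OF alg]] by (simp add: monoid.r_one)
    moreover have "pure2 K L k l F = F k l" using F by (simp add: pure2_def)
    ultimately show "(?a k \<otimes>\<^bsub>heis\<^esub> ?b l) F = pure2 K L k l F"
     using comult_one[OF 3] Lh.comult_one[OF 4] F
     by (simp add: heis_pure unit_laws p_one_K Lh.counit_one)
  qed simp_all
  have ba: "G (?b l \<otimes>\<^bsub>heis\<^esub> ?a k) = comult K k (%k1 k2. comult L l (%l1 l2. p k2 l1 * G (pure2 K L k1 l2)))"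
    if [simp]: "k \<in> carrier K" "l \<in> carrier L" and G: "linear_form heis G" for k l G
  proof -
    have "?b l \<otimes>\<^bsub>heis\<^esub> ?a k \<in> tens K L" using bilinear_map_closed[OF heis_mult_bilinear, of "?b l" "?a k"] by simp
    then have "G (?b l \<otimes>\<^bsub>heis\<^esub> ?a k) = (?b l \<otimes>\<^bsub>heis\<^esub> ?a k) (%v w. G (pure2 K L v w))"
     using form_on_tensor[OF vK vspace_L] G by simp
    also have "... = comult K k (%k1 k2. comult L l (%l1 l2. p k2 l1 * G (pure2 K L k1 l2)))"
    proof -
     have "bilinear_form K L (%v w. G (pure2 K L v w))"
      by (intro bilinear_formI linear_form_compose[OF G] pure_maps)
     then have "(?b l \<otimes>\<^bsub>heis\<^esub> ?a k) (%v w. G (pure2 K L v w)) =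
       comult K k (%k1 k2. comult L l (%l1 l2. p k2 l1 * G (pure2 K L (\<one> \<otimes> k1) (l2 \<otimes>\<^bsub>L\<^esub> \<one>\<^bsub>L\<^esub>))))"
      by (simp add: heis_pure)
     also have "... = comult K k (%k1 k2. comult L l (%l1 l2. p k2 l1 * G (pure2 K L k1 l2)))"
      using ring.is_monoid[OF k_algebra_ring[OF alg]]
      by (intro comult_cong Lh.comult_cong) (simp_all add: unit_laws monoid.l_one)
     finally show ?thesis .
    qed
    finally show ?thesis .
  qed
  note \<mu>cong = tens_cong[OF \<mu> vK vX] and \<nu>cong = tens_cong[OF \<nu> vspace_L vX]
  let ?s = "T2 heis X (%F. \<mu> (%k x. F (?a k) x))" and ?t = "T2 heis X (%F. \<nu> (%l y. F (?b l) y))"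
  have 1: "(?s \<otimes>\<^bsub>tensor_alg heis X\<^esub> ?t) F = \<mu> (%k x. \<nu> (%l y. F (pure2 K L k l) (x \<otimes>\<^bsub>X\<^esub> y)))"
    "(?t \<otimes>\<^bsub>tensor_alg heis X\<^esub> ?s) F = \<nu> (%l y. \<mu> (%k x. comult K k (%k1 k2. comult L l (%l1 l2.
      p k2 l1 * F (pure2 K L k1 l2) (y \<otimes>\<^bsub>X\<^esub> x)))))" if F: "bilinear_form heis X F" for F
  proof -
    show "(?s \<otimes>\<^bsub>tensor_alg heis X\<^esub> ?t) F = \<mu> (%k x. \<nu> (%l y. F (pure2 K L k l) (x \<otimes>\<^bsub>X\<^esub> y)))"
     unfolding placed(1)[OF F] by (rule \<mu>cong, rule \<nu>cong) (simp add: ab)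
    show "(?t \<otimes>\<^bsub>tensor_alg heis X\<^esub> ?s) F = \<nu> (%l y. \<mu> (%k x. comult K k (%k1 k2. comult L l (%l1 l2.
      p k2 l1 * F (pure2 K L k1 l2) (y \<otimes>\<^bsub>X\<^esub> x)))))"
     unfolding placed(2)[OF F]
     by (rule \<nu>cong, rule \<mu>cong, rule ba) (use F in \<open>auto simp: bilinear_form_def\<close>)
  qed
  have 2: "\<mu> (%k x. \<nu> (%l y. pure2 K L k l (%k l. T k l (x \<otimes>\<^bsub>X\<^esub> y)))) = \<mu> (%k x. \<nu> (%l y. T k l (x \<otimes>\<^bsub>X\<^esub> y)))"
    "\<nu> (%l y. \<mu> (%k x. comult K k (%k1 k2. comult L l (%l1 l2.
      p k2 l1 * pure2 K L k1 l2 (%k l. T k l (y \<otimes>\<^bsub>X\<^esub> x)))))) =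
    \<nu> (%l y. \<mu> (%k x. comult K k (%k1 k2. comult L l (%l1 l2. p k2 l1 * T k1 l2 (y \<otimes>\<^bsub>X\<^esub> x)))))"
    if T: "trilinear_form K L X T" for T
  proof -
    have b: "bilinear_form K L (%k l. T k l z)" if "z \<in> carrier X" for z
     using T that by (simp add: trilinear_form_def bilinear_form_def)
    show "\<mu> (%k x. \<nu> (%l y. pure2 K L k l (%k l. T k l (x \<otimes>\<^bsub>X\<^esub> y)))) = \<mu> (%k x. \<nu> (%l y. T k l (x \<otimes>\<^bsub>X\<^esub> y)))"
     by (rule \<mu>cong, rule \<nu>cong) (simp add: pure2_def b)
    show "\<nu> (%l y. \<mu> (%k x. comult K k (%k1 k2. comult L l (%l1 l2.
      p k2 l1 * pure2 K L k1 l2 (%k l. T k l (y \<otimes>\<^bsub>X\<^esub> x)))))) =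
    \<nu> (%l y. \<mu> (%k x. comult K k (%k1 k2. comult L l (%l1 l2. p k2 l1 * T k1 l2 (y \<otimes>\<^bsub>X\<^esub> x)))))"
     by (rule \<nu>cong, rule \<mu>cong) (simp add: pure2_def b)
  qed
  have 3: "bilinear_form heis X (%u z. u (%k l. T k l z))" if T: "trilinear_form K L X T" for T
  proof (rule bilinear_formI)
    fix u assume "u \<in> carrier heis"
    then have u: "u \<in> tens K L" by simp
    show "linear_form X (%z. u (%k l. T k l z))"
     by (rule tens_linear[OF vX u]) (use T in \<open>auto simp: trilinear_form_def bilinear_form_def\<close>)
  qed (simp add: linear_form_def tensor_alg_def)
  have 4: "trilinear_form K L X (%k l z. F (pure2 K L k l) z)" if F: "bilinear_form heis X F" for F
    by (intro trilinear_formI bilinear_form_slot[OF F] pure_maps linear_map_id; simp)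
  have "commuting (tensor_alg heis X) ?s ?t \<longleftrightarrow> (\<forall>F. bilinear_form heis X F -->
     (?s \<otimes>\<^bsub>tensor_alg heis X\<^esub> ?t) F = (?t \<otimes>\<^bsub>tensor_alg heis X\<^esub> ?s) F)"
    unfolding commuting_def by (auto simp: tensor_alg_def T2_def fun_eq_iff)
  also have "... \<longleftrightarrow> heis_commute X \<mu> \<nu>"
    unfolding heis_commute_def
  proof (rule all_transfer[of _ _ "%F k l z. F (pure2 K L k l) z" _ _ "%T u z. u (%k l. T k l z)"], goal_cases)
    case F: (1 F)
    show ?case unfolding 1[OF F] using 4[OF F] by simp
  next
    case T: (2 T)
    show ?case unfolding 1[OF 3[OF T]] 2[OF T] using 3[OF T] by simp
  qed
  finally show ?thesis .
qed

end

context dual_pair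
begin

lemma pure_maps: "l \<in> carrier L ==> linear_map K heis (%k. pure2 K L k l)"
    "k \<in> carrier K ==> linear_map L heis (%l. pure2 K L k l)"
  by (auto simp: linear_map_tens'[OF vK] linear_map_tens'[OF vspace_L] pure2_def bilinear_form_def T2_pure_closed)

text \<open>The antipode in the condition rr cancels the inverse antipode in the change of side.\<close>

lemma braided_rr_iff_lr:
  assumes X: "k_algebra X" and \<alpha>: "left_coaction K X \<alpha>"
  shows "braided_commutative_rr K L p (X, left_to_right_op K X \<alpha>, \<beta>) \<longleftrightarrow> braided_commutative_lr K L p (X, \<alpha>, \<beta>)"
proof -
  interpret s: anti_comult_map K "opp K" "antipode_inv K" by (rule antipode_anti_comult_map)
  note vX [simp] = k_algebra_vspace[OF X]
  note \<alpha>l = coactionD(1)[OF \<alpha>]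
  have ap: "left_to_right_op K X \<alpha> y F = \<alpha> y (%k z. F z (antipode_inv K k))" if "y \<in> carrier X" "bilinear_form X K F" for y F
    using s.coact_to_right_linear(2)[OF X \<alpha>l that(1)] that(2) by (simp add: side_changes(3)[OF X \<alpha>l])
  have "T2 heis X (%F. left_to_right_op K X \<alpha> x (%x a. F (pure2 K L (antipode K a) \<one>\<^bsub>L\<^esub>) x)) =
     T2 heis X (%F. \<alpha> x (%k x0. F (pure2 K L k \<one>\<^bsub>L\<^esub>) x0))" if x: "x \<in> carrier X" for x
    unfolding T2_eq_iff
  proof (intro allI impI)
    fix F assume F: "bilinear_form heis X F"
    have "bilinear_form X K (%x a. F (pure2 K L (antipode K a) \<one>\<^bsub>L\<^esub>) x)"
     by (intro bilinear_formI bilinear_form_slot[OF F] linear_map_id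
       linear_map_compose[OF pure_maps(1)[OF one_L_closed] antipode_map]; simp)
    from ap[OF x this] show "left_to_right_op K X \<alpha> x (%x a. F (pure2 K L (antipode K a) \<one>\<^bsub>L\<^esub>) x) =
      \<alpha> x (%k x0. F (pure2 K L k \<one>\<^bsub>L\<^esub>) x0)"
     using tens_cong[OF linear_map_tensD(1)[OF \<alpha>l x] vK vX, of "%k z. F (pure2 K L (antipode K (antipode_inv K k)) \<one>\<^bsub>L\<^esub>) z"]
     by simp
  qed
  then show ?thesis
    unfolding braided_commutative_rr_def braided_commutative_lr_def prod.case
    unfolding commuting_flip[of X heis] by (simp cong: ball_cong)
qed

lemma ball_pairs_swap: "(!!x y. P x y \<longleftrightarrow> Q y x) ==> (\<forall>x\<in>A. \<forall>y\<in>A. P x y) \<longleftrightarrow> (\<forall>x\<in>A. \<forall>y\<in>A. Q x y)"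
  by blast

lemma braided_rl_iff_lr:
  "braided_commutative_rl K L p (X, \<alpha>, \<beta>) \<longleftrightarrow> braided_commutative_lr L K (%l k. p k l) (X, \<beta>, \<alpha>)"
  unfolding braided_commutative_rl_def braided_commutative_lr_def Let_def prod.case
  unfolding commuting_flip[of X "heisenberg L K (%l k. p k l)"]
  by (rule ball_pairs_swap, rule commuting_sym)

text \<open>Substitute T (antipode_inv k) (antipode l) for the test form. The two antipodes reverse the coproducts
  of K and L, and the pairing of their values is the original pairing, because the antipodes of K and L are
  adjoint. What remains is the commutation relation in the smash product of L and K.\<close>

lemma braided_ll_iff_lr:
  assumes X: "k_algebra X" and \<alpha>: "right_coaction K X \<alpha>" and \<beta>: "left_coaction L X \<beta>"
  shows "braided_commutative_ll K L p (X, right_to_left_op K X \<alpha>, \<beta>) \<longleftrightarrow>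
    braided_commutative_lr L K (%l k. p k l) (X, \<beta>, \<alpha>)"
proof -
  interpret Lh: fd_hopf_algebra L by (rule dual_fd_hopf_algebra)
  note sw = dual_pair.heis_commute_def[OF swap] dual_pair.pure_maps[OF swap] dual_pair.commuting_heisenberg[OF swap]
  interpret s: anti_comult_map K "opp K" "antipode_inv K" by (rule antipode_anti_comult_map)
  interpret X: ring X using X by (rule k_algebra_ring)
  note vX [simp] = k_algebra_vspace[OF X]
  note Xop = k_algebra_opp[OF X]
  note \<alpha>l = coactionD(3)[OF \<alpha>] and \<beta>l = coactionD(1)[OF \<beta>]
  note \<alpha>t [simp] = linear_map_tensD(1)[OF \<alpha>l] and \<beta>t [simp] = linear_map_tensD(1)[OF \<beta>l]
  let ?S = "antipode_inv K" and ?\<alpha> = "right_to_left_op K X \<alpha>"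
  let ?\<nu> = "%y. map2 L X (antipode L) (%x. x) (\<beta> y)"
  have \<alpha>': "linear_map X (tensor_alg K X) ?\<alpha>"
    using s.coact_to_left_linear(1)[OF X \<alpha>l] by (simp add: side_changes(1)[OF X \<alpha>l])
  have ap: "?\<alpha> y F = \<alpha> y (%z k. F (?S k) z)" if "y \<in> carrier X" "bilinear_form K X F" for y F
    using s.coact_to_left_linear(2)[OF X \<alpha>l that(1)] that(2) by (simp add: side_changes(1)[OF X \<alpha>l])
  have \<nu>: "?\<nu> y \<in> tens L X" if "y \<in> carrier X" for y
    using map2_closed[OF \<beta>t[OF that] antipode_L_map linear_map_id] .
  have \<nu>ap: "?\<nu> y F = \<beta> y (%l z. F (antipode L l) z)" if "bilinear_form L X F" for y F
    using that by (simp add: map2_def)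
  note xlin = pair_lin X linear_map_tensD(2,3)[OF \<alpha>l] linear_map_tensD(2,3)[OF \<beta>l] linear_map_tensD(2,3)[OF \<alpha>']
    linear_map_compose[OF antipode_inv_map]
  note acong = tens_cong[OF \<alpha>t vX vK] and bcong = tens_cong[OF \<beta>t vspace_L vX]
  have lhs: "?\<alpha> x (%k x0. ?\<nu> y (%l y0. T k l (y0 \<otimes>\<^bsub>X\<^esub> x0))) =
     \<beta> y (%l y0. \<alpha> x (%x0 k. T (?S k) (antipode L l) (y0 \<otimes>\<^bsub>X\<^esub> x0)))"
    if T: "trilinear_form K L X T" and c [simp]: "x \<in> carrier X" "y \<in> carrier X" for T x y
  proof -
    note Ts = trilinear_form_slot[OF T]
    have 1: "bilinear_form K X (%k x0. ?\<nu> y (%l y0. T k l (y0 \<otimes>\<^bsub>X\<^esub> x0)))"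
     by (intro xlin tens_linear[OF _ \<nu>[OF c(2)]] Ts; simp)
    have 2: "bilinear_form L X (%l y0. T k l (y0 \<otimes>\<^bsub>X\<^esub> x0))" if "k \<in> carrier K" "x0 \<in> carrier X" for k x0
     by (intro xlin Ts; simp add: that)
    have "?\<alpha> x (%k x0. ?\<nu> y (%l y0. T k l (y0 \<otimes>\<^bsub>X\<^esub> x0))) =
      \<alpha> x (%x0 k. \<beta> y (%l y0. T (?S k) (antipode L l) (y0 \<otimes>\<^bsub>X\<^esub> x0)))"
     unfolding ap[OF c(1) 1] by (rule acong[OF c(1)], rule \<nu>ap[OF 2]) simp_all
    also have "... = \<beta> y (%l y0. \<alpha> x (%x0 k. T (?S k) (antipode L l) (y0 \<otimes>\<^bsub>X\<^esub> x0)))"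
     by (rule tens_fubini[OF \<alpha>t[OF c(1)] \<beta>t[OF c(2)]]; (intro xlin Ts)?; simp)
    finally show ?thesis .
  qed
  have rhs: "?\<nu> y (%l y0. ?\<alpha> x (%k x0. comult K k (%k1 k2. comult L l (%l1 l2. p k2 l1 * T k1 l2 (x0 \<otimes>\<^bsub>X\<^esub> y0))))) =
     \<alpha> x (%x0 k. \<beta> y (%l y0. comult L l (%l1 l2. comult K k (%k1 k2. p k1 l2 * T (?S k2) (antipode L l1) (x0 \<otimes>\<^bsub>X\<^esub> y0)))))"
    if T: "trilinear_form K L X T" and c [simp]: "x \<in> carrier X" "y \<in> carrier X" for T x y
  proof -
    note Ts = trilinear_form_slot[OF T]
    let ?C = "%k l x0 y0. comult K k (%k1 k2. comult L l (%l1 l2. p k2 l1 * T k1 l2 (x0 \<otimes>\<^bsub>X\<^esub> y0)))"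
    have 1: "bilinear_form L X (%l y0. ?\<alpha> x (%k x0. ?C k l x0 y0))" by (intro xlin Ts; simp)
    have 2: "bilinear_form K X (%k x0. ?C k l x0 y0)" if "l \<in> carrier L" "y0 \<in> carrier X" for l y0
     by (intro xlin Ts; simp add: that)
    have C: "?C (?S k) (antipode L l) x0 y0 =
      comult L l (%l1 l2. comult K k (%k1 k2. p k1 l2 * T (?S k2) (antipode L l1) (x0 \<otimes>\<^bsub>X\<^esub> y0)))"
     if c [simp]: "k \<in> carrier K" "l \<in> carrier L" "x0 \<in> carrier X" "y0 \<in> carrier X" for k l x0 y0
    proof -
     have 3: "bilinear_form K K (%k1 k2. comult L (antipode L l) (%l1 l2. p k2 l1 * T k1 l2 (x0 \<otimes>\<^bsub>X\<^esub> y0)))"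
      by (intro xlin Ts; simp)
     have 4: "bilinear_form L L (%l1 l2. p (?S a) l1 * T (?S b) l2 (x0 \<otimes>\<^bsub>X\<^esub> y0))"
      if "a \<in> carrier K" "b \<in> carrier K" for a b by (intro xlin Ts; simp add: that)
     have "?C (?S k) (antipode L l) x0 y0 =
       comult K k (%a b. comult L (antipode L l) (%l1 l2. p (?S a) l1 * T (?S b) l2 (x0 \<otimes>\<^bsub>X\<^esub> y0)))"
      by (rule comult_antipode_inv_K[OF c(1) 3])
     also have "... = comult K k (%a b. comult L l (%l1 l2. p a l2 * T (?S b) (antipode L l1) (x0 \<otimes>\<^bsub>X\<^esub> y0)))"
     proof (rule comult_cong[OF c(1)])
      fix a b assume ab: "a \<in> carrier K" "b \<in> carrier K"
      show "comult L (antipode L l) (%l1 l2. p (?S a) l1 * T (?S b) l2 (x0 \<otimes>\<^bsub>X\<^esub> y0)) =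
        comult L l (%l1 l2. p a l2 * T (?S b) (antipode L l1) (x0 \<otimes>\<^bsub>X\<^esub> y0))"
       unfolding comult_antipode_L[OF c(2) 4[OF ab]]
       by (rule Lh.comult_cong[OF c(2)]) (simp add: ab flip: p_antipode)
     qed
     also have "... = comult L l (%l1 l2. comult K k (%k1 k2. p k1 l2 * T (?S k2) (antipode L l1) (x0 \<otimes>\<^bsub>X\<^esub> y0)))"
      by (rule tens_fubini[OF comult_closed[OF c(1)] comult_L_closed[OF c(2)]]; (intro xlin Ts)?; simp)
     finally show ?thesis .
    qed
    have "?\<nu> y (%l y0. ?\<alpha> x (%k x0. ?C k l x0 y0)) = \<beta> y (%l y0. \<alpha> x (%x0 k. ?C (?S k) (antipode L l) x0 y0))"
     unfolding \<nu>ap[OF 1] by (rule bcong[OF c(2)], rule ap[OF c(1) 2]) simp_all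
    also have "... = \<alpha> x (%x0 k. \<beta> y (%l y0. ?C (?S k) (antipode L l) x0 y0))"
     by (rule tens_fubini[OF \<beta>t[OF c(2)] \<alpha>t[OF c(1)]]; (intro xlin Ts)?; simp)
    also have "... = \<alpha> x (%x0 k. \<beta> y (%l y0. comult L l (%l1 l2. comult K k (%k1 k2.
      p k1 l2 * T (?S k2) (antipode L l1) (x0 \<otimes>\<^bsub>X\<^esub> y0)))))"
     by (rule acong[OF c(1)], rule bcong[OF c(2)], rule C)
    finally show ?thesis .
  qed
  have flip: "flip K X (\<alpha> x) F = \<alpha> x (%x0 k. F k x0)" if "bilinear_form K X F" for x F
    using that by (rule flip_apply)
  have key: "heis_commute (opp X) (?\<alpha> x) (?\<nu> y) \<longleftrightarrow> dual_pair.heis_commute L K (%l k. p k l) X (\<beta> y) (flip K X (\<alpha> x))"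
    if c [simp]: "x \<in> carrier X" "y \<in> carrier X" for x y
  proof -
    have sides: "\<beta> y (%l y0. flip K X (\<alpha> x) (%k x0. T l k (y0 \<otimes>\<^bsub>X\<^esub> x0))) = \<beta> y (%l y0. \<alpha> x (%x0 k. T l k (y0 \<otimes>\<^bsub>X\<^esub> x0)))"
     "flip K X (\<alpha> x) (%k x0. \<beta> y (%l y0. comult L l (%l1 l2. comult K k (%k1 k2. p k1 l2 * T l1 k2 (x0 \<otimes>\<^bsub>X\<^esub> y0))))) =
      \<alpha> x (%x0 k. \<beta> y (%l y0. comult L l (%l1 l2. comult K k (%k1 k2. p k1 l2 * T l1 k2 (x0 \<otimes>\<^bsub>X\<^esub> y0)))))"
     if T: "trilinear_form L K X T" for T
    proof -
     note Ts = trilinear_form_slot[OF T]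
     show "\<beta> y (%l y0. flip K X (\<alpha> x) (%k x0. T l k (y0 \<otimes>\<^bsub>X\<^esub> x0))) = \<beta> y (%l y0. \<alpha> x (%x0 k. T l k (y0 \<otimes>\<^bsub>X\<^esub> x0)))"
      by (rule bcong[OF c(2)], rule flip; intro xlin Ts; simp)
     show "flip K X (\<alpha> x) (%k x0. \<beta> y (%l y0. comult L l (%l1 l2. comult K k (%k1 k2. p k1 l2 * T l1 k2 (x0 \<otimes>\<^bsub>X\<^esub> y0))))) =
      \<alpha> x (%x0 k. \<beta> y (%l y0. comult L l (%l1 l2. comult K k (%k1 k2. p k1 l2 * T l1 k2 (x0 \<otimes>\<^bsub>X\<^esub> y0)))))"
      by (rule flip; intro xlin Ts; simp)
    qed
    have tri: "trilinear_form L K X (%l k z. T (?S k) (antipode L l) z)" if T: "trilinear_form K L X T" for T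
     by (intro xlin trilinear_form_slot[OF T]; simp)
    have tri': "trilinear_form K L X (%k l z. T (antipode_inv L l) (antipode K k) z)" if T: "trilinear_form L K X T" for T
     by (intro xlin linear_map_compose[OF Lh.antipode_inv_map] trilinear_form_slot[OF T]; simp)
    have inv: "\<beta> y (%l y0. \<alpha> x (%x0 k. T (antipode_inv L (antipode L l)) (antipode K (?S k)) (y0 \<otimes>\<^bsub>X\<^esub> x0))) =
      \<beta> y (%l y0. \<alpha> x (%x0 k. T l k (y0 \<otimes>\<^bsub>X\<^esub> x0)))"
     "\<alpha> x (%x0 k. \<beta> y (%l y0. comult L l (%l1 l2. comult K k (%k1 k2. p k1 l2 *
       T (antipode_inv L (antipode L l1)) (antipode K (?S k2)) (x0 \<otimes>\<^bsub>X\<^esub> y0))))) =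
      \<alpha> x (%x0 k. \<beta> y (%l y0. comult L l (%l1 l2. comult K k (%k1 k2. p k1 l2 * T l1 k2 (x0 \<otimes>\<^bsub>X\<^esub> y0)))))" for T
     by (rule bcong[OF c(2)], rule acong[OF c(1)], simp,
       rule acong[OF c(1)], rule bcong[OF c(2)], rule Lh.comult_cong, assumption, rule comult_cong, assumption, simp)
    have opp: "trilinear_form K L (opp X) T = trilinear_form K L X T" for T by simp
    show ?thesis
     unfolding heis_commute_def sw(1) opp_simps opp
    proof (rule all_transfer[of _ _ "%T l k z. T (?S k) (antipode L l) z" _ _ "%T k l z. T (antipode_inv L l) (antipode K k) z"],
      goal_cases)
     case T: (1 T)
     show ?case unfolding lhs[OF T c] rhs[OF T c] sides[OF tri[OF T]] using tri[OF T] by blast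
    next
     case T: (2 T)
     show ?case unfolding lhs[OF tri'[OF T] c] rhs[OF tri'[OF T] c] sides[OF T] inv using tri'[OF T] by blast
    qed
  qed
  have ll: "T2 heis (opp X) (%B. \<beta> y (%l y0. B (pure2 K L \<one> (antipode L l)) y0)) =
     T2 heis (opp X) (%F. ?\<nu> y (%l y0. F (pure2 K L \<one> l) y0))" for y
    unfolding T2_eq_iff
  proof (intro allI impI \<nu>ap[symmetric])
    fix F assume "bilinear_form heis (opp X) F"
    then have F: "bilinear_form heis X F" by simp
    show "bilinear_form L X (%l y0. F (pure2 K L \<one> l) y0)"
     by (intro bilinear_formI bilinear_form_slot[OF F] linear_map_id pure_maps(2); simp)
  qed
  have lr: "T2 (heisenberg L K (%l k. p k l)) X (%B. \<alpha> x (%x0 k. B (pure2 L K \<one>\<^bsub>L\<^esub> k) x0)) =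
     T2 (heisenberg L K (%l k. p k l)) X (%F. flip K X (\<alpha> x) (%k x0. F (pure2 L K \<one>\<^bsub>L\<^esub> k) x0))" for x
    unfolding T2_eq_iff
  proof (intro allI impI flip[symmetric])
    fix F assume F: "bilinear_form (heisenberg L K (%l k. p k l)) X F"
    show "bilinear_form K X (%k x0. F (pure2 L K \<one>\<^bsub>L\<^esub> k) x0)"
     by (intro bilinear_formI bilinear_form_slot[OF F] linear_map_id sw(3); simp add: dual_pair.heis_linear[OF swap])
  qed
  have "braided_commutative_ll K L p (X, ?\<alpha>, \<beta>) \<longleftrightarrow>
     (\<forall>x\<in>carrier X. \<forall>y\<in>carrier X. heis_commute (opp X) (?\<alpha> x) (?\<nu> y))"
    unfolding braided_commutative_ll_def prod.case ll
    by (intro ball_cong refl commuting_heisenberg[OF Xop]) (simp_all add: linear_map_tensD(1)[OF \<alpha>'] \<nu>)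
  also have "... \<longleftrightarrow> (\<forall>x\<in>carrier X. \<forall>y\<in>carrier X. dual_pair.heis_commute L K (%l k. p k l) X (\<beta> y) (flip K X (\<alpha> x)))"
    by (intro ball_cong refl key)
  also have "... \<longleftrightarrow> (\<forall>y\<in>carrier X. \<forall>x\<in>carrier X. dual_pair.heis_commute L K (%l k. p k l) X (\<beta> y) (flip K X (\<alpha> x)))" by blast
  also have "... \<longleftrightarrow> braided_commutative_lr L K (%l k. p k l) (X, \<beta>, \<alpha>)"
    unfolding braided_commutative_lr_def prod.case lr
    by (intro ball_cong refl sw(4)[OF X, symmetric]) (simp_all add: flip_closed)
  finally show ?thesis .
qed

end

theorem proposition6p15:
  fixes H :: "('k::field, 'h) hopf"
    and Hd :: "('k, 'h \<Rightarrow> 'k) hopf"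
    and p :: "'h \<Rightarrow> ('h \<Rightarrow> 'k) \<Rightarrow> 'k"
    and q :: "('h \<Rightarrow> 'k) \<Rightarrow> 'h \<Rightarrow> 'k"
    and RL :: "(('k, 'x, 'h, 'h \<Rightarrow> 'k) rl_obj, 'x \<Rightarrow> 'x) category"
    and LR :: "(('k, 'x, 'h \<Rightarrow> 'k, 'h) lr_obj, 'x \<Rightarrow> 'x) category"
    and LL :: "(('k, 'x, 'h, 'h \<Rightarrow> 'k) ll_obj, 'x \<Rightarrow> 'x) category"
    and RR :: "(('k, 'x, 'h \<Rightarrow> 'k, 'h) rr_obj, 'x \<Rightarrow> 'x) category"
    and stdRL :: "(('k, 'x, 'h, 'h) ract_rcoact_obj, 'x \<Rightarrow> 'x) category"
    and stdLR :: "(('k, 'x, 'h \<Rightarrow> 'k, 'h \<Rightarrow> 'k) lact_lcoact_obj, 'x \<Rightarrow> 'x) category"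
    and stdLL :: "(('k, 'x, 'h, 'h) ract_lcoact_obj, 'x \<Rightarrow> 'x) category"
    and stdRR :: "(('k, 'x, 'h \<Rightarrow> 'k, 'h \<Rightarrow> 'k) lact_rcoact_obj, 'x \<Rightarrow> 'x) category"
  defines "Hd \<equiv> dual_hopf H"
    and "p \<equiv> \<lambda>h \<theta>. \<theta> h"
    and "q \<equiv> \<lambda>\<theta> h. \<theta> h"
    and "RL \<equiv> YD_rl H Hd p"
    and "LR \<equiv> YD_lr Hd H q"
    and "LL \<equiv> YD_ll H Hd p"
    and "RR \<equiv> YD_rr Hd H q"
    and "stdRL \<equiv> YD_ract_rcoact H"
    and "stdLR \<equiv> YD_lact_lcoact Hd"
    and "stdLL \<equiv> YD_ract_lcoact H"
    and "stdRR \<equiv> YD_lact_rcoact Hd"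
  assumes H: "fd_hopf_algebra H"
  shows "
    bij_betw (fst rl_to_lr) (Obj RL) (Obj LR) \<and>
    bij_betw (fst (rl_to_ll H)) (Obj RL) (Obj LL) \<and>
    bij_betw (fst (lr_to_rr Hd)) (Obj LR) (Obj RR) \<and>
    bij_betw (fst (ll_to_rr H Hd)) (Obj LL) (Obj RR) \<and>
    is_equivalence RL LR rl_to_lr \<and>
    is_equivalence RL LL (rl_to_ll H) \<and>
    is_equivalence LR RR (lr_to_rr Hd) \<and>
    is_equivalence LL RR (ll_to_rr H Hd) \<and>
    functors_eq RL (comp_functor (ll_to_rr H Hd) (rl_to_ll H))
                    (comp_functor (lr_to_rr Hd) rl_to_lr) \<and>
    is_functor RL stdRL (std_rl H Hd p) \<and>
    is_functor LR stdLR (std_lr Hd H q) \<and>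
    is_functor LL stdLL (std_ll H Hd p) \<and>
    is_functor RR stdRR (std_rr Hd H q) \<and>
    is_equivalence stdRL stdLR (std_rl_to_lr H Hd p q) \<and>
    is_equivalence stdRL stdLL (std_rl_to_ll H) \<and>
    is_equivalence stdLR stdRR (std_lr_to_rr Hd) \<and>
    is_equivalence stdLL stdRR (std_ll_to_rr H Hd p q) \<and>
    functors_eq RL (comp_functor (std_rl_to_lr H Hd p q) (std_rl H Hd p))
                    (comp_functor (std_lr Hd H q) rl_to_lr) \<and>
    functors_eq RL (comp_functor (std_rl_to_ll H) (std_rl H Hd p))
                    (comp_functor (std_ll H Hd p) (rl_to_ll H)) \<and>
    functors_eq LR (comp_functor (std_lr_to_rr Hd) (std_lr Hd H q))
                    (comp_functor (std_rr Hd H q) (lr_to_rr Hd)) \<and>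
    functors_eq LL (comp_functor (std_ll_to_rr H Hd p q) (std_ll H Hd p))
                    (comp_functor (std_rr Hd H q) (ll_to_rr H Hd)) \<and>
    (\<forall>a\<in>Obj RL. braided_commutative_rl H Hd p a \<longleftrightarrow> braided_commutative_lr Hd H q (fst rl_to_lr a)) \<and>
    (\<forall>a\<in>Obj RL. braided_commutative_rl H Hd p a \<longleftrightarrow> braided_commutative_ll H Hd p (fst (rl_to_ll H) a)) \<and>
    (\<forall>a\<in>Obj LR. braided_commutative_lr Hd H q a \<longleftrightarrow> braided_commutative_rr Hd H q (fst (lr_to_rr Hd) a)) \<and>
    (\<forall>a\<in>Obj LL. braided_commutative_ll H Hd p a \<longleftrightarrow> braided_commutative_rr Hd H q (fst (ll_to_rr H Hd) a))"
proof -
  obtain n e f where dp0: "dual_pair H (dual_hopf H) (%h \<theta>. \<theta> h) n e f"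
    by (rule dual_pair_dual_hopf[OF H])
  have dp: "dual_pair H Hd p n e f" using dp0 unfolding Hd_def p_def .
  have pq: "(%l k. p k l) = q" by (simp add: p_def q_def)
  have sw: "dual_pair Hd H q n f e" using dual_pair.swap[OF dp] unfolding pq .
  note defs = rl_to_lr_def rl_to_ll_def lr_to_rr_def ll_to_rr_def std_rl_def std_lr_def std_ll_def std_rr_def
    std_rl_to_lr_def std_rl_to_ll_def std_lr_to_rr_def std_ll_to_rr_def
  have RLD: "k_algebra X" "right_coaction H X \<alpha>" "left_coaction Hd X \<beta>" if "(X, \<alpha>, \<beta>) \<in> Obj RL" for X \<alpha> \<beta>
    using that unfolding RL_def YD_rl_def structured_algebras_def by simp_all
  have LRD: "k_algebra X" "left_coaction Hd X \<alpha>" "right_coaction H X \<beta>" if "(X, \<alpha>, \<beta>) \<in> Obj LR" for X \<alpha> \<beta>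
    using that unfolding LR_def YD_lr_def structured_algebras_def by simp_all
  have LLD: "k_algebra X" "left_coaction (opp H) X \<alpha>" "left_coaction Hd X \<beta>" if "(X, \<alpha>, \<beta>) \<in> Obj LL" for X \<alpha> \<beta>
    using that unfolding LL_def YD_ll_def structured_algebras_def by simp_all
  have i1: "cat_iso RL LR (fst rl_to_lr)"
    using dual_pair.iso_rl_lr[OF dp] unfolding pq by (simp add: RL_def LR_def defs id_on_morphisms_def)
  have i2: "cat_iso RL LL (fst (rl_to_ll H))"
    using dual_pair.iso_rl_ll[OF dp] by (simp add: RL_def LL_def defs id_on_morphisms_def)
  have i3: "cat_iso LR RR (fst (lr_to_rr Hd))"
    using dual_pair.iso_lr_rr[OF sw] by (simp add: LR_def RR_def defs id_on_morphisms_def)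
  have s1: "cat_iso RL stdRL (fst (std_rl H Hd p))"
    using dual_pair.iso_std_rl[OF dp] by (simp add: RL_def stdRL_def defs id_on_morphisms_def)
  have s2: "cat_iso LR stdLR (fst (std_lr Hd H q))"
    using dual_pair.iso_std_lr[OF sw] by (simp add: LR_def stdLR_def defs id_on_morphisms_def)
  have s3: "cat_iso LL stdLL (fst (std_ll H Hd p))"
    using dual_pair.iso_std_ll[OF dp] by (simp add: LL_def stdLL_def defs id_on_morphisms_def)
  have s4: "cat_iso RR stdRR (fst (std_rr Hd H q))"
    using dual_pair.iso_std_rr[OF sw] by (simp add: RR_def stdRR_def defs id_on_morphisms_def)
  have c1: "fst (ll_to_rr H Hd) (fst (rl_to_ll H) a) = fst (lr_to_rr Hd) (fst rl_to_lr a)" if "a \<in> Obj RL" for a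
  proof -
    obtain X \<alpha> \<beta> where a: "a = (X, \<alpha>, \<beta>)" by (cases a)
    show ?thesis
     using dual_pair.coaction_side_changes(2)[OF dp RLD(1,2)[OF that[unfolded a]]]
     by (simp add: a defs id_on_morphisms_def)
  qed
  have c2: "fst (std_rl_to_lr H Hd p q) (fst (std_rl H Hd p) a) = fst (std_lr Hd H q) (fst rl_to_lr a)" if "a \<in> Obj RL" for a
  proof -
    obtain X \<alpha> \<beta> where a: "a = (X, \<alpha>, \<beta>)" by (cases a)
    show ?thesis
     using dual_pair.coact_of_ract_induced[OF dp RLD(1,3)[OF that[unfolded a]]]
     by (simp add: a defs id_on_morphisms_def)
  qed
  have c3: "fst (std_rl_to_ll H) (fst (std_rl H Hd p) a) = fst (std_ll H Hd p) (fst (rl_to_ll H) a)" for a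
    by (cases a) (simp add: defs id_on_morphisms_def)
  have c4: "fst (std_lr_to_rr Hd) (fst (std_lr Hd H q) a) = fst (std_rr Hd H q) (fst (lr_to_rr Hd) a)" for a
    by (cases a) (simp add: defs id_on_morphisms_def)
  have c5: "fst (std_ll_to_rr H Hd p q) (fst (std_ll H Hd p) a) = fst (std_rr Hd H q) (fst (ll_to_rr H Hd) a)"
    if "a \<in> Obj LL" for a
  proof -
    obtain X \<alpha> \<beta> where a: "a = (X, \<alpha>, \<beta>)" by (cases a)
    show ?thesis
     using dual_pair.coact_of_ract_induced[OF dp LLD(1,3)[OF that[unfolded a]]]
     by (simp add: a defs id_on_morphisms_def)
  qed
  \<comment> \<open>Each remaining functor is determined by a commuting square in which the other three are isomorphisms.\<close>
  have i4: "cat_iso LL RR (fst (ll_to_rr H Hd))"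
    by (rule cat_iso_cancel[OF i2 cat_iso_compose[OF i1 i3] c1])
  have j1: "cat_iso stdRL stdLR (fst (std_rl_to_lr H Hd p q))"
    by (rule cat_iso_cancel[OF s1 cat_iso_compose[OF i1 s2] c2])
  have j2: "cat_iso stdRL stdLL (fst (std_rl_to_ll H))"
    by (rule cat_iso_cancel[OF s1 cat_iso_compose[OF i2 s3] c3])
  have j3: "cat_iso stdLR stdRR (fst (std_lr_to_rr Hd))"
    by (rule cat_iso_cancel[OF s2 cat_iso_compose[OF i3 s4] c4])
  have j4: "cat_iso stdLL stdRR (fst (std_ll_to_rr H Hd p q))"
    by (rule cat_iso_cancel[OF s3 cat_iso_compose[OF i4 s4] c5])
  have RL: "category RL" using dual_pair.category_YD_rl[OF dp] unfolding RL_def .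
  note LR = cat_iso_category[OF RL i1] and LL = cat_iso_category[OF RL i2] and stdRL = cat_iso_category[OF RL s1]
  note RR = cat_iso_category[OF LR i3] and stdLR = cat_iso_category[OF LR s2] and stdLL = cat_iso_category[OF LL s3]
  have id: "id_on_morphisms (fst rl_to_lr) = rl_to_lr" "id_on_morphisms (fst (rl_to_ll H)) = rl_to_ll H"
    "id_on_morphisms (fst (lr_to_rr Hd)) = lr_to_rr Hd" "id_on_morphisms (fst (ll_to_rr H Hd)) = ll_to_rr H Hd"
    "id_on_morphisms (fst (std_rl H Hd p)) = std_rl H Hd p" "id_on_morphisms (fst (std_lr Hd H q)) = std_lr Hd H q"
    "id_on_morphisms (fst (std_ll H Hd p)) = std_ll H Hd p" "id_on_morphisms (fst (std_rr Hd H q)) = std_rr Hd H q"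
    "id_on_morphisms (fst (std_rl_to_lr H Hd p q)) = std_rl_to_lr H Hd p q"
    "id_on_morphisms (fst (std_rl_to_ll H)) = std_rl_to_ll H" "id_on_morphisms (fst (std_lr_to_rr Hd)) = std_lr_to_rr Hd"
    "id_on_morphisms (fst (std_ll_to_rr H Hd p q)) = std_ll_to_rr H Hd p q"
    by (simp_all add: defs id_on_morphisms_def)
  note equivs = cat_iso_equivalence[OF RL i1, unfolded id] cat_iso_equivalence[OF RL i2, unfolded id]
    cat_iso_equivalence[OF LR i3, unfolded id] cat_iso_equivalence[OF LL i4, unfolded id]
    cat_iso_equivalence[OF stdRL j1, unfolded id] cat_iso_equivalence[OF stdRL j2, unfolded id]
    cat_iso_equivalence[OF stdLR j3, unfolded id] cat_iso_equivalence[OF stdLL j4, unfolded id]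
  note functors = cat_iso_functor[OF RL s1, unfolded id] cat_iso_functor[OF LR s2, unfolded id]
    cat_iso_functor[OF LL s3, unfolded id] cat_iso_functor[OF RR s4, unfolded id]
  have eqs: "functors_eq RL (comp_functor (ll_to_rr H Hd) (rl_to_ll H)) (comp_functor (lr_to_rr Hd) rl_to_lr)"
    "functors_eq RL (comp_functor (std_rl_to_lr H Hd p q) (std_rl H Hd p)) (comp_functor (std_lr Hd H q) rl_to_lr)"
    "functors_eq RL (comp_functor (std_rl_to_ll H) (std_rl H Hd p)) (comp_functor (std_ll H Hd p) (rl_to_ll H))"
    "functors_eq LR (comp_functor (std_lr_to_rr Hd) (std_lr Hd H q)) (comp_functor (std_rr Hd H q) (lr_to_rr Hd))"
    "functors_eq LL (comp_functor (std_ll_to_rr H Hd p q) (std_ll H Hd p)) (comp_functor (std_rr Hd H q) (ll_to_rr H Hd))"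
    unfolding functors_eq_def comp_functor_def fst_conv
    by (intro conjI ballI c1 c2 c3 c4 c5; (assumption | simp add: defs id_on_morphisms_def))+
  have b1: "braided_commutative_rl H Hd p a \<longleftrightarrow> braided_commutative_lr Hd H q (fst rl_to_lr a)" for a
    using dual_pair.braided_rl_iff_lr[OF dp, unfolded pq]
    by (cases a) (simp add: defs id_on_morphisms_def)
  have b2: "braided_commutative_rl H Hd p a \<longleftrightarrow> braided_commutative_ll H Hd p (fst (rl_to_ll H) a)" if "a \<in> Obj RL" for a
  proof -
    obtain X \<alpha> \<beta> where a: "a = (X, \<alpha>, \<beta>)" by (cases a)
    show ?thesis
     using dual_pair.braided_ll_iff_lr[OF dp RLD[OF that[unfolded a]], unfolded pq] b1[of a]
     by (simp add: a defs id_on_morphisms_def)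
  qed
  have b3: "braided_commutative_lr Hd H q a \<longleftrightarrow> braided_commutative_rr Hd H q (fst (lr_to_rr Hd) a)" if "a \<in> Obj LR" for a
  proof -
    obtain X \<alpha> \<beta> where a: "a = (X, \<alpha>, \<beta>)" by (cases a)
    show ?thesis
     using dual_pair.braided_rr_iff_lr[OF sw LRD(1,2)[OF that[unfolded a]], of \<beta>]
     by (simp add: a defs id_on_morphisms_def)
  qed
  have b4: "braided_commutative_ll H Hd p a \<longleftrightarrow> braided_commutative_rr Hd H q (fst (ll_to_rr H Hd) a)" if a: "a \<in> Obj LL" for a
  proof -
    obtain b where b: "b \<in> Obj RL" "a = fst (rl_to_ll H) b" by (rule bij_betw_obtains[OF cat_isoD(1)[OF i2] a])
    obtain X \<alpha> \<beta> where b': "b = (X, \<alpha>, \<beta>)" by (cases b)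
    show ?thesis
     using b1[of b] b2[OF b(1)] b3[OF cat_isoD(2)[OF i1 b(1)]] c1[OF b(1)] unfolding b(2) b'
     by (simp add: defs id_on_morphisms_def)
  qed
  show ?thesis
    by (intro conjI ballI equivs functors eqs b1 b2 b3 b4 cat_isoD(1)[OF i1] cat_isoD(1)[OF i2] cat_isoD(1)[OF i3]
      cat_isoD(1)[OF i4]) assumption+
qed

end
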